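(* Let $\mathcal C$ be a join restriction category with local glueings, and consider the adjunction $\Psi\dashv\Phi\colon \mathrm{pCat}_c(\mathcal C)\to \mathrm{rCat}/\!/\mathcal C$. Restricting this adjunction to its fixpoints yields an equivalence of categories $$\Phi\colon \mathrm{peCat}_c(\mathcal C)\;\simeq\;\mathrm{jrCat}/\!/_h\,\mathcal C\;\colon\Psi$$ between the category of source-étale partite internal categories in $\mathcal C$ (with partite cofunctors as morphisms) and the category of join restriction categories hyperconnected over $\mathcal C$; that is, the left fixpoints are exactly the source-étale partite internal categories, the right fixpoints are exactly the objects of $\mathrm{jrCat}/\!/_h\,\mathcal C$, and $\Phi,\Psi$ restrict to mutually pseudo-inverse functors between these full subcategories.
   Context: RESTRICTION CATEGORIES. A restriction category is a category with an operation assigning to each $f\colon A\to B$ a map $\bar f\colon A\to A$ such that $f\bar f=f$; $\bar f\bar g=\bar g\bar f$ and $\overline{g\bar f}=\bar g\bar f$ for $f\colon A\to B$, $g\colon A\to C$; and $\bar g f=f\,\overline{gf}$ for $f\colon A\to B$, $g\colon B\to C$. $\mathcal O(A)$ is the set of restriction idempotents on $A$ (maps $e\colon A\to A$ with $\bar e=e$). A map $f$ is total if $\bar f=1$. For parallel maps, $f\leqslant g$ iff $f=g\bar f$, and $f\smile g$ (compatible) iff $f\bar g=g\bar f$. A restriction functor satisfies $F\bar f=\overline{Ff}$; it is hyperconnected if each induced $\mathcal O(A)\to\mathcal O(FA)$ is an isomorphism. A join restriction category is a restriction category in which every pairwise-compatible family of parallel maps has a join for $\leqslant$, and these joins are preserved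 by precomposition. A partial isomorphism is a map $s\colon A\to B$ with a (necessarily unique) partial inverse $s^*\colon B\to A$: $s^*s=\bar s$, $ss^*=\overline{s^*}$. A local homeomorphism is a total map which is a join of partial isomorphisms. A local atlas on $X$ is a set $I$ and a family $\varphi_{ij}\in\mathcal O(X)$ ($i,j\in I$) with $\varphi_{ij}=\varphi_{ji}$ and $\varphi_{jk}\varphi_{ij}\leqslant\varphi_{ik}$. A glueing of $\varphi$ is a local homeomorphism $p=\bigvee_i p_i\colon A\to X$, with each $p_i$ a partial isomorphism with partial inverse $s_i$, such that $\varphi_{ij}=p_js_i$. $\mathcal C$ has local glueings if every local atlas on every object has a glueing. A partial section of a total map $p\colon A\to X$ is a map $s\colon X\to A$ with $ps=\bar s$. PARTITE INTERNAL CATEGORIES. For a set $I$, an $I$-partite internal category $\mathbb A$ in $\mathcal C$ comprises objects $A_i$; objects $A_{ij}$ with total maps $\sigma_{ij}\colon A_{ij}\to A_i$, $\tau_{ij}\colon A_{ij}\to A_j$, where $\sigma_{ij}$ admits pullbacks along all total maps; maps $\eta_i\colon A_i\to A_{ii}$ with $\sigma_{ii}\eta_i=1=\tau_{ii}\eta_i$; and maps $\mu_{ijk}\colon A_{jk}\times_{A_j}A_{ij}\to A_{ik}$ (domain the pullback of $\sigma_{jk}$ along $\tau_{ij}$) with $\sigma_{ik}\mu_{ijk}=\sigma_{ij}\pi_2$, $\tau_{ik}\mu_{ijk}=\tau_{jk}\pi_1$, satisfying $\mu_{iij}(1,\eta_i\sigma_{ij})=1=\mu_{ijj}(\eta_j\tau_{ij},1)$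 and $\mu_{ik\ell}(1\times\mu_{ijk})=\mu_{ij\ell}(\mu_{jk\ell}\times 1)$. It is source-étale if every $\sigma_{ij}$ is a local homeomorphism. A partite cofunctor $F\colon\mathbb A\rightsquigarrow\mathbb B$ from an $I$-partite to a $J$-partite internal category comprises a function $I\to J$, $i\mapsto Fi$; total maps $F_i\colon B_{Fi}\to A_i$; and total maps $F_{ij}\colon A_{ij}\times_{A_i}B_{Fi}\to B_{Fi,Fj}$ (domain the pullback of $\sigma_{ij}$ along $F_i$) with $\sigma_{Fi,Fj}F_{ij}=\pi_2$, $F_j\tau_{Fi,Fj}F_{ij}=\tau_{ij}\pi_1$, $F_{ii}(\eta_iF_i,1)=\eta_{Fi}$, and $F_{ik}(\mu_{ijk}\times1)=\mu_{Fi,Fj,Fk}(F_{jk}\times1)(1\times F_{ij})$ on $A_{jk}\times_{A_j}A_{ij}\times_{A_i}B_{Fi}$ (using $A_{jk}\times_{A_j}B_{Fi,Fj}\cong(A_{jk}\times_{A_j}B_{Fj})\times_{B_{Fj}}B_{Fi,Fj}$). Composition: $(GF)i=G(Fi)$, $(GF)_i=F_iG_{Fi}$, $(GF)_{ij}=G_{Fi,Fj}(F_{ij}\times1)$ up to the canonical isomorphism of pullbacks. $\mathrm{pCat}_c(\mathcal C)$ is the resulting category, $\mathrm{peCat}_c(\mathcal C)$ its full subcategory of source-étale objects. CATEGORIES OVER $\mathcal C$. $\mathrm{rCat}/\!/\mathcal C$ has as objects pairs $(\mathcal A,P)$ of a restriction category and a restriction functor $P\colon\mathcal A\to\mathcal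 C$; a map $(F,\alpha)\colon(\mathcal A,P)\to(\mathcal B,Q)$ is a restriction functor $F\colon\mathcal A\to\mathcal B$ and a natural transformation $\alpha\colon QF\Rightarrow P$ with total components; $(G,\beta)(F,\alpha)=(GF,\alpha\circ\beta F)$. $\mathrm{jrCat}/\!/_h\,\mathcal C$ is the full subcategory of those $(\mathcal A,P)$ with $\mathcal A$ a join restriction category and $P$ hyperconnected. THE FUNCTOR $\Phi$. $\Phi(\mathbb A)=(\Phi\mathbb A,\pi_{\mathbb A})$: $\Phi\mathbb A$ has object-set $I$; $\Phi\mathbb A(i,j)$ is the set of partial sections of $\sigma_{ij}$; identities are $\eta_i$; the composite of $s\in\Phi\mathbb A(i,j)$, $t\in\Phi\mathbb A(j,k)$ is $\mu_{ijk}\circ\tau_{ij}^*(t)\circ s$ where $\tau_{ij}^*(t)=(t\tau_{ij},\overline{t\tau_{ij}})\colon A_{ij}\to A_{jk}\times_{A_j}A_{ij}$; the restriction of $s$ is $\eta_i\bar s$; $\pi_{\mathbb A}(i)=A_i$, $\pi_{\mathbb A}(s)=\tau_{ij}s$. For a cofunctor $F$, $\Phi(F)=(\Phi F,\varpi^F)$ with $\Phi F(i)=Fi$, $\Phi F(s)=F_{ij}\circ(sF_i,\overline{sF_i})$, $\varpi^F_i=F_i$. THE FUNCTOR $\Psi$. Given $(\mathcal A,P)$ and $f,g\in\mathcal A(i,j)$ put $[\![f=_Pg]\!]=\bigvee\{Pe: e\in\mathcal O(i),\ e\leqslant\bar f\bar g,\ fe=ge\}\in\mathcal O(Pi)$.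 $\Psi P$ is the $\mathrm{ob}(\mathcal A)$-partite internal category with objects $Pi$; $\sigma_{ij}\colon\Psi P_{ij}\to Pi$ a glueing of the local atlas $([\![f=_Pg]\!])_{f,g\in\mathcal A(i,j)}$, with associated partial sections $s_f$; $\tau_{ij}$ the unique map with $\tau_{ij}s_f=Pf$ for all $f$; $\eta_i=s_{1_i}$; $\mu_{ijk}$ the unique map with $\mu_{ijk}\tau_{ij}^*(s_g)s_f=s_{gf}$ for all $f,g$. $\Psi$ is left adjoint to $\Phi$ with unit $(\eta_P,1)\colon(\mathcal A,P)\to\Phi(\Psi P)$, $\eta_P$ the identity on objects and $f\mapsto s_f$ on maps. A left (resp. right) fixpoint of an adjunction is an object at which the counit (resp. unit) is invertible. *)

theory Defs
  imports "HOL-Library.Equipollence" "HOL-Library.FuncSet"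
begin

text \<open>
  Size conventions. A type \<open>'u\<close> plays the role of the universe of small sets: a set is small if it
  is strictly dominated by \<open>UNIV :: 'u set\<close>. A category has a type of objects, which may be
  large, and an arrow is a label (of type \<open>'u\<close> for the locally small categories) tagged with its
  source and target, so that the hom-sets are automatically disjoint and composition needs
  no object arguments. Strictness of the size bound matters: if \<open>\<kappa>\<close> bounded both the
  hom-sets and the index sets of local atlases non-strictly, then the \<open>\<kappa>\<close>-fold copower of an
  object would have more than \<open>\<kappa>\<close> maps to its twofold copower, and only degenerate categories
  would have local glueings.

  Operations are unconstrained outside their intended domain. For maps between structures this
  would create spurious inequalities, so maps are required to be extensional.
\<close>

section \<open>Categories, functors, adjunctions\<close>

datatype ('o, 'l) arr = Arw (src: 'o) (lbl: 'l) (tgt: 'o)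

record ('o, 'l) cat =
  Obj :: "'o set"
  Mor :: "('o, 'l) arr set"
  Idn :: "'o \<Rightarrow> ('o, 'l) arr"
  Cmp :: "('o, 'l) arr \<Rightarrow> ('o, 'l) arr \<Rightarrow> ('o, 'l) arr" (infixl \<open>\<cdot>\<index>\<close> 70)

definition hom :: "('o, 'l, 'm) cat_scheme \<Rightarrow> 'o \<Rightarrow> 'o \<Rightarrow> ('o, 'l) arr set" where
  "hom C X Y = {f \<in> Mor C. src f = X \<and> tgt f = Y}"

locale category =
  fixes C :: "('o, 'l, 'm) cat_scheme" (structure)
  assumes src_obj: "f \<in> Mor C \<Longrightarrow> src f \<in> Obj C"
    and tgt_obj: "f \<in> Mor C \<Longrightarrow> tgt f \<in> Obj C"
    and idn_hom: "X \<in> Obj C \<Longrightarrow> Idn C X \<in> hom C X X"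
    and cmp_hom: "\<lbrakk>f \<in> hom C X Y; g \<in> hom C Y Z\<rbrakk> \<Longrightarrow> g \<cdot> f \<in> hom C X Z"
    and idn_right: "f \<in> hom C X Y \<Longrightarrow> f \<cdot> Idn C X = f"
    and idn_left: "f \<in> hom C X Y \<Longrightarrow> Idn C Y \<cdot> f = f"
    and cmp_assoc: "\<lbrakk>f \<in> hom C W X; g \<in> hom C X Y; h \<in> hom C Y Z\<rbrakk>
      \<Longrightarrow> (h \<cdot> g) \<cdot> f = h \<cdot> (g \<cdot> f)"

definition locally_small :: "('o, 'u, 'm) cat_scheme \<Rightarrow> bool" where
  "locally_small C \<longleftrightarrow> (\<forall>X\<in>Obj C. \<forall>Y\<in>Obj C. hom C X Y \<prec> (UNIV :: 'u set))"

definition iso_arr :: "('o, 'l, 'm) cat_scheme \<Rightarrow> ('o, 'l) arr \<Rightarrow> bool" where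
  "iso_arr C f \<longleftrightarrow> f \<in> Mor C \<and>
    (\<exists>g \<in> hom C (tgt f) (src f).
       g \<cdot>\<^bsub>C\<^esub> f = Idn C (src f) \<and> f \<cdot>\<^bsub>C\<^esub> g = Idn C (tgt f))"

definition full_subcat :: "('o, 'l, 'm) cat_scheme \<Rightarrow> ('o \<Rightarrow> bool) \<Rightarrow> ('o, 'l, 'm) cat_scheme" where
  "full_subcat C S =
     C\<lparr>Obj := {X \<in> Obj C. S X}, Mor := {f \<in> Mor C. S (src f) \<and> S (tgt f)}\<rparr>"

record ('o, 'l, 'p, 'k) functr =
  FO :: "'o \<Rightarrow> 'p"
  FA :: "('o, 'l) arr \<Rightarrow> ('p, 'k) arr"

definition is_functor ::
  "('o, 'l, 'm) cat_scheme \<Rightarrow> ('p, 'k, 'n) cat_scheme \<Rightarrow> ('o, 'l, 'p, 'k) functr \<Rightarrow> bool" where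
  "is_functor A B F \<longleftrightarrow> category A \<and> category B \<and>
     (\<forall>X\<in>Obj A. FO F X \<in> Obj B) \<and>
     (\<forall>f\<in>Mor A. FA F f \<in> hom B (FO F (src f)) (FO F (tgt f))) \<and>
     (\<forall>X\<in>Obj A. FA F (Idn A X) = Idn B (FO F X)) \<and>
     (\<forall>f\<in>Mor A. \<forall>g\<in>Mor A. tgt f = src g \<longrightarrow> FA F (g \<cdot>\<^bsub>A\<^esub> f) = FA F g \<cdot>\<^bsub>B\<^esub> FA F f)"

definition id_functr :: "('o, 'l, 'o, 'l) functr" where
  "id_functr = \<lparr>FO = \<lambda>X. X, FA = \<lambda>f. f\<rparr>"

definition comp_functr ::
  "('p, 'k, 'q, 'j) functr \<Rightarrow> ('o, 'l, 'p, 'k) functr \<Rightarrow> ('o, 'l, 'q, 'j) functr" where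
  "comp_functr G F = \<lparr>FO = \<lambda>X. FO G (FO F X), FA = \<lambda>f. FA G (FA F f)\<rparr>"

definition res_functr ::
  "('o, 'l, 'm) cat_scheme \<Rightarrow> ('o, 'l, 'p, 'k) functr \<Rightarrow> ('o, 'l, 'p, 'k) functr" where
  "res_functr A F = \<lparr>FO = restrict (FO F) (Obj A), FA = restrict (FA F) (Mor A)\<rparr>"

definition nat_trans ::
  "('o, 'l, 'm) cat_scheme \<Rightarrow> ('p, 'k, 'n) cat_scheme \<Rightarrow> ('o, 'l, 'p, 'k) functr
    \<Rightarrow> ('o, 'l, 'p, 'k) functr \<Rightarrow> ('o \<Rightarrow> ('p, 'k) arr) \<Rightarrow> bool" where
  "nat_trans A B F G \<alpha> \<longleftrightarrow>
     (\<forall>X\<in>Obj A. \<alpha> X \<in> hom B (FO F X) (FO G X)) \<and>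
     (\<forall>f\<in>Mor A. \<alpha> (tgt f) \<cdot>\<^bsub>B\<^esub> FA F f = FA G f \<cdot>\<^bsub>B\<^esub> \<alpha> (src f))"

text \<open>\<open>L\<close> is left adjoint to \<open>R\<close> with unit \<open>\<eta>\<close> and counit \<open>\<epsilon>\<close>.\<close>

definition adjunction ::
  "('o, 'l, 'm) cat_scheme \<Rightarrow> ('p, 'k, 'n) cat_scheme \<Rightarrow> ('o, 'l, 'p, 'k) functr
    \<Rightarrow> ('p, 'k, 'o, 'l) functr \<Rightarrow> ('o \<Rightarrow> ('o, 'l) arr) \<Rightarrow> ('p \<Rightarrow> ('p, 'k) arr) \<Rightarrow> bool" where
  "adjunction A B L R \<eta> \<epsilon> \<longleftrightarrow>
     is_functor A B L \<and> is_functor B A R \<and>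
     nat_trans A A id_functr (comp_functr R L) \<eta> \<and>
     nat_trans B B (comp_functr L R) id_functr \<epsilon> \<and>
     (\<forall>X\<in>Obj A. \<epsilon> (FO L X) \<cdot>\<^bsub>B\<^esub> FA L (\<eta> X) = Idn B (FO L X)) \<and>
     (\<forall>Y\<in>Obj B. FA R (\<epsilon> Y) \<cdot>\<^bsub>A\<^esub> \<eta> (FO R Y) = Idn A (FO R Y))"

definition left_fixpoints ::
  "('p, 'k, 'n) cat_scheme \<Rightarrow> ('p \<Rightarrow> ('p, 'k) arr) \<Rightarrow> 'p set" where
  "left_fixpoints B \<epsilon> = {Y \<in> Obj B. iso_arr B (\<epsilon> Y)}"

definition right_fixpoints ::
  "('o, 'l, 'm) cat_scheme \<Rightarrow> ('o \<Rightarrow> ('o, 'l) arr) \<Rightarrow> 'o set" where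
  "right_fixpoints A \<eta> = {X \<in> Obj A. iso_arr A (\<eta> X)}"

definition adjoint_equivalence ::
  "('o, 'l, 'm) cat_scheme \<Rightarrow> ('p, 'k, 'n) cat_scheme \<Rightarrow> ('o, 'l, 'p, 'k) functr
    \<Rightarrow> ('p, 'k, 'o, 'l) functr \<Rightarrow> ('o \<Rightarrow> ('o, 'l) arr) \<Rightarrow> ('p \<Rightarrow> ('p, 'k) arr) \<Rightarrow> bool" where
  "adjoint_equivalence A B L R \<eta> \<epsilon> \<longleftrightarrow>
     adjunction A B L R \<eta> \<epsilon> \<and>
     (\<forall>X\<in>Obj A. iso_arr A (\<eta> X)) \<and> (\<forall>Y\<in>Obj B. iso_arr B (\<epsilon> Y))"

text \<open>Ordinary pullbacks: the universal property is tested against all maps, total or not. The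
  first projection goes to the source of \<open>f\<close>, so this is the pullback of \<open>f\<close> along \<open>g\<close>.\<close>

definition is_pullback ::
  "('o, 'l, 'm) cat_scheme \<Rightarrow> ('o, 'l) arr \<Rightarrow> ('o, 'l) arr \<Rightarrow> ('o, 'l) arr \<Rightarrow> ('o, 'l) arr \<Rightarrow> bool"
  where
  "is_pullback C f g p q \<longleftrightarrow>
     f \<in> Mor C \<and> g \<in> Mor C \<and> tgt f = tgt g \<and>
     p \<in> hom C (src p) (src f) \<and> q \<in> hom C (src p) (src g) \<and> f \<cdot>\<^bsub>C\<^esub> p = g \<cdot>\<^bsub>C\<^esub> q \<and>
     (\<forall>W\<in>Obj C. \<forall>a \<in> hom C W (src f). \<forall>b \<in> hom C W (src g). f \<cdot>\<^bsub>C\<^esub> a = g \<cdot>\<^bsub>C\<^esub> b \<longrightarrow>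
        (\<exists>!h. h \<in> hom C W (src p) \<and> p \<cdot>\<^bsub>C\<^esub> h = a \<and> q \<cdot>\<^bsub>C\<^esub> h = b))"

definition chosen_pb ::
  "('o, 'l, 'm) cat_scheme \<Rightarrow> ('o, 'l) arr \<Rightarrow> ('o, 'l) arr \<Rightarrow> ('o, 'l) arr \<times> ('o, 'l) arr" where
  "chosen_pb C f g = (SOME pq. is_pullback C f g (fst pq) (snd pq))"

definition pb1 :: "('o, 'l, 'm) cat_scheme \<Rightarrow> ('o, 'l) arr \<Rightarrow> ('o, 'l) arr \<Rightarrow> ('o, 'l) arr" where
  "pb1 C f g = fst (chosen_pb C f g)"

definition pb2 :: "('o, 'l, 'm) cat_scheme \<Rightarrow> ('o, 'l) arr \<Rightarrow> ('o, 'l) arr \<Rightarrow> ('o, 'l) arr" where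
  "pb2 C f g = snd (chosen_pb C f g)"

definition pb_obj :: "('o, 'l, 'm) cat_scheme \<Rightarrow> ('o, 'l) arr \<Rightarrow> ('o, 'l) arr \<Rightarrow> 'o" where
  "pb_obj C f g = src (pb1 C f g)"

text \<open>\<open>pb_pair C f g a b\<close> is the map \<open>(a, b)\<close> into the chosen pullback of \<open>f\<close> along \<open>g\<close>.\<close>

definition pb_pair ::
  "('o, 'l, 'm) cat_scheme \<Rightarrow> ('o, 'l) arr \<Rightarrow> ('o, 'l) arr \<Rightarrow> ('o, 'l) arr \<Rightarrow> ('o, 'l) arr
    \<Rightarrow> ('o, 'l) arr" where
  "pb_pair C f g a b =
     (THE h. h \<in> hom C (src a) (pb_obj C f g) \<and> pb1 C f g \<cdot>\<^bsub>C\<^esub> h = a \<and> pb2 C f g \<cdot>\<^bsub>C\<^esub> h = b)"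


section \<open>Restriction categories\<close>

record ('o, 'l) rcat = "('o, 'l) cat" +
  Rst :: "('o, 'l) arr \<Rightarrow> ('o, 'l) arr" (\<open>\<rho>\<index>\<close>)

locale restriction_category = category C
  for C :: "('o, 'l, 'm) rcat_scheme" (structure) +
  assumes rst_hom: "f \<in> hom C X Y \<Longrightarrow> \<rho> f \<in> hom C X X"
    and cmp_rst: "f \<in> hom C X Y \<Longrightarrow> f \<cdot> \<rho> f = f"
    and rst_commute: "\<lbrakk>f \<in> hom C X Y; g \<in> hom C X Z\<rbrakk> \<Longrightarrow> \<rho> f \<cdot> \<rho> g = \<rho> g \<cdot> \<rho> f"
    and rst_cmp_rst: "\<lbrakk>f \<in> hom C X Y; g \<in> hom C X Z\<rbrakk> \<Longrightarrow> \<rho> (g \<cdot> \<rho> f) = \<rho> g \<cdot> \<rho> f"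
    and rst_cmp: "\<lbrakk>f \<in> hom C X Y; g \<in> hom C Y Z\<rbrakk> \<Longrightarrow> \<rho> g \<cdot> f = f \<cdot> \<rho> (g \<cdot> f)"

definition rid :: "('o, 'l, 'm) rcat_scheme \<Rightarrow> 'o \<Rightarrow> ('o, 'l) arr set" where
  "rid C X = {e \<in> hom C X X. \<rho>\<^bsub>C\<^esub> e = e}"

definition total :: "('o, 'l, 'm) rcat_scheme \<Rightarrow> ('o, 'l) arr \<Rightarrow> bool" where
  "total C f \<longleftrightarrow> \<rho>\<^bsub>C\<^esub> f = Idn C (src f)"

text \<open>The next two relations are only meant for parallel maps.\<close>

definition rle :: "('o, 'l, 'm) rcat_scheme \<Rightarrow> ('o, 'l) arr \<Rightarrow> ('o, 'l) arr \<Rightarrow> bool" where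
  "rle C f g \<longleftrightarrow> f = g \<cdot>\<^bsub>C\<^esub> \<rho>\<^bsub>C\<^esub> f"

definition compat :: "('o, 'l, 'm) rcat_scheme \<Rightarrow> ('o, 'l) arr \<Rightarrow> ('o, 'l) arr \<Rightarrow> bool" where
  "compat C f g \<longleftrightarrow> f \<cdot>\<^bsub>C\<^esub> \<rho>\<^bsub>C\<^esub> g = g \<cdot>\<^bsub>C\<^esub> \<rho>\<^bsub>C\<^esub> f"

definition is_join ::
  "('o, 'l, 'm) rcat_scheme \<Rightarrow> 'o \<Rightarrow> 'o \<Rightarrow> ('o, 'l) arr set \<Rightarrow> ('o, 'l) arr \<Rightarrow> bool" where
  "is_join C X Y S f \<longleftrightarrow> f \<in> hom C X Y \<and> (\<forall>s\<in>S. rle C s f) \<and>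
     (\<forall>g \<in> hom C X Y. (\<forall>s\<in>S. rle C s g) \<longrightarrow> rle C f g)"

definition Join ::
  "('o, 'l, 'm) rcat_scheme \<Rightarrow> 'o \<Rightarrow> 'o \<Rightarrow> ('o, 'l) arr set \<Rightarrow> ('o, 'l) arr" where
  "Join C X Y S = (THE f. is_join C X Y S f)"

locale join_restriction_category = restriction_category C
  for C :: "('o, 'l, 'm) rcat_scheme" (structure) +
  assumes join_exists:
    "\<lbrakk>X \<in> Obj C; Y \<in> Obj C; S \<subseteq> hom C X Y; \<forall>s\<in>S. \<forall>t\<in>S. compat C s t\<rbrakk>
       \<Longrightarrow> \<exists>f. is_join C X Y S f"
    and join_precomp:
    "\<lbrakk>S \<subseteq> hom C X Y; is_join C X Y S f; g \<in> hom C W X\<rbrakk>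
       \<Longrightarrow> is_join C W Y ((\<lambda>s. s \<cdot> g) ` S) (f \<cdot> g)"

definition restriction_functor ::
  "('o, 'l, 'm) rcat_scheme \<Rightarrow> ('p, 'k, 'n) rcat_scheme \<Rightarrow> ('o, 'l, 'p, 'k) functr \<Rightarrow> bool" where
  "restriction_functor A B F \<longleftrightarrow>
     is_functor A B F \<and> (\<forall>f\<in>Mor A. FA F (\<rho>\<^bsub>A\<^esub> f) = \<rho>\<^bsub>B\<^esub> (FA F f))"

text \<open>The order on restriction idempotents is \<open>d \<le> e \<longleftrightarrow> d = e \<cdot> d\<close>, so a bijection induced by a
  functor is automatically an isomorphism of meet-semilattices.\<close>

definition hyperconnected ::
  "('o, 'l, 'm) rcat_scheme \<Rightarrow> ('p, 'k, 'n) rcat_scheme \<Rightarrow> ('o, 'l, 'p, 'k) functr \<Rightarrow> bool" where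
  "hyperconnected A B F \<longleftrightarrow>
     restriction_functor A B F \<and> (\<forall>X\<in>Obj A. bij_betw (FA F) (rid A X) (rid B (FO F X)))"

definition partial_inverse ::
  "('o, 'l, 'm) rcat_scheme \<Rightarrow> ('o, 'l) arr \<Rightarrow> ('o, 'l) arr \<Rightarrow> bool" where
  "partial_inverse C s t \<longleftrightarrow> s \<in> Mor C \<and> t \<in> hom C (tgt s) (src s) \<and>
     t \<cdot>\<^bsub>C\<^esub> s = \<rho>\<^bsub>C\<^esub> s \<and> s \<cdot>\<^bsub>C\<^esub> t = \<rho>\<^bsub>C\<^esub> t"

definition partial_iso :: "('o, 'l, 'm) rcat_scheme \<Rightarrow> ('o, 'l) arr \<Rightarrow> bool" where
  "partial_iso C s \<longleftrightarrow> (\<exists>t. partial_inverse C s t)"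

definition local_homeo :: "('o, 'l, 'm) rcat_scheme \<Rightarrow> ('o, 'l) arr \<Rightarrow> bool" where
  "local_homeo C p \<longleftrightarrow> p \<in> Mor C \<and> total C p \<and>
     (\<exists>S \<subseteq> hom C (src p) (tgt p). (\<forall>s\<in>S. partial_iso C s) \<and> is_join C (src p) (tgt p) S p)"

definition partial_section ::
  "('o, 'l, 'm) rcat_scheme \<Rightarrow> ('o, 'l) arr \<Rightarrow> ('o, 'l) arr \<Rightarrow> bool" where
  "partial_section C p s \<longleftrightarrow> s \<in> hom C (tgt p) (src p) \<and> p \<cdot>\<^bsub>C\<^esub> s = \<rho>\<^bsub>C\<^esub> s"

definition local_atlas ::
  "('o, 'l, 'm) rcat_scheme \<Rightarrow> 'o \<Rightarrow> 'i set \<Rightarrow> ('i \<Rightarrow> 'i \<Rightarrow> ('o, 'l) arr) \<Rightarrow> bool" where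
  "local_atlas C X I \<phi> \<longleftrightarrow>
     (\<forall>i\<in>I. \<forall>j\<in>I. \<phi> i j \<in> rid C X \<and> \<phi> i j = \<phi> j i) \<and>
     (\<forall>i\<in>I. \<forall>j\<in>I. \<forall>k\<in>I. rle C (\<phi> j k \<cdot>\<^bsub>C\<^esub> \<phi> i j) (\<phi> i k))"

definition is_glueing ::
  "('o, 'l, 'm) rcat_scheme \<Rightarrow> 'o \<Rightarrow> 'i set \<Rightarrow> ('i \<Rightarrow> 'i \<Rightarrow> ('o, 'l) arr) \<Rightarrow> ('o, 'l) arr
    \<Rightarrow> ('i \<Rightarrow> ('o, 'l) arr) \<Rightarrow> ('i \<Rightarrow> ('o, 'l) arr) \<Rightarrow> bool" where
  "is_glueing C X I \<phi> p pp ss \<longleftrightarrow>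
     local_homeo C p \<and> tgt p = X \<and>
     (\<forall>i\<in>I. pp i \<in> hom C (src p) X \<and> partial_inverse C (pp i) (ss i)) \<and>
     is_join C (src p) X (pp ` I) p \<and>
     (\<forall>i\<in>I. \<forall>j\<in>I. \<phi> i j = pp j \<cdot>\<^bsub>C\<^esub> ss i)"

definition has_local_glueings :: "('o, 'u, 'm) rcat_scheme \<Rightarrow> bool" where
  "has_local_glueings C \<longleftrightarrow>
     (\<forall>X\<in>Obj C. \<forall>(I :: 'u set) \<phi>. I \<prec> (UNIV :: 'u set) \<longrightarrow> local_atlas C X I \<phi> \<longrightarrow>
        (\<exists>p pp ss. is_glueing C X I \<phi> p pp ss))"


section \<open>Partite internal categories\<close>

record ('o, 'u) partite =
  Ix :: "'u set"
  PO :: "'u \<Rightarrow> 'o"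
  PA :: "'u \<Rightarrow> 'u \<Rightarrow> 'o"
  Sg :: "'u \<Rightarrow> 'u \<Rightarrow> ('o, 'u) arr"
  Ta :: "'u \<Rightarrow> 'u \<Rightarrow> ('o, 'u) arr"
  Et :: "'u \<Rightarrow> ('o, 'u) arr"
  Mu :: "'u \<Rightarrow> 'u \<Rightarrow> 'u \<Rightarrow> ('o, 'u) arr"

definition admits_pullbacks :: "('o, 'l, 'm) rcat_scheme \<Rightarrow> ('o, 'l) arr \<Rightarrow> bool" where
  "admits_pullbacks C f \<longleftrightarrow>
     (\<forall>g\<in>Mor C. total C g \<and> tgt g = tgt f \<longrightarrow> (\<exists>p q. is_pullback C f g p q))"

text \<open>In \<open>mu_assoc\<close> the threefold pullback is formed as
  \<open>A\<^sub>k\<^sub>l \<times> (A\<^sub>j\<^sub>k \<times> A\<^sub>i\<^sub>j)\<close>; \<open>q1\<close>, \<open>q2\<close> are its outer and \<open>p1\<close>, \<open>p2\<close> its inner projections.\<close>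

locale partite_category =
  fixes C :: "('o, 'u) rcat" (structure) and A :: "('o, 'u) partite"
  assumes ix_small: "Ix A \<prec> (UNIV :: 'u set)"
    and po_obj: "i \<in> Ix A \<Longrightarrow> PO A i \<in> Obj C"
    and pa_obj: "\<lbrakk>i \<in> Ix A; j \<in> Ix A\<rbrakk> \<Longrightarrow> PA A i j \<in> Obj C"
    and sg_hom: "\<lbrakk>i \<in> Ix A; j \<in> Ix A\<rbrakk> \<Longrightarrow> Sg A i j \<in> hom C (PA A i j) (PO A i)"
    and sg_total: "\<lbrakk>i \<in> Ix A; j \<in> Ix A\<rbrakk> \<Longrightarrow> total C (Sg A i j)"
    and sg_pullbacks: "\<lbrakk>i \<in> Ix A; j \<in> Ix A\<rbrakk> \<Longrightarrow> admits_pullbacks C (Sg A i j)"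
    and ta_hom: "\<lbrakk>i \<in> Ix A; j \<in> Ix A\<rbrakk> \<Longrightarrow> Ta A i j \<in> hom C (PA A i j) (PO A j)"
    and ta_total: "\<lbrakk>i \<in> Ix A; j \<in> Ix A\<rbrakk> \<Longrightarrow> total C (Ta A i j)"
    and et_hom: "i \<in> Ix A \<Longrightarrow> Et A i \<in> hom C (PO A i) (PA A i i)"
    and sg_et: "i \<in> Ix A \<Longrightarrow> Sg A i i \<cdot> Et A i = Idn C (PO A i)"
    and ta_et: "i \<in> Ix A \<Longrightarrow> Ta A i i \<cdot> Et A i = Idn C (PO A i)"
    and mu_hom: "\<lbrakk>i \<in> Ix A; j \<in> Ix A; k \<in> Ix A\<rbrakk>
      \<Longrightarrow> Mu A i j k \<in> hom C (pb_obj C (Sg A j k) (Ta A i j)) (PA A i k)"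
    and sg_mu: "\<lbrakk>i \<in> Ix A; j \<in> Ix A; k \<in> Ix A\<rbrakk>
      \<Longrightarrow> Sg A i k \<cdot> Mu A i j k = Sg A i j \<cdot> pb2 C (Sg A j k) (Ta A i j)"
    and ta_mu: "\<lbrakk>i \<in> Ix A; j \<in> Ix A; k \<in> Ix A\<rbrakk>
      \<Longrightarrow> Ta A i k \<cdot> Mu A i j k = Ta A j k \<cdot> pb1 C (Sg A j k) (Ta A i j)"
    and mu_unit_right: "\<lbrakk>i \<in> Ix A; j \<in> Ix A\<rbrakk>
      \<Longrightarrow> Mu A i i j \<cdot> pb_pair C (Sg A i j) (Ta A i i) (Idn C (PA A i j)) (Et A i \<cdot> Sg A i j)
          = Idn C (PA A i j)"
    and mu_unit_left: "\<lbrakk>i \<in> Ix A; j \<in> Ix A\<rbrakk>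
      \<Longrightarrow> Mu A i j j \<cdot> pb_pair C (Sg A j j) (Ta A i j) (Et A j \<cdot> Ta A i j) (Idn C (PA A i j))
          = Idn C (PA A i j)"
    and mu_assoc: "\<lbrakk>i \<in> Ix A; j \<in> Ix A; k \<in> Ix A; l \<in> Ix A\<rbrakk>
      \<Longrightarrow> let p1 = pb1 C (Sg A j k) (Ta A i j);
              p2 = pb2 C (Sg A j k) (Ta A i j);
              q1 = pb1 C (Sg A k l) (Ta A j k \<cdot> p1);
              q2 = pb2 C (Sg A k l) (Ta A j k \<cdot> p1)
          in Mu A i k l \<cdot> pb_pair C (Sg A k l) (Ta A i k) q1 (Mu A i j k \<cdot> q2)
             = Mu A i j l \<cdot> pb_pair C (Sg A j l) (Ta A i j)
                 (Mu A j k l \<cdot> pb_pair C (Sg A k l) (Ta A j k) q1 (p1 \<cdot> q2)) (p2 \<cdot> q2)"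

definition source_etale :: "('o, 'u) rcat \<Rightarrow> ('o, 'u) partite \<Rightarrow> bool" where
  "source_etale C A \<longleftrightarrow> (\<forall>i \<in> Ix A. \<forall>j \<in> Ix A. local_homeo C (Sg A i j))"

record ('o, 'u) cofun =
  CI :: "'u \<Rightarrow> 'u"
  CO :: "'u \<Rightarrow> ('o, 'u) arr"
  CA :: "'u \<Rightarrow> 'u \<Rightarrow> ('o, 'u) arr"

text \<open>In \<open>ca_mu\<close> the threefold pullback is formed as
  \<open>A\<^sub>j\<^sub>k \<times> (A\<^sub>i\<^sub>j \<times> B\<^sub>F\<^sub>i)\<close>, with outer projections \<open>q1\<close>, \<open>q2\<close> and inner ones \<open>p1\<close>, \<open>p2\<close>.\<close>

locale partite_cofunctor =
  fixes C :: "('o, 'u) rcat" (structure) and A B :: "('o, 'u) partite" and F :: "('o, 'u) cofun"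
  assumes ci_funcset: "CI F \<in> Ix A \<rightarrow>\<^sub>E Ix B"
    and co_extensional: "CO F \<in> extensional (Ix A)"
    and ca_extensional: "\<not> (i \<in> Ix A \<and> j \<in> Ix A) \<Longrightarrow> CA F i j = undefined"
    and co_hom: "i \<in> Ix A \<Longrightarrow> CO F i \<in> hom C (PO B (CI F i)) (PO A i)"
    and co_total: "i \<in> Ix A \<Longrightarrow> total C (CO F i)"
    and ca_hom: "\<lbrakk>i \<in> Ix A; j \<in> Ix A\<rbrakk>
      \<Longrightarrow> CA F i j \<in> hom C (pb_obj C (Sg A i j) (CO F i)) (PA B (CI F i) (CI F j))"
    and ca_total: "\<lbrakk>i \<in> Ix A; j \<in> Ix A\<rbrakk> \<Longrightarrow> total C (CA F i j)"
    and sg_ca: "\<lbrakk>i \<in> Ix A; j \<in> Ix A\<rbrakk>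
      \<Longrightarrow> Sg B (CI F i) (CI F j) \<cdot> CA F i j = pb2 C (Sg A i j) (CO F i)"
    and ta_ca: "\<lbrakk>i \<in> Ix A; j \<in> Ix A\<rbrakk>
      \<Longrightarrow> CO F j \<cdot> Ta B (CI F i) (CI F j) \<cdot> CA F i j = Ta A i j \<cdot> pb1 C (Sg A i j) (CO F i)"
    and ca_et: "i \<in> Ix A
      \<Longrightarrow> CA F i i \<cdot> pb_pair C (Sg A i i) (CO F i) (Et A i \<cdot> CO F i) (Idn C (PO B (CI F i)))
          = Et B (CI F i)"
    and ca_mu: "\<lbrakk>i \<in> Ix A; j \<in> Ix A; k \<in> Ix A\<rbrakk>
      \<Longrightarrow> let p1 = pb1 C (Sg A i j) (CO F i);
              p2 = pb2 C (Sg A i j) (CO F i);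
              q1 = pb1 C (Sg A j k) (Ta A i j \<cdot> p1);
              q2 = pb2 C (Sg A j k) (Ta A i j \<cdot> p1)
          in CA F i k \<cdot> pb_pair C (Sg A i k) (CO F i)
               (Mu A i j k \<cdot> pb_pair C (Sg A j k) (Ta A i j) q1 (p1 \<cdot> q2)) (p2 \<cdot> q2)
             = Mu B (CI F i) (CI F j) (CI F k) \<cdot>
               pb_pair C (Sg B (CI F j) (CI F k)) (Ta B (CI F i) (CI F j))
                 (CA F j k \<cdot> pb_pair C (Sg A j k) (CO F j)
                    q1 (Ta B (CI F i) (CI F j) \<cdot> CA F i j \<cdot> q2))
                 (CA F i j \<cdot> q2)"

definition cofun_id :: "('o, 'u) rcat \<Rightarrow> ('o, 'u) partite \<Rightarrow> ('o, 'u) cofun" where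
  "cofun_id C A =
     \<lparr>CI = (\<lambda>i\<in>Ix A. i),
      CO = (\<lambda>i\<in>Ix A. Idn C (PO A i)),
      CA = (\<lambda>i j. if i \<in> Ix A \<and> j \<in> Ix A then pb1 C (Sg A i j) (Idn C (PO A i)) else undefined)\<rparr>"

text \<open>\<open>cofun_comp C A B G F\<close> is the composite \<open>GF\<close> of \<open>F\<close> from \<open>A\<close> to \<open>B\<close> with \<open>G\<close> out of \<open>B\<close>.\<close>

definition cofun_comp ::
  "('o, 'u) rcat \<Rightarrow> ('o, 'u) partite \<Rightarrow> ('o, 'u) partite \<Rightarrow> ('o, 'u) cofun \<Rightarrow> ('o, 'u) cofun
    \<Rightarrow> ('o, 'u) cofun" where
  "cofun_comp C A B G F =
     \<lparr>CI = (\<lambda>i\<in>Ix A. CI G (CI F i)),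
      CO = (\<lambda>i\<in>Ix A. CO F i \<cdot>\<^bsub>C\<^esub> CO G (CI F i)),
      CA = (\<lambda>i j. if i \<in> Ix A \<and> j \<in> Ix A then
              let Gi = CO G (CI F i);
                  p1 = pb1 C (Sg A i j) (CO F i \<cdot>\<^bsub>C\<^esub> Gi);
                  p2 = pb2 C (Sg A i j) (CO F i \<cdot>\<^bsub>C\<^esub> Gi)
              in CA G (CI F i) (CI F j) \<cdot>\<^bsub>C\<^esub>
                 pb_pair C (Sg B (CI F i) (CI F j)) Gi
                   (CA F i j \<cdot>\<^bsub>C\<^esub> pb_pair C (Sg A i j) (CO F i) p1 (Gi \<cdot>\<^bsub>C\<^esub> p2)) p2
            else undefined)\<rparr>"

definition pCat :: "('o, 'u) rcat \<Rightarrow> (('o, 'u) partite, ('o, 'u) cofun) cat" where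
  "pCat C =
     \<lparr>Obj = {A. partite_category C A},
      Mor = {Arw A F B |A F B.
               partite_category C A \<and> partite_category C B \<and> partite_cofunctor C A B F},
      Idn = (\<lambda>A. Arw A (cofun_id C A) A),
      Cmp = (\<lambda>g f. Arw (src f) (cofun_comp C (src f) (tgt f) (lbl g) (lbl f)) (tgt g))\<rparr>"

definition peCat :: "('o, 'u) rcat \<Rightarrow> (('o, 'u) partite, ('o, 'u) cofun) cat" where
  "peCat C = full_subcat (pCat C) (source_etale C)"


section \<open>Categories over \<open>C\<close>\<close>

type_synonym ('o, 'u) over = "('u, 'u) rcat \<times> ('u, 'u, 'o, 'u) functr"
type_synonym ('o, 'u) over_map = "('u, 'u, 'u, 'u) functr \<times> ('u \<Rightarrow> ('o, 'u) arr)"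

definition over_obj :: "('o, 'u) rcat \<Rightarrow> ('o, 'u) over \<Rightarrow> bool" where
  "over_obj C X \<longleftrightarrow> (case X of (A, P) \<Rightarrow>
     restriction_category A \<and> Obj A \<prec> (UNIV :: 'u set) \<and> locally_small A \<and>
     restriction_functor A C P)"

definition over_hom ::
  "('o, 'u) rcat \<Rightarrow> ('o, 'u) over \<Rightarrow> ('o, 'u) over \<Rightarrow> ('o, 'u) over_map \<Rightarrow> bool" where
  "over_hom C X Y h \<longleftrightarrow> (case (X, Y, h) of ((A, P), (B, Q), (F, \<alpha>)) \<Rightarrow>
     restriction_functor A B F \<and> F = res_functr A F \<and>
     nat_trans A C (comp_functr Q F) P \<alpha> \<and> \<alpha> \<in> extensional (Obj A) \<and>
     (\<forall>i\<in>Obj A. total C (\<alpha> i)))"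

definition over_id :: "('o, 'u) rcat \<Rightarrow> ('o, 'u) over \<Rightarrow> ('o, 'u) over_map" where
  "over_id C X = (case X of (A, P) \<Rightarrow>
     (res_functr A id_functr, \<lambda>i\<in>Obj A. Idn C (FO P i)))"

definition over_comp ::
  "('o, 'u) rcat \<Rightarrow> ('o, 'u) over \<Rightarrow> ('o, 'u) over_map \<Rightarrow> ('o, 'u) over_map
    \<Rightarrow> ('o, 'u) over_map" where
  "over_comp C X k h = (case (X, k, h) of ((A, P), (G, \<beta>), (F, \<alpha>)) \<Rightarrow>
     (res_functr A (comp_functr G F), \<lambda>i\<in>Obj A. \<alpha> i \<cdot>\<^bsub>C\<^esub> \<beta> (FO F i)))"

definition rCat_over :: "('o, 'u) rcat \<Rightarrow> (('o, 'u) over, ('o, 'u) over_map) cat" where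
  "rCat_over C =
     \<lparr>Obj = {X. over_obj C X},
      Mor = {Arw X h Y |X h Y. over_obj C X \<and> over_obj C Y \<and> over_hom C X Y h},
      Idn = (\<lambda>X. Arw X (over_id C X) X),
      Cmp = (\<lambda>g f. Arw (src f) (over_comp C (src f) (lbl g) (lbl f)) (tgt g))\<rparr>"

definition jrCat_over :: "('o, 'u) rcat \<Rightarrow> (('o, 'u) over, ('o, 'u) over_map) cat" where
  "jrCat_over C = full_subcat (rCat_over C)
     (\<lambda>(A, P). join_restriction_category A \<and> hyperconnected A C P)"


section \<open>The functor \<open>\<Phi>\<close>\<close>

text \<open>An arrow from \<open>i\<close> to \<open>j\<close> in \<open>\<Phi> A\<close> carries the label of a partial section of \<open>\<sigma>\<^sub>i\<^sub>j\<close>, which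
  \<open>sect\<close> recovers.\<close>

definition sect :: "('o, 'u) partite \<Rightarrow> ('u, 'u) arr \<Rightarrow> ('o, 'u) arr" where
  "sect A s = Arw (PO A (src s)) (lbl s) (PA A (src s) (tgt s))"

text \<open>\<open>pb_lift C f g t\<close> is \<open>g\<^sup>*(t)\<close>, the pullback along \<open>g\<close> of a partial section \<open>t\<close> of \<open>f\<close>.\<close>

definition pb_lift ::
  "('o, 'u) rcat \<Rightarrow> ('o, 'u) arr \<Rightarrow> ('o, 'u) arr \<Rightarrow> ('o, 'u) arr \<Rightarrow> ('o, 'u) arr" where
  "pb_lift C f g t = pb_pair C f g (t \<cdot>\<^bsub>C\<^esub> g) (\<rho>\<^bsub>C\<^esub> (t \<cdot>\<^bsub>C\<^esub> g))"

definition Phi_cat :: "('o, 'u) rcat \<Rightarrow> ('o, 'u) partite \<Rightarrow> ('u, 'u) rcat" where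
  "Phi_cat C A =
     \<lparr>Obj = Ix A,
      Mor = {s. src s \<in> Ix A \<and> tgt s \<in> Ix A \<and>
                partial_section C (Sg A (src s) (tgt s)) (sect A s)},
      Idn = (\<lambda>i. Arw i (lbl (Et A i)) i),
      Cmp = (\<lambda>t s. let i = src s; j = tgt s; k = tgt t in
               Arw i (lbl (Mu A i j k \<cdot>\<^bsub>C\<^esub> pb_lift C (Sg A j k) (Ta A i j) (sect A t) \<cdot>\<^bsub>C\<^esub> sect A s)) k),
      Rst = (\<lambda>s. Arw (src s) (lbl (Et A (src s) \<cdot>\<^bsub>C\<^esub> \<rho>\<^bsub>C\<^esub> (sect A s))) (src s))\<rparr>"

definition Phi_proj :: "('o, 'u) rcat \<Rightarrow> ('o, 'u) partite \<Rightarrow> ('u, 'u, 'o, 'u) functr" where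
  "Phi_proj C A = \<lparr>FO = PO A, FA = \<lambda>s. Ta A (src s) (tgt s) \<cdot>\<^bsub>C\<^esub> sect A s\<rparr>"

definition Phi_map :: "('o, 'u) rcat \<Rightarrow> ('o, 'u) partite \<Rightarrow> ('o, 'u) cofun \<Rightarrow> ('o, 'u) over_map" where
  "Phi_map C A F =
     (res_functr (Phi_cat C A)
        \<lparr>FO = CI F,
         FA = \<lambda>s. let i = src s; j = tgt s in
           Arw (CI F i)
             (lbl (CA F i j \<cdot>\<^bsub>C\<^esub> pb_lift C (Sg A i j) (CO F i) (sect A s)))
             (CI F j)\<rparr>,
      \<lambda>i\<in>Ix A. CO F i)"

definition Phi ::
  "('o, 'u) rcat \<Rightarrow>
    (('o, 'u) partite, ('o, 'u) cofun, ('o, 'u) over, ('o, 'u) over_map) functr" where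
  "Phi C =
     \<lparr>FO = \<lambda>A. (Phi_cat C A, Phi_proj C A),
      FA = \<lambda>f. Arw (Phi_cat C (src f), Phi_proj C (src f))
                 (Phi_map C (src f) (lbl f))
                 (Phi_cat C (tgt f), Phi_proj C (tgt f))\<rparr>"


section \<open>The functor \<open>\<Psi>\<close> and the adjunction\<close>

text \<open>The restriction idempotent \<open>\<lbrakk>f =\<^sub>P g\<rbrakk>\<close>.\<close>

definition eq_ext ::
  "('o, 'u) rcat \<Rightarrow> ('o, 'u) over \<Rightarrow> ('u, 'u) arr \<Rightarrow> ('u, 'u) arr \<Rightarrow> ('o, 'u) arr" where
  "eq_ext C X f g = (case X of (A, P) \<Rightarrow>
     Join C (FO P (src f)) (FO P (src f))
       (FA P ` {e \<in> rid A (src f). rle A e (\<rho>\<^bsub>A\<^esub> f \<cdot>\<^bsub>A\<^esub> \<rho>\<^bsub>A\<^esub> g) \<and> f \<cdot>\<^bsub>A\<^esub> e = g \<cdot>\<^bsub>A\<^esub> e}))"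

definition Psi_glueing ::
  "('o, 'u) rcat \<Rightarrow> ('o, 'u) over \<Rightarrow> 'u \<Rightarrow> 'u
    \<Rightarrow> ('o, 'u) arr \<times> (('u, 'u) arr \<Rightarrow> ('o, 'u) arr) \<times> (('u, 'u) arr \<Rightarrow> ('o, 'u) arr)" where
  "Psi_glueing C X i j =
     (SOME (p, pp, ss). is_glueing C (FO (snd X) i) (hom (fst X) i j) (eq_ext C X) p pp ss)"

definition Psi_sigma :: "('o, 'u) rcat \<Rightarrow> ('o, 'u) over \<Rightarrow> 'u \<Rightarrow> 'u \<Rightarrow> ('o, 'u) arr" where
  "Psi_sigma C X i j = fst (Psi_glueing C X i j)"

definition Psi_sec :: "('o, 'u) rcat \<Rightarrow> ('o, 'u) over \<Rightarrow> ('u, 'u) arr \<Rightarrow> ('o, 'u) arr" where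
  "Psi_sec C X f = snd (snd (Psi_glueing C X (src f) (tgt f))) f"

definition Psi_tau :: "('o, 'u) rcat \<Rightarrow> ('o, 'u) over \<Rightarrow> 'u \<Rightarrow> 'u \<Rightarrow> ('o, 'u) arr" where
  "Psi_tau C X i j =
     (THE t. t \<in> hom C (src (Psi_sigma C X i j)) (FO (snd X) j) \<and>
        (\<forall>f \<in> hom (fst X) i j. t \<cdot>\<^bsub>C\<^esub> Psi_sec C X f = FA (snd X) f))"

definition Psi_mu :: "('o, 'u) rcat \<Rightarrow> ('o, 'u) over \<Rightarrow> 'u \<Rightarrow> 'u \<Rightarrow> 'u \<Rightarrow> ('o, 'u) arr" where
  "Psi_mu C X i j k =
     (THE m. m \<in> hom C (pb_obj C (Psi_sigma C X j k) (Psi_tau C X i j)) (src (Psi_sigma C X i k)) \<and>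
        (\<forall>f \<in> hom (fst X) i j. \<forall>g \<in> hom (fst X) j k.
           m \<cdot>\<^bsub>C\<^esub> pb_lift C (Psi_sigma C X j k) (Psi_tau C X i j) (Psi_sec C X g) \<cdot>\<^bsub>C\<^esub> Psi_sec C X f
           = Psi_sec C X (g \<cdot>\<^bsub>fst X\<^esub> f)))"

definition Psi_obj :: "('o, 'u) rcat \<Rightarrow> ('o, 'u) over \<Rightarrow> ('o, 'u) partite" where
  "Psi_obj C X =
     \<lparr>Ix = Obj (fst X),
      PO = FO (snd X),
      PA = \<lambda>i j. src (Psi_sigma C X i j),
      Sg = Psi_sigma C X,
      Ta = Psi_tau C X,
      Et = \<lambda>i. Psi_sec C X (Idn (fst X) i),
      Mu = Psi_mu C X\<rparr>"

definition adj_unit ::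
  "('o, 'u) rcat \<Rightarrow> ('o, 'u) over \<Rightarrow> (('o, 'u) over, ('o, 'u) over_map) arr" where
  "adj_unit C X =
     Arw X
       (res_functr (fst X)
          \<lparr>FO = \<lambda>i. i, FA = \<lambda>f. Arw (src f) (lbl (Psi_sec C X f)) (tgt f)\<rparr>,
        \<lambda>i\<in>Obj (fst X). Idn C (FO (snd X) i))
       (FO (Phi C) (Psi_obj C X))"

text \<open>The action of \<open>\<Psi>\<close> on maps and the counit are the ones determined by the unit.\<close>

definition Psi ::
  "('o, 'u) rcat \<Rightarrow>
    (('o, 'u) over, ('o, 'u) over_map, ('o, 'u) partite, ('o, 'u) cofun) functr" where
  "Psi C =
     \<lparr>FO = Psi_obj C,
      FA = \<lambda>h. THE G. G \<in> hom (pCat C) (Psi_obj C (src h)) (Psi_obj C (tgt h)) \<and>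
             FA (Phi C) G \<cdot>\<^bsub>rCat_over C\<^esub> adj_unit C (src h)
             = adj_unit C (tgt h) \<cdot>\<^bsub>rCat_over C\<^esub> h\<rparr>"

definition adj_counit ::
  "('o, 'u) rcat \<Rightarrow> ('o, 'u) partite \<Rightarrow> (('o, 'u) partite, ('o, 'u) cofun) arr" where
  "adj_counit C A =
     (THE G. G \<in> hom (pCat C) (Psi_obj C (FO (Phi C) A)) A \<and>
        FA (Phi C) G \<cdot>\<^bsub>rCat_over C\<^esub> adj_unit C (FO (Phi C) A)
        = Idn (rCat_over C) (FO (Phi C) A))"

end

theory Submission
  imports Defs
begin

text \<open>
  By the universal property of pullbacks, the structure maps of partite categories and cofunctors are
  determined by what they do to pairs of generalized (possibly partial) elements, so the axioms
  become identities between elements.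

  The glueing \<open>\<sigma>\<^sub>i\<^sub>j\<close> is covered by the sections \<open>s\<^sub>f\<close>: every element \<open>a\<close> of the glued object is locally
  of the form \<open>s\<^sub>f x\<close>, and maps out of the glued object, or out of a pullback of it, are the same as
  families of maps on the sections that agree wherever the sections do. In these terms composition
  is \<open>(s\<^sub>g (P f x), s\<^sub>f x) \<mapsto> s\<^sub>g\<^sub>f x\<close>, and a map \<open>(F, \<alpha>)\<close> from \<open>(A, P)\<close> to \<open>\<Phi> B\<close> transposes to the only
  cofunctor sending \<open>(s\<^sub>f (\<alpha> b), b)\<close> to \<open>(F f) b\<close>.

  All categories \<open>\<Phi> B\<close> have joins and are hyperconnected, computed from the joins of \<open>C\<close>. Conversely, if
  \<open>(A, P)\<close> has these properties, then a section of \<open>\<sigma>\<^sub>i\<^sub>j\<close> is a join of restrictions of sections \<open>s\<^sub>f\<close>, which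
  is itself of the form \<open>s\<^sub>h\<close>, so the unit is invertible. The counit is the identity on objects,
  and on arrows it compares \<open>\<sigma>\<^sub>i\<^sub>j\<close> with the glueing of all its partial sections; these cover exactly
  if \<open>\<sigma>\<^sub>i\<^sub>j\<close> is a local homeomorphism.
\<close>

section \<open>Restriction categories\<close>

text \<open>No pullbacks are assumed in \<open>C\<close>, so those along \<open>\<sigma>\<close>
  have to be built: the overlaps of an etale map are pulled back along a total map and glued again
  (\<open>pullback_exists\<close>). The universal property covers partial maps as well, so equations
  can be tested on partial elements; the price is bookkeeping with domains, and a pair often carries
  one component cut down to the domain of the other.

  Two localizations are interleaved. An element of a glued object is split along the idempotents
  over which it lies in the image of one section. Where \<open>sec f\<close> and
  \<open>sec g\<close> agree in \<open>C\<close>, however, \<open>f\<close> and \<open>g\<close>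
  need not agree on a single idempotent of \<open>A\<close>, since \<open>A\<close> need not have
  joins; they agree on a family of idempotents whose images under \<open>P\<close> have the join
  \<open>eqx f g\<close>. Hence a second splitting, along \<open>agree f g\<close>. Both rest on
  \<open>join_local_eq\<close>: maps equal on each member of a family of idempotents are equal on
  its join, although joins are assumed to be preserved by precomposition only.\<close>

lemma in_hom [simp]: "f \<in> hom C X Y \<longleftrightarrow> f \<in> Mor C \<and> src f = X \<and> tgt f = Y"
  by (auto simp: hom_def)

context category
begin

lemma idn_mor [simp]:
  assumes "X \<in> Obj C"
  shows "Idn C X \<in> Mor C" "src (Idn C X) = X" "tgt (Idn C X) = X"
  using idn_hom[OF assms] by simp_all

lemma cmp_mor [simp]:
  assumes "f \<in> Mor C" "g \<in> Mor C" "tgt f = src g"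
  shows "g \<cdot> f \<in> Mor C" "src (g \<cdot> f) = src f" "tgt (g \<cdot> f) = tgt g"
  using cmp_hom[of f "src f" "tgt f" g "tgt g"] assms by simp_all

lemma assoc [simp]:
  assumes "f \<in> Mor C" "g \<in> Mor C" "h \<in> Mor C" "tgt f = src g" "tgt g = src h"
  shows "(h \<cdot> g) \<cdot> f = h \<cdot> (g \<cdot> f)"
  using cmp_assoc[of f "src f" "tgt f" g "tgt g" h "tgt h"] assms by simp

lemma src_obj' [simp]: "f \<in> Mor C \<Longrightarrow> src f \<in> Obj C"
  and tgt_obj' [simp]: "f \<in> Mor C \<Longrightarrow> tgt f \<in> Obj C"
  by (simp_all add: src_obj tgt_obj)

lemma cmp_idn [simp]: "f \<in> Mor C \<Longrightarrow> src f = X \<Longrightarrow> f \<cdot> Idn C X = f"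
  and idn_cmp [simp]: "f \<in> Mor C \<Longrightarrow> tgt f = X \<Longrightarrow> Idn C X \<cdot> f = f"
  using idn_right[of f "src f" "tgt f"] idn_left[of f "src f" "tgt f"] by auto

text \<open>Composites are kept bracketed to the right by \<open>assoc\<close>, so a known equation
  \<open>g \<cdot> f = k\<close> no longer matches once something is precomposed; this rule applies
  it at the head of the longer composite.\<close>

lemma cmp_reassoc:
  assumes "g \<cdot> f = k" "f \<in> Mor C" "g \<in> Mor C" "h \<in> Mor C" "tgt h = src f" "tgt f = src g"
  shows "g \<cdot> (f \<cdot> h) = k \<cdot> h"
  using assms assoc[of h f g] by simp

end

section \<open>Pairing into chosen pullbacks\<close>

lemma is_pullback_chosen:
  "is_pullback C f g p q \<Longrightarrow> is_pullback C f g (pb1 C f g) (pb2 C f g)"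
  unfolding pb1_def pb2_def chosen_pb_def
  by (rule someI[of "\<lambda>pq. is_pullback C f g (fst pq) (snd pq)" "(p, q)"]) simp

context category
begin

context
  fixes f g
  assumes pb: "is_pullback C f g (pb1 C f g) (pb2 C f g)"
begin

lemma pb_mor:
  "pb1 C f g \<in> Mor C" "src (pb1 C f g) = pb_obj C f g" "tgt (pb1 C f g) = src f"
  "pb2 C f g \<in> Mor C" "src (pb2 C f g) = pb_obj C f g" "tgt (pb2 C f g) = src g"
  using pb by (simp_all add: is_pullback_def pb_obj_def)

lemma pb_obj_obj: "pb_obj C f g \<in> Obj C"
  using src_obj'[OF pb_mor(1)] by (simp add: pb_mor)

lemma pb_square: "f \<cdot> pb1 C f g = g \<cdot> pb2 C f g"
  using pb by (simp add: is_pullback_def)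

lemma pb_base: "f \<in> Mor C" "g \<in> Mor C" "tgt f = tgt g"
  using pb by (simp_all add: is_pullback_def)

lemma pb_unique:
  assumes "h \<in> Mor C" "k \<in> Mor C" "src h = src k" "tgt h = pb_obj C f g" "tgt k = pb_obj C f g"
    and "pb1 C f g \<cdot> h = pb1 C f g \<cdot> k" "pb2 C f g \<cdot> h = pb2 C f g \<cdot> k"
  shows "h = k"
proof -
  have "f \<cdot> (pb1 C f g \<cdot> h) = g \<cdot> (pb2 C f g \<cdot> h)"
    using cmp_reassoc[OF pb_square, of h] assms pb_mor pb_base by simp
  then have "\<exists>!l. l \<in> hom C (src h) (src (pb1 C f g)) \<and>
      pb1 C f g \<cdot> l = pb1 C f g \<cdot> h \<and> pb2 C f g \<cdot> l = pb2 C f g \<cdot> h"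
    using pb assms pb_mor unfolding is_pullback_def by simp
  then show ?thesis using assms pb_mor by auto
qed

lemma pair:
  assumes "a \<in> Mor C" "b \<in> Mor C" "src a = src b" "tgt a = src f" "tgt b = src g"
    "f \<cdot> a = g \<cdot> b"
  shows "pb_pair C f g a b \<in> Mor C" "src (pb_pair C f g a b) = src b"
    "tgt (pb_pair C f g a b) = pb_obj C f g"
    "pb1 C f g \<cdot> pb_pair C f g a b = a" "pb2 C f g \<cdot> pb_pair C f g a b = b"
proof -
  have "\<exists>!l. l \<in> hom C (src a) (pb_obj C f g) \<and> pb1 C f g \<cdot> l = a \<and> pb2 C f g \<cdot> l = b"
    using pb assms pb_mor unfolding is_pullback_def by simp
  from theI'[OF this] show "pb_pair C f g a b \<in> Mor C" "src (pb_pair C f g a b) = src b"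
    "tgt (pb_pair C f g a b) = pb_obj C f g"
    "pb1 C f g \<cdot> pb_pair C f g a b = a" "pb2 C f g \<cdot> pb_pair C f g a b = b"
    using assms unfolding pb_pair_def by simp_all
qed

lemma pair_cmp:
  assumes "a \<in> Mor C" "b \<in> Mor C" "src a = src b" "tgt a = src f" "tgt b = src g"
    "f \<cdot> a = g \<cdot> b" "x \<in> Mor C" "tgt x = src b"
  shows "pb_pair C f g a b \<cdot> x = pb_pair C f g (a \<cdot> x) (b \<cdot> x)"
proof -
  note p = pair[OF assms(1-6)]
  have "f \<cdot> (a \<cdot> x) = g \<cdot> (b \<cdot> x)"
    using cmp_reassoc[OF assms(6), of x] assms pb_base by simp
  then have q: "pb_pair C f g (a \<cdot> x) (b \<cdot> x) \<in> Mor C" "src (pb_pair C f g (a \<cdot> x) (b \<cdot> x)) = src x"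
    "tgt (pb_pair C f g (a \<cdot> x) (b \<cdot> x)) = pb_obj C f g"
    "pb1 C f g \<cdot> pb_pair C f g (a \<cdot> x) (b \<cdot> x) = a \<cdot> x"
    "pb2 C f g \<cdot> pb_pair C f g (a \<cdot> x) (b \<cdot> x) = b \<cdot> x"
    using pair[of "a \<cdot> x" "b \<cdot> x"] assms by simp_all
  show ?thesis
    by (rule pb_unique)
       (use assms p q pb_mor cmp_reassoc[OF p(4), of x] cmp_reassoc[OF p(5), of x] in simp_all)
qed

lemma pair_eta:
  assumes "h \<in> Mor C" "tgt h = pb_obj C f g"
  shows "pb_pair C f g (pb1 C f g \<cdot> h) (pb2 C f g \<cdot> h) = h"
proof -
  have eq: "f \<cdot> (pb1 C f g \<cdot> h) = g \<cdot> (pb2 C f g \<cdot> h)"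
    using cmp_reassoc[OF pb_square, of h] assms pb_mor pb_base by simp
  show ?thesis
    by (rule pb_unique) (use assms pb_mor pair[OF _ _ _ _ _ eq] in simp_all)
qed

text \<open>The two projections form the generic pair: evaluating there recovers a map out of the
  pullback from its effect on elements.\<close>

lemma pair_proj: "pb_pair C f g (pb1 C f g) (pb2 C f g) = Idn C (pb_obj C f g)"
  using pair_eta[of "Idn C (pb_obj C f g)"] pb_obj_obj pb_mor by simp

end

end

section \<open>Calculus of restrictions, idempotents and total maps\<close>

context restriction_category
begin

lemma rst_mor [simp]:
  assumes "f \<in> Mor C"
  shows "\<rho> f \<in> Mor C" "src (\<rho> f) = src f" "tgt (\<rho> f) = src f"
  using rst_hom[of f "src f" "tgt f"] assms by simp_all

lemma cmp_rst_self [simp]: "f \<in> Mor C \<Longrightarrow> f \<cdot> \<rho> f = f"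
  using cmp_rst[of f "src f" "tgt f"] by simp

lemma rst_comm: "f \<in> Mor C \<Longrightarrow> g \<in> Mor C \<Longrightarrow> src f = src g \<Longrightarrow> \<rho> f \<cdot> \<rho> g = \<rho> g \<cdot> \<rho> f"
  using rst_commute[of f "src f" "tgt f" g "tgt g"] by simp

lemma rst_cmp_rst' [simp]:
  "f \<in> Mor C \<Longrightarrow> g \<in> Mor C \<Longrightarrow> src f = src g \<Longrightarrow> \<rho> (g \<cdot> \<rho> f) = \<rho> g \<cdot> \<rho> f"
  using rst_cmp_rst[of f "src f" "tgt f" g "tgt g"] by simp

lemma rst_shift: "f \<in> Mor C \<Longrightarrow> g \<in> Mor C \<Longrightarrow> tgt f = src g \<Longrightarrow> \<rho> g \<cdot> f = f \<cdot> \<rho> (g \<cdot> f)"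
  using rst_cmp[of f "src f" "tgt f" g "tgt g"] by simp

lemma rst_idn [simp]: "X \<in> Obj C \<Longrightarrow> \<rho> (Idn C X) = Idn C X"
  using cmp_rst_self[of "Idn C X"] idn_cmp[of "\<rho> (Idn C X)" X] by simp

lemma rst_rst [simp]: "f \<in> Mor C \<Longrightarrow> \<rho> (\<rho> f) = \<rho> f"
  using rst_cmp_rst'[of f "Idn C (src f)"] by simp

lemma rst_idem [simp]: "f \<in> Mor C \<Longrightarrow> \<rho> f \<cdot> \<rho> f = \<rho> f"
  using rst_cmp_rst'[of f f] by simp

lemma rst_cmp_absorb [simp]:
  "f \<in> Mor C \<Longrightarrow> g \<in> Mor C \<Longrightarrow> tgt f = src g \<Longrightarrow> \<rho> (g \<cdot> f) \<cdot> \<rho> f = \<rho> (g \<cdot> f)"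
  using rst_cmp_rst'[of f "g \<cdot> f"] by simp

lemma rst_cmp_absorb' [simp]:
  "f \<in> Mor C \<Longrightarrow> g \<in> Mor C \<Longrightarrow> tgt f = src g \<Longrightarrow> \<rho> f \<cdot> \<rho> (g \<cdot> f) = \<rho> (g \<cdot> f)"
  by (subst rst_comm) simp_all

lemma rst_rst_cmp [simp]:
  "f \<in> Mor C \<Longrightarrow> g \<in> Mor C \<Longrightarrow> tgt f = src g \<Longrightarrow> \<rho> (\<rho> g \<cdot> f) = \<rho> (g \<cdot> f)"
  by (subst rst_shift) simp_all

lemma rid_iff: "e \<in> rid C X \<longleftrightarrow> e \<in> Mor C \<and> src e = X \<and> tgt e = X \<and> \<rho> e = e"
  by (auto simp: rid_def)

lemma rst_rid [simp]: "f \<in> Mor C \<Longrightarrow> src f = X \<Longrightarrow> \<rho> f \<in> rid C X"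
  by (simp add: rid_iff)

lemma idn_rid [simp]: "X \<in> Obj C \<Longrightarrow> Idn C X \<in> rid C X"
  by (simp add: rid_iff)

lemma rid_mor:
  assumes "e \<in> rid C X"
  shows "e \<in> Mor C" "src e = X" "tgt e = X" "\<rho> e = e" "e \<cdot> e = e"
  using assms rst_idem[of e] by (simp_all add: rid_iff)

lemma rid_hom: "rid C X \<subseteq> hom C X X"
  by (auto simp: rid_iff)

lemma rid_comm: "d \<in> rid C X \<Longrightarrow> e \<in> rid C X \<Longrightarrow> d \<cdot> e = e \<cdot> d"
  using rst_comm[of d e] by (simp add: rid_iff)

lemma rid_left_comm:
  "\<lbrakk>d \<in> rid C X; e \<in> rid C X; f \<in> Mor C; tgt f = X\<rbrakk> \<Longrightarrow> d \<cdot> (e \<cdot> f) = e \<cdot> (d \<cdot> f)"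
  using assoc[of f e d] assoc[of f d e] rid_comm[of d X e] by (simp add: rid_mor)

lemma rid_idem_cmp: "\<lbrakk>e \<in> rid C X; f \<in> Mor C; tgt f = X\<rbrakk> \<Longrightarrow> e \<cdot> (e \<cdot> f) = e \<cdot> f"
  using assoc[of f e e] by (simp add: rid_mor)

lemma rst_cmp_rid: "e \<in> rid C X \<Longrightarrow> f \<in> Mor C \<Longrightarrow> src f = X \<Longrightarrow> \<rho> (f \<cdot> e) = \<rho> f \<cdot> e"
  using rst_cmp_rst'[of e f] by (simp add: rid_iff)

lemma rid_cmp: "d \<in> rid C X \<Longrightarrow> e \<in> rid C X \<Longrightarrow> d \<cdot> e \<in> rid C X"
  using rst_cmp_rid[of e X d] by (simp add: rid_iff)

lemma rid_shift:
  "e \<in> rid C X \<Longrightarrow> f \<in> Mor C \<Longrightarrow> tgt f = X \<Longrightarrow> e \<cdot> f = f \<cdot> \<rho> (e \<cdot> f)"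
  using rst_shift[of f e] by (simp add: rid_iff)

lemma rst_cmp_total [simp]:
  assumes "total C g" "f \<in> Mor C" "g \<in> Mor C" "tgt f = src g"
  shows "\<rho> (g \<cdot> f) = \<rho> f"
  using rst_rst_cmp[of f g, symmetric] assms unfolding total_def by simp

lemma total_idn [simp]: "X \<in> Obj C \<Longrightarrow> total C (Idn C X)"
  by (simp add: total_def)

lemma total_cmp [simp]:
  "\<lbrakk>f \<in> Mor C; g \<in> Mor C; tgt f = src g; total C f; total C g\<rbrakk> \<Longrightarrow> total C (g \<cdot> f)"
  by (simp add: total_def[of C "g \<cdot> f"]) (simp add: total_def)

text \<open>The domain of \<open>g \<cdot> f\<close> lies inside that of \<open>f\<close>, so it can
  be everything only if the latter is.\<close>

lemma total_of_cmp:
  assumes "total C (g \<cdot> f)" "f \<in> Mor C" "g \<in> Mor C" "tgt f = src g"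
  shows "total C f"
  using assms rst_cmp_absorb[of f g] by (simp add: total_def)

lemma rst_total: "total C f \<Longrightarrow> \<rho> f = Idn C (src f)"
  by (simp add: total_def)

lemma rle_cmp_rid:
  "f \<in> Mor C \<Longrightarrow> e \<in> rid C (src f) \<Longrightarrow> rle C (f \<cdot> e) f"
  by (simp add: rle_def rst_cmp_rid rid_mor)
     (metis assoc cmp_rst_self rid_mor(1,3) rst_mor)

lemma rle_antisym_rst: "rle C f g \<Longrightarrow> \<rho> f = \<rho> g \<Longrightarrow> g \<in> Mor C \<Longrightarrow> f = g"
  by (simp add: rle_def)

lemma rle_antisym:
  assumes "rle C f g" "rle C g f" "f \<in> Mor C" "g \<in> Mor C" "src f = src g"
  shows "f = g"
proof -
  have "\<rho> f = \<rho> g \<cdot> \<rho> f" "\<rho> g = \<rho> f \<cdot> \<rho> g"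
    using assms by (metis rle_def rst_cmp_rst')+
  then have "\<rho> f = \<rho> g" using assms(3,4,5) rst_comm by metis
  then show ?thesis using assms rle_antisym_rst by blast
qed

lemma rle_rid_iff: "d \<in> rid C X \<Longrightarrow> rle C d e \<longleftrightarrow> e \<cdot> d = d"
  by (auto simp: rle_def rid_iff)

lemma rle_rst:
  assumes "rle C f g" "f \<in> Mor C" "g \<in> Mor C" "src f = src g"
  shows "\<rho> g \<cdot> \<rho> f = \<rho> f"
  using assms by (metis rle_def rst_cmp_rst')

lemma cmp_cmp_rst:
  "\<lbrakk>f \<in> Mor C; g \<in> Mor C; tgt f = src g\<rbrakk> \<Longrightarrow> g \<cdot> (f \<cdot> \<rho> (g \<cdot> f)) = g \<cdot> f"
  using assoc[of "\<rho> (g \<cdot> f)" f g] cmp_rst_self[of "g \<cdot> f"] by (simp del: assoc cmp_rst_self)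

text \<open>\<open>\<rho> (d \<cdot> g)\<close> is the inverse image of \<open>d\<close> under
  \<open>g\<close>, and inverse images preserve meets. The shift law moves \<open>e\<close> to the
  right of \<open>g\<close>, where it splits off.\<close>

lemma rst_rid_cmp:
  assumes "d \<in> rid C X" "e \<in> rid C X" "g \<in> Mor C" "tgt g = X"
  shows "\<rho> (d \<cdot> (e \<cdot> g)) = \<rho> (d \<cdot> g) \<cdot> \<rho> (e \<cdot> g)"
proof -
  have "d \<cdot> (e \<cdot> g) = d \<cdot> (g \<cdot> \<rho> (e \<cdot> g))" using rid_shift[of e X g] assms by simp
  then show ?thesis using rid_mor[OF assms(1)] rid_mor[OF assms(2)] assms(3,4)
      rst_cmp_rst'[of "e \<cdot> g" "d \<cdot> g"] by simp
qed

text \<open>Both sides are the restriction of \<open>\<rho> f \<cdot> x\<close>. This exchanges maps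
  with a common domain but different targets, such as \<open>sec f\<close> and
  \<open>FA P f\<close>.\<close>

lemma rst_cmp_eq:
  assumes "\<rho> f = \<rho> g" "x \<in> Mor C" "f \<in> Mor C" "g \<in> Mor C" "tgt x = src f" "tgt x = src g"
  shows "\<rho> (f \<cdot> x) = \<rho> (g \<cdot> x)"
  using assms rst_rst_cmp by metis

lemma rle_cmp:
  assumes "rle C s f" "s \<in> Mor C" "f \<in> Mor C" "g \<in> Mor C" "tgt g = src f" "src s = src f"
  shows "rle C (s \<cdot> g) (f \<cdot> g)"
proof -
  have "f \<cdot> (\<rho> s \<cdot> g) = s \<cdot> g"
    using cmp_reassoc[OF assms(1)[unfolded rle_def, symmetric], of g] assms(2-) by simp
  then show ?thesis using assms by (simp add: rle_def rst_shift[of g s])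
qed

lemma join_unique:
  "is_join C X Y S f \<Longrightarrow> is_join C X Y S g \<Longrightarrow> f = g"
  by (rule rle_antisym) (auto simp: is_join_def)

lemma compat_rid: "d \<in> rid C X \<Longrightarrow> e \<in> rid C X \<Longrightarrow> compat C d e"
  by (simp add: compat_def rid_mor rid_comm)

text \<open>As \<open>f\<close> and \<open>g\<close> are total, both projections have the domain of
  the diagonal of the square. Each projection absorbs this idempotent, so by uniqueness it is the
  identity.\<close>

lemma pb_total:
  assumes pb: "is_pullback C f g (pb1 C f g) (pb2 C f g)" and "total C f" "total C g"
  shows "total C (pb1 C f g)" "total C (pb2 C f g)"
proof -
  note m = pb_mor[OF pb] pb_base[OF pb]
  have r: "\<rho> (pb1 C f g) = \<rho> (pb2 C f g)"
    using pb_square[OF pb] rst_cmp_total[OF assms(2), of "pb1 C f g"]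
      rst_cmp_total[OF assms(3), of "pb2 C f g"] m by simp
  have "\<rho> (pb1 C f g) = Idn C (pb_obj C f g)"
    by (rule pb_unique[OF pb]) (use m pb_obj_obj[OF pb] cmp_rst_self[of "pb2 C f g"] in \<open>simp_all add: r\<close>,
      use m cmp_rst_self[of "pb1 C f g"] r in simp)
  then show "total C (pb1 C f g)" "total C (pb2 C f g)" using r m by (simp_all add: total_def)
qed

lemma rst_pair:
  assumes pb: "is_pullback C f g (pb1 C f g) (pb2 C f g)" and "total C f" "total C g"
    and "a \<in> Mor C" "b \<in> Mor C" "src a = src b" "tgt a = src f" "tgt b = src g" "f \<cdot> a = g \<cdot> b"
  shows "\<rho> (pb_pair C f g a b) = \<rho> b"
  using rst_cmp_total[OF pb_total(2)[OF assms(1-3)], of "pb_pair C f g a b"]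
    pair[OF pb assms(4-9)] pb_mor[OF pb] by simp

context
  fixes f g t
  assumes pb: "is_pullback C f g (pb1 C f g) (pb2 C f g)"
    and t: "t \<in> Mor C" "src t = tgt f" "tgt t = src f" "f \<cdot> t = \<rho> t"
begin

text \<open>The section law gives \<open>f \<cdot> t \<cdot> g = \<rho> t \<cdot> g\<close>, and
  shifting the restriction past \<open>g\<close> explains why the second component has to be cut
  down to the domain of \<open>t \<cdot> g\<close>.\<close>

lemma lift_square: "f \<cdot> (t \<cdot> g) = g \<cdot> \<rho> (t \<cdot> g)"
  using cmp_reassoc[OF t(4), of g] rst_shift[of g t] t pb_base[OF pb] by simp

lemma lift:
  defines "l \<equiv> pb_pair C f g (t \<cdot> g) (\<rho> (t \<cdot> g))"
  shows "l \<in> Mor C" "src l = src g" "tgt l = pb_obj C f g"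
    "pb1 C f g \<cdot> l = t \<cdot> g" "pb2 C f g \<cdot> l = \<rho> (t \<cdot> g)"
  using pair[OF pb _ _ _ _ _ lift_square] t pb_base[OF pb] by (simp_all add: l_def)

lemma lift_cmp:
  assumes "x \<in> Mor C" "tgt x = src g"
  shows "pb_pair C f g (t \<cdot> g) (\<rho> (t \<cdot> g)) \<cdot> x
    = pb_pair C f g (t \<cdot> (g \<cdot> x)) (x \<cdot> \<rho> (t \<cdot> (g \<cdot> x)))"
  using pair_cmp[OF pb _ _ _ _ _ lift_square] t pb_base[OF pb] assms rst_shift[of x "t \<cdot> g"] by simp

end

end

section \<open>Joins of idempotents and equality on a cover\<close>

context join_restriction_category
begin

lemma Join_eq: "is_join C X Y S f \<Longrightarrow> Join C X Y S = f"
  unfolding Join_def using join_unique by blast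

lemma join_rid_exists:
  "X \<in> Obj C \<Longrightarrow> E \<subseteq> rid C X \<Longrightarrow> \<exists>c. is_join C X X E c"
  using join_exists[of X X E] compat_rid by (simp add: subset_iff rid_iff)

text \<open>The identity is an upper bound, so the join lies below it, and every map below the
  identity is a restriction idempotent.\<close>

lemma join_rid: 
  assumes "E \<subseteq> rid C X" "is_join C X X E c"
  shows "c \<in> rid C X"
proof -
  have X: "X \<in> Obj C" and c: "c \<in> Mor C" "src c = X" "tgt c = X"
    using assms(2) by (auto simp: is_join_def)
  have "rle C c (Idn C X)"
    using assms X unfolding is_join_def by (auto simp: rle_def rid_iff subset_iff)
  then have "c = \<rho> c" using c by (simp add: rle_def)
  then show ?thesis using c by (simp add: rid_iff)
qed

lemma join_rid_upper: "E \<subseteq> rid C X \<Longrightarrow> is_join C X X E c \<Longrightarrow> e \<in> E \<Longrightarrow> c \<cdot> e = e"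
  by (metis is_join_def rle_rid_iff subsetD)

text \<open>Both \<open>h \<cdot> c\<close> and \<open>k \<cdot> c\<close> turn out to be the join
  \<open>x\<close> of the maps \<open>h \<cdot> e\<close>. Preservation of joins by postcomposition
  is not an axiom; for idempotents it is recovered by showing that \<open>x\<close> lies below
  \<open>h \<cdot> c\<close> and has the same restriction.\<close>

lemma join_local_eq:
  assumes E: "E \<subseteq> rid C X" "is_join C X X E c"
    and h: "h \<in> hom C X Z" and k: "k \<in> hom C X Z"
    and eq: "\<And>e. e \<in> E \<Longrightarrow> h \<cdot> e = k \<cdot> e"
  shows "h \<cdot> c = k \<cdot> c"
proof -
  have c: "c \<in> rid C X" using E by (rule join_rid)
  have Z: "Z \<in> Obj C" "X \<in> Obj C" using h by auto
  have e: "e \<in> rid C X" if "e \<in> E" for e using E that by auto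
  note ce = join_rid_upper[OF E]
  have cpt: "compat C (h \<cdot> d) (h \<cdot> e)" if "d \<in> E" "e \<in> E" for d e
  proof -
    have "h \<cdot> d \<cdot> \<rho> (h \<cdot> e) = h \<cdot> (d \<cdot> (\<rho> h \<cdot> e))"
      using h e[OF that(1)] e[OF that(2)] by (simp add: rst_cmp_rid rid_mor)
    also have "\<dots> = h \<cdot> (e \<cdot> (\<rho> h \<cdot> d))"
      using h e[OF that(1)] e[OF that(2)]
      using rid_left_comm[OF e[OF that(1)] e[OF that(2)], of "\<rho> h"] 
        rid_comm[OF e[OF that(1)], of "\<rho> h"] rid_comm[OF e[OF that(2)], of "\<rho> h"] by simp
    also have "\<dots> = h \<cdot> e \<cdot> \<rho> (h \<cdot> d)"
      using h e[OF that(1)] e[OF that(2)] by (simp add: rst_cmp_rid rid_mor)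
    finally show ?thesis by (simp add: compat_def)
  qed
  have "(\<lambda>e. h \<cdot> e) ` E \<subseteq> hom C X Z" using h rid_mor(1-3)[OF e] by auto
  then obtain x where x: "is_join C X Z ((\<lambda>e. h \<cdot> e) ` E) x"
    using join_exists[of X Z "(\<lambda>e. h \<cdot> e) ` E"] Z cpt by auto
  then have xm: "x \<in> Mor C" "src x = X" "tgt x = Z" by (auto simp: is_join_def)
  \<comment> \<open>\<open>x\<close> depends only on the maps \<open>h \<cdot> e\<close>, so one
    argument for an arbitrary \<open>g\<close> agreeing with \<open>h\<close> on \<open>E\<close>
    covers both \<open>h\<close> and \<open>k\<close>.\<close>
  have main: "g \<cdot> c = x" if g: "g \<in> hom C X Z" and ge: "\<And>e. e \<in> E \<Longrightarrow> h \<cdot> e = g \<cdot> e" for g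
  proof -
    have "rle C (h \<cdot> e) (g \<cdot> c)" if "e \<in> E" for e
      using rle_cmp_rid[of "g \<cdot> c" e] g c e[OF that] ce[OF that] ge[OF that] by (simp add: rid_mor)
    then have "rle C x (g \<cdot> c)" using x g c by (auto simp: is_join_def rid_mor)
    moreover have "\<rho> (g \<cdot> c) = \<rho> x"
    proof -
      \<comment> \<open>The domain of \<open>g \<cdot> c\<close> is
        \<open>c \<cdot> \<rho> g\<close>. Being a precomposite of \<open>c\<close>, it is the join
        of the \<open>e \<cdot> \<rho> g\<close>; these are the domains of the
        \<open>h \<cdot> e\<close> and so lie below that of \<open>x\<close>.\<close>
      have "is_join C X X ((\<lambda>s. s \<cdot> \<rho> g) ` E) (c \<cdot> \<rho> g)"
        using join_precomp[OF subset_trans[OF E(1) rid_hom] E(2), of "\<rho> g" X] g by simp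
      moreover have "rle C (e \<cdot> \<rho> g) (\<rho> x)" if "e \<in> E" for e
      proof -
        have "rle C (h \<cdot> e) x" using x that by (auto simp: is_join_def)
        then have "\<rho> x \<cdot> \<rho> (h \<cdot> e) = \<rho> (h \<cdot> e)"
          using h e[OF that] xm by (intro rle_rst) (auto simp: rid_mor)
        moreover have "\<rho> (h \<cdot> e) = e \<cdot> \<rho> g"
          using ge[OF that] g e[OF that] rst_cmp_rid[of e X g] rid_comm[of e X "\<rho> g"] by simp
        ultimately show ?thesis using g e[OF that] by (subst rle_rid_iff) (auto intro: rid_cmp)
      qed
      ultimately have "rle C (c \<cdot> \<rho> g) (\<rho> x)" using xm by (auto simp: is_join_def)
      moreover have "c \<cdot> \<rho> g = \<rho> (g \<cdot> c)"
        using g c rst_cmp_rid[of c X g] rid_comm[of c X "\<rho> g"] by simp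
      ultimately have "\<rho> x \<cdot> \<rho> (g \<cdot> c) = \<rho> (g \<cdot> c)"
        using g c by (metis (no_types) in_hom rid_mor(1,2,3) cmp_mor rle_rid_iff rst_rid)
      moreover have "\<rho> (g \<cdot> c) \<cdot> \<rho> x = \<rho> x"
        using \<open>rle C x (g \<cdot> c)\<close> g c xm by (intro rle_rst) (auto simp: rid_mor)
      ultimately show ?thesis using g c xm rst_comm[of x "g \<cdot> c"] by (simp add: rid_mor)
    qed
    ultimately show ?thesis using rle_antisym_rst[of x "g \<cdot> c"] g c by (simp add: rid_mor)
  qed
  show ?thesis using main[OF h] main[OF k] eq by simp
qed

text \<open>The join exists and is itself an idempotent, so \<open>c\<close> need only be compared
  with upper bounds that are idempotents.\<close>

lemma join_ridI:
  assumes "E \<subseteq> rid C X" "c \<in> rid C X" "\<And>e. e \<in> E \<Longrightarrow> c \<cdot> e = e"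
    and "\<And>u. u \<in> rid C X \<Longrightarrow> (\<And>e. e \<in> E \<Longrightarrow> u \<cdot> e = e) \<Longrightarrow> u \<cdot> c = c"
  shows "is_join C X X E c"
proof -
  have "X \<in> Obj C" using assms(2) by (auto simp: rid_iff)
  then obtain u where u: "is_join C X X E u" using join_rid_exists assms(1) by blast
  have ur: "u \<in> rid C X" using join_rid[OF assms(1) u] .
  have "rle C u c" using u assms(1-3) unfolding is_join_def
    by (metis in_hom rid_iff rle_rid_iff subsetD)
  then have "c \<cdot> u = u" using ur rle_rid_iff by blast
  moreover have "u \<cdot> c = c" using assms(4)[OF ur] join_rid_upper[OF assms(1) u] by blast
  ultimately show ?thesis using u rid_comm[OF ur assms(2)] by simp
qed

text \<open>If an idempotent \<open>u\<close> absorbs all \<open>\<rho> s\<close>, then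
  \<open>f \<cdot> u\<close> is an upper bound of \<open>S\<close>; hence \<open>f\<close> lies
  below it and \<open>\<rho> f\<close> below \<open>u\<close>.\<close>

lemma join_rst:
  assumes "S \<subseteq> hom C X Y" "is_join C X Y S f"
  shows "is_join C X X (\<rho> ` S) (\<rho> f)"
proof (rule join_ridI)
  have f: "f \<in> Mor C" "src f = X" "tgt f = Y" using assms(2) by (auto simp: is_join_def)
  then show "\<rho> f \<in> rid C X" by simp
  show "\<rho> ` S \<subseteq> rid C X" using assms(1) by auto
  show "\<rho> f \<cdot> e = e" if "e \<in> \<rho> ` S" for e
    using that assms f by (auto simp: is_join_def subset_iff intro!: rle_rst)
  show "u \<cdot> \<rho> f = \<rho> f" if u: "u \<in> rid C X" and ue: "\<And>e. e \<in> \<rho> ` S \<Longrightarrow> u \<cdot> e = e" for u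
  proof -
    have "rle C s (f \<cdot> u)" if "s \<in> S" for s
    proof -
      have s: "s \<in> Mor C" "src s = X" "tgt s = Y" using that assms(1) by auto
      have "s = f \<cdot> \<rho> s" using assms(2) that by (auto simp: is_join_def rle_def)
      also have "\<dots> = f \<cdot> (u \<cdot> \<rho> s)" using ue that by auto
      finally show ?thesis using f s u by (simp add: rle_def rid_mor)
    qed
    then have "rle C f (f \<cdot> u)" using assms(2) f u by (auto simp: is_join_def rid_mor)
    then have "\<rho> (f \<cdot> u) \<cdot> \<rho> f = \<rho> f" using f u by (intro rle_rst) (auto simp: rid_mor)
    then have "\<rho> f \<cdot> u \<cdot> \<rho> f = \<rho> f" using f u by (simp add: rst_cmp_rid)
    moreover have "\<rho> f \<cdot> u \<cdot> \<rho> f = u \<cdot> \<rho> f"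
      using f u rid_comm[of u X "\<rho> f"] by (metis assoc rid_mor(1,2,3) rst_idem rst_mor rst_rid)
    ultimately show ?thesis by simp
  qed
qed

text \<open>Any other upper bound agrees with \<open>f\<close> on each \<open>\<rho> s\<close>,
  hence by \<open>join_local_eq\<close> on their join \<open>\<rho> f\<close>.\<close>

lemma joinI:
  assumes "S \<subseteq> hom C X Y" "f \<in> hom C X Y" "\<And>s. s \<in> S \<Longrightarrow> rle C s f"
    and "is_join C X X (\<rho> ` S) (\<rho> f)"
  shows "is_join C X Y S f"
  unfolding is_join_def
proof (intro conjI ballI impI)
  show "rle C f g" if g: "g \<in> hom C X Y" and ub: "\<forall>s\<in>S. rle C s g" for g
  proof -
    have "f \<cdot> \<rho> f = g \<cdot> \<rho> f"
    proof (rule join_local_eq[OF _ assms(4) assms(2) g])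
      show "\<rho> ` S \<subseteq> rid C X" using assms(1) by auto
      show "f \<cdot> e = g \<cdot> e" if "e \<in> \<rho> ` S" for e
        using that ub assms(3) by (auto simp: rle_def)
    qed
    then show ?thesis using assms(2) by (simp add: rle_def)
  qed
qed (use assms in auto)

text \<open>Used to pull covers back along maps, \<open>\<rho> (e \<cdot> g)\<close> being the
  inverse image of \<open>e\<close>: \<open>join_precomp\<close> gives the join of the maps
  \<open>e \<cdot> g\<close>, and \<open>join_rst\<close> passes to their domains.\<close>

lemma cover_precomp:
  assumes "E \<subseteq> rid C X" "is_join C X X E c" "g \<in> hom C W X"
  shows "is_join C W W ((\<lambda>e. \<rho> (e \<cdot> g)) ` E) (\<rho> (c \<cdot> g))"
proof -
  have "is_join C W X ((\<lambda>e. e \<cdot> g) ` E) (c \<cdot> g)"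
    by (rule join_precomp[OF _ assms(2,3)]) (use assms(1) in \<open>auto simp: rid_mor\<close>)
  then have "is_join C W W (\<rho> ` (\<lambda>e. e \<cdot> g) ` E) (\<rho> (c \<cdot> g))"
    by (rule join_rst[rotated]) (use assms in \<open>auto simp: rid_mor\<close>)
  then show ?thesis by (simp add: image_image)
qed

lemma join_eq_local:
  assumes "E \<subseteq> rid C X" "is_join C X X E c"
    and "h \<in> hom C X Z" "k \<in> hom C X Z" "h \<cdot> c = h" "k \<cdot> c = k"
    and "\<And>e. e \<in> E \<Longrightarrow> h \<cdot> e = k \<cdot> e"
  shows "h = k"
  using join_local_eq[OF assms(1-4,7)] assms(5,6) by simp

text \<open>The last conclusion keeps track of the domain of the glued map, by which it is compared
  with other maps later.\<close>

lemma glue_compat: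
  assumes "W \<in> Obj C" "Y \<in> Obj C" "\<And>i. i \<in> I \<Longrightarrow> x i \<in> hom C W Y"
    and "\<And>i j. i \<in> I \<Longrightarrow> j \<in> I \<Longrightarrow> x i \<cdot> \<rho> (x j) = x j \<cdot> \<rho> (x i)"
  obtains h where "h \<in> hom C W Y" "\<And>i. i \<in> I \<Longrightarrow> h \<cdot> \<rho> (x i) = x i"
    "is_join C W W ((\<lambda>i. \<rho> (x i)) ` I) (\<rho> h)"
proof -
  obtain h where h: "is_join C W Y (x ` I) h"
    using join_exists[of W Y "x ` I"] assms(1,2,3) assms(4) unfolding compat_def by blast
  have "h \<cdot> \<rho> (x i) = x i" if "i \<in> I" for i
    using h that by (auto simp: is_join_def rle_def)
  moreover have "is_join C W W ((\<lambda>i. \<rho> (x i)) ` I) (\<rho> h)"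
    using join_rst[OF _ h] assms(3) by (simp add: image_image image_subset_iff)
  ultimately show ?thesis using that h by (auto simp: is_join_def)
qed

end

section \<open>Etale families\<close>

text \<open>A presentation of \<open>p\<close> as a join of partial isomorphisms \<open>p \<cdot> e i\<close> with partial inverses \<open>s i\<close>.\<close>

locale etale_family = join_restriction_category C
  for C :: "('o, 'u) rcat" (structure) +
  fixes p :: "('o, 'u) arr" and I :: "'i set" and s e :: "'i \<Rightarrow> ('o, 'u) arr"
  assumes p_mor [simp]: "p \<in> Mor C"
    and p_total [simp]: "total C p"
    and s_hom: "i \<in> I \<Longrightarrow> s i \<in> hom C (tgt p) (src p)"
    and p_s [simp]: "i \<in> I \<Longrightarrow> p \<cdot> s i = \<rho> (s i)"
    and e_rid: "i \<in> I \<Longrightarrow> e i \<in> rid C (src p)"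
    and s_p_e: "i \<in> I \<Longrightarrow> s i \<cdot> (p \<cdot> e i) = e i"
    and e_s [simp]: "i \<in> I \<Longrightarrow> e i \<cdot> s i = s i"
    and cover: "is_join C (src p) (src p) (e ` I) (Idn C (src p))"
begin

lemma s_mor [simp]: "i \<in> I \<Longrightarrow> s i \<in> Mor C" "i \<in> I \<Longrightarrow> src (s i) = tgt p" "i \<in> I \<Longrightarrow> tgt (s i) = src p"
  using s_hom by auto

lemma e_mor [simp]: "i \<in> I \<Longrightarrow> e i \<in> Mor C" "i \<in> I \<Longrightarrow> src (e i) = src p" "i \<in> I \<Longrightarrow> tgt (e i) = src p"
  "i \<in> I \<Longrightarrow> \<rho> (e i) = e i"
  using e_rid by (auto simp: rid_iff)

lemma e_img: "e ` I \<subseteq> rid C (src p)"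
  using e_rid by auto

lemma e_cmp: "i \<in> I \<Longrightarrow> a \<in> Mor C \<Longrightarrow> tgt a = src p \<Longrightarrow> e i \<cdot> a = a \<cdot> \<rho> (e i \<cdot> a)"
  using rid_shift[OF e_rid] by simp

text \<open>\<open>w\<close> is the inverse image of \<open>e i\<close> under \<open>a\<close>.
  There \<open>a\<close> is recovered from its projection to the base, because
  \<open>e i = s i \<cdot> (p \<cdot> e i)\<close>.\<close>

lemma localize:
  assumes a: "a \<in> Mor C" "tgt a = src p" and i: "i \<in> I"
  defines "w \<equiv> \<rho> (e i \<cdot> a)"
  shows "w \<in> rid C (src a)" "a \<cdot> w = s i \<cdot> (p \<cdot> (a \<cdot> w))" "\<rho> (a \<cdot> w) = w" "e i \<cdot> a = a \<cdot> w"
proof -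
  show w: "w \<in> rid C (src a)" using a i by (simp add: w_def)
  show ea: "e i \<cdot> a = a \<cdot> w" using e_cmp[OF i a] by (simp add: w_def)
  show "\<rho> (a \<cdot> w) = w" using ea w_def by simp
  have "a \<cdot> w = s i \<cdot> (p \<cdot> e i) \<cdot> a" using s_p_e[OF i] ea by simp
  also have "\<dots> = s i \<cdot> (p \<cdot> (a \<cdot> w))" using a i ea by simp
  finally show "a \<cdot> w = s i \<cdot> (p \<cdot> (a \<cdot> w))" .
qed

lemma localize_cover:
  assumes "a \<in> Mor C" "tgt a = src p"
  shows "is_join C (src a) (src a) ((\<lambda>i. \<rho> (e i \<cdot> a)) ` I) (\<rho> a)"
  using cover_precomp[OF e_img cover, of a "src a"] assms by (simp add: image_image)

text \<open>The inverse images of the \<open>e i\<close> cover the domain of \<open>a\<close>, so in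
  an equation about \<open>a\<close> it may be assumed to have the form
  \<open>s i \<cdot> x\<close>.\<close>

lemma local_eq:
  assumes a: "a \<in> hom C W (src p)" and h: "h \<in> hom C W Y" "h \<cdot> \<rho> a = h"
    and k: "k \<in> hom C W Y" "k \<cdot> \<rho> a = k"
    and eq: "\<And>i w. \<lbrakk>i \<in> I; w = \<rho> (e i \<cdot> a); w \<in> rid C W; a \<cdot> w = s i \<cdot> (p \<cdot> (a \<cdot> w)); \<rho> (a \<cdot> w) = w\<rbrakk>
      \<Longrightarrow> h \<cdot> w = k \<cdot> w"
  shows "h = k"
proof (rule join_eq_local[OF _ _ h(1) k(1) h(2) k(2)])
  show "is_join C W W ((\<lambda>i. \<rho> (e i \<cdot> a)) ` I) (\<rho> a)" using localize_cover[of a] a by simp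
  show "(\<lambda>i. \<rho> (e i \<cdot> a)) ` I \<subseteq> rid C W" using a by auto
  show "h \<cdot> w = k \<cdot> w" if "w \<in> (\<lambda>i. \<rho> (e i \<cdot> a)) ` I" for w
    using that eq localize[of a] a by auto
qed

text \<open>Each \<open>e i\<close> factors through \<open>s i\<close>, and the \<open>e i\<close>
  cover the source of \<open>p\<close>.\<close>

lemma eq_on_sections:
  assumes h: "h \<in> hom C (src p) Y" and k: "k \<in> hom C (src p) Y"
    and eq: "\<And>i. i \<in> I \<Longrightarrow> h \<cdot> s i = k \<cdot> s i"
  shows "h = k"
proof (rule join_eq_local[OF e_img cover h k])
  fix w assume "w \<in> e ` I"
  then obtain i where i: "i \<in> I" "w = e i" by blast
  have "h \<cdot> e i = h \<cdot> s i \<cdot> (p \<cdot> e i)" using i h s_p_e[of i] by simp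
  also have "\<dots> = k \<cdot> e i" using i k s_p_e[of i] by (simp add: eq)
  finally show "h \<cdot> w = k \<cdot> w" using i by simp
qed (use h k in auto)

text \<open>In a glueing \<open>p \<cdot> e j\<close> is the \<open>j\<close>-th partial
  isomorphism, so this is the entry \<open>\<phi> i j\<close> of the atlas.\<close>

definition overlap where "overlap i j = p \<cdot> (e j \<cdot> s i)"

lemma overlap:
  assumes i: "i \<in> I" and j: "j \<in> I"
  shows "overlap i j = \<rho> (e j \<cdot> s i)" "overlap i j \<in> rid C (tgt p)"
    "s i \<cdot> overlap i j = s j \<cdot> overlap i j" "\<rho> (s i) \<cdot> overlap i j = overlap i j"
    "e j \<cdot> s i = s i \<cdot> overlap i j"
proof -
  have ej: "e j \<cdot> s i = s i \<cdot> \<rho> (e j \<cdot> s i)" using e_cmp[OF j, of "s i"] i by simp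
  have "overlap i j = p \<cdot> (s i \<cdot> \<rho> (e j \<cdot> s i))" using ej by (simp add: overlap_def)
  also have "\<dots> = p \<cdot> s i \<cdot> \<rho> (e j \<cdot> s i)" using i j by (subst assoc) auto
  also have "\<dots> = \<rho> (e j \<cdot> s i)" using i j by simp
  finally show o: "overlap i j = \<rho> (e j \<cdot> s i)" .
  show "overlap i j \<in> rid C (tgt p)" "\<rho> (s i) \<cdot> overlap i j = overlap i j" using i j by (simp_all add: o)
  show 1: "e j \<cdot> s i = s i \<cdot> overlap i j" using ej o by simp
  have "e j \<cdot> s i = s j \<cdot> (p \<cdot> e j) \<cdot> s i" using s_p_e[OF j] by simp
  also have "\<dots> = s j \<cdot> overlap i j" using i j by (simp add: overlap_def)
  finally show "s i \<cdot> overlap i j = s j \<cdot> overlap i j" using 1 by simp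
qed

text \<open>\<open>e j\<close> fixes \<open>s j\<close>, hence also \<open>s i\<close> wherever the
  two agree. So every idempotent inside the domain of \<open>s i\<close> on which the sections agree
  lies below the overlap.\<close>

lemma overlap_upper:
  assumes i: "i \<in> I" and j: "j \<in> I" and d: "d \<in> rid C (tgt p)" "s i \<cdot> d = s j \<cdot> d"
  shows "overlap i j \<cdot> d = \<rho> (s i) \<cdot> d"
proof -
  have "e j \<cdot> (s i \<cdot> d) = s i \<cdot> d"
    using i j d rid_mor[OF d(1)] by (simp add: cmp_reassoc[OF e_s])
  then have "\<rho> (e j \<cdot> s i \<cdot> d) = \<rho> (s i \<cdot> d)" using i j rid_mor[OF d(1)] by simp
  then show ?thesis using i j rid_mor[OF d(1)] by (simp add: rst_cmp_rid[OF d(1)] overlap(1) del: assoc)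
qed

text \<open>\<open>s i \<cdot> (p \<cdot> e i)\<close> collapses to \<open>e i\<close> inside the
  composite. So \<open>p\<close> carries the intersection of the pieces \<open>e i\<close> and
  \<open>e j\<close> into the overlap.\<close>

lemma p_overlap:
  assumes i: "i \<in> I" and j: "j \<in> I"
  shows "overlap i j \<cdot> (p \<cdot> (e i \<cdot> e j)) = p \<cdot> (e i \<cdot> e j)"
proof -
  have "overlap i j \<cdot> (p \<cdot> (e i \<cdot> e j)) = p \<cdot> (e j \<cdot> (s i \<cdot> (p \<cdot> e i)) \<cdot> e j)"
    using i j by (simp add: overlap_def)
  also have "\<dots> = p \<cdot> (e i \<cdot> e j)"
    using i j s_p_e rid_comm[OF e_rid[OF i] e_rid[OF j]] rid_idem_cmp[OF e_rid[OF j]] by simp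
  finally show ?thesis .
qed

text \<open>The maps \<open>x i\<close> live on the base; \<open>x i \<cdot> (p \<cdot> e i)\<close>
  moves them to the source, with domain \<open>e i\<close>. On \<open>e i \<cdot> e j\<close> the
  projection \<open>p\<close> lands in the overlap, where \<open>x i\<close> and \<open>x j\<close>
  agree by hypothesis, so the moved maps are compatible and their join is the required map.\<close>

lemma extend:
  assumes Y: "Y \<in> Obj C"
    and x: "\<And>i. i \<in> I \<Longrightarrow> x i \<in> hom C (tgt p) Y" "\<And>i. i \<in> I \<Longrightarrow> \<rho> (x i) = \<rho> (s i)"
    and eq: "\<And>i j d. \<lbrakk>i \<in> I; j \<in> I; d \<in> rid C (tgt p); \<rho> (s i) \<cdot> d = d; \<rho> (s j) \<cdot> d = d;
      s i \<cdot> d = s j \<cdot> d\<rbrakk> \<Longrightarrow> x i \<cdot> d = x j \<cdot> d"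
  shows "\<exists>!h. h \<in> hom C (src p) Y \<and> (\<forall>i\<in>I. h \<cdot> s i = x i)"
proof -
  define y where "y i = x i \<cdot> (p \<cdot> e i)" for i
  have xm [simp]: "x i \<in> Mor C" "src (x i) = tgt p" "tgt (x i) = Y" if "i \<in> I" for i
    using x that by auto
  have ym [simp]: "y i \<in> Mor C" "src (y i) = src p" "tgt (y i) = Y" if "i \<in> I" for i
    using that by (simp_all add: y_def)
  have ry: "\<rho> (y i) = e i" if i: "i \<in> I" for i
  proof -
    have "\<rho> (y i) = \<rho> (\<rho> (x i) \<cdot> (p \<cdot> e i))" using i by (simp add: y_def)
    also have "\<dots> = \<rho> (s i \<cdot> (p \<cdot> e i))" using i x(2) by simp
    finally show ?thesis using i s_p_e by simp
  qed
  have xo: "x i \<cdot> overlap i j = x j \<cdot> overlap i j" if "i \<in> I" "j \<in> I" for i j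
  proof (rule eq)
    show "\<rho> (s j) \<cdot> overlap i j = overlap i j"
    proof -
      have "\<rho> (s j) \<cdot> overlap i j = \<rho> (s j \<cdot> overlap i j)"
        using that overlap(2)[OF that] by (simp add: rst_cmp_rid)
      also have "\<dots> = overlap i j" using that overlap[OF that] 
        by (metis rst_cmp_rid s_mor(1,2))
      finally show ?thesis .
    qed
  qed (use that overlap[OF that] in auto)
  have yc: "y i \<cdot> \<rho> (y j) = y j \<cdot> \<rho> (y i)" if i: "i \<in> I" and j: "j \<in> I" for i j
  proof -
    have o: "overlap i j \<in> Mor C" "src (overlap i j) = tgt p" "tgt (overlap i j) = tgt p"
      using rid_mor[OF overlap(2)[OF i j]] by auto
    have "y i \<cdot> \<rho> (y j) = x i \<cdot> (p \<cdot> (e i \<cdot> e j))" using i j by (simp add: ry) (simp add: y_def)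
    also have "\<dots> = x i \<cdot> overlap i j \<cdot> (p \<cdot> (e i \<cdot> e j))" using i j o by (simp add: p_overlap)
    also have "\<dots> = x j \<cdot> overlap i j \<cdot> (p \<cdot> (e i \<cdot> e j))" using xo[OF i j] by simp
    also have "\<dots> = x j \<cdot> (p \<cdot> (e i \<cdot> e j))" using i j o by (simp add: p_overlap)
    also have "\<dots> = y j \<cdot> \<rho> (y i)"
      using i j rid_comm[OF e_rid e_rid, of i j] by (simp add: ry) (simp add: y_def)
    finally show ?thesis .
  qed
  obtain h where h: "h \<in> hom C (src p) Y" "\<And>i. i \<in> I \<Longrightarrow> h \<cdot> \<rho> (y i) = y i"
    by (rule glue_compat[of "src p" Y I y]) (use Y ym yc in auto)
  have hs: "h \<cdot> s i = x i" if i: "i \<in> I" for i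
  proof -
    have "h \<cdot> s i = h \<cdot> e i \<cdot> s i" using h i by simp
    also have "\<dots> = x i \<cdot> (p \<cdot> (e i \<cdot> s i))" using h(2)[OF i] i ry[OF i] by (simp add: y_def)
    also have "\<dots> = x i \<cdot> \<rho> (x i)" using i by (simp add: x(2))
    finally show ?thesis using i by simp
  qed
  show ?thesis
  proof (rule ex1I[of _ h])
    show "h \<in> hom C (src p) Y \<and> (\<forall>i\<in>I. h \<cdot> s i = x i)" using h hs by blast
    show "k = h" if "k \<in> hom C (src p) Y \<and> (\<forall>i\<in>I. k \<cdot> s i = x i)" for k
      by (rule eq_on_sections[of k Y h]) (use that h hs in auto)
  qed
qed

text \<open>\<open>\<rho> h\<close> fixes every section, and so does the identity.\<close>

lemma extend_total:
  assumes "h \<in> hom C (src p) Y" "\<And>i. i \<in> I \<Longrightarrow> \<rho> (h \<cdot> s i) = \<rho> (s i)"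
  shows "total C h"
proof -
  have "\<rho> h = Idn C (src p)"
  proof (rule eq_on_sections)
    show "\<rho> h \<cdot> s i = Idn C (src p) \<cdot> s i" if "i \<in> I" for i
      using assms that rst_shift[of "s i" h] by simp
  qed (use assms in auto)
  then show ?thesis using assms by (simp add: total_def)
qed

text \<open>A point of the pullback lying over \<open>e i\<close> is determined by its second
  projection, since its first component is \<open>s i\<close> of the common image in the base. The
  inverse images of the \<open>e i\<close> cover because the first projection is total.\<close>

lemma base_change:
  assumes pb: "is_pullback C p g (pb1 C p g) (pb2 C p g)" and g: "total C g"
  shows "etale_family C (pb2 C p g) I (\<lambda>i. pb_lift C p g (s i)) (\<lambda>i. \<rho> (e i \<cdot> pb1 C p g))"
proof
  note [simp] = pb_mor[OF pb] pb_base[OF pb] g pb_total[OF pb p_total g]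
  have sm: "s i \<in> Mor C" "src (s i) = tgt p" "tgt (s i) = src p" "p \<cdot> s i = \<rho> (s i)" if "i \<in> I" for i
    using that by (simp_all del: pb_base)
  note l = lift[OF pb sm, folded pb_lift_def]
  note l_cmp = lift_cmp[OF pb sm, folded pb_lift_def]
  let ?r = "pb1 C p g" and ?q = "pb2 C p g"
  note o [simp] = pb_obj_obj[OF pb]
  show "?q \<in> Mor C" "total C ?q" by auto
  fix i assume i: "i \<in> I"
  let ?w = "\<rho> (e i \<cdot> ?r)" and ?l = "pb_lift C p g (s i)"
  show "?l \<in> hom C (tgt ?q) (src ?q)" using l[OF i i i i] by simp
  have rl: "\<rho> ?l = \<rho> (s i \<cdot> g)"
    using rst_cmp_total[of ?q ?l] l[OF i i i i] i by simp
  then show "?q \<cdot> ?l = \<rho> ?l" using l[OF i i i i] by simp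
  show "?w \<in> rid C (src ?q)" using i by simp
  have er: "e i \<cdot> ?r = ?r \<cdot> ?w" using e_cmp[OF i, of ?r] by simp
  \<comment> \<open>On \<open>?w\<close> the first projection lies in \<open>e i\<close>, so it is
    \<open>s i\<close> applied to its image under \<open>p\<close>, and that image is
    \<open>g\<close> of the second projection.\<close>
  have sgq: "s i \<cdot> (g \<cdot> (?q \<cdot> ?w)) = ?r \<cdot> ?w"
  proof -
    have "g \<cdot> (?q \<cdot> ?w) = p \<cdot> (e i \<cdot> ?r)"
      using cmp_reassoc[OF pb_square[OF pb], of ?w] i er by simp
    moreover have "s i \<cdot> (p \<cdot> (e i \<cdot> ?r)) = e i \<cdot> ?r"
      using cmp_reassoc[OF s_p_e, of i ?r] i by simp
    ultimately show ?thesis using er by simp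
  qed
  show "?l \<cdot> (?q \<cdot> ?w) = ?w"
  proof -
    have "?l \<cdot> (?q \<cdot> ?w) = pb_pair C p g (?r \<cdot> ?w) (?q \<cdot> ?w \<cdot> \<rho> (?r \<cdot> ?w))"
      using l_cmp[OF i i i i, of "?q \<cdot> ?w"] i sgq by simp
    also have "?q \<cdot> ?w \<cdot> \<rho> (?r \<cdot> ?w) = ?q \<cdot> ?w" using i by simp
    finally show ?thesis using pair_eta[OF pb, of ?w] i by simp
  qed
  show "?w \<cdot> ?l = ?l"
  proof -
    have "?w \<cdot> ?l = ?l \<cdot> \<rho> (e i \<cdot> ?r \<cdot> ?l)" using rst_shift[of ?l "e i \<cdot> ?r"] i l[OF i i i i] by simp
    also have "e i \<cdot> ?r \<cdot> ?l = s i \<cdot> g"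
      using i l[OF i i i i] cmp_reassoc[OF e_s, of i g] by simp
    finally show ?thesis using rl l[OF i i i i] cmp_rst_self[of ?l] by simp
  qed
next
  note [simp] = pb_mor[OF pb] pb_base[OF pb] g pb_total[OF pb p_total g]
  show "is_join C (src (pb2 C p g)) (src (pb2 C p g)) ((\<lambda>i. \<rho> (e i \<cdot> pb1 C p g)) ` I)
     (Idn C (src (pb2 C p g)))"
    using localize_cover[of "pb1 C p g"] rst_total[OF pb_total(1)[OF pb p_total g]] by simp
qed

text \<open>The pieces are the intersections of \<open>d j\<close> with the inverse image of
  \<open>e i\<close>. That they cover is seen in two stages: the inverse images of the
  \<open>e i\<close> cover because \<open>q\<close> is total, and each of these is covered by its
  intersections with the \<open>d j\<close>.\<close>

lemma compose:
  assumes "etale_family C q J t d" and tq: "tgt q = src p"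
  shows "etale_family C (p \<cdot> q) (I \<times> J) (\<lambda>(i, j). t j \<cdot> s i) (\<lambda>(i, j). d j \<cdot> \<rho> (e i \<cdot> q))"
proof -
  interpret Q: etale_family C q J t d by fact
  note [simp] = tq
  have pq: "p \<cdot> q \<in> Mor C" "total C (p \<cdot> q)" "src (p \<cdot> q) = src q" "tgt (p \<cdot> q) = tgt p" by auto
  have w: "\<rho> (e i \<cdot> q) \<in> rid C (src q)" if "i \<in> I" for i using that by simp
  have eq: "e i \<cdot> q = q \<cdot> \<rho> (e i \<cdot> q)" if "i \<in> I" for i using e_cmp[OF that, of q] by simp
  show ?thesis
  proof (unfold_locales, unfold pq)
    fix x assume "x \<in> I \<times> J"
    then obtain i j where x: "x = (i, j)" and i: "i \<in> I" and j: "j \<in> J" by blast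
    let ?w = "\<rho> (e i \<cdot> q)"
    note [simp] = i j
    note dw = rid_comm[OF Q.e_rid[OF j] w[OF i]]
    have tjq: "t j \<cdot> (q \<cdot> (d j \<cdot> ?w)) = d j \<cdot> ?w" using cmp_reassoc[OF Q.s_p_e, of j ?w] by simp
    show "(case x of (i, j) \<Rightarrow> t j \<cdot> s i) \<in> hom C (tgt p) (src q)" by (simp add: x)
    have "\<rho> (t j \<cdot> s i) = \<rho> (\<rho> (t j) \<cdot> s i)" by simp
    show "p \<cdot> q \<cdot> (case x of (i, j) \<Rightarrow> t j \<cdot> s i) = \<rho> (case x of (i, j) \<Rightarrow> t j \<cdot> s i)"
    proof -
      have "p \<cdot> q \<cdot> (t j \<cdot> s i) = p \<cdot> (\<rho> (t j) \<cdot> s i)" using cmp_reassoc[OF Q.p_s, of j "s i"] by simp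
      also have "\<dots> = \<rho> (s i) \<cdot> \<rho> (t j \<cdot> s i)"
        using rst_shift[of "s i" "t j"] cmp_reassoc[OF p_s, of i "\<rho> (t j \<cdot> s i)"] by simp
      finally show ?thesis by (simp add: x)
    qed
    show "(case x of (i, j) \<Rightarrow> d j \<cdot> \<rho> (e i \<cdot> q)) \<in> rid C (src q)"
      using rid_cmp[OF Q.e_rid[OF j] w[OF i]] by (simp add: x)
    show "(case x of (i, j) \<Rightarrow> t j \<cdot> s i) \<cdot> (p \<cdot> q \<cdot> (case x of (i, j) \<Rightarrow> d j \<cdot> \<rho> (e i \<cdot> q)))
      = (case x of (i, j) \<Rightarrow> d j \<cdot> \<rho> (e i \<cdot> q))"
    proof -
      have "(t j \<cdot> s i) \<cdot> (p \<cdot> q \<cdot> (d j \<cdot> ?w)) = t j \<cdot> (s i \<cdot> (p \<cdot> (q \<cdot> (?w \<cdot> d j))))"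
        using dw by simp
      also have "q \<cdot> (?w \<cdot> d j) = e i \<cdot> (q \<cdot> d j)" using cmp_reassoc[OF eq[symmetric], of i "d j"] by simp
      also have "t j \<cdot> (s i \<cdot> (p \<cdot> \<dots>)) = t j \<cdot> (e i \<cdot> (q \<cdot> d j))"
        using cmp_reassoc[OF s_p_e, of i "q \<cdot> d j"] by simp
      also have "e i \<cdot> (q \<cdot> d j) = q \<cdot> (d j \<cdot> ?w)" using cmp_reassoc[OF eq[symmetric], of i "d j"] dw by simp
      finally show ?thesis using tjq by (simp add: x)
    qed
    show "(case x of (i, j) \<Rightarrow> d j \<cdot> \<rho> (e i \<cdot> q)) \<cdot> (case x of (i, j) \<Rightarrow> t j \<cdot> s i) = (case x of (i, j) \<Rightarrow> t j \<cdot> s i)"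
    proof -
      have "?w \<cdot> t j = t j \<cdot> \<rho> (e i \<cdot> (q \<cdot> t j))" using rst_shift[of "t j" "e i \<cdot> q"] by simp
      also have "\<dots> = t j \<cdot> (\<rho> (t j) \<cdot> e i)"
        using rid_comm[of "e i" "src p" "\<rho> (t j)"] rst_cmp_rid[of "e i" "src p" "t j"] e_rid[OF i] by simp
      also have "\<dots> = t j \<cdot> e i" using cmp_reassoc[OF cmp_rst_self, of "t j" "e i"] by simp
      finally have "?w \<cdot> (t j \<cdot> s i) = t j \<cdot> s i"
        using cmp_reassoc[of ?w "t j" "t j \<cdot> e i" "s i"] by simp
      then have "(d j \<cdot> ?w) \<cdot> (t j \<cdot> s i) = t j \<cdot> s i"
        using cmp_reassoc[OF Q.e_s, of j "s i"] by simp
      then show ?thesis by (simp add: x)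
    qed
  next
    show "is_join C (src q) (src q) ((\<lambda>(i, j). d j \<cdot> \<rho> (e i \<cdot> q)) ` (I \<times> J)) (Idn C (src q))"
    proof (rule join_ridI)
      show E: "(\<lambda>(i, j). d j \<cdot> \<rho> (e i \<cdot> q)) ` (I \<times> J) \<subseteq> rid C (src q)"
        using rid_cmp[OF Q.e_rid w] by auto
      show "Idn C (src q) \<in> rid C (src q)" by simp
      show "Idn C (src q) \<cdot> x = x" if "x \<in> (\<lambda>(i, j). d j \<cdot> \<rho> (e i \<cdot> q)) ` (I \<times> J)" for x
        using that by auto
      fix u assume u: "u \<in> rid C (src q)"
        and ux: "\<And>x. x \<in> (\<lambda>(i, j). d j \<cdot> \<rho> (e i \<cdot> q)) ` (I \<times> J) \<Longrightarrow> u \<cdot> x = x"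
      note [simp] = rid_mor(1-3)[OF u]
      have "u = Idn C (src q)"
      proof (rule join_eq_local[of "(\<lambda>i. \<rho> (e i \<cdot> q)) ` I"])
        show "(\<lambda>i. \<rho> (e i \<cdot> q)) ` I \<subseteq> rid C (src q)" using w by auto
        show "is_join C (src q) (src q) ((\<lambda>i. \<rho> (e i \<cdot> q)) ` I) (Idn C (src q))"
          using localize_cover[of q] rst_total[OF Q.p_total] by simp
        fix x assume "x \<in> (\<lambda>i. \<rho> (e i \<cdot> q)) ` I"
        then obtain i where x: "x = \<rho> (e i \<cdot> q)" and i: "i \<in> I" by blast
        have "u \<cdot> x \<cdot> Idn C (src q) = x \<cdot> Idn C (src q)"
        proof (rule join_local_eq[OF Q.e_img Q.cover])
          fix y assume "y \<in> d ` J"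
          then obtain j where j: "y = d j" "j \<in> J" by blast
          have "u \<cdot> (d j \<cdot> x) = d j \<cdot> x" using ux i j by (auto simp: x)
          then show "u \<cdot> x \<cdot> y = x \<cdot> y" using rid_comm[OF Q.e_rid[OF j(2)] w[OF i]] i j by (simp add: x)
        qed (use i in \<open>simp_all add: x\<close>)
        then show "u \<cdot> x = Idn C (src q) \<cdot> x" using i by (simp add: x)
      qed auto
      then show "u \<cdot> Idn C (src q) = Idn C (src q)" by simp
    qed
  qed simp_all
qed

end

text \<open>The covering idempotent is the domain of \<open>pp i\<close>; since \<open>pp i\<close>
  lies below \<open>p\<close>, restricting \<open>p\<close> to it returns \<open>pp i\<close>. The
  domains cover because the join \<open>p\<close> is total.\<close>

lemma etale_family_of_partial_inverses:
  fixes C :: "('o, 'u) rcat" (structure)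
  assumes "join_restriction_category C" and p: "p \<in> Mor C" "total C p"
    and pp: "\<And>i. i \<in> I \<Longrightarrow> pp i \<in> hom C (src p) (tgt p) \<and> partial_inverse C (pp i) (ss i)"
    and j: "is_join C (src p) (tgt p) (pp ` I) p"
  shows "etale_family C p I ss (\<lambda>i. \<rho> (pp i))"
proof -
  interpret join_restriction_category C by fact
  show ?thesis
  proof
    fix i assume i: "i \<in> I"
    have [simp]: "pp i \<in> Mor C" "src (pp i) = src p" "tgt (pp i) = tgt p"
      "ss i \<in> Mor C" "src (ss i) = tgt p" "tgt (ss i) = src p"
      and inv: "ss i \<cdot> pp i = \<rho> (pp i)" "pp i \<cdot> ss i = \<rho> (ss i)"
      using pp[OF i] by (auto simp: partial_inverse_def)
    have pe: "p \<cdot> \<rho> (pp i) = pp i" using j i by (simp add: is_join_def rle_def)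
    show "ss i \<in> hom C (tgt p) (src p)" "\<rho> (pp i) \<in> rid C (src p)" by simp_all
    show 1: "\<rho> (pp i) \<cdot> ss i = ss i" using rst_shift[of "ss i" "pp i"] inv by simp
    show "ss i \<cdot> (p \<cdot> \<rho> (pp i)) = \<rho> (pp i)" using pe inv by simp
    have "p \<cdot> ss i = p \<cdot> (\<rho> (pp i) \<cdot> ss i)" using 1 by simp
    also have "\<dots> = \<rho> (ss i)" using cmp_reassoc[OF pe, of "ss i"] p inv by simp
    finally show "p \<cdot> ss i = \<rho> (ss i)" .
  next
    show "is_join C (src p) (src p) ((\<lambda>i. \<rho> (pp i)) ` I) (Idn C (src p))"
      using join_rst[OF _ j] pp p by (simp add: image_image image_subset_iff total_def)
  qed (use p in auto)
qed

text \<open>Local glueings are given for index sets in \<open>'u\<close>, while the atlases below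
  are indexed by arrows, which form another type. A small set injects into \<open>'u\<close>, so the
  atlas is transported along an injection.\<close>

lemma is_glueing_any_index:
  fixes C :: "('o, 'u) rcat" and I :: "'i set"
  assumes "has_local_glueings C" "X \<in> Obj C" "I \<prec> (UNIV :: 'u set)" "local_atlas C X I \<phi>"
  shows "\<exists>p pp ss. is_glueing C X I \<phi> p pp ss"
proof -
  obtain f :: "'i \<Rightarrow> 'u" where f: "inj_on f I"
    using assms(3) by (auto simp: lesspoll_def lepoll_def)
  define g where "g = the_inv_into I f"
  have g [simp]: "g (f i) = i" if "i \<in> I" for i
    using the_inv_into_f_f[OF f that] by (simp add: g_def)
  have "f ` I \<approx> I" using f inj_on_image_eqpoll_self by blast
  then have "f ` I \<prec> (UNIV :: 'u set)"
    using assms(3) eqpoll_imp_lepoll lesspoll_trans1 by blast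
  moreover have "local_atlas C X (f ` I) (\<lambda>i j. \<phi> (g i) (g j))"
    using assms(4) unfolding local_atlas_def by simp
  ultimately obtain p pp ss where
    "is_glueing C X (f ` I) (\<lambda>i j. \<phi> (g i) (g j)) p pp ss"
    using assms(1,2) unfolding has_local_glueings_def by blast
  then have "is_glueing C X I \<phi> p (pp \<circ> f) (ss \<circ> f)"
    unfolding is_glueing_def by (simp add: image_comp)
  then show ?thesis by blast
qed

lemma is_glueing_etale_family:
  fixes C :: "('o, 'u) rcat" (structure)
  assumes "join_restriction_category C" "is_glueing C X I \<phi> p pp ss"
  shows "etale_family C p I ss (\<lambda>i. \<rho> (pp i))"
  by (rule etale_family_of_partial_inverses) (use assms in \<open>auto simp: is_glueing_def local_homeo_def\<close>)

lemma is_glueing_overlap: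
  fixes C :: "('o, 'u) rcat" (structure)
  assumes "join_restriction_category C" "is_glueing C X I \<phi> p pp ss" "i \<in> I" "j \<in> I"
  shows "etale_family.overlap C p ss (\<lambda>i. \<rho> (pp i)) i j = \<phi> i j"
proof -
  interpret E: etale_family C p I ss "\<lambda>i. \<rho> (pp i)" by (rule is_glueing_etale_family[OF assms(1,2)])
  have "p \<cdot> \<rho> (pp j) = pp j" "pp j \<in> Mor C" "src (pp j) = src p"
    using assms by (auto simp: is_glueing_def is_join_def rle_def)
  then have "E.overlap i j = pp j \<cdot> ss i"
    using assms E.cmp_reassoc[of p "\<rho> (pp j)" "pp j" "ss i"] by (simp add: E.overlap_def)
  then show ?thesis using assms by (simp add: is_glueing_def)
qed

section \<open>Pullbacks of etale families along total maps\<close>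

context etale_family
begin

text \<open>On either side both sections are defined and agree, so by \<open>overlap_upper\<close>
  it lies below the other.\<close>

lemma overlap_sym:
  assumes i: "i \<in> I" and j: "j \<in> I"
  shows "overlap i j = overlap j i"
proof -
  have *: "overlap i j \<cdot> overlap j i = overlap j i" if i: "i \<in> I" and j: "j \<in> I" for i j
  proof -
    note o = overlap[OF j i] and om = rid_mor[OF overlap(2)[OF j i]]
    have "overlap i j \<cdot> overlap j i = \<rho> (s i) \<cdot> overlap j i"
      by (rule overlap_upper[OF i j]) (use o in auto)
    also have "\<dots> = \<rho> (s j) \<cdot> overlap j i"
      using i j o(3) rst_cmp_rid[OF o(2)] by (metis s_mor(1,2))
    finally show ?thesis using o(4) by simp
  qed
  show ?thesis using *[OF i j] *[OF j i] rid_comm[OF overlap(2)[OF i j] overlap(2)[OF j i]] by simp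
qed

text \<open>On the product of the two overlaps \<open>s i\<close>, \<open>s j\<close> and
  \<open>s k\<close> all agree, so \<open>overlap_upper\<close> places it below
  \<open>overlap i k\<close>.\<close>

lemma overlap_trans:
  assumes i: "i \<in> I" and j: "j \<in> I" and k: "k \<in> I"
  shows "overlap i k \<cdot> (overlap j k \<cdot> overlap i j) = overlap j k \<cdot> overlap i j"
proof -
  note ij = overlap[OF i j] rid_mor[OF overlap(2)[OF i j]]
  note jk = overlap[OF j k] rid_mor[OF overlap(2)[OF j k]]
  note c = rid_comm[OF ij(2) jk(2)]
  have "s i \<cdot> (overlap j k \<cdot> overlap i j) = s i \<cdot> (overlap i j \<cdot> overlap j k)" by (simp only: c)
  also have "\<dots> = s j \<cdot> (overlap i j \<cdot> overlap j k)"
    using cmp_reassoc[OF ij(3), of "overlap j k"] ij(6-8) jk(6-8) i j by simp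
  also have "\<dots> = s j \<cdot> (overlap j k \<cdot> overlap i j)" by (simp only: c)
  also have "\<dots> = s k \<cdot> (overlap j k \<cdot> overlap i j)"
    using cmp_reassoc[OF jk(3), of "overlap i j"] ij(6-8) jk(6-8) j k by simp
  finally have "s i \<cdot> (overlap j k \<cdot> overlap i j) = s k \<cdot> (overlap j k \<cdot> overlap i j)" .
  then have "overlap i k \<cdot> (overlap j k \<cdot> overlap i j) = \<rho> (s i) \<cdot> (overlap j k \<cdot> overlap i j)"
    using overlap_upper[OF i k rid_cmp[OF jk(2) ij(2)]] by simp
  also have "\<dots> = overlap j k \<cdot> overlap i j"
    using cmp_reassoc[OF ij(4), of "overlap j k"] ij(6-8) jk(6-8) i by (simp flip: c)
  finally show ?thesis .
qed

lemma overlap_refl: "i \<in> I \<Longrightarrow> overlap i i = \<rho> (s i)"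
  by (simp add: overlap_def)

lemma overlap_atlas:
  assumes g: "g \<in> Mor C" "tgt g = tgt p"
  shows "local_atlas C (src g) I (\<lambda>i j. \<rho> (overlap i j \<cdot> g))"
  unfolding local_atlas_def
proof (intro conjI ballI)
  fix i j assume ij: "i \<in> I" "j \<in> I"
  note o = rid_mor[OF overlap(2)[OF ij]]
  show "\<rho> (overlap i j \<cdot> g) \<in> rid C (src g)" using o g by simp
  show "\<rho> (overlap i j \<cdot> g) = \<rho> (overlap j i \<cdot> g)" using overlap_sym[OF ij] by simp
  fix k assume k: "k \<in> I"
  note jk = overlap(2)[OF ij(2) k] and ik = overlap(2)[OF ij(1) k]
  note m = o rid_mor[OF jk] rid_mor[OF ik]
  have "\<rho> (overlap i k \<cdot> g) \<cdot> (\<rho> (overlap j k \<cdot> g) \<cdot> \<rho> (overlap i j \<cdot> g))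
    = \<rho> (overlap i k \<cdot> (overlap j k \<cdot> overlap i j) \<cdot> g)"
    using rst_rid_cmp[OF ik rid_cmp[OF jk overlap(2)[OF ij]] g]
      rst_rid_cmp[OF jk overlap(2)[OF ij] g] m g by simp
  also have "\<dots> = \<rho> (overlap j k \<cdot> g) \<cdot> \<rho> (overlap i j \<cdot> g)"
    using rst_rid_cmp[OF jk overlap(2)[OF ij] g] m g ij k by (simp only: overlap_trans) simp
  finally show "rle C (\<rho> (overlap j k \<cdot> g) \<cdot> \<rho> (overlap i j \<cdot> g)) (\<rho> (overlap i k \<cdot> g))"
    by (subst rle_rid_iff[of _ "src g"]) (use m g in \<open>auto intro!: rid_cmp\<close>)
qed

text \<open>The inverse images of the overlaps under \<open>g\<close> are glued; the glueing
  \<open>q\<close> is the second projection, and the first is the extension of the family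
  \<open>s i \<cdot> g\<close>. For a cone \<open>(a, b)\<close> the mediating map is glued from the
  pieces \<open>t i \<cdot> (b \<cdot> w i)\<close>, where \<open>w i\<close> is the part on which
  \<open>a\<close> lies in \<open>e i\<close>.\<close>

theorem pullback_exists:
  assumes gl: "has_local_glueings C" "I \<prec> (UNIV :: 'u set)"
    and g: "g \<in> Mor C" "total C g" "tgt g = tgt p"
  shows "\<exists>r q. is_pullback C p g r q"
proof -
  note [simp] = g
  define \<psi> where "\<psi> i j = \<rho> (overlap i j \<cdot> g)" for i j
  obtain q pp t where G: "is_glueing C (src g) I \<psi> q pp t"
    using is_glueing_any_index[OF gl(1) _ gl(2) overlap_atlas[OF g(1,3)]] g unfolding \<psi>_def by auto
  define d where "d = (\<lambda>i. \<rho> (pp i))"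
  interpret Q: etale_family C q I t d using is_glueing_etale_family[OF join_restriction_category_axioms G] by (simp add: d_def)
  have [simp]: "tgt q = src g" using G by (simp add: is_glueing_def)
  have Qo: "Q.overlap i j = \<psi> i j" if "i \<in> I" "j \<in> I" for i j
    using is_glueing_overlap[OF join_restriction_category_axioms G that] by (simp add: d_def)
  have om [simp]: "overlap i j \<in> Mor C" "src (overlap i j) = tgt p" "tgt (overlap i j) = tgt p"
    if "i \<in> I" "j \<in> I" for i j
    using rid_mor[OF overlap(2)[OF that]] by simp_all
  have rt: "\<rho> (t i) = \<rho> (s i \<cdot> g)" if "i \<in> I" for i
    using Q.overlap_refl[OF that] Qo[OF that that] that by (simp add: \<psi>_def overlap_refl)
  have og: "overlap i j \<cdot> g = g \<cdot> \<psi> i j" if "i \<in> I" "j \<in> I" for i j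
    using rid_shift[OF overlap(2)[OF that], of g] by (simp add: \<psi>_def)
  have \<psi>r: "\<psi> i j \<in> rid C (src g)" if "i \<in> I" "j \<in> I" for i j using that by (simp add: \<psi>_def)
  have \<psi>m [simp]: "\<psi> i j \<in> Mor C" "src (\<psi> i j) = src g" "tgt (\<psi> i j) = src g"
    if "i \<in> I" "j \<in> I" for i j using that by (simp_all add: \<psi>_def)
  have sg: "s i \<cdot> (g \<cdot> \<psi> i j) = s j \<cdot> (g \<cdot> \<psi> i j)" if "i \<in> I" "j \<in> I" for i j
    using cmp_reassoc[OF overlap(3)[OF that], of g] that by (simp add: og)
  have "\<exists>!r. r \<in> hom C (src q) (src p) \<and> (\<forall>i\<in>I. r \<cdot> t i = s i \<cdot> g)"
  proof (rule Q.extend)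
    show "src p \<in> Obj C" by simp
    show "s i \<cdot> g \<in> hom C (tgt q) (src p)" "\<rho> (s i \<cdot> g) = \<rho> (t i)" if "i \<in> I" for i
      using that rt by simp_all
    fix i j d assume i: "i \<in> I" and j: "j \<in> I" and d: "d \<in> rid C (tgt q)" "\<rho> (t i) \<cdot> d = d"
      and td: "t i \<cdot> d = t j \<cdot> d"
    have "\<psi> i j \<cdot> d = d" using Q.overlap_upper[OF i j d(1) td] d(2) Qo[OF i j] by simp
    then show "s i \<cdot> g \<cdot> d = s j \<cdot> g \<cdot> d"
      using cmp_reassoc[of "s i" "g \<cdot> \<psi> i j" "s j \<cdot> (g \<cdot> \<psi> i j)" d] sg[OF i j] i j rid_mor[OF d(1)] by simp
  qed
  then obtain r where r: "r \<in> hom C (src q) (src p)" and rt': "\<And>i. i \<in> I \<Longrightarrow> r \<cdot> t i = s i \<cdot> g"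
    by blast
  have [simp]: "r \<in> Mor C" "src r = src q" "tgt r = src p" using r by auto
  have d: "d i = \<rho> (e i \<cdot> r)" if i: "i \<in> I" for i
  proof (rule Q.eq_on_sections)
    fix j assume j: "j \<in> I"
    have "\<rho> (e i \<cdot> r) \<cdot> t j = t j \<cdot> \<rho> (e i \<cdot> (s j \<cdot> g))"
      using rst_shift[of "t j" "e i \<cdot> r"] i j rt' by simp
    also have "\<rho> (e i \<cdot> (s j \<cdot> g)) = \<rho> (\<rho> (e i \<cdot> s j) \<cdot> g)" using i j by simp
    also have "\<dots> = \<psi> j i" using overlap(1)[OF j i] by (simp add: \<psi>_def)
    finally show "d i \<cdot> t j = \<rho> (e i \<cdot> r) \<cdot> t j" using Q.overlap(5)[OF j i] Qo[OF j i] by simp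
  qed (use i in auto)
  have sq: "p \<cdot> r = g \<cdot> q"
  proof (rule Q.eq_on_sections)
    fix i assume i: "i \<in> I"
    have "p \<cdot> (s i \<cdot> g) = g \<cdot> \<rho> (s i \<cdot> g)"
      using cmp_reassoc[OF p_s, of i g] i rst_shift[of g "s i"] by simp
    then show "p \<cdot> r \<cdot> t i = g \<cdot> q \<cdot> t i" using i rt rt' by simp
  qed auto
  have univ: "\<exists>!h. h \<in> hom C W (src r) \<and> r \<cdot> h = a \<and> q \<cdot> h = b"
    if ab: "a \<in> hom C W (src p)" "b \<in> hom C W (src g)" "p \<cdot> a = g \<cdot> b" for W a b
  proof -
    define w where "w i = \<rho> (e i \<cdot> a)" for i
    have [simp]: "a \<in> Mor C" "src a = W" "tgt a = src p" "b \<in> Mor C" "src b = W" "tgt b = src g" "W \<in> Obj C"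
      using ab by auto
    have wr: "w i \<in> rid C W" if "i \<in> I" for i using that by (simp add: w_def)
    note wm [simp] = rid_mor(1-4)[OF wr]
    note loc = localize[of a, folded w_def, simplified]
    have rab: "\<rho> a = \<rho> b"
      using rst_cmp_total[of p a] rst_cmp_total[of g b] ab(3) by simp
    have gb: "g \<cdot> (b \<cdot> x) = p \<cdot> (a \<cdot> x)" if "x \<in> Mor C" "tgt x = W" for x
      using cmp_reassoc[OF ab(3), of x] that by simp
    have bw: "\<rho> (t i) \<cdot> (b \<cdot> w i) = b \<cdot> w i" if i: "i \<in> I" for i
    proof -
      have "\<rho> (t i) \<cdot> (b \<cdot> w i) = b \<cdot> (w i \<cdot> \<rho> (s i \<cdot> (g \<cdot> (b \<cdot> w i))))"
        using rst_shift[of "b \<cdot> w i" "s i \<cdot> g"] i rt by simp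
      also have "s i \<cdot> (g \<cdot> (b \<cdot> w i)) = a \<cdot> w i" using gb[of "w i"] i loc(2)[OF i] by simp
      finally show ?thesis using i loc(3)[OF i] rid_mor(5)[OF wr] by simp
    qed
    define x where "x i = t i \<cdot> (b \<cdot> w i)" for i
    have xm [simp]: "x i \<in> Mor C" "src (x i) = W" "tgt (x i) = src q" if "i \<in> I" for i
      using that by (simp_all add: x_def)
    have rx: "\<rho> (x i) = w i" if i: "i \<in> I" for i
    proof -
      have "\<rho> (x i) = \<rho> (\<rho> (t i) \<cdot> (b \<cdot> w i))" using i by (simp add: x_def)
      also have "\<dots> = \<rho> (b \<cdot> w i)" by (simp add: bw i)
      also have "\<dots> = \<rho> (a \<cdot> w i)" using i rab by (intro rst_cmp_eq) auto
      finally show ?thesis using loc(3)[OF i] by simp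
    qed
    \<comment> \<open>On \<open>w i \<cdot> w j\<close> the point \<open>b\<close> lands in
      \<open>\<psi> i j\<close>, the inverse image of the overlap, where \<open>t i\<close> and
      \<open>t j\<close> agree.\<close>
    have xx: "x i \<cdot> w j = x j \<cdot> w i" if i: "i \<in> I" and j: "j \<in> I" for i j
    proof -
      let ?v = "w i \<cdot> w j"
      have v: "?v = w j \<cdot> w i" using rid_comm wr i j by blast
      have av: "a \<cdot> ?v = e i \<cdot> (e j \<cdot> a)"
        using cmp_reassoc[OF loc(4)[OF i, symmetric], of "w j"] loc(4)[OF j] i j by simp
      have rav: "\<rho> (a \<cdot> ?v) = ?v"
        using rst_cmp_rid[OF wr[OF j], of "a \<cdot> w i"] i j loc(3)[OF i] by simp
      have "overlap i j \<cdot> (g \<cdot> (b \<cdot> ?v)) = p \<cdot> (a \<cdot> ?v)"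
        using gb[of ?v] av p_overlap[OF i j] cmp_reassoc[of "overlap i j" "p \<cdot> (e i \<cdot> e j)" "p \<cdot> (e i \<cdot> e j)" a] i j
        by simp
      then have "\<psi> i j \<cdot> (b \<cdot> ?v) = b \<cdot> (?v \<cdot> \<rho> (p \<cdot> (a \<cdot> ?v)))"
        using rst_shift[of "b \<cdot> ?v" "overlap i j \<cdot> g"] i j by (simp add: \<psi>_def)
      then have \<psi>b: "\<psi> i j \<cdot> (b \<cdot> ?v) = b \<cdot> ?v" using i j rav rid_mor(5)[OF rid_cmp[OF wr wr], of i j] by simp
      have "t i \<cdot> (\<psi> i j \<cdot> (b \<cdot> ?v)) = t j \<cdot> (\<psi> i j \<cdot> (b \<cdot> ?v))"
        using cmp_reassoc[OF Q.overlap(3)[OF i j], of "b \<cdot> ?v"] Qo[OF i j] i j by simp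
      then have "t i \<cdot> (b \<cdot> ?v) = t j \<cdot> (b \<cdot> ?v)" by (simp only: \<psi>b)
      then show ?thesis using i j v by (simp add: x_def)
    qed
    obtain h where h: "h \<in> hom C W (src q)" "\<And>i. i \<in> I \<Longrightarrow> h \<cdot> \<rho> (x i) = x i"
      "is_join C W W ((\<lambda>i. \<rho> (x i)) ` I) (\<rho> h)"
      by (rule glue_compat[of W "src q" I x]) (use xx in \<open>auto simp: rx\<close>)
    have [simp]: "h \<in> Mor C" "src h = W" "tgt h = src q" using h(1) by auto
    have cov: "is_join C W W (w ` I) (\<rho> a)" using localize_cover[of a] by (simp add: w_def)
    have "(\<lambda>i. \<rho> (x i)) ` I = w ` I" using rx by auto
    then have rh: "\<rho> h = \<rho> a" using h(3) join_unique cov by metis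
    have wI: "w ` I \<subseteq> rid C W" using wr by auto
    have "r \<cdot> h = a"
    proof (rule join_eq_local[OF wI cov])
      show "r \<cdot> h \<cdot> \<rho> a = r \<cdot> h" using cmp_rst_self[of h] rh by simp
      fix v assume "v \<in> w ` I"
      then obtain i where i: "i \<in> I" "v = w i" by blast
      have "r \<cdot> (h \<cdot> w i) = s i \<cdot> (g \<cdot> (b \<cdot> w i))"
        using h(2)[of i] i rx cmp_reassoc[OF rt', of i "b \<cdot> w i"] by (simp add: x_def)
      then show "r \<cdot> h \<cdot> v = a \<cdot> v" using i gb[of "w i"] loc(2) by simp
    qed auto
    moreover have "q \<cdot> h = b"
    proof (rule join_eq_local[OF wI cov])
      show "q \<cdot> h \<cdot> \<rho> a = q \<cdot> h" using cmp_rst_self[of h] rh by simp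
      fix v assume "v \<in> w ` I"
      then obtain i where i: "i \<in> I" "v = w i" by blast
      have "q \<cdot> (h \<cdot> w i) = \<rho> (t i) \<cdot> (b \<cdot> w i)"
        using h(2)[of i] i rx cmp_reassoc[OF Q.p_s, of i "b \<cdot> w i"] by (simp add: x_def)
      then show "q \<cdot> h \<cdot> v = b \<cdot> v" using i bw by simp
    qed (use rab in auto)
    moreover have "k = h" if k: "k \<in> hom C W (src r)" "r \<cdot> k = a" "q \<cdot> k = b" for k
    proof (rule join_eq_local[OF wI cov])
      have [simp]: "k \<in> Mor C" "src k = W" "tgt k = src q" using k by auto
      show "k \<in> hom C W (src q)" by simp
      show "h \<cdot> \<rho> a = h" using cmp_rst_self[of h] rh by simp
      have "\<rho> k = \<rho> a" using k(3) rst_cmp_total[of q k] rab by simp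
      then show "k \<cdot> \<rho> a = k" using cmp_rst_self[of k] by simp
      fix v assume "v \<in> w ` I"
      then obtain i where i: "i \<in> I" "v = w i" by blast
      have "\<rho> (d i \<cdot> k) = w i" using i d k(2) by (simp add: w_def)
      then have kw: "d i \<cdot> k = k \<cdot> w i" using Q.e_cmp[of i k] i by simp
      have "k \<cdot> w i = t i \<cdot> (q \<cdot> (k \<cdot> w i))"
        using cmp_reassoc[OF Q.s_p_e, of i k] i kw by simp
      also have "\<dots> = x i" using cmp_reassoc[OF k(3), of "w i"] i by (simp add: x_def)
      also have "\<dots> = h \<cdot> w i" using h(2) rx i by simp
      finally show "k \<cdot> v = h \<cdot> v" using i by simp
    qed (use h in auto)
    ultimately show ?thesis by (intro ex1I[of _ h]) auto
  qed
  have "is_pullback C p g r q"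
    unfolding is_pullback_def by (intro conjI ballI impI univ) (simp_all add: sq)
  then show ?thesis by blast
qed

end

section \<open>Partite internal categories and cofunctors on generalized elements\<close>

text \<open>\<open>Mu\<close> evaluated at two generalized elements, in the order of composition:
  \<open>b\<close> after \<open>a\<close>.\<close>

definition mul ::
  "('o, 'u) rcat \<Rightarrow> ('o, 'u) partite \<Rightarrow> 'u \<Rightarrow> 'u \<Rightarrow> 'u \<Rightarrow> ('o, 'u) arr \<Rightarrow> ('o, 'u) arr \<Rightarrow> ('o, 'u) arr"
  where "mul C A i j k b a = Mu A i j k \<cdot>\<^bsub>C\<^esub> pb_pair C (Sg A j k) (Ta A i j) b a"

text \<open>An arrow \<open>a\<close> of \<open>A\<close> acts on an element \<open>b\<close> lying
  over its source through \<open>CO F\<close>; the value is an arrow of the codomain that starts at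
  \<open>b\<close>.\<close>

definition act ::
  "('o, 'u) rcat \<Rightarrow> ('o, 'u) partite \<Rightarrow> ('o, 'u) cofun \<Rightarrow> 'u \<Rightarrow> 'u \<Rightarrow> ('o, 'u) arr \<Rightarrow> ('o, 'u) arr
    \<Rightarrow> ('o, 'u) arr"
  where "act C A F i j a b = CA F i j \<cdot>\<^bsub>C\<^esub> pb_pair C (Sg A i j) (CO F i) a b"

text \<open>Only the data and laws that composing elements requires, without units and
  associativity: \<open>\<Psi> P\<close> is first shown to be such a graph, and the remaining axioms
  are then proved by computing in it.\<close>

locale partite_graph = restriction_category C
  for C :: "('o, 'u) rcat" (structure) and A :: "('o, 'u) partite" +
  assumes PO_obj [simp]: "i \<in> Ix A \<Longrightarrow> PO A i \<in> Obj C"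
    and Sg_mor [simp]: "\<lbrakk>i \<in> Ix A; j \<in> Ix A\<rbrakk> \<Longrightarrow> Sg A i j \<in> Mor C"
      "\<lbrakk>i \<in> Ix A; j \<in> Ix A\<rbrakk> \<Longrightarrow> src (Sg A i j) = PA A i j"
      "\<lbrakk>i \<in> Ix A; j \<in> Ix A\<rbrakk> \<Longrightarrow> tgt (Sg A i j) = PO A i"
      "\<lbrakk>i \<in> Ix A; j \<in> Ix A\<rbrakk> \<Longrightarrow> total C (Sg A i j)"
    and Ta_mor [simp]: "\<lbrakk>i \<in> Ix A; j \<in> Ix A\<rbrakk> \<Longrightarrow> Ta A i j \<in> Mor C"
      "\<lbrakk>i \<in> Ix A; j \<in> Ix A\<rbrakk> \<Longrightarrow> src (Ta A i j) = PA A i j"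
      "\<lbrakk>i \<in> Ix A; j \<in> Ix A\<rbrakk> \<Longrightarrow> tgt (Ta A i j) = PO A j"
      "\<lbrakk>i \<in> Ix A; j \<in> Ix A\<rbrakk> \<Longrightarrow> total C (Ta A i j)"
    and Sg_pullbacks: "\<lbrakk>i \<in> Ix A; j \<in> Ix A\<rbrakk> \<Longrightarrow> admits_pullbacks C (Sg A i j)"
    and Mu_hom: "\<lbrakk>i \<in> Ix A; j \<in> Ix A; k \<in> Ix A\<rbrakk>
      \<Longrightarrow> Mu A i j k \<in> hom C (pb_obj C (Sg A j k) (Ta A i j)) (PA A i k)"
    and Sg_Mu: "\<lbrakk>i \<in> Ix A; j \<in> Ix A; k \<in> Ix A\<rbrakk>
      \<Longrightarrow> Sg A i k \<cdot> Mu A i j k = Sg A i j \<cdot> pb2 C (Sg A j k) (Ta A i j)"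
    and Ta_Mu: "\<lbrakk>i \<in> Ix A; j \<in> Ix A; k \<in> Ix A\<rbrakk>
      \<Longrightarrow> Ta A i k \<cdot> Mu A i j k = Ta A j k \<cdot> pb1 C (Sg A j k) (Ta A i j)"
begin

lemma PA_obj [simp]: "\<lbrakk>i \<in> Ix A; j \<in> Ix A\<rbrakk> \<Longrightarrow> PA A i j \<in> Obj C"
  using src_obj'[of "Sg A i j"] by simp

lemma pullback_along:
  assumes "i \<in> Ix A" "j \<in> Ix A" "g \<in> Mor C" "total C g" "tgt g = PO A i"
  shows "is_pullback C (Sg A i j) g (pb1 C (Sg A i j) g) (pb2 C (Sg A i j) g)"
  using Sg_pullbacks[OF assms(1,2)] assms unfolding admits_pullbacks_def
  by (auto intro: is_pullback_chosen)

lemma pullback: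
  assumes "i \<in> Ix A" "j \<in> Ix A" "k \<in> Ix A"
  shows "is_pullback C (Sg A j k) (Ta A i j) (pb1 C (Sg A j k) (Ta A i j)) (pb2 C (Sg A j k) (Ta A i j))"
  using assms by (intro pullback_along) auto

definition composable where
  "composable i j k b a \<longleftrightarrow> a \<in> Mor C \<and> b \<in> Mor C \<and> src b = src a \<and> tgt a = PA A i j \<and>
     tgt b = PA A j k \<and> Sg A j k \<cdot> b = Ta A i j \<cdot> a"

lemma composable_cmp:
  assumes "composable i j k b a" "i \<in> Ix A" "j \<in> Ix A" "k \<in> Ix A" "x \<in> Mor C" "tgt x = src a"
  shows "composable i j k (b \<cdot> x) (a \<cdot> x)"
  using assms unfolding composable_def
  by (auto intro: cmp_reassoc[of "Sg A j k" b "Ta A i j \<cdot> a" x, THEN trans])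

lemma mul:
  assumes I: "i \<in> Ix A" "j \<in> Ix A" "k \<in> Ix A" and c: "composable i j k b a"
  shows "mul C A i j k b a \<in> Mor C" "src (mul C A i j k b a) = src a" "tgt (mul C A i j k b a) = PA A i k"
    "Sg A i k \<cdot> mul C A i j k b a = Sg A i j \<cdot> a"
    "Ta A i k \<cdot> mul C A i j k b a = Ta A j k \<cdot> b"
    "\<rho> (mul C A i j k b a) = \<rho> a"
proof -
  note [simp] = I pb_mor[OF pullback[OF I]]
  let ?h = "pb_pair C (Sg A j k) (Ta A i j) b a"
  have h [simp]: "?h \<in> Mor C" "src ?h = src a" "tgt ?h = pb_obj C (Sg A j k) (Ta A i j)"
    "pb1 C (Sg A j k) (Ta A i j) \<cdot> ?h = b" "pb2 C (Sg A j k) (Ta A i j) \<cdot> ?h = a"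
    using c pair[OF pullback[OF I], of b a] by (simp_all add: composable_def)
  have [simp]: "Mu A i j k \<in> Mor C" "src (Mu A i j k) = pb_obj C (Sg A j k) (Ta A i j)"
    "tgt (Mu A i j k) = PA A i k" using Mu_hom[OF I] by simp_all
  show m: "mul C A i j k b a \<in> Mor C" "src (mul C A i j k b a) = src a" "tgt (mul C A i j k b a) = PA A i k"
    by (simp_all add: mul_def)
  show s: "Sg A i k \<cdot> mul C A i j k b a = Sg A i j \<cdot> a"
    using cmp_reassoc[OF Sg_Mu[OF I], of ?h] by (simp add: mul_def)
  show "Ta A i k \<cdot> mul C A i j k b a = Ta A j k \<cdot> b"
    using cmp_reassoc[OF Ta_Mu[OF I], of ?h] by (simp add: mul_def)
  show "\<rho> (mul C A i j k b a) = \<rho> a"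
    using rst_cmp_total[of "Sg A i k" "mul C A i j k b a"] rst_cmp_total[of "Sg A i j" a] m s c
    by (simp add: composable_def)
qed

lemma mul_cmp:
  assumes I: "i \<in> Ix A" "j \<in> Ix A" "k \<in> Ix A" and c: "composable i j k b a"
    and x: "x \<in> Mor C" "tgt x = src a"
  shows "mul C A i j k b a \<cdot> x = mul C A i j k (b \<cdot> x) (a \<cdot> x)"
  using pair_cmp[OF pullback[OF I], of b a x] pair[OF pullback[OF I], of b a] c x I Mu_hom[OF I]
  by (simp add: mul_def composable_def)

end

locale partite = restriction_category C + partite_category C A
  for C :: "('o, 'u) rcat" (structure) and A :: "('o, 'u) partite"
begin

sublocale partite_graph C A
  by unfold_locales
    (use sg_hom ta_hom in \<open>auto simp: po_obj sg_total ta_total sg_pullbacks mu_hom[simplified] sg_mu ta_mu\<close>)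

lemma unit_mor [simp]:
  assumes "i \<in> Ix A"
  shows "Et A i \<in> Mor C" "src (Et A i) = PO A i" "tgt (Et A i) = PA A i i"
  using et_hom[OF assms] by simp_all

text \<open>The unit axiom is the case of the identity element; precomposition with \<open>a\<close>
  gives the rest.\<close>

lemma mul_unit_right:
  assumes I: "i \<in> Ix A" "j \<in> Ix A" and a: "a \<in> Mor C" "tgt a = PA A i j"
  shows "mul C A i i j a (Et A i \<cdot> (Sg A i j \<cdot> a)) = a"
proof -
  have "Ta A i i \<cdot> (Et A i \<cdot> Sg A i j) = Sg A i j"
    using cmp_reassoc[OF ta_et, of i "Sg A i j"] I by simp
  then have "composable i i j (Idn C (PA A i j)) (Et A i \<cdot> Sg A i j)"
    using I by (simp add: composable_def)
  from mul_cmp[OF _ _ _ this, of a] show ?thesis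
    using I a mu_unit_right[OF I] by (simp add: mul_def[symmetric])
qed

lemma mul_unit_left:
  assumes I: "i \<in> Ix A" "j \<in> Ix A" and a: "a \<in> Mor C" "tgt a = PA A i j"
  shows "mul C A i j j (Et A j \<cdot> (Ta A i j \<cdot> a)) a = a"
proof -
  have "Sg A j j \<cdot> (Et A j \<cdot> Ta A i j) = Ta A i j"
    using cmp_reassoc[OF sg_et, of j "Ta A i j"] I by simp
  then have "composable i j j (Et A j \<cdot> Ta A i j) (Idn C (PA A i j))"
    using I by (simp add: composable_def)
  from mul_cmp[OF _ _ _ this, of a] show ?thesis
    using I a mu_unit_left[OF I] by (simp add: mul_def[symmetric])
qed

text \<open>The axiom is this identity for the generic composable triple, given by the projections
  of the threefold pullback. The map \<open>h\<close> classifies the triple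
  \<open>(c, b, a)\<close>, and precomposing with it yields the general case.\<close>

lemma mul_assoc:
  assumes I: "i \<in> Ix A" "j \<in> Ix A" "k \<in> Ix A" "l \<in> Ix A"
    and ba: "composable i j k b a" and cb: "composable j k l c b"
  shows "mul C A i k l c (mul C A i j k b a) = mul C A i j l (mul C A j k l c b) a"
proof -
  define p1 where "p1 = pb1 C (Sg A j k) (Ta A i j)"
  define p2 where "p2 = pb2 C (Sg A j k) (Ta A i j)"
  define q1 where "q1 = pb1 C (Sg A k l) (Ta A j k \<cdot> p1)"
  define q2 where "q2 = pb2 C (Sg A k l) (Ta A j k \<cdot> p1)"
  note pb = pullback[OF I(1-3)]
  have p [simp]: "p1 \<in> Mor C" "src p1 = pb_obj C (Sg A j k) (Ta A i j)" "tgt p1 = PA A j k"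
    "p2 \<in> Mor C" "src p2 = pb_obj C (Sg A j k) (Ta A i j)" "tgt p2 = PA A i j"
    "total C p1" "total C p2" and sp: "Sg A j k \<cdot> p1 = Ta A i j \<cdot> p2"
    using pb_mor[OF pb] pb_total[OF pb] pb_square[OF pb] I by (simp_all add: p1_def p2_def)
  have qb: "is_pullback C (Sg A k l) (Ta A j k \<cdot> p1) q1 q2"
    unfolding q1_def q2_def using I by (intro pullback_along) auto
  have q [simp]: "q1 \<in> Mor C" "src q1 = src q2" "tgt q1 = PA A k l" "q2 \<in> Mor C"
    "tgt q2 = pb_obj C (Sg A j k) (Ta A i j)" and sq: "Sg A k l \<cdot> q1 = Ta A j k \<cdot> (p1 \<cdot> q2)"
    using qb I by (auto simp: is_pullback_def)
  have Mu [simp]: "Mu A i j k \<in> Mor C" "src (Mu A i j k) = pb_obj C (Sg A j k) (Ta A i j)"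
    "tgt (Mu A i j k) = PA A i k" using mu_hom[OF I(1-3)] by simp_all
  define x where "x = pb_pair C (Sg A j k) (Ta A i j) b a"
  have x: "x \<in> Mor C" "src x = src a" "tgt x = pb_obj C (Sg A j k) (Ta A i j)" "p1 \<cdot> x = b" "p2 \<cdot> x = a"
    using ba pair[OF pb, of b a] I by (simp_all add: composable_def p1_def p2_def x_def)
  define h where "h = pb_pair C (Sg A k l) (Ta A j k \<cdot> p1) c x"
  have h: "h \<in> Mor C" "src h = src a" "tgt h = src q2" "q1 \<cdot> h = c" "q2 \<cdot> h = x"
    using pair[OF qb[unfolded q1_def q2_def], of c x] pb_mor[OF qb[unfolded q1_def q2_def]] cb ba x I
    by (simp_all add: composable_def q1_def q2_def h_def)
  have ax: "mul C A i k l q1 (Mu A i j k \<cdot> q2) = mul C A i j l (mul C A j k l q1 (p1 \<cdot> q2)) (p2 \<cdot> q2)"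
    using mu_assoc[OF I] by (simp add: Let_def p1_def p2_def q1_def q2_def mul_def)
  have c1: "composable i k l q1 (Mu A i j k \<cdot> q2)"
    using cmp_reassoc[OF ta_mu[OF I(1-3)], of q2] sq I p by (simp add: composable_def p1_def[symmetric])
  have c2: "composable j k l q1 (p1 \<cdot> q2)" using sq I by (simp add: composable_def)
  have c3: "composable i j l (mul C A j k l q1 (p1 \<cdot> q2)) (p2 \<cdot> q2)"
    using mul[OF I(2-4) c2] cmp_reassoc[OF sp, of q2] I by (simp add: composable_def)
  have "mul C A i k l q1 (Mu A i j k \<cdot> q2) \<cdot> h = mul C A i k l c (mul C A i j k b a)"
    using mul_cmp[OF _ _ _ c1, of h] I h by (simp add: mul_def x_def)
  moreover have "mul C A i j l (mul C A j k l q1 (p1 \<cdot> q2)) (p2 \<cdot> q2) \<cdot> h = mul C A i j l (mul C A j k l c b) a"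
    using mul_cmp[OF _ _ _ c3, of h] mul_cmp[OF _ _ _ c2, of h] I h x by simp
  ultimately show ?thesis using ax by simp
qed

end

locale cofunctor = restriction_category C + dom: partite C A + cod: partite C B + partite_cofunctor C A B F
  for C :: "('o, 'u) rcat" (structure) and A B :: "('o, 'u) partite" and F :: "('o, 'u) cofun"
begin

lemma ci [simp]: "i \<in> Ix A \<Longrightarrow> CI F i \<in> Ix B"
  using ci_funcset by auto

lemma co [simp]:
  assumes "i \<in> Ix A"
  shows "CO F i \<in> Mor C" "src (CO F i) = PO B (CI F i)" "tgt (CO F i) = PO A i" "total C (CO F i)"
  using co_hom[OF assms] co_total[OF assms] by simp_all

lemma pullback:
  assumes "i \<in> Ix A" "j \<in> Ix A"
  shows "is_pullback C (Sg A i j) (CO F i) (pb1 C (Sg A i j) (CO F i)) (pb2 C (Sg A i j) (CO F i))"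
  using assms by (intro dom.pullback_along) auto

definition actable where
  "actable i j a b \<longleftrightarrow> a \<in> Mor C \<and> b \<in> Mor C \<and> src a = src b \<and> tgt a = PA A i j \<and>
     tgt b = PO B (CI F i) \<and> Sg A i j \<cdot> a = CO F i \<cdot> b"

lemma actable_cmp:
  assumes "actable i j a b" "i \<in> Ix A" "j \<in> Ix A" "x \<in> Mor C" "tgt x = src b"
  shows "actable i j (a \<cdot> x) (b \<cdot> x)"
  using assms unfolding actable_def
  by (auto intro: cmp_reassoc[of "Sg A i j" a "CO F i \<cdot> b" x, THEN trans])

lemma act:
  assumes I: "i \<in> Ix A" "j \<in> Ix A" and c: "actable i j a b"
  shows "act C A F i j a b \<in> Mor C" "src (act C A F i j a b) = src b"
    "tgt (act C A F i j a b) = PA B (CI F i) (CI F j)"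
    "Sg B (CI F i) (CI F j) \<cdot> act C A F i j a b = b"
    "CO F j \<cdot> (Ta B (CI F i) (CI F j) \<cdot> act C A F i j a b) = Ta A i j \<cdot> a"
    "\<rho> (act C A F i j a b) = \<rho> b"
proof -
  note [simp] = I pb_mor[OF pullback[OF I]]
  let ?h = "pb_pair C (Sg A i j) (CO F i) a b"
  have h [simp]: "?h \<in> Mor C" "src ?h = src b" "tgt ?h = pb_obj C (Sg A i j) (CO F i)"
    "pb1 C (Sg A i j) (CO F i) \<cdot> ?h = a" "pb2 C (Sg A i j) (CO F i) \<cdot> ?h = b"
    using c pair[OF pullback[OF I], of a b] by (simp_all add: actable_def)
  have [simp]: "CA F i j \<in> Mor C" "src (CA F i j) = pb_obj C (Sg A i j) (CO F i)"
    "tgt (CA F i j) = PA B (CI F i) (CI F j)" using ca_hom[OF I] by simp_all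
  show m: "act C A F i j a b \<in> Mor C" "src (act C A F i j a b) = src b"
    "tgt (act C A F i j a b) = PA B (CI F i) (CI F j)"
    by (simp_all add: act_def)
  show s: "Sg B (CI F i) (CI F j) \<cdot> act C A F i j a b = b"
    using cmp_reassoc[OF sg_ca[OF I], of ?h] by (simp add: act_def)
  show "CO F j \<cdot> (Ta B (CI F i) (CI F j) \<cdot> act C A F i j a b) = Ta A i j \<cdot> a"
    using cmp_reassoc[OF ta_ca[OF I], of ?h] by (simp add: act_def)
  show "\<rho> (act C A F i j a b) = \<rho> b"
    using rst_cmp_total[of "Sg B (CI F i) (CI F j)" "act C A F i j a b"] m s by simp
qed

lemma act_cmp:
  assumes I: "i \<in> Ix A" "j \<in> Ix A" and c: "actable i j a b" and x: "x \<in> Mor C" "tgt x = src b"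
  shows "act C A F i j a b \<cdot> x = act C A F i j (a \<cdot> x) (b \<cdot> x)"
  using pair_cmp[OF pullback[OF I], of a b x] pair[OF pullback[OF I], of a b] c x I ca_hom[OF I]
  by (simp add: act_def actable_def)

text \<open>The projections are the generic pair, whose pairing is the identity of the
  pullback.\<close>

lemma ca_eq_act:
  assumes I: "i \<in> Ix A" "j \<in> Ix A"
  shows "CA F i j = act C A F i j (pb1 C (Sg A i j) (CO F i)) (pb2 C (Sg A i j) (CO F i))"
  using pair_proj[OF pullback[OF I]] ca_hom[OF I] by (simp add: act_def)

lemma act_unit:
  assumes i: "i \<in> Ix A" and b: "b \<in> Mor C" "tgt b = PO B (CI F i)"
  shows "act C A F i i (Et A i \<cdot> (CO F i \<cdot> b)) b = Et B (CI F i) \<cdot> b"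
proof -
  have "actable i i (Et A i \<cdot> CO F i) (Idn C (PO B (CI F i)))"
    using i cmp_reassoc[OF dom.sg_et, of i "CO F i"] by (simp add: actable_def)
  from act_cmp[OF i i this, of b] show ?thesis
    using ca_et[OF i] i b by (simp add: act_def[symmetric])
qed

text \<open>As for \<open>mul_assoc\<close>: the axiom is the identity for the generic triple on the
  threefold pullback, and \<open>h\<close> classifies the given one.\<close>

lemma act_mul:
  assumes I: "i \<in> Ix A" "j \<in> Ix A" "k \<in> Ix A"
    and ab: "actable i j a b" and ca: "dom.composable i j k a' a"
  shows "act C A F i k (mul C A i j k a' a) b
    = mul C B (CI F i) (CI F j) (CI F k)
        (act C A F j k a' (Ta B (CI F i) (CI F j) \<cdot> act C A F i j a b)) (act C A F i j a b)"
proof -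
  define p1 where "p1 = pb1 C (Sg A i j) (CO F i)"
  define p2 where "p2 = pb2 C (Sg A i j) (CO F i)"
  define q1 where "q1 = pb1 C (Sg A j k) (Ta A i j \<cdot> p1)"
  define q2 where "q2 = pb2 C (Sg A j k) (Ta A i j \<cdot> p1)"
  note pb = pullback[OF I(1-2)]
  have p [simp]: "p1 \<in> Mor C" "src p1 = pb_obj C (Sg A i j) (CO F i)" "tgt p1 = PA A i j"
    "p2 \<in> Mor C" "src p2 = pb_obj C (Sg A i j) (CO F i)" "tgt p2 = PO B (CI F i)"
    "total C p1" "total C p2" and sp: "Sg A i j \<cdot> p1 = CO F i \<cdot> p2"
    using pb_mor[OF pb] pb_total[OF pb] pb_square[OF pb] I by (simp_all add: p1_def p2_def)
  have qb: "is_pullback C (Sg A j k) (Ta A i j \<cdot> p1) q1 q2"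
    unfolding q1_def q2_def using I by (intro dom.pullback_along) auto
  have q [simp]: "q1 \<in> Mor C" "src q1 = src q2" "tgt q1 = PA A j k" "q2 \<in> Mor C"
    "tgt q2 = pb_obj C (Sg A i j) (CO F i)" and sq: "Sg A j k \<cdot> q1 = Ta A i j \<cdot> (p1 \<cdot> q2)"
    using qb I by (auto simp: is_pullback_def)
  have CAm [simp]: "CA F i j \<in> Mor C" "src (CA F i j) = pb_obj C (Sg A i j) (CO F i)"
    "tgt (CA F i j) = PA B (CI F i) (CI F j)" using ca_hom[OF I(1-2)] by simp_all
  define x where "x = pb_pair C (Sg A i j) (CO F i) a b"
  have x: "x \<in> Mor C" "src x = src b" "tgt x = pb_obj C (Sg A i j) (CO F i)" "p1 \<cdot> x = a" "p2 \<cdot> x = b"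
    using ab pair[OF pb, of a b] I by (simp_all add: actable_def p1_def p2_def x_def)
  define h where "h = pb_pair C (Sg A j k) (Ta A i j \<cdot> p1) a' x"
  have h: "h \<in> Mor C" "src h = src b" "tgt h = src q2" "q1 \<cdot> h = a'" "q2 \<cdot> h = x"
    using pair[OF qb[unfolded q1_def q2_def], of a' x] pb_mor[OF qb[unfolded q1_def q2_def]] ca ab x I
    by (simp_all add: actable_def dom.composable_def q1_def q2_def h_def)
  let ?B = "Ta B (CI F i) (CI F j)"
  have ax: "act C A F i k (mul C A i j k q1 (p1 \<cdot> q2)) (p2 \<cdot> q2)
    = mul C B (CI F i) (CI F j) (CI F k) (act C A F j k q1 (?B \<cdot> CA F i j \<cdot> q2)) (CA F i j \<cdot> q2)"
    using ca_mu[OF I] by (simp add: Let_def p1_def p2_def q1_def q2_def mul_def act_def)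
  have c1: "dom.composable i j k q1 (p1 \<cdot> q2)" using sq I by (simp add: dom.composable_def)
  have c2: "actable i k (mul C A i j k q1 (p1 \<cdot> q2)) (p2 \<cdot> q2)"
    using dom.mul[OF I c1] cmp_reassoc[OF sp, of q2] I by (simp add: actable_def)
  have "CO F j \<cdot> (?B \<cdot> (CA F i j \<cdot> q2)) = Ta A i j \<cdot> (p1 \<cdot> q2)"
    using cmp_reassoc[OF ta_ca[OF I(1,2)], of q2] I p by (simp add: p1_def[symmetric])
  then have c3: "actable j k q1 (?B \<cdot> CA F i j \<cdot> q2)" using I sq by (simp add: actable_def)
  have c4: "cod.composable (CI F i) (CI F j) (CI F k) (act C A F j k q1 (?B \<cdot> CA F i j \<cdot> q2)) (CA F i j \<cdot> q2)"
    using act[OF I(2,3) c3] I by (simp add: cod.composable_def)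
  have "act C A F i k (mul C A i j k q1 (p1 \<cdot> q2)) (p2 \<cdot> q2) \<cdot> h = act C A F i k (mul C A i j k a' a) b"
    using act_cmp[OF _ _ c2, of h] dom.mul_cmp[OF _ _ _ c1, of h] I h x by simp
  moreover have "mul C B (CI F i) (CI F j) (CI F k) (act C A F j k q1 (?B \<cdot> CA F i j \<cdot> q2)) (CA F i j \<cdot> q2) \<cdot> h
    = mul C B (CI F i) (CI F j) (CI F k) (act C A F j k a' (?B \<cdot> act C A F i j a b)) (act C A F i j a b)"
    using cod.mul_cmp[OF _ _ _ c4, of h] act_cmp[OF _ _ c3, of h] I h by (simp add: act_def x_def)
  ultimately show ?thesis using ax by simp
qed

end

text \<open>The laws are assumed for elements; the diagrams of a cofunctor are their instances at
  the projections of the pullbacks.\<close>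

lemma cofunctorI:
  fixes C :: "('o, 'u) rcat" (structure)
  assumes "partite C A" "partite C B"
    and ext: "CI F \<in> Ix A \<rightarrow>\<^sub>E Ix B" "CO F \<in> extensional (Ix A)"
      "\<And>i j. \<not> (i \<in> Ix A \<and> j \<in> Ix A) \<Longrightarrow> CA F i j = undefined"
    and co: "\<And>i. i \<in> Ix A \<Longrightarrow> CO F i \<in> hom C (PO B (CI F i)) (PO A i) \<and> total C (CO F i)"
    and ca: "\<And>i j. \<lbrakk>i \<in> Ix A; j \<in> Ix A\<rbrakk>
      \<Longrightarrow> CA F i j \<in> hom C (pb_obj C (Sg A i j) (CO F i)) (PA B (CI F i) (CI F j))"
    and sg: "\<And>i j a b. \<lbrakk>i \<in> Ix A; j \<in> Ix A; a \<in> hom C (src b) (PA A i j); b \<in> Mor C;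
        tgt b = PO B (CI F i); Sg A i j \<cdot> a = CO F i \<cdot> b\<rbrakk>
      \<Longrightarrow> Sg B (CI F i) (CI F j) \<cdot> act C A F i j a b = b"
    and ta: "\<And>i j a b. \<lbrakk>i \<in> Ix A; j \<in> Ix A; a \<in> hom C (src b) (PA A i j); b \<in> Mor C;
        tgt b = PO B (CI F i); Sg A i j \<cdot> a = CO F i \<cdot> b\<rbrakk>
      \<Longrightarrow> CO F j \<cdot> (Ta B (CI F i) (CI F j) \<cdot> act C A F i j a b) = Ta A i j \<cdot> a"
    and et: "\<And>i b. \<lbrakk>i \<in> Ix A; b \<in> Mor C; tgt b = PO B (CI F i)\<rbrakk>
      \<Longrightarrow> act C A F i i (Et A i \<cdot> (CO F i \<cdot> b)) b = Et B (CI F i) \<cdot> b"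
    and mu: "\<And>i j k a' a b. \<lbrakk>i \<in> Ix A; j \<in> Ix A; k \<in> Ix A; a \<in> hom C (src b) (PA A i j); b \<in> Mor C;
        tgt b = PO B (CI F i); Sg A i j \<cdot> a = CO F i \<cdot> b; partite_graph.composable C A i j k a' a\<rbrakk>
      \<Longrightarrow> act C A F i k (mul C A i j k a' a) b
        = mul C B (CI F i) (CI F j) (CI F k)
            (act C A F j k a' (Ta B (CI F i) (CI F j) \<cdot> act C A F i j a b)) (act C A F i j a b)"
  shows "cofunctor C A B F"
proof -
  interpret dom: partite C A by fact
  interpret cod: partite C B by fact
  note [simp] = PiE_mem[OF ext(1)]
  have cos [simp]: "CO F i \<in> Mor C" "src (CO F i) = PO B (CI F i)" "tgt (CO F i) = PO A i" "total C (CO F i)"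
    if "i \<in> Ix A" for i using co[OF that] by auto
  have pb: "is_pullback C (Sg A i j) (CO F i) (pb1 C (Sg A i j) (CO F i)) (pb2 C (Sg A i j) (CO F i))"
    if "i \<in> Ix A" "j \<in> Ix A" for i j
    using that by (intro dom.pullback_along) auto
  note pm = dom.pb_mor[OF pb]
  have cam: "CA F i j \<in> Mor C" "src (CA F i j) = pb_obj C (Sg A i j) (CO F i)"
    "tgt (CA F i j) = PA B (CI F i) (CI F j)" if "i \<in> Ix A" "j \<in> Ix A" for i j
    using ca[OF that] by auto
  have ca_act: "act C A F i j (pb1 C (Sg A i j) (CO F i)) (pb2 C (Sg A i j) (CO F i)) = CA F i j"
    if "i \<in> Ix A" "j \<in> Ix A" for i j
    using dom.pair_proj[OF pb[OF that]] ca[OF that] by (simp add: act_def)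
  have sg_ca: "Sg B (CI F i) (CI F j) \<cdot> CA F i j = pb2 C (Sg A i j) (CO F i)"
    if I: "i \<in> Ix A" "j \<in> Ix A" for i j
    using sg[OF I, of "pb1 C (Sg A i j) (CO F i)" "pb2 C (Sg A i j) (CO F i)"] I pm[OF I]
      dom.pb_square[OF pb[OF I]] ca_act[OF I] by simp
  have ta_ca: "CO F j \<cdot> (Ta B (CI F i) (CI F j) \<cdot> CA F i j) = Ta A i j \<cdot> pb1 C (Sg A i j) (CO F i)"
    if I: "i \<in> Ix A" "j \<in> Ix A" for i j
    using ta[OF I, of "pb1 C (Sg A i j) (CO F i)" "pb2 C (Sg A i j) (CO F i)"] I pm[OF I]
      dom.pb_square[OF pb[OF I]] ca_act[OF I] by simp
  have "partite_cofunctor C A B F"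
  proof
    fix i j assume I: "i \<in> Ix A" "j \<in> Ix A"
    show "CA F i j \<in> hom C (pb_obj C (Sg A i j) (CO F i)) (PA B (CI F i) (CI F j))" using ca[OF I] .
    show "Sg B (CI F i) (CI F j) \<cdot> CA F i j = pb2 C (Sg A i j) (CO F i)" using sg_ca[OF I] .
    \<comment> \<open>Totality of \<open>CA\<close> comes from the source law: its composite with
      \<open>Sg\<close> is a projection from a pullback of total maps.\<close>
    then have "total C (Sg B (CI F i) (CI F j) \<cdot> CA F i j)"
      using dom.pb_total(2)[OF pb[OF I]] I by simp
    from dom.total_of_cmp[OF this] show "total C (CA F i j)" using I cam[OF I] by simp
    show "CO F j \<cdot> Ta B (CI F i) (CI F j) \<cdot> CA F i j = Ta A i j \<cdot> pb1 C (Sg A i j) (CO F i)"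
      using ta_ca[OF I] I cam[OF I] by simp
  next
    fix i assume i: "i \<in> Ix A"
    show "CA F i i \<cdot> pb_pair C (Sg A i i) (CO F i) (Et A i \<cdot> CO F i) (Idn C (PO B (CI F i))) = Et B (CI F i)"
      using et[OF i, of "Idn C (PO B (CI F i))"] i by (simp add: act_def)
  next
    fix i j k assume I: "i \<in> Ix A" "j \<in> Ix A" "k \<in> Ix A"
    define p1 where "p1 = pb1 C (Sg A i j) (CO F i)"
    define p2 where "p2 = pb2 C (Sg A i j) (CO F i)"
    define q1 where "q1 = pb1 C (Sg A j k) (Ta A i j \<cdot> p1)"
    define q2 where "q2 = pb2 C (Sg A j k) (Ta A i j \<cdot> p1)"
    have p [simp]: "p1 \<in> Mor C" "src p1 = pb_obj C (Sg A i j) (CO F i)" "tgt p1 = PA A i j"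
      "p2 \<in> Mor C" "src p2 = pb_obj C (Sg A i j) (CO F i)" "tgt p2 = PO B (CI F i)"
      "total C p1" "total C p2" and sp: "Sg A i j \<cdot> p1 = CO F i \<cdot> p2"
      using pm[OF I(1,2)] dom.pb_total[OF pb[OF I(1,2)]] dom.pb_square[OF pb[OF I(1,2)]] I
      by (simp_all add: p1_def p2_def)
    have qb: "is_pullback C (Sg A j k) (Ta A i j \<cdot> p1) q1 q2"
      unfolding q1_def q2_def using I by (intro dom.pullback_along) auto
    have q [simp]: "q1 \<in> Mor C" "src q1 = src q2" "tgt q1 = PA A j k" "q2 \<in> Mor C"
      "tgt q2 = pb_obj C (Sg A i j) (CO F i)" and sq: "Sg A j k \<cdot> q1 = Ta A i j \<cdot> (p1 \<cdot> q2)"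
      using qb I by (auto simp: is_pullback_def)
    have c1: "dom.composable i j k q1 (p1 \<cdot> q2)" using sq I by (simp add: dom.composable_def)
    have "pb_pair C (Sg A i j) (CO F i) (p1 \<cdot> q2) (p2 \<cdot> q2) = q2"
      using dom.pair_eta[OF pb[OF I(1,2)], of q2] by (simp add: p1_def p2_def)
    then have "act C A F i j (p1 \<cdot> q2) (p2 \<cdot> q2) = CA F i j \<cdot> q2" by (simp add: act_def)
    then have "act C A F i k (mul C A i j k q1 (p1 \<cdot> q2)) (p2 \<cdot> q2)
      = mul C B (CI F i) (CI F j) (CI F k)
          (act C A F j k q1 (Ta B (CI F i) (CI F j) \<cdot> (CA F i j \<cdot> q2))) (CA F i j \<cdot> q2)"
      using mu[OF I, of "p1 \<cdot> q2" "p2 \<cdot> q2" q1] I c1 dom.cmp_reassoc[OF sp, of q2] by simp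
    then show "let p1 = pb1 C (Sg A i j) (CO F i); p2 = pb2 C (Sg A i j) (CO F i);
              q1 = pb1 C (Sg A j k) (Ta A i j \<cdot> p1); q2 = pb2 C (Sg A j k) (Ta A i j \<cdot> p1)
          in CA F i k \<cdot> pb_pair C (Sg A i k) (CO F i)
               (Mu A i j k \<cdot> pb_pair C (Sg A j k) (Ta A i j) q1 (p1 \<cdot> q2)) (p2 \<cdot> q2)
             = Mu B (CI F i) (CI F j) (CI F k) \<cdot>
               pb_pair C (Sg B (CI F j) (CI F k)) (Ta B (CI F i) (CI F j))
                 (CA F j k \<cdot> pb_pair C (Sg A j k) (CO F j)
                    q1 (Ta B (CI F i) (CI F j) \<cdot> CA F i j \<cdot> q2))
                 (CA F i j \<cdot> q2)"
      using I cam[OF I(1,2)]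
      by (simp add: Let_def p1_def[symmetric] p2_def[symmetric] q1_def[symmetric] q2_def[symmetric] mul_def act_def)
  qed (use ext co in \<open>auto\<close>)
  then show ?thesis by (simp add: cofunctor_def dom.restriction_category_axioms assms)
qed

text \<open>Extensionality fixes the values off the index set, and on it \<open>CA\<close> is its
  own action on the generic pair.\<close>

lemma cofun_eqI:
  fixes C :: "('o, 'u) rcat" (structure)
  assumes "cofunctor C A B F" "cofunctor C A B G"
    and ci: "\<And>i. i \<in> Ix A \<Longrightarrow> CI F i = CI G i" and co: "\<And>i. i \<in> Ix A \<Longrightarrow> CO F i = CO G i"
    and act: "\<And>i j a b. \<lbrakk>i \<in> Ix A; j \<in> Ix A; cofunctor.actable C A B F i j a b\<rbrakk>
      \<Longrightarrow> act C A F i j a b = act C A G i j a b"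
  shows "F = G"
proof (rule cofun.equality)
  interpret F: cofunctor C A B F by fact
  interpret G: cofunctor C A B G by fact
  show "CI F = CI G" using F.ci_funcset G.ci_funcset ci by (intro PiE_ext) auto
  show "CO F = CO G" using F.co_extensional G.co_extensional co by (intro extensionalityI) auto
  show "CA F = CA G"
  proof (intro ext)
    fix i j
    show "CA F i j = CA G i j"
    proof (cases "i \<in> Ix A \<and> j \<in> Ix A")
      case True
      then have I: "i \<in> Ix A" "j \<in> Ix A" by auto
      have "F.actable i j (pb1 C (Sg A i j) (CO F i)) (pb2 C (Sg A i j) (CO F i))"
        using F.pb_mor[OF F.pullback[OF I]] F.pb_square[OF F.pullback[OF I]] I
        by (simp add: F.actable_def)
      then show ?thesis using F.ca_eq_act[OF I] G.ca_eq_act[OF I] act[OF I] co[OF I(1)] by simp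
    qed (simp add: F.ca_extensional G.ca_extensional)
  qed
qed simp

section \<open>The category of partite internal categories\<close>

lemma cofun_id_simps [simp]:
  "i \<in> Ix A \<Longrightarrow> CI (cofun_id C A) i = i"
  "i \<in> Ix A \<Longrightarrow> CO (cofun_id C A) i = Idn C (PO A i)"
  "i \<in> Ix A \<Longrightarrow> j \<in> Ix A \<Longrightarrow> CA (cofun_id C A) i j = pb1 C (Sg A i j) (Idn C (PO A i))"
  by (simp_all add: cofun_id_def)

lemma act_cofun_id:
  fixes C :: "('o, 'u) rcat" (structure)
  assumes "partite C A" "i \<in> Ix A" "j \<in> Ix A" "a \<in> hom C (src b) (PA A i j)" "b \<in> Mor C"
    "Sg A i j \<cdot> a = b"
  shows "act C A (cofun_id C A) i j a b = a"
proof -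
  interpret partite C A by fact
  have pb: "is_pullback C (Sg A i j) (Idn C (PO A i)) (pb1 C (Sg A i j) (Idn C (PO A i)))
      (pb2 C (Sg A i j) (Idn C (PO A i)))"
    by (rule pullback_along) (use assms in auto)
  have "tgt b = PO A i" using assms(2-5) cmp_mor(3)[of a "Sg A i j"] by (simp flip: assms(6))
  then show ?thesis using pair(4)[OF pb, of a b] assms(2-6) by (simp add: act_def)
qed

lemma cofunctor_id:
  fixes C :: "('o, 'u) rcat" (structure)
  assumes "partite C A"
  shows "cofunctor C A A (cofun_id C A)"
proof -
  interpret partite C A by fact
  note act_id = act_cofun_id[OF assms]
  have pb: "is_pullback C (Sg A i j) (Idn C (PO A i)) (pb1 C (Sg A i j) (Idn C (PO A i)))
      (pb2 C (Sg A i j) (Idn C (PO A i)))" if "i \<in> Ix A" "j \<in> Ix A" for i j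
    by (rule pullback_along) (use that in auto)
  show ?thesis
  proof (rule cofunctorI[OF assms assms])
    show "CA (cofun_id C A) i j \<in> hom C (pb_obj C (Sg A i j) (CO (cofun_id C A) i))
      (PA A (CI (cofun_id C A) i) (CI (cofun_id C A) j))" if "i \<in> Ix A" "j \<in> Ix A" for i j
      using that pb_mor[OF pb[OF that]] by simp
    fix i b assume i: "i \<in> Ix A" and b: "b \<in> Mor C" "tgt b = PO A (CI (cofun_id C A) i)"
    then have "Sg A i i \<cdot> (Et A i \<cdot> b) = b"
      using cmp_reassoc[OF sg_et, of i b] by simp
    then show "act C A (cofun_id C A) i i (Et A i \<cdot> (CO (cofun_id C A) i \<cdot> b)) b = Et A (CI (cofun_id C A) i) \<cdot> b"
      using i b act_id[of i i "Et A i \<cdot> b" b] by simp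
  next
    fix i j k a' a b assume I: "i \<in> Ix A" "j \<in> Ix A" "k \<in> Ix A"
      and a: "a \<in> hom C (src b) (PA A i j)" and b: "b \<in> Mor C" "tgt b = PO A (CI (cofun_id C A) i)"
      and ab: "Sg A i j \<cdot> a = CO (cofun_id C A) i \<cdot> b" and c: "composable i j k a' a"
    have ab': "Sg A i j \<cdot> a = b" using ab b I by (simp add: cofun_id_def)
    show "act C A (cofun_id C A) i k (mul C A i j k a' a) b = mul C A (CI (cofun_id C A) i)
       (CI (cofun_id C A) j) (CI (cofun_id C A) k)
       (act C A (cofun_id C A) j k a' (Ta A (CI (cofun_id C A) i) (CI (cofun_id C A) j) \<cdot>
          act C A (cofun_id C A) i j a b)) (act C A (cofun_id C A) i j a b)"
      using I b a c act_id[OF I(1,2) a _ ab'] ab' mul[OF I c]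
      by (simp add: act_id[of i k] act_id[of j k] composable_def)
  next
    fix i j a b assume I: "i \<in> Ix A" "j \<in> Ix A"
      and a: "a \<in> hom C (src b) (PA A i j)" and b: "b \<in> Mor C" "tgt b = PO A (CI (cofun_id C A) i)"
      and ab: "Sg A i j \<cdot> a = CO (cofun_id C A) i \<cdot> b"
    have "Sg A i j \<cdot> a = b" using ab b I by simp
    then show "Sg A (CI (cofun_id C A) i) (CI (cofun_id C A) j) \<cdot> act C A (cofun_id C A) i j a b = b"
      "CO (cofun_id C A) j \<cdot> (Ta A (CI (cofun_id C A) i) (CI (cofun_id C A) j) \<cdot> act C A (cofun_id C A) i j a b)
       = Ta A i j \<cdot> a"
      using I a b(1) act_id[OF I a b(1)] by simp_all
  qed (auto simp: cofun_id_def)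
qed

locale cofunctor_pair = restriction_category C + F: cofunctor C A B F + G: cofunctor C B D G
  for C :: "('o, 'u) rcat" (structure) and A B D F G
begin

abbreviation "GF \<equiv> cofun_comp C A B G F"

lemma comp_simps [simp]:
  "i \<in> Ix A \<Longrightarrow> CI GF i = CI G (CI F i)"
  "i \<in> Ix A \<Longrightarrow> CO GF i = CO F i \<cdot> CO G (CI F i)"
  by (simp_all add: cofun_comp_def)

lemma pullback:
  assumes "i \<in> Ix A" "j \<in> Ix A"
  shows "is_pullback C (Sg A i j) (CO GF i) (pb1 C (Sg A i j) (CO GF i)) (pb2 C (Sg A i j) (CO GF i))"
  using assms by (intro F.dom.pullback_along) auto

lemma ca_comp:
  assumes "i \<in> Ix A" "j \<in> Ix A"
  shows "CA GF i j = act C B G (CI F i) (CI F j)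
    (act C A F i j (pb1 C (Sg A i j) (CO GF i)) (CO G (CI F i) \<cdot> pb2 C (Sg A i j) (CO GF i)))
    (pb2 C (Sg A i j) (CO GF i))"
  using assms by (simp add: cofun_comp_def act_def Let_def)

lemma comp_actable:
  assumes I: "i \<in> Ix A" "j \<in> Ix A" and a: "a \<in> hom C (src b) (PA A i j)"
    and b: "b \<in> Mor C" "tgt b = PO D (CI GF i)" and ab: "Sg A i j \<cdot> a = CO GF i \<cdot> b"
  shows "F.actable i j a (CO G (CI F i) \<cdot> b)"
    and "G.actable (CI F i) (CI F j) (act C A F i j a (CO G (CI F i) \<cdot> b)) b"
proof -
  show 1: "F.actable i j a (CO G (CI F i) \<cdot> b)" using assms by (simp add: F.actable_def)
  show "G.actable (CI F i) (CI F j) (act C A F i j a (CO G (CI F i) \<cdot> b)) b"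
    using F.act[OF I 1] assms by (simp add: G.actable_def)
qed

lemma ca_comp_hom:
  assumes I: "i \<in> Ix A" "j \<in> Ix A"
  shows "CA GF i j \<in> hom C (pb_obj C (Sg A i j) (CO GF i)) (PA D (CI GF i) (CI GF j))"
proof -
  note pm = pb_mor[OF pullback[OF I]] pb_square[OF pullback[OF I]]
  have "G.actable (CI F i) (CI F j)
    (act C A F i j (pb1 C (Sg A i j) (CO GF i)) (CO G (CI F i) \<cdot> pb2 C (Sg A i j) (CO GF i)))
    (pb2 C (Sg A i j) (CO GF i))"
    by (rule comp_actable) (use pm I in auto)
  from G.act[OF _ _ this] show ?thesis using I pm by (simp add: ca_comp)
qed

text \<open>The definition of the composite is this formula at the generic pair;
  \<open>act_cmp\<close> for \<open>F\<close> and for \<open>G\<close> carries it to all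
  others.\<close>

lemma act_comp:
  assumes I: "i \<in> Ix A" "j \<in> Ix A" and a: "a \<in> hom C (src b) (PA A i j)"
    and b: "b \<in> Mor C" "tgt b = PO D (CI GF i)" and ab: "Sg A i j \<cdot> a = CO GF i \<cdot> b"
  shows "act C A GF i j a b = act C B G (CI F i) (CI F j) (act C A F i j a (CO G (CI F i) \<cdot> b)) b"
proof -
  note pm = pb_mor[OF pullback[OF I]] pb_square[OF pullback[OF I]]
  let ?p1 = "pb1 C (Sg A i j) (CO GF i)" and ?p2 = "pb2 C (Sg A i j) (CO GF i)"
  let ?h = "pb_pair C (Sg A i j) (CO GF i) a b"
  have h: "?h \<in> Mor C" "src ?h = src b" "tgt ?h = pb_obj C (Sg A i j) (CO GF i)" "?p1 \<cdot> ?h = a" "?p2 \<cdot> ?h = b"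
    using pair[OF pullback[OF I], of a b] I a b ab by simp_all
  have c: "F.actable i j ?p1 (CO G (CI F i) \<cdot> ?p2)"
    "G.actable (CI F i) (CI F j) (act C A F i j ?p1 (CO G (CI F i) \<cdot> ?p2)) ?p2"
    by (rule comp_actable; use pm I in auto)+
  have "act C A GF i j a b = act C B G (CI F i) (CI F j) (act C A F i j ?p1 (CO G (CI F i) \<cdot> ?p2)) ?p2 \<cdot> ?h"
    using I by (simp only: act_def[of C A GF] ca_comp)
  also have "\<dots> = act C B G (CI F i) (CI F j) (act C A F i j a (CO G (CI F i) \<cdot> b)) b"
    using G.act_cmp[OF _ _ c(2), of ?h] F.act_cmp[OF _ _ c(1), of ?h] I pm h by simp
  finally show ?thesis .
qed

lemma cofunctor_comp: "cofunctor C A D GF"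
proof (rule cofunctorI)
  show "partite C A" "partite C D" by unfold_locales
  show "CI GF \<in> Ix A \<rightarrow>\<^sub>E Ix D" by (auto simp: cofun_comp_def)
  show "CO GF \<in> extensional (Ix A)" by (simp add: cofun_comp_def)
  show "CA GF i j = undefined" if "\<not> (i \<in> Ix A \<and> j \<in> Ix A)" for i j
    using that by (auto simp: cofun_comp_def)
  show "CO GF i \<in> hom C (PO D (CI GF i)) (PO A i) \<and> total C (CO GF i)" if "i \<in> Ix A" for i
    using that by simp
  show "CA GF i j \<in> hom C (pb_obj C (Sg A i j) (CO GF i)) (PA D (CI GF i) (CI GF j))"
    if "i \<in> Ix A" "j \<in> Ix A" for i j
    using ca_comp_hom[OF that] .
next
  fix i j a b assume I: "i \<in> Ix A" "j \<in> Ix A" and a: "a \<in> hom C (src b) (PA A i j)"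
    and b: "b \<in> Mor C" "tgt b = PO D (CI GF i)" and ab: "Sg A i j \<cdot> a = CO GF i \<cdot> b"
  note c = comp_actable[OF I a b ab] and e = act_comp[OF I a b ab]
  show "Sg D (CI GF i) (CI GF j) \<cdot> act C A GF i j a b = b" using G.act(4)[OF _ _ c(2)] I e by simp
  show "CO GF j \<cdot> (Ta D (CI GF i) (CI GF j) \<cdot> act C A GF i j a b) = Ta A i j \<cdot> a"
    using G.act[OF _ _ c(2)] F.act[OF _ _ c(1)] I e by simp
  fix k a' assume k: "k \<in> Ix A" and ca: "F.dom.composable i j k a' a"
  let ?x = "act C A F i j a (CO G (CI F i) \<cdot> b)"
  let ?z = "act C B G (CI F i) (CI F j) ?x b"
  note Fx = F.act[OF I c(1)] and Gz = G.act[OF _ _ c(2)]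
  let ?Tz = "Ta D (CI G (CI F i)) (CI G (CI F j)) \<cdot> ?z"
  \<comment> \<open>Through \<open>CO G\<close> the target of \<open>?z\<close> lies over the target
    of \<open>?x\<close>, so the actions of \<open>a'\<close> at the two places can be
    compared.\<close>
  have Tz: "CO G (CI F j) \<cdot> ?Tz = Ta B (CI F i) (CI F j) \<cdot> ?x" using Gz I by simp
  have bj: "?Tz \<in> Mor C" "src ?Tz = src b" "tgt ?Tz = PO D (CI GF j)" using Gz I by simp_all
  have aj: "a' \<in> hom C (src ?Tz) (PA A j k)" "Sg A j k \<cdot> a' = CO GF j \<cdot> ?Tz"
    using ca Gz Fx I a bj Tz by (simp_all add: F.dom.composable_def)
  note j = comp_actable[OF I(2) k aj(1) bj(1,3) aj(2)] act_comp[OF I(2) k aj(1) bj(1,3) aj(2)]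
  let ?y = "act C A F j k a' (Ta B (CI F i) (CI F j) \<cdot> ?x)"
  have cy: "F.cod.composable (CI F i) (CI F j) (CI F k) ?y ?x"
    using F.act[OF I(2) k j(1)] Fx Tz I k bj by (simp add: F.cod.composable_def)
  note m = F.dom.mul[OF I k ca]
  have "act C A GF i k (mul C A i j k a' a) b =
      act C B G (CI F i) (CI F k) (act C A F i k (mul C A i j k a' a) (CO G (CI F i) \<cdot> b)) b"
    by (rule act_comp) (use I k m a b ab in auto)
  also have "act C A F i k (mul C A i j k a' a) (CO G (CI F i) \<cdot> b) = mul C B (CI F i) (CI F j) (CI F k) ?y ?x"
    by (rule F.act_mul[OF I k c(1) ca])
  also have "act C B G (CI F i) (CI F k) (mul C B (CI F i) (CI F j) (CI F k) ?y ?x) b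
    = mul C D (CI G (CI F i)) (CI G (CI F j)) (CI G (CI F k)) (act C B G (CI F j) (CI F k) ?y ?Tz) ?z"
    by (rule G.act_mul[OF _ _ _ c(2) cy]) (use I k in auto)
  also have "act C B G (CI F j) (CI F k) ?y ?Tz = act C A GF j k a' ?Tz"
    using j(3) Tz by simp
  finally show "act C A GF i k (mul C A i j k a' a) b = mul C D (CI GF i) (CI GF j) (CI GF k)
        (act C A GF j k a' (Ta D (CI GF i) (CI GF j) \<cdot> act C A GF i j a b)) (act C A GF i j a b)"
    using I k e by simp
next
  fix i b assume i: "i \<in> Ix A" and b: "b \<in> Mor C" "tgt b = PO D (CI GF i)"
  have s: "Sg A i i \<cdot> (Et A i \<cdot> (CO GF i \<cdot> b)) = CO GF i \<cdot> b"
    using cmp_reassoc[OF F.dom.sg_et, of i "CO GF i \<cdot> b"] i b by simp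
  have "act C A GF i i (Et A i \<cdot> (CO GF i \<cdot> b)) b =
    act C B G (CI F i) (CI F i) (act C A F i i (Et A i \<cdot> (CO GF i \<cdot> b)) (CO G (CI F i) \<cdot> b)) b"
    by (rule act_comp) (use i b s in auto)
  then show "act C A GF i i (Et A i \<cdot> (CO GF i \<cdot> b)) b = Et D (CI GF i) \<cdot> b"
    using F.act_unit[OF i, of "CO G (CI F i) \<cdot> b"] G.act_unit[of "CI F i" b] i b by simp
qed

end

lemma pCat_simps [simp]:
  "A \<in> Obj (pCat C) \<longleftrightarrow> partite_category C A"
  "Idn (pCat C) A = Arw A (cofun_id C A) A"
  "src (g \<cdot>\<^bsub>pCat C\<^esub> f) = src f" "tgt (g \<cdot>\<^bsub>pCat C\<^esub> f) = tgt g"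
  "lbl (g \<cdot>\<^bsub>pCat C\<^esub> f) = cofun_comp C (src f) (tgt f) (lbl g) (lbl f)"
  by (simp_all add: pCat_def)

lemma pCat_mor_iff:
  assumes "restriction_category C"
  shows "f \<in> Mor (pCat C) \<longleftrightarrow> cofunctor C (src f) (tgt f) (lbl f)"
  using assms by (cases f) (auto simp: pCat_def cofunctor_def partite_def)

lemma category_pCat:
  fixes C :: "('o, 'u) rcat" (structure)
  assumes "restriction_category C"
  shows "category (pCat C)"
proof -
  interpret restriction_category C by fact
  note mor = pCat_mor_iff[OF assms]
  have part: "partite C A" if "partite_category C A" for A using that assms by (simp add: partite_def)
  have comp: "cofunctor_pair C A B D F G" if "cofunctor C A B F" "cofunctor C B D G" for A B D F G
    using that assms by (simp add: cofunctor_pair_def)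
  show ?thesis
  proof
    fix f assume "f \<in> Mor (pCat C)"
    then interpret cofunctor C "src f" "tgt f" "lbl f" by (simp add: mor)
    show "src f \<in> Obj (pCat C)" "tgt f \<in> Obj (pCat C)"
      using dom.partite_category_axioms cod.partite_category_axioms by simp_all
  next
    show "Idn (pCat C) X \<in> hom (pCat C) X X" if "X \<in> Obj (pCat C)" for X
      using cofunctor_id[OF part, of X] that by (simp add: mor)
  next
    fix f g X Y Z assume "f \<in> hom (pCat C) X Y" "g \<in> hom (pCat C) Y Z"
    then interpret cofunctor_pair C X Y Z "lbl f" "lbl g" by (auto simp: mor intro!: comp)
    show "g \<cdot>\<^bsub>pCat C\<^esub> f \<in> hom (pCat C) X Z"
      using cofunctor_comp \<open>f \<in> _\<close> \<open>g \<in> _\<close> by (simp add: mor)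
  next
    fix f X Y assume f: "f \<in> hom (pCat C) X Y"
    then interpret F: cofunctor C X Y "lbl f" by (auto simp: mor)
    have pX: "partite C X" and pY: "partite C Y" by unfold_locales
    interpret r: cofunctor_pair C X X Y "cofun_id C X" "lbl f"
      using cofunctor_id[OF pX] F.cofunctor_axioms by (rule comp)
    interpret l: cofunctor_pair C X Y Y "lbl f" "cofun_id C Y"
      using F.cofunctor_axioms cofunctor_id[OF pY] by (rule comp)
    have "cofun_comp C X X (lbl f) (cofun_id C X) = lbl f"
    proof (rule cofun_eqI[OF r.cofunctor_comp F.cofunctor_axioms])
      fix i j a b assume I: "i \<in> Ix X" "j \<in> Ix X" and "cofunctor.actable C X Y r.GF i j a b"
      then have ab: "a \<in> hom C (src b) (PA X i j)" "b \<in> Mor C" "tgt b = PO Y (CI (lbl f) i)"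
        "Sg X i j \<cdot> a = CO (lbl f) i \<cdot> b"
        using cofunctor.actable_def[OF r.cofunctor_comp] I by simp_all
      show "act C X r.GF i j a b = act C X (lbl f) i j a b"
        using r.act_comp[OF I ab(1,2)] ab I act_cofun_id[OF pX I, of a "CO (lbl f) i \<cdot> b"] by simp
    qed simp_all
    then show "f \<cdot>\<^bsub>pCat C\<^esub> Idn (pCat C) X = f" using f by (intro arr.expand) auto
    have "cofun_comp C X Y (cofun_id C Y) (lbl f) = lbl f"
    proof (rule cofun_eqI[OF l.cofunctor_comp F.cofunctor_axioms])
      fix i j a b assume I: "i \<in> Ix X" "j \<in> Ix X" and "cofunctor.actable C X Y l.GF i j a b"
      then have ab: "a \<in> hom C (src b) (PA X i j)" "b \<in> Mor C" "tgt b = PO Y (CI (lbl f) i)"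
        "Sg X i j \<cdot> a = CO (lbl f) i \<cdot> b"
        using cofunctor.actable_def[OF l.cofunctor_comp] I by simp_all
      then have "F.actable i j a b" by (simp add: F.actable_def)
      from F.act[OF I this] show "act C X l.GF i j a b = act C X (lbl f) i j a b"
        using l.act_comp[OF I ab(1,2)] ab I act_cofun_id[OF pY, of "CI (lbl f) i" "CI (lbl f) j" _ b] by simp
    qed simp_all
    then show "Idn (pCat C) Y \<cdot>\<^bsub>pCat C\<^esub> f = f" using f by (intro arr.expand) auto
  next
    fix f g h W X Y Z
    assume fgh: "f \<in> hom (pCat C) W X" "g \<in> hom (pCat C) X Y" "h \<in> hom (pCat C) Y Z"
    then interpret F: cofunctor C W X "lbl f" + G: cofunctor C X Y "lbl g" + H: cofunctor C Y Z "lbl h"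
      by (auto simp: mor)
    interpret GF: cofunctor_pair C W X Y "lbl f" "lbl g" using F.cofunctor_axioms G.cofunctor_axioms by (rule comp)
    interpret HG: cofunctor_pair C X Y Z "lbl g" "lbl h" using G.cofunctor_axioms H.cofunctor_axioms by (rule comp)
    interpret L: cofunctor_pair C W Y Z "GF.GF" "lbl h"
      using GF.cofunctor_comp H.cofunctor_axioms by (rule comp)
    interpret R: cofunctor_pair C W X Z "lbl f" "HG.GF"
      using F.cofunctor_axioms HG.cofunctor_comp by (rule comp)
    have "R.GF = L.GF"
    proof (rule cofun_eqI[OF R.cofunctor_comp L.cofunctor_comp])
      fix i j a b assume I: "i \<in> Ix W" "j \<in> Ix W" and "cofunctor.actable C W Z R.GF i j a b"
      then have ab: "a \<in> hom C (src b) (PA W i j)" "b \<in> Mor C" "tgt b = PO Z (CI (lbl h) (CI (lbl g) (CI (lbl f) i)))"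
        "Sg W i j \<cdot> a = CO (lbl f) i \<cdot> (CO (lbl g) (CI (lbl f) i) \<cdot> (CO (lbl h) (CI (lbl g) (CI (lbl f) i)) \<cdot> b))"
        using cofunctor.actable_def[OF R.cofunctor_comp] I by simp_all
      let ?hb = "CO (lbl h) (CI (lbl g) (CI (lbl f) i)) \<cdot> b"
      let ?ghb = "CO (lbl g) (CI (lbl f) i) \<cdot> ?hb"
      have "F.actable i j a ?ghb" using ab I by (simp add: F.actable_def)
      note Fa = F.act[OF I this]
      have "act C W R.GF i j a b = act C X HG.GF (CI (lbl f) i) (CI (lbl f) j) (act C W (lbl f) i j a ?ghb) b"
        using R.act_comp[OF I ab(1,2)] ab I by simp
      also have "\<dots> = act C Y (lbl h) (CI (lbl g) (CI (lbl f) i)) (CI (lbl g) (CI (lbl f) j))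
          (act C X (lbl g) (CI (lbl f) i) (CI (lbl f) j) (act C W (lbl f) i j a ?ghb) ?hb) b"
        by (rule HG.act_comp) (use I ab Fa in auto)
      also have "\<dots> = act C W L.GF i j a b"
        using L.act_comp[OF I ab(1,2)] GF.act_comp[OF I, of a ?hb] ab I by simp
      finally show "act C W R.GF i j a b = act C W L.GF i j a b" .
    qed simp_all
    then show "h \<cdot>\<^bsub>pCat C\<^esub> g \<cdot>\<^bsub>pCat C\<^esub> f = h \<cdot>\<^bsub>pCat C\<^esub> (g \<cdot>\<^bsub>pCat C\<^esub> f)"
      using fgh by (intro arr.expand) auto
  qed
qed

section \<open>Adjunctions from universal arrows\<close>

lemma is_functor_simps:
  assumes "is_functor A B F"
  shows "X \<in> Obj A \<Longrightarrow> FO F X \<in> Obj B" "f \<in> Mor A \<Longrightarrow> FA F f \<in> Mor B"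
    "f \<in> Mor A \<Longrightarrow> src (FA F f) = FO F (src f)" "f \<in> Mor A \<Longrightarrow> tgt (FA F f) = FO F (tgt f)"
    "X \<in> Obj A \<Longrightarrow> FA F (Idn A X) = Idn B (FO F X)"
    "\<lbrakk>f \<in> Mor A; g \<in> Mor A; tgt f = src g\<rbrakk> \<Longrightarrow> FA F (g \<cdot>\<^bsub>A\<^esub> f) = FA F g \<cdot>\<^bsub>B\<^esub> FA F f"
  using assms by (simp_all add: is_functor_def)

text \<open>The passage from universal arrows to an adjunction. The hypotheses on
  \<open>FA L\<close> and \<open>\<epsilon>\<close> have the form of the definitions of
  \<open>Psi\<close> and \<open>adj_counit\<close>, which describe transposes.\<close>

lemma adjunction_from_universal:
  assumes R: "is_functor B A R"
    and \<eta>: "\<And>X. X \<in> Obj A \<Longrightarrow> FO L X \<in> Obj B \<and> \<eta> X \<in> hom A X (FO R (FO L X))"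
    and univ: "\<And>X Y h. \<lbrakk>X \<in> Obj A; Y \<in> Obj B; h \<in> hom A X (FO R Y)\<rbrakk>
      \<Longrightarrow> \<exists>!G. G \<in> hom B (FO L X) Y \<and> FA R G \<cdot>\<^bsub>A\<^esub> \<eta> X = h"
    and L: "\<And>h. h \<in> Mor A \<Longrightarrow> FA L h = (THE G. G \<in> hom B (FO L (src h)) (FO L (tgt h)) \<and>
      FA R G \<cdot>\<^bsub>A\<^esub> \<eta> (src h) = \<eta> (tgt h) \<cdot>\<^bsub>A\<^esub> h)"
    and \<epsilon>: "\<And>Y. Y \<in> Obj B \<Longrightarrow> \<epsilon> Y = (THE G. G \<in> hom B (FO L (FO R Y)) Y \<and>
      FA R G \<cdot>\<^bsub>A\<^esub> \<eta> (FO R Y) = Idn A (FO R Y))"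
  shows "adjunction A B L R \<eta> \<epsilon>"
proof -
  interpret A: category A using R by (simp add: is_functor_def)
  interpret B: category B using R by (simp add: is_functor_def)
  note [simp] = is_functor_simps[OF R]
  have \<eta>m [simp]: "FO L X \<in> Obj B" "\<eta> X \<in> Mor A" "src (\<eta> X) = X" "tgt (\<eta> X) = FO R (FO L X)"
    if "X \<in> Obj A" for X using \<eta>[OF that] by simp_all
  \<comment> \<open>Uniqueness in the universal property, used as a test: maps out of
    \<open>FO L X\<close> are equal once their transposes are.\<close>
  have eqI: "G = H" if "G \<in> Mor B" "H \<in> Mor B" "src G = FO L X" "src H = FO L X" "tgt G = tgt H" "X \<in> Obj A"
    "FA R G \<cdot>\<^bsub>A\<^esub> \<eta> X = FA R H \<cdot>\<^bsub>A\<^esub> \<eta> X" for G H X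
    using univ[of X "tgt G" "FA R G \<cdot>\<^bsub>A\<^esub> \<eta> X"] that by auto
  have Lh: "FA L h \<in> Mor B" "src (FA L h) = FO L (src h)" "tgt (FA L h) = FO L (tgt h)"
    "FA R (FA L h) \<cdot>\<^bsub>A\<^esub> \<eta> (src h) = \<eta> (tgt h) \<cdot>\<^bsub>A\<^esub> h" if h: "h \<in> Mor A" for h
    using theI'[OF univ[of "src h" "FO L (tgt h)" "\<eta> (tgt h) \<cdot>\<^bsub>A\<^esub> h"]] h unfolding L[OF h] by simp_all
  have \<epsilon>Y: "\<epsilon> Y \<in> Mor B" "src (\<epsilon> Y) = FO L (FO R Y)" "tgt (\<epsilon> Y) = Y"
    "FA R (\<epsilon> Y) \<cdot>\<^bsub>A\<^esub> \<eta> (FO R Y) = Idn A (FO R Y)" if Y: "Y \<in> Obj B" for Y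
    using theI'[OF univ[of "FO R Y" Y "Idn A (FO R Y)"]] Y unfolding \<epsilon>[OF Y] by simp_all
  have func: "is_functor A B L"
    unfolding is_functor_def
  proof (intro conjI ballI impI)
    show "category A" "category B" by unfold_locales
    show "FO L X \<in> Obj B" if "X \<in> Obj A" for X using that by simp
    show "FA L f \<in> hom B (FO L (src f)) (FO L (tgt f))" if "f \<in> Mor A" for f using Lh[OF that] by simp
    show "FA L (Idn A X) = Idn B (FO L X)" if "X \<in> Obj A" for X
      by (rule eqI[of _ _ X]) (use that Lh[of "Idn A X"] in simp_all)
    fix f g assume fg: "f \<in> Mor A" "g \<in> Mor A" "tgt f = src g"
    note [simp] = Lh[OF fg(1)] Lh[OF fg(2)] Lh[OF A.cmp_mor(1)[OF fg], unfolded A.cmp_mor(2,3)[OF fg]] fg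
    have "FA R (FA L g \<cdot>\<^bsub>B\<^esub> FA L f) \<cdot>\<^bsub>A\<^esub> \<eta> (src f) = \<eta> (tgt g) \<cdot>\<^bsub>A\<^esub> (g \<cdot>\<^bsub>A\<^esub> f)"
      using A.cmp_reassoc[OF Lh(4)[OF fg(2)], of f] by simp
    then show "FA L (g \<cdot>\<^bsub>A\<^esub> f) = FA L g \<cdot>\<^bsub>B\<^esub> FA L f"
      by (intro eqI[of _ _ "src f"]) simp_all
  qed
  moreover have "nat_trans A A id_functr (comp_functr R L) \<eta>"
    by (simp add: nat_trans_def id_functr_def comp_functr_def Lh)
  moreover have "nat_trans B B (comp_functr L R) id_functr \<epsilon>"
    unfolding nat_trans_def
  proof (intro conjI ballI)
    show "\<epsilon> Y \<in> hom B (FO (comp_functr L R) Y) (FO id_functr Y)" if "Y \<in> Obj B" for Y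
      using \<epsilon>Y[OF that] by (simp add: comp_functr_def id_functr_def)
    fix f assume f: "f \<in> Mor B"
    note [simp] = f \<epsilon>Y[OF B.src_obj'[OF f]] \<epsilon>Y[OF B.tgt_obj'[OF f]] Lh[of "FA R f"]
    show "\<epsilon> (tgt f) \<cdot>\<^bsub>B\<^esub> FA (comp_functr L R) f = FA id_functr f \<cdot>\<^bsub>B\<^esub> \<epsilon> (src f)"
      by (rule eqI[of _ _ "FO R (src f)"])
        (use A.cmp_reassoc[OF \<epsilon>Y(4), of "tgt f" "FA R f"] Lh(4)[of "FA R f"] in
          \<open>simp_all add: comp_functr_def id_functr_def\<close>)
  qed
  moreover have "\<epsilon> (FO L X) \<cdot>\<^bsub>B\<^esub> FA L (\<eta> X) = Idn B (FO L X)" if X: "X \<in> Obj A" for X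
  proof (rule eqI[of _ _ X])
    note [simp] = X \<epsilon>Y[of "FO L X"] Lh[of "\<eta> X"]
    show "FA R (\<epsilon> (FO L X) \<cdot>\<^bsub>B\<^esub> FA L (\<eta> X)) \<cdot>\<^bsub>A\<^esub> \<eta> X = FA R (Idn B (FO L X)) \<cdot>\<^bsub>A\<^esub> \<eta> X"
      using A.cmp_reassoc[OF \<epsilon>Y(4), of "FO L X" "\<eta> X"] Lh(4)[of "\<eta> X"] by simp
  qed (use X \<epsilon>Y[of "FO L X"] Lh[of "\<eta> X"] in simp_all)
  ultimately show ?thesis unfolding adjunction_def using func R \<epsilon>Y(4) by blast
qed

section \<open>Full subcategories\<close>

lemma full_subcat_simps [simp]:
  "X \<in> Obj (full_subcat A S) \<longleftrightarrow> X \<in> Obj A \<and> S X"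
  "f \<in> Mor (full_subcat A S) \<longleftrightarrow> f \<in> Mor A \<and> S (src f) \<and> S (tgt f)"
  "Idn (full_subcat A S) = Idn A" "g \<cdot>\<^bsub>full_subcat A S\<^esub> f = g \<cdot>\<^bsub>A\<^esub> f"
  by (simp_all add: full_subcat_def)

lemma category_full_subcat:
  assumes "category A"
  shows "category (full_subcat A S)"
proof -
  interpret category A by fact
  show ?thesis by unfold_locales auto
qed

lemma iso_arr_full_subcat:
  "S (src f) \<Longrightarrow> S (tgt f) \<Longrightarrow> iso_arr (full_subcat A S) f \<longleftrightarrow> iso_arr A f"
  by (auto simp: iso_arr_def)

text \<open>Unit and counit stay the same maps. The hypotheses ask \<open>L\<close> and
  \<open>R\<close> to send all objects into the subcategories, as \<open>Psi\<close> and
  \<open>Phi\<close> do.\<close>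

lemma adjunction_full_subcat:
  assumes adj: "adjunction A B L R \<eta> \<epsilon>"
    and L: "\<And>X. X \<in> Obj A \<Longrightarrow> T (FO L X)" and R: "\<And>Y. Y \<in> Obj B \<Longrightarrow> S (FO R Y)"
  shows "adjunction (full_subcat A S) (full_subcat B T) L R \<eta> \<epsilon>"
proof -
  have cat: "category A" "category B" using adj by (auto simp: adjunction_def is_functor_def)
  interpret A: category A by fact
  interpret B: category B by fact
  have F: "is_functor A B L" "is_functor B A R" using adj by (auto simp: adjunction_def)
  note s = is_functor_simps[OF F(1)] is_functor_simps[OF F(2)]
  have "is_functor (full_subcat A S) (full_subcat B T) L"
    using s L by (simp add: is_functor_def category_full_subcat cat)
  moreover have "is_functor (full_subcat B T) (full_subcat A S) R"
    using s R by (simp add: is_functor_def category_full_subcat cat)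
  ultimately show ?thesis
    using adj L R s by (simp add: adjunction_def nat_trans_def comp_functr_def id_functr_def)
qed

section \<open>Categories over a restriction category\<close>

lemma rCat_over_simps [simp]:
  "X \<in> Obj (rCat_over C) \<longleftrightarrow> over_obj C X"
  "Idn (rCat_over C) X = Arw X (over_id C X) X"
  "src (g \<cdot>\<^bsub>rCat_over C\<^esub> f) = src f" "tgt (g \<cdot>\<^bsub>rCat_over C\<^esub> f) = tgt g"
  "lbl (g \<cdot>\<^bsub>rCat_over C\<^esub> f) = over_comp C (src f) (lbl g) (lbl f)"
  "f \<in> Mor (rCat_over C) \<longleftrightarrow> over_obj C (src f) \<and> over_obj C (tgt f) \<and> over_hom C (src f) (tgt f) (lbl f)"
  by (simp_all add: rCat_over_def) (metis arr.collapse arr.sel surj_pair)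

lemma res_functr_simps [simp]:
  "X \<in> Obj A \<Longrightarrow> FO (res_functr A F) X = FO F X"
  "f \<in> Mor A \<Longrightarrow> FA (res_functr A F) f = FA F f"
  "res_functr A (res_functr A F) = res_functr A F"
  by (simp_all add: res_functr_def)

lemma comp_functr_simps [simp]:
  "FO (comp_functr G F) X = FO G (FO F X)"
  "FA (comp_functr G F) f = FA G (FA F f)"
  by (simp_all add: comp_functr_def)

lemma res_functr_eqI:
  assumes "F = res_functr A F" "G = res_functr A G"
    and "\<And>X. X \<in> Obj A \<Longrightarrow> FO F X = FO G X" "\<And>f. f \<in> Mor A \<Longrightarrow> FA F f = FA G f"
  shows "F = G"
proof -
  have "res_functr A F = res_functr A G"
    using assms(3,4) by (auto simp: res_functr_def intro!: restrict_ext)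
  then show ?thesis using assms(1,2) by simp
qed

lemma restriction_functor_res:
  assumes "restriction_category A"
  shows "restriction_functor A B (res_functr A F) \<longleftrightarrow> restriction_functor A B F"
proof -
  interpret restriction_category A by fact
  show ?thesis by (simp add: restriction_functor_def is_functor_def)
qed

lemma restriction_functor_comp:
  assumes "restriction_functor A B F" "restriction_functor B D G"
  shows "restriction_functor A D (comp_functr G F)"
proof -
  have F: "is_functor A B F" "is_functor B D G" using assms by (simp_all add: restriction_functor_def)
  note [simp] = is_functor_simps[OF F(1)] is_functor_simps[OF F(2)]
  show ?thesis using assms by (simp add: restriction_functor_def is_functor_def)
qed

lemma restriction_functor_id:
  assumes "restriction_category A"
  shows "restriction_functor A A id_functr"
proof -
  interpret restriction_category A by fact
  show ?thesis using category_axioms by (simp add: restriction_functor_def is_functor_def id_functr_def)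
qed

lemma category_rCat_over:
  fixes C :: "('o, 'u) rcat" (structure)
  assumes "restriction_category C"
  shows "category (rCat_over C)"
proof -
  interpret restriction_category C by fact
  show ?thesis
  proof
    fix f assume "f \<in> Mor (rCat_over C)"
    then show "src f \<in> Obj (rCat_over C)" "tgt f \<in> Obj (rCat_over C)" by simp_all
  next
    fix X assume "X \<in> Obj (rCat_over C)"
    then have X: "over_obj C X" by simp
    obtain A P where AP: "X = (A, P)" by fastforce
    interpret A: restriction_category A using X AP by (simp add: over_obj_def)
    have "is_functor A C P" using X AP by (simp add: over_obj_def restriction_functor_def)
    note s = is_functor_simps[OF this]
    have "restriction_functor A A (res_functr A id_functr)"
      using restriction_functor_id restriction_functor_res A.restriction_category_axioms by blast
    moreover have "nat_trans A C (comp_functr P (res_functr A id_functr)) P (\<lambda>i\<in>Obj A. Idn C (FO P i))"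
      using s(1-4) by (simp add: nat_trans_def id_functr_def)
    ultimately show "Idn (rCat_over C) X \<in> hom (rCat_over C) X X"
      using X s(1) by (simp add: AP over_hom_def over_id_def)
  next
    fix f g X Y Z assume f: "f \<in> hom (rCat_over C) X Y" and g: "g \<in> hom (rCat_over C) Y Z"
    obtain A P B Q D R F \<alpha> G \<beta> where eqs: "X = (A, P)" "Y = (B, Q)" "Z = (D, R)"
      "lbl f = (F, \<alpha>)" "lbl g = (G, \<beta>)" by (metis surj_pair)
    interpret A: restriction_category A using f eqs by (auto simp: over_obj_def)
    interpret B: restriction_category B using f eqs by (auto simp: over_obj_def)
    have F: "restriction_functor A B F" "nat_trans A C (comp_functr Q F) P \<alpha>" "\<forall>i\<in>Obj A. total C (\<alpha> i)"
      and G: "restriction_functor B D G" "nat_trans B C (comp_functr R G) Q \<beta>" "\<forall>i\<in>Obj B. total C (\<beta> i)"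
      using f g by (auto simp: eqs over_hom_def)
    have PQR: "is_functor A C P" "is_functor B C Q" "is_functor D C R"
      using f g by (auto simp: eqs over_obj_def restriction_functor_def)
    have FG: "is_functor A B F" "is_functor B D G" using F G by (auto simp: restriction_functor_def)
    note s [simp] = is_functor_simps[OF PQR(1)] is_functor_simps[OF PQR(2)] is_functor_simps[OF PQR(3)]
      is_functor_simps[OF FG(1)] is_functor_simps[OF FG(2)]
    have \<alpha> [simp]: "\<alpha> i \<in> Mor C" "src (\<alpha> i) = FO Q (FO F i)" "tgt (\<alpha> i) = FO P i" "total C (\<alpha> i)" if "i \<in> Obj A" for i
      using F that by (auto simp: nat_trans_def)
    have \<beta> [simp]: "\<beta> i \<in> Mor C" "src (\<beta> i) = FO R (FO G i)" "tgt (\<beta> i) = FO Q i" "total C (\<beta> i)" if "i \<in> Obj B" for i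
      using G that by (auto simp: nat_trans_def)
    have nat: "\<alpha> (tgt f) \<cdot> \<beta> (FO F (tgt f)) \<cdot> FA R (FA G (FA F f)) = FA P f \<cdot> (\<alpha> (src f) \<cdot> \<beta> (FO F (src f)))"
      if f: "f \<in> Mor A" for f
    proof -
      have 1: "\<alpha> (tgt f) \<cdot> FA Q (FA F f) = FA P f \<cdot> \<alpha> (src f)" using F(2) f by (simp add: nat_trans_def)
      have 2: "\<beta> (FO F (tgt f)) \<cdot> FA R (FA G (FA F f)) = FA Q (FA F f) \<cdot> \<beta> (FO F (src f))"
        proof -
        have "\<forall>f\<in>Mor B. \<beta> (tgt f) \<cdot> FA (comp_functr R G) f = FA Q f \<cdot> \<beta> (src f)"
          using G(2) by (simp add: nat_trans_def)
        from bspec[OF this, of "FA F f"] f show ?thesis by simp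
      qed
      show ?thesis using 2 f cmp_reassoc[OF 1, of "\<beta> (FO F (src f))"] by simp
    qed
    have "over_hom C X Z (over_comp C X (lbl g) (lbl f))"
      using restriction_functor_comp[OF F(1) G(1)] nat
      by (simp add: eqs over_hom_def over_comp_def restriction_functor_res A.restriction_category_axioms
          nat_trans_def)
    then show "g \<cdot>\<^bsub>rCat_over C\<^esub> f \<in> hom (rCat_over C) X Z" using f g by auto
  next
    fix f X Y assume f: "f \<in> hom (rCat_over C) X Y"
    obtain A P B Q F \<alpha> where eqs: "X = (A, P)" "Y = (B, Q)" "lbl f = (F, \<alpha>)" by (metis surj_pair)
    interpret A: restriction_category A using f eqs by (auto simp: over_obj_def)
    have F: "restriction_functor A B F" "F = res_functr A F"
      and nat: "nat_trans A C (comp_functr Q F) P \<alpha>" and ext: "\<alpha> \<in> extensional (Obj A)"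
      using f by (auto simp: eqs over_hom_def)
    have FF: "is_functor A B F" using F(1) by (simp add: restriction_functor_def)
    have \<alpha> [simp]: "\<alpha> i \<in> Mor C" "src (\<alpha> i) = FO Q (FO F i)" "tgt (\<alpha> i) = FO P i" if "i \<in> Obj A" for i
      using nat that by (auto simp: nat_trans_def)
    note [simp] = is_functor_simps[OF FF]
    have 1: "res_functr A (comp_functr F (res_functr A id_functr)) = F"
      by (rule res_functr_eqI[OF _ F(2)]) (simp_all add: id_functr_def)
    have 2: "res_functr A (comp_functr (res_functr B id_functr) F) = F"
      by (rule res_functr_eqI[OF _ F(2)]) (simp_all add: id_functr_def)
    have 3: "(\<lambda>i\<in>Obj A. (\<lambda>i\<in>Obj A. Idn C (FO P i)) i \<cdot> \<alpha> i) = \<alpha>"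
      "(\<lambda>i\<in>Obj A. \<alpha> i \<cdot> (\<lambda>i\<in>Obj B. Idn C (FO Q i)) (FO F i)) = \<alpha>"
      by (rule extensionalityI[OF restrict_extensional ext]; simp)+
    show "f \<cdot>\<^bsub>rCat_over C\<^esub> Idn (rCat_over C) X = f"
      using f 1 3 by (intro arr.expand) (auto simp: eqs over_comp_def over_id_def id_functr_def cong: restrict_cong)
    show "Idn (rCat_over C) Y \<cdot>\<^bsub>rCat_over C\<^esub> f = f"
      using f 2 3 by (intro arr.expand) (auto simp: eqs over_comp_def over_id_def)
  next
    fix f g h W X Y Z
    assume f: "f \<in> hom (rCat_over C) W X" and g: "g \<in> hom (rCat_over C) X Y" and h: "h \<in> hom (rCat_over C) Y Z"
    obtain A P B Q D R E S F \<alpha> G \<beta> H \<gamma> where eqs: "W = (A, P)" "X = (B, Q)" "Y = (D, R)" "Z = (E, S)"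
      "lbl f = (F, \<alpha>)" "lbl g = (G, \<beta>)" "lbl h = (H, \<gamma>)" by (metis surj_pair)
    have F: "is_functor A B F" "nat_trans A C (comp_functr Q F) P \<alpha>"
      and G: "is_functor B D G" "nat_trans B C (comp_functr R G) Q \<beta>"
      and H: "is_functor D E H" "nat_trans D C (comp_functr S H) R \<gamma>"
      using f g h by (auto simp: eqs over_hom_def restriction_functor_def)
    note [simp] = is_functor_simps[OF F(1)] is_functor_simps[OF G(1)] is_functor_simps[OF H(1)]
    have [simp]: "\<alpha> i \<in> Mor C" "src (\<alpha> i) = FO Q (FO F i)" if "i \<in> Obj A" for i
      using F that by (auto simp: nat_trans_def)
    have [simp]: "\<beta> i \<in> Mor C" "src (\<beta> i) = FO R (FO G i)" "tgt (\<beta> i) = FO Q i" if "i \<in> Obj B" for i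
      using G that by (auto simp: nat_trans_def)
    have [simp]: "\<gamma> i \<in> Mor C" "tgt (\<gamma> i) = FO R i" if "i \<in> Obj D" for i
      using H that by (auto simp: nat_trans_def)
    have "res_functr A (comp_functr (res_functr B (comp_functr H G)) F)
      = res_functr A (comp_functr H (res_functr A (comp_functr G F)))"
      by (rule res_functr_eqI[of _ A]) simp_all
    then show "h \<cdot>\<^bsub>rCat_over C\<^esub> g \<cdot>\<^bsub>rCat_over C\<^esub> f = h \<cdot>\<^bsub>rCat_over C\<^esub> (g \<cdot>\<^bsub>rCat_over C\<^esub> f)"
      using f g h by (intro arr.expand) (auto simp: eqs over_comp_def intro!: restrict_ext)
  qed
qed

section \<open>The functor \<open>\<Phi>\<close>\<close>

lemma sect_simps [simp]:
  "src (sect A s) = PO A (src s)" "tgt (sect A s) = PA A (src s) (tgt s)" "lbl (sect A s) = lbl s"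
  by (simp_all add: sect_def)

lemma sect_Arw: "src f = PO A i \<Longrightarrow> tgt f = PA A i j \<Longrightarrow> sect A (Arw i (lbl f) j) = f"
  by (cases f) (simp add: sect_def)

text \<open>Equations in \<open>\<Phi> A\<close> are proved this way: an arrow is recovered from its
  underlying partial section once its endpoints in the index set are known.\<close>

lemma sect_eqI: "src s = src t \<Longrightarrow> tgt s = tgt t \<Longrightarrow> sect A s = sect A t \<Longrightarrow> s = t"
  by (cases s; cases t) (simp add: sect_def)

context partite
begin

lemma et_total [simp]: "i \<in> Ix A \<Longrightarrow> total C (Et A i)"
  using total_of_cmp[of "Sg A i i" "Et A i"] sg_et[of i] by simp

lemma ta_et_cmp [simp]: "i \<in> Ix A \<Longrightarrow> x \<in> Mor C \<Longrightarrow> tgt x = PO A i \<Longrightarrow> Ta A i i \<cdot> (Et A i \<cdot> x) = x"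
  using cmp_reassoc[OF ta_et, of i x] by simp

lemma sg_et_cmp [simp]: "i \<in> Ix A \<Longrightarrow> x \<in> Mor C \<Longrightarrow> tgt x = PO A i \<Longrightarrow> Sg A i i \<cdot> (Et A i \<cdot> x) = x"
  using cmp_reassoc[OF sg_et, of i x] by simp

abbreviation "\<Phi> \<equiv> Phi_cat C A"

lemma Phi_Obj [simp]: "Obj \<Phi> = Ix A"
  and Phi_Idn_def: "Idn \<Phi> i = Arw i (lbl (Et A i)) i"
  and Phi_Cmp_def: "t \<cdot>\<^bsub>\<Phi>\<^esub> s = Arw (src s) (lbl (Mu A (src s) (tgt s) (tgt t) \<cdot>
    pb_lift C (Sg A (tgt s) (tgt t)) (Ta A (src s) (tgt s)) (sect A t) \<cdot> sect A s)) (tgt t)"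
  and Phi_Rst_def: "\<rho>\<^bsub>\<Phi>\<^esub> s = Arw (src s) (lbl (Et A (src s) \<cdot> \<rho> (sect A s))) (src s)"
  by (simp_all add: Phi_cat_def Let_def)

lemma Phi_Mor: "s \<in> Mor \<Phi> \<longleftrightarrow> src s \<in> Ix A \<and> tgt s \<in> Ix A \<and> sect A s \<in> Mor C \<and>
    Sg A (src s) (tgt s) \<cdot> sect A s = \<rho> (sect A s)"
  by (auto simp: Phi_cat_def partial_section_def)

lemma Phi_Mor_simps [simp]:
  assumes "s \<in> Mor \<Phi>"
  shows "src s \<in> Ix A" "tgt s \<in> Ix A" "sect A s \<in> Mor C"
    "Sg A (src s) (tgt s) \<cdot> sect A s = \<rho> (sect A s)"
  using assms by (simp_all add: Phi_Mor)

lemma Phi_MorI: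
  assumes "i \<in> Ix A" "j \<in> Ix A" "f \<in> hom C (PO A i) (PA A i j)" "Sg A i j \<cdot> f = \<rho> f"
  shows "Arw i (lbl f) j \<in> Mor \<Phi>" "sect A (Arw i (lbl f) j) = f"
proof -
  show f: "sect A (Arw i (lbl f) j) = f" by (rule sect_Arw) (use assms(3) in simp_all)
  show "Arw i (lbl f) j \<in> Mor \<Phi>" using assms by (simp add: Phi_Mor f)
qed

lemma Phi_Idn:
  assumes "i \<in> Ix A"
  shows "Idn \<Phi> i \<in> Mor \<Phi>" "src (Idn \<Phi> i) = i" "tgt (Idn \<Phi> i) = i" "sect A (Idn \<Phi> i) = Et A i"
proof -
  have "Sg A i i \<cdot> Et A i = \<rho> (Et A i)" using sg_et[OF assms] rst_total[of "Et A i"] assms by simp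
  from Phi_MorI[OF assms assms et_hom[OF assms] this]
  show "Idn \<Phi> i \<in> Mor \<Phi>" "src (Idn \<Phi> i) = i" "tgt (Idn \<Phi> i) = i" "sect A (Idn \<Phi> i) = Et A i"
    unfolding Phi_Idn_def by simp_all
qed

text \<open>The restriction idempotent of \<open>\<Phi> A\<close> lying over \<open>d\<close>; this
  is the inverse of the projection to \<open>C\<close> on restriction idempotents.\<close>

definition Phi_rid where "Phi_rid i d = Arw i (lbl (Et A i \<cdot> d)) i"

lemma Phi_rid:
  assumes "i \<in> Ix A" "d \<in> rid C (PO A i)"
  shows "Phi_rid i d \<in> Mor \<Phi>" "src (Phi_rid i d) = i" "tgt (Phi_rid i d) = i"
    "sect A (Phi_rid i d) = Et A i \<cdot> d"
proof -
  have "Sg A i i \<cdot> (Et A i \<cdot> d) = \<rho> (Et A i \<cdot> d)"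
    using assms rid_mor[OF assms(2)] by simp
  moreover have "Et A i \<cdot> d \<in> hom C (PO A i) (PA A i i)" using assms rid_mor[OF assms(2)] by simp
  ultimately have "Arw i (lbl (Et A i \<cdot> d)) i \<in> Mor \<Phi>" "sect A (Arw i (lbl (Et A i \<cdot> d)) i) = Et A i \<cdot> d"
    using Phi_MorI[OF assms(1) assms(1)] by blast+
  then show "Phi_rid i d \<in> Mor \<Phi>" "src (Phi_rid i d) = i" "tgt (Phi_rid i d) = i"
    "sect A (Phi_rid i d) = Et A i \<cdot> d"
    by (simp_all add: Phi_rid_def)
qed

lemma Phi_Rst: "\<rho>\<^bsub>\<Phi>\<^esub> s = Phi_rid (src s) (\<rho> (sect A s))"
  by (simp add: Phi_Rst_def Phi_rid_def)

context
  fixes s t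
  assumes s: "s \<in> Mor \<Phi>" and t: "t \<in> Mor \<Phi>" and st: "tgt s = src t"
begin

text \<open>The value of \<open>t\<close> at the target of \<open>s\<close>. Its restriction is the
  domain of the composite, to which \<open>sect A s\<close> has to be cut down before the two can be
  paired.\<close>

abbreviation (input) "lifted \<equiv> sect A t \<cdot> (Ta A (src s) (tgt s) \<cdot> sect A s)"

lemma Phi_composable: "composable (src s) (src t) (tgt t) lifted (sect A s \<cdot> \<rho> lifted)"
proof -
  have "Sg A (src t) (tgt t) \<cdot> lifted = \<rho> (sect A t) \<cdot> (Ta A (src s) (src t) \<cdot> sect A s)"
    using cmp_reassoc[OF Phi_Mor_simps(4)[OF t], of "Ta A (src s) (src t) \<cdot> sect A s"] s t st by simp
  also have "\<dots> = Ta A (src s) (src t) \<cdot> (sect A s \<cdot> \<rho> lifted)"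
    using rst_shift[of "Ta A (src s) (src t) \<cdot> sect A s" "sect A t"] s t st by simp
  finally show ?thesis using s t st by (simp add: composable_def)
qed

lemma Phi_Cmp:
  "t \<cdot>\<^bsub>\<Phi>\<^esub> s \<in> Mor \<Phi>" "src (t \<cdot>\<^bsub>\<Phi>\<^esub> s) = src s" "tgt (t \<cdot>\<^bsub>\<Phi>\<^esub> s) = tgt t"
  "sect A (t \<cdot>\<^bsub>\<Phi>\<^esub> s) = mul C A (src s) (src t) (tgt t) lifted (sect A s \<cdot> \<rho> lifted)"
  "\<rho> (sect A (t \<cdot>\<^bsub>\<Phi>\<^esub> s)) = \<rho> lifted"
  "Ta A (src s) (tgt t) \<cdot> sect A (t \<cdot>\<^bsub>\<Phi>\<^esub> s) = Ta A (src t) (tgt t) \<cdot> lifted"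
proof -
  note I = Phi_Mor_simps(1,2)[OF s] Phi_Mor_simps(1,2)[OF t]
  have pb: "is_pullback C (Sg A (src t) (tgt t)) (Ta A (src s) (src t))
    (pb1 C (Sg A (src t) (tgt t)) (Ta A (src s) (src t))) (pb2 C (Sg A (src t) (tgt t)) (Ta A (src s) (src t)))"
    using I st by (intro pullback_along) auto
  let ?m = "mul C A (src s) (src t) (tgt t) lifted (sect A s \<cdot> \<rho> lifted)"
  note m = mul[OF _ _ _ Phi_composable]
  have l: "pb_lift C (Sg A (src t) (tgt t)) (Ta A (src s) (src t)) (sect A t) \<cdot> sect A s
    = pb_pair C (Sg A (src t) (tgt t)) (Ta A (src s) (src t)) lifted (sect A s \<cdot> \<rho> lifted)"
    unfolding pb_lift_def by (subst lift_cmp[OF pb]) (use s t st I in auto)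
  have eq: "t \<cdot>\<^bsub>\<Phi>\<^esub> s = Arw (src s) (lbl ?m) (tgt t)"
  proof -
    have "Mu A (src s) (src t) (tgt t) \<cdot> pb_lift C (Sg A (src t) (tgt t)) (Ta A (src s) (src t)) (sect A t) \<cdot> sect A s
      = Mu A (src s) (src t) (tgt t) \<cdot> (pb_lift C (Sg A (src t) (tgt t)) (Ta A (src s) (src t)) (sect A t) \<cdot> sect A s)"
      using lift[OF pb, of "sect A t", folded pb_lift_def] mu_hom[of "src s" "src t" "tgt t"] s t st I
      by simp
    then show ?thesis using st by (simp add: Phi_Cmp_def mul_def l)
  qed
  have rle: "\<rho> (sect A s) \<cdot> \<rho> lifted = \<rho> lifted"
    using rst_cmp_absorb'[of "sect A s" "sect A t \<cdot> Ta A (src s) (src t)"] s t st I by simp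
  have sg: "Sg A (src s) (tgt t) \<cdot> ?m = \<rho> lifted"
    using m(4) cmp_reassoc[OF Phi_Mor_simps(4)[OF s], of "\<rho> lifted"] I s t st rle by simp
  have rm: "\<rho> ?m = \<rho> lifted" using m I s t st rle by simp
  have hm: "?m \<in> hom C (PO A (src s)) (PA A (src s) (tgt t))"
    using m(1-3) I s t st by simp
  have "Arw (src s) (lbl ?m) (tgt t) \<in> Mor \<Phi>" "sect A (Arw (src s) (lbl ?m) (tgt t)) = ?m"
    by (rule Phi_MorI[OF I(1,4) hm]; simp only: sg rm)+
  then show "t \<cdot>\<^bsub>\<Phi>\<^esub> s \<in> Mor \<Phi>" "src (t \<cdot>\<^bsub>\<Phi>\<^esub> s) = src s" "tgt (t \<cdot>\<^bsub>\<Phi>\<^esub> s) = tgt t"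
    "sect A (t \<cdot>\<^bsub>\<Phi>\<^esub> s) = ?m" "\<rho> (sect A (t \<cdot>\<^bsub>\<Phi>\<^esub> s)) = \<rho> lifted"
    "Ta A (src s) (tgt t) \<cdot> sect A (t \<cdot>\<^bsub>\<Phi>\<^esub> s) = Ta A (src t) (tgt t) \<cdot> lifted"
    using m(5) I rm st by (simp_all add: eq)
qed

end

text \<open>The right unit law absorbs \<open>Et\<close>; what remains of \<open>Phi_rid\<close> is
  the restriction to \<open>d\<close>.\<close>

lemma Phi_cmp_rid:
  assumes s: "s \<in> Mor \<Phi>" and d: "d \<in> rid C (PO A (src s))"
  shows "sect A (s \<cdot>\<^bsub>\<Phi>\<^esub> Phi_rid (src s) d) = sect A s \<cdot> d"
proof -
  note I = Phi_Mor_simps(1,2)[OF s] and e = Phi_rid[OF Phi_Mor_simps(1)[OF s] d]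
  note [simp] = rid_mor(1-4)[OF d]
  have "Et A (src s) \<cdot> (d \<cdot> \<rho> (sect A s \<cdot> d)) = Et A (src s) \<cdot> (Sg A (src s) (tgt s) \<cdot> (sect A s \<cdot> d))"
    using cmp_reassoc[OF Phi_Mor_simps(4)[OF s], of d] s I rid_left_comm[OF d rst_rid, of "sect A s"]
      rid_mor(5)[OF d] rid_comm[OF d rst_rid, of "sect A s"] by (simp add: rst_cmp_rid[OF d])
  then show ?thesis
    using Phi_Cmp(4)[OF e(1) s] e s I mul_unit_right[OF I, of "sect A s \<cdot> d"] by simp
qed

text \<open>By the left unit law only the inverse image of \<open>d\<close> under the target of
  \<open>s\<close> remains.\<close>

lemma Phi_rid_cmp:
  assumes s: "s \<in> Mor \<Phi>" and d: "d \<in> rid C (PO A (tgt s))"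
  shows "sect A (Phi_rid (tgt s) d \<cdot>\<^bsub>\<Phi>\<^esub> s) = sect A s \<cdot> \<rho> (d \<cdot> (Ta A (src s) (tgt s) \<cdot> sect A s))"
proof -
  note I = Phi_Mor_simps(1,2)[OF s] and e = Phi_rid[OF Phi_Mor_simps(2)[OF s] d]
  note [simp] = rid_mor(1-4)[OF d]
  let ?w = "\<rho> (d \<cdot> (Ta A (src s) (tgt s) \<cdot> sect A s))"
  have "d \<cdot> (Ta A (src s) (tgt s) \<cdot> sect A s) = Ta A (src s) (tgt s) \<cdot> (sect A s \<cdot> ?w)"
    using rid_shift[OF d, of "Ta A (src s) (tgt s) \<cdot> sect A s"] s I by simp
  moreover have "\<rho> (sect A s) \<cdot> ?w = ?w"
    using rst_cmp_absorb'[of "sect A s" "d \<cdot> Ta A (src s) (tgt s)"] s I by simp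
  ultimately show ?thesis
    using Phi_Cmp(4)[OF s e(1)] e s I mul_unit_left[OF I, of "sect A s \<cdot> ?w"] by simp
qed

text \<open>Both composites have the domain \<open>w\<close>. Cut down to it, their underlying
  sections are the two bracketings of one composable triple of elements, and
  \<open>mul_assoc\<close> applies.\<close>

lemma Phi_assoc:
  assumes s: "s \<in> Mor \<Phi>" and t: "t \<in> Mor \<Phi>" and u: "u \<in> Mor \<Phi>" and st: "tgt s = src t" and tu: "tgt t = src u"
  shows "u \<cdot>\<^bsub>\<Phi>\<^esub> t \<cdot>\<^bsub>\<Phi>\<^esub> s = u \<cdot>\<^bsub>\<Phi>\<^esub> (t \<cdot>\<^bsub>\<Phi>\<^esub> s)"
proof -
  note I = Phi_Mor_simps(1,2)[OF s] Phi_Mor_simps(1,2)[OF t] Phi_Mor_simps(1,2)[OF u]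
  note [simp] = s t u st tu I
  note ts = Phi_Cmp[OF s t st] and ut = Phi_Cmp[OF t u tu]
  have tsu: "tgt (t \<cdot>\<^bsub>\<Phi>\<^esub> s) = src u" and sut: "tgt s = src (u \<cdot>\<^bsub>\<Phi>\<^esub> t)" using ts ut by simp_all
  note uts = Phi_Cmp[OF ts(1) u tsu] and uts' = Phi_Cmp[OF s ut(1) sut]
  define b where "b = Ta A (src s) (src t) \<cdot> sect A s"
  define c where "c = Ta A (src t) (src u) \<cdot> sect A t"
  have bm [simp]: "b \<in> Mor C" "src b = PO A (src s)" "tgt b = PO A (src t)"
    and cm [simp]: "c \<in> Mor C" "src c = PO A (src t)" "tgt c = PO A (src u)" by (simp_all add: b_def c_def)
  define w where "w = \<rho> (sect A u \<cdot> (c \<cdot> b))"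
  have w: "w \<in> rid C (PO A (src s))" by (simp add: w_def)
  note [simp] = rid_mor(1-4)[OF w]
  have cb: "c \<cdot> b = Ta A (src t) (src u) \<cdot> (sect A t \<cdot> b)" by (simp add: c_def)
  have w1: "\<rho> (sect A t \<cdot> b) \<cdot> w = w" unfolding w_def cb
    using rst_cmp_absorb'[of "sect A t \<cdot> b" "sect A u \<cdot> Ta A (src t) (src u)"] by simp
  have w2: "\<rho> b \<cdot> w = w" unfolding w_def using rst_cmp_absorb'[of b "sect A u \<cdot> c"] by simp
  have w3: "\<rho> (sect A u \<cdot> c) \<cdot> b = b \<cdot> w" unfolding w_def using rst_shift[of b "sect A u \<cdot> c"] by simp
  have k1: "composable (src s) (src t) (src u) (sect A t \<cdot> b) (sect A s \<cdot> \<rho> (sect A t \<cdot> b))"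
    using Phi_composable[OF s t st] by (simp add: b_def)
  have k2: "composable (src t) (src u) (tgt u) (sect A u \<cdot> c) (sect A t \<cdot> \<rho> (sect A u \<cdot> c))"
    using Phi_composable[OF t u tu] by (simp add: c_def)
  have k1': "composable (src s) (src t) (src u) (sect A t \<cdot> (b \<cdot> w)) (sect A s \<cdot> w)"
    using composable_cmp[OF k1, of w] by (simp add: w1)
  have k2': "composable (src t) (src u) (tgt u) (sect A u \<cdot> (c \<cdot> b)) (sect A t \<cdot> (b \<cdot> w))"
    using composable_cmp[OF k2, of b] w3 by simp
  have L: "sect A (u \<cdot>\<^bsub>\<Phi>\<^esub> (t \<cdot>\<^bsub>\<Phi>\<^esub> s)) =
    mul C A (src s) (src u) (tgt u) (sect A u \<cdot> (c \<cdot> b))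
      (mul C A (src s) (src t) (src u) (sect A t \<cdot> (b \<cdot> w)) (sect A s \<cdot> w))"
  proof -
    have "Ta A (src s) (src u) \<cdot> sect A (t \<cdot>\<^bsub>\<Phi>\<^esub> s) = c \<cdot> b" using ts(6) cb by (simp add: b_def)
    then have "sect A (u \<cdot>\<^bsub>\<Phi>\<^esub> (t \<cdot>\<^bsub>\<Phi>\<^esub> s)) = mul C A (src s) (src u) (tgt u) (sect A u \<cdot> (c \<cdot> b))
      (sect A (t \<cdot>\<^bsub>\<Phi>\<^esub> s) \<cdot> w)" using uts(4) ts by (simp add: w_def)
    also have "sect A (t \<cdot>\<^bsub>\<Phi>\<^esub> s) \<cdot> w = mul C A (src s) (src t) (src u) (sect A t \<cdot> (b \<cdot> w)) (sect A s \<cdot> w)"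
      using ts(4) mul_cmp[OF _ _ _ k1, of w] by (simp add: b_def[symmetric] w1)
    finally show ?thesis .
  qed
  have R: "sect A (u \<cdot>\<^bsub>\<Phi>\<^esub> t \<cdot>\<^bsub>\<Phi>\<^esub> s) =
    mul C A (src s) (src t) (tgt u) (mul C A (src t) (src u) (tgt u) (sect A u \<cdot> (c \<cdot> b)) (sect A t \<cdot> (b \<cdot> w)))
      (sect A s \<cdot> w)"
  proof -
    have "sect A (u \<cdot>\<^bsub>\<Phi>\<^esub> t) \<cdot> b = mul C A (src t) (src u) (tgt u) (sect A u \<cdot> (c \<cdot> b)) (sect A t \<cdot> (b \<cdot> w))"
      using ut(4) mul_cmp[OF _ _ _ k2, of b] w3 by (simp add: c_def[symmetric])
    moreover have "\<rho> (sect A (u \<cdot>\<^bsub>\<Phi>\<^esub> t) \<cdot> b) = w"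
    proof -
      have "\<rho> (sect A (u \<cdot>\<^bsub>\<Phi>\<^esub> t) \<cdot> b) = \<rho> (sect A u \<cdot> c \<cdot> b)"
        by (rule rst_cmp_eq) (use ut(1,2,3,5) in \<open>simp_all add: c_def\<close>)
      then show ?thesis by (simp add: w_def)
    qed
    ultimately show ?thesis using uts'(4) ut by (simp add: b_def[symmetric])
  qed
  show ?thesis
    by (rule sect_eqI[of _ _ A]) (use uts uts' ts ut L R mul_assoc[OF _ _ _ _ k1' k2'] in simp_all)
qed

lemma Phi_category: "category \<Phi>"
proof
  show "src f \<in> Obj \<Phi>" "tgt f \<in> Obj \<Phi>" if "f \<in> Mor \<Phi>" for f using that by simp_all
  show "Idn \<Phi> X \<in> hom \<Phi> X X" if "X \<in> Obj \<Phi>" for X using Phi_Idn[of X] that by simp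
  show "g \<cdot>\<^bsub>\<Phi>\<^esub> f \<in> hom \<Phi> X Z" if "f \<in> hom \<Phi> X Y" "g \<in> hom \<Phi> Y Z" for f g X Y Z
    using that Phi_Cmp[of f g] by simp
  show "h \<cdot>\<^bsub>\<Phi>\<^esub> g \<cdot>\<^bsub>\<Phi>\<^esub> f = h \<cdot>\<^bsub>\<Phi>\<^esub> (g \<cdot>\<^bsub>\<Phi>\<^esub> f)" if "f \<in> hom \<Phi> W X" "g \<in> hom \<Phi> X Y" "h \<in> hom \<Phi> Y Z" for f g h W X Y Z
    using that by (intro Phi_assoc) auto
  fix f X Y assume f: "f \<in> hom \<Phi> X Y"
  \<comment> \<open>Identities are the idempotents attached to identities of \<open>C\<close>, so
    the unit laws become instances of \<open>Phi_cmp_rid\<close> and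
    \<open>Phi_rid_cmp\<close>.\<close>
  have idn: "Idn \<Phi> i = Phi_rid i (Idn C (PO A i))" if "i \<in> Ix A" for i
    by (rule sect_eqI[of _ _ A]) (use that Phi_Idn[of i] Phi_rid[of i "Idn C (PO A i)"] in simp_all)
  have I: "X \<in> Ix A" "Y \<in> Ix A" using f by auto
  show "f \<cdot>\<^bsub>\<Phi>\<^esub> Idn \<Phi> X = f"
    by (rule sect_eqI[of _ _ A])
      (use f I Phi_Idn[of X] Phi_Cmp[of "Idn \<Phi> X" f] Phi_cmp_rid[of f "Idn C (PO A X)"] idn[of X] in auto)
  have "\<rho> (Ta A X Y \<cdot> sect A f) = \<rho> (sect A f)" using f I by auto
  then show "Idn \<Phi> Y \<cdot>\<^bsub>\<Phi>\<^esub> f = f"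
    by (intro sect_eqI[of _ _ A])
      (use f I Phi_Idn[of Y] Phi_Cmp[of f "Idn \<Phi> Y"] Phi_rid_cmp[of f "Idn C (PO A Y)"] idn[of Y] in auto)
qed

text \<open>Precomposing with a restriction acts on underlying sections as in \<open>C\<close>, and
  postcomposing with one restricts to an inverse image along the target map
  (\<open>Phi_rid_cmp\<close>); the axioms reduce to those of \<open>C\<close>.\<close>

lemma Phi_restriction_category: "restriction_category \<Phi>"
proof -
  interpret \<Phi>: category \<Phi> by (rule Phi_category)
  have rst: "\<rho>\<^bsub>\<Phi>\<^esub> s \<in> Mor \<Phi>" "src (\<rho>\<^bsub>\<Phi>\<^esub> s) = src s" "tgt (\<rho>\<^bsub>\<Phi>\<^esub> s) = src s"
    "sect A (\<rho>\<^bsub>\<Phi>\<^esub> s) = Et A (src s) \<cdot> \<rho> (sect A s)" if "s \<in> Mor \<Phi>" for s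
    using Phi_rid[of "src s" "\<rho> (sect A s)"] that by (simp_all add: Phi_Rst)
  have cr: "sect A (s \<cdot>\<^bsub>\<Phi>\<^esub> \<rho>\<^bsub>\<Phi>\<^esub> t) = sect A s \<cdot> \<rho> (sect A t)"
    if "s \<in> Mor \<Phi>" "t \<in> Mor \<Phi>" "src s = src t" for s t
    using that Phi_cmp_rid[of s "\<rho> (sect A t)"] by (simp add: Phi_Rst)
  show ?thesis
  proof
    fix f X Y assume f: "f \<in> hom \<Phi> X Y"
    then show "\<rho>\<^bsub>\<Phi>\<^esub> f \<in> hom \<Phi> X X" using rst by simp
    show "f \<cdot>\<^bsub>\<Phi>\<^esub> \<rho>\<^bsub>\<Phi>\<^esub> f = f"
      by (rule sect_eqI[of _ _ A]) (use f rst[of f] cr[of f f] in auto)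
    fix g Z assume g: "g \<in> hom \<Phi> X Z"
    show "\<rho>\<^bsub>\<Phi>\<^esub> f \<cdot>\<^bsub>\<Phi>\<^esub> \<rho>\<^bsub>\<Phi>\<^esub> g = \<rho>\<^bsub>\<Phi>\<^esub> g \<cdot>\<^bsub>\<Phi>\<^esub> \<rho>\<^bsub>\<Phi>\<^esub> f"
      by (rule sect_eqI[of _ _ A])
        (use f g rst[of f] rst[of g] cr[of "\<rho>\<^bsub>\<Phi>\<^esub> f" g] cr[of "\<rho>\<^bsub>\<Phi>\<^esub> g" f] rst_comm[of "sect A f" "sect A g"] in auto)
    have gf: "g \<cdot>\<^bsub>\<Phi>\<^esub> \<rho>\<^bsub>\<Phi>\<^esub> f \<in> Mor \<Phi>" using f g rst[of f] by simp
    show "\<rho>\<^bsub>\<Phi>\<^esub> (g \<cdot>\<^bsub>\<Phi>\<^esub> \<rho>\<^bsub>\<Phi>\<^esub> f) = \<rho>\<^bsub>\<Phi>\<^esub> g \<cdot>\<^bsub>\<Phi>\<^esub> \<rho>\<^bsub>\<Phi>\<^esub> f"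
      by (rule sect_eqI[of _ _ A])
        (use f g rst[of f] rst[of g] rst[OF gf] cr[of g f] cr[of "\<rho>\<^bsub>\<Phi>\<^esub> g" f] in auto)
  next
    fix f g X Y Z assume f: "f \<in> hom \<Phi> X Y" and g: "g \<in> hom \<Phi> Y Z"
    note [simp] = rst[of f] rst[of g]
    have I: "X \<in> Ix A" "Y \<in> Ix A" "Z \<in> Ix A" using f g by auto
    have gf: "g \<cdot>\<^bsub>\<Phi>\<^esub> f \<in> Mor \<Phi>" "src (g \<cdot>\<^bsub>\<Phi>\<^esub> f) = X"
      "\<rho> (sect A (g \<cdot>\<^bsub>\<Phi>\<^esub> f)) = \<rho> (sect A g \<cdot> (Ta A X Y \<cdot> sect A f))"
      using f g Phi_Cmp[of f g] by auto
    have "sect A (\<rho>\<^bsub>\<Phi>\<^esub> g \<cdot>\<^bsub>\<Phi>\<^esub> f) = sect A f \<cdot> \<rho> (\<rho> (sect A g) \<cdot> (Ta A X Y \<cdot> sect A f))"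
      using Phi_rid_cmp[of f "\<rho> (sect A g)"] f g by (auto simp: Phi_Rst)
    also have "\<dots> = sect A f \<cdot> \<rho> (sect A (g \<cdot>\<^bsub>\<Phi>\<^esub> f))" using gf f g I by auto
    also have "\<dots> = sect A (f \<cdot>\<^bsub>\<Phi>\<^esub> \<rho>\<^bsub>\<Phi>\<^esub> (g \<cdot>\<^bsub>\<Phi>\<^esub> f))" using cr[of f "g \<cdot>\<^bsub>\<Phi>\<^esub> f"] gf f by auto
    finally show "\<rho>\<^bsub>\<Phi>\<^esub> g \<cdot>\<^bsub>\<Phi>\<^esub> f = f \<cdot>\<^bsub>\<Phi>\<^esub> \<rho>\<^bsub>\<Phi>\<^esub> (g \<cdot>\<^bsub>\<Phi>\<^esub> f)"
      by (rule sect_eqI[of _ _ A, rotated 2]) (use f g gf rst[of "g \<cdot>\<^bsub>\<Phi>\<^esub> f"] in auto)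
  qed
qed

lemma Phi_Rst_simps:
  assumes "s \<in> Mor \<Phi>"
  shows "\<rho>\<^bsub>\<Phi>\<^esub> s \<in> Mor \<Phi>" "src (\<rho>\<^bsub>\<Phi>\<^esub> s) = src s" "tgt (\<rho>\<^bsub>\<Phi>\<^esub> s) = src s"
    "sect A (\<rho>\<^bsub>\<Phi>\<^esub> s) = Et A (src s) \<cdot> \<rho> (sect A s)"
  using Phi_rid[of "src s" "\<rho> (sect A s)"] assms by (simp_all add: Phi_Rst)

lemma Phi_Cmp_Rst:
  assumes "s \<in> Mor \<Phi>" "t \<in> Mor \<Phi>" "src s = src t"
  shows "sect A (s \<cdot>\<^bsub>\<Phi>\<^esub> \<rho>\<^bsub>\<Phi>\<^esub> t) = sect A s \<cdot> \<rho> (sect A t)"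
  using assms Phi_cmp_rid[of s "\<rho> (sect A t)"] by (simp add: Phi_Rst)

lemma Phi_rle:
  assumes "s \<in> hom \<Phi> i j" "t \<in> hom \<Phi> i j"
  shows "rle \<Phi> s t \<longleftrightarrow> rle C (sect A s) (sect A t)"
proof -
  have "s = t \<cdot>\<^bsub>\<Phi>\<^esub> \<rho>\<^bsub>\<Phi>\<^esub> s \<longleftrightarrow> sect A s = sect A (t \<cdot>\<^bsub>\<Phi>\<^esub> \<rho>\<^bsub>\<Phi>\<^esub> s)"
    using sect_eqI[of s "t \<cdot>\<^bsub>\<Phi>\<^esub> \<rho>\<^bsub>\<Phi>\<^esub> s" A] Phi_Cmp(2,3)[of "\<rho>\<^bsub>\<Phi>\<^esub> s" t] Phi_Rst_simps[of s] assms
    by (metis in_hom)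
  then show ?thesis using Phi_Cmp_Rst[of t s] assms by (simp add: rle_def)
qed

lemma Phi_proj_simps [simp]:
  "FO (Phi_proj C A) i = PO A i"
  "FA (Phi_proj C A) s = Ta A (src s) (tgt s) \<cdot> sect A s"
  by (simp_all add: Phi_proj_def)

lemma Phi_proj_restriction_functor: "restriction_functor \<Phi> C (Phi_proj C A)"
  unfolding restriction_functor_def is_functor_def
proof (intro conjI ballI impI)
  show "category \<Phi>" by (rule Phi_category)
  show "category C" by unfold_locales
  show "FA (Phi_proj C A) (\<rho>\<^bsub>\<Phi>\<^esub> f) = \<rho> (FA (Phi_proj C A) f)" if "f \<in> Mor \<Phi>" for f
    using that Phi_Rst_simps[OF that] by simp
  show "FA (Phi_proj C A) (g \<cdot>\<^bsub>\<Phi>\<^esub> f) = FA (Phi_proj C A) g \<cdot> FA (Phi_proj C A) f"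
    if "f \<in> Mor \<Phi>" "g \<in> Mor \<Phi>" "tgt f = src g" for f g
    using that Phi_Cmp[OF that] by simp
qed (use Phi_Idn ta_et in auto)

text \<open>A restriction idempotent of \<open>\<Phi> A\<close> has as underlying section
  \<open>Et A i\<close> restricted to an idempotent of \<open>C\<close>, and the target map undoes
  \<open>Et A i\<close>; so \<open>Phi_rid i\<close> is the inverse.\<close>

lemma Phi_hyperconnected: "hyperconnected \<Phi> C (Phi_proj C A)"
  unfolding hyperconnected_def
proof (intro conjI ballI)
  show "restriction_functor \<Phi> C (Phi_proj C A)" by (rule Phi_proj_restriction_functor)
  interpret \<Phi>: restriction_category \<Phi> by (rule Phi_restriction_category)
  fix i assume "i \<in> Obj \<Phi>"
  then have i: "i \<in> Ix A" by simp
  show "bij_betw (FA (Phi_proj C A)) (rid \<Phi> i) (rid C (FO (Phi_proj C A) i))"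
  proof (rule bij_betw_byWitness[where f' = "Phi_rid i"])
    show "\<forall>e\<in>rid \<Phi> i. Phi_rid i (FA (Phi_proj C A) e) = e"
    proof
      fix e assume "e \<in> rid \<Phi> i"
      then have e: "e \<in> Mor \<Phi>" "src e = i" "tgt e = i" "\<rho>\<^bsub>\<Phi>\<^esub> e = e" by (auto simp: \<Phi>.rid_iff)
      have "FA (Phi_proj C A) e = Ta A i i \<cdot> (Et A i \<cdot> \<rho> (sect A e))"
        using Phi_Rst_simps(4)[OF e(1)] e(2-4) by (simp only: Phi_proj_simps)
      then have "FA (Phi_proj C A) e = \<rho> (sect A e)" using e(1-3) i by simp
      then show "Phi_rid i (FA (Phi_proj C A) e) = e" using e by (simp add: Phi_Rst)
    qed
    show "\<forall>d\<in>rid C (FO (Phi_proj C A) i). FA (Phi_proj C A) (Phi_rid i d) = d"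
      using i Phi_rid[of i] by (auto simp: rid_iff)
    show "FA (Phi_proj C A) ` rid \<Phi> i \<subseteq> rid C (FO (Phi_proj C A) i)"
    proof safe
      fix e assume "e \<in> rid \<Phi> i"
      then have e: "e \<in> Mor \<Phi>" "src e = i" "tgt e = i" "\<rho>\<^bsub>\<Phi>\<^esub> e = e" by (auto simp: \<Phi>.rid_iff)
      have "FA (Phi_proj C A) e = Ta A i i \<cdot> (Et A i \<cdot> \<rho> (sect A e))"
        using Phi_Rst_simps(4)[OF e(1)] e(2-4) by (simp only: Phi_proj_simps)
      then have "FA (Phi_proj C A) e = \<rho> (sect A e)" using e(1-3) i by simp
      then show "FA (Phi_proj C A) e \<in> rid C (FO (Phi_proj C A) i)" using e i by simp
    qed
    show "Phi_rid i ` rid C (FO (Phi_proj C A) i) \<subseteq> rid \<Phi> i"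
    proof safe
      fix d assume "d \<in> rid C (FO (Phi_proj C A) i)"
      then have d: "d \<in> rid C (PO A i)" by simp
      then have "\<rho>\<^bsub>\<Phi>\<^esub> (Phi_rid i d) = Phi_rid i d"
        using Phi_rid[OF i d] i rid_mor[OF d] by (simp add: Phi_Rst)
      then show "Phi_rid i d \<in> rid \<Phi> i" using Phi_rid[OF i d] by (simp add: \<Phi>.rid_iff)
    qed
  qed
qed

end

text \<open>A join in \<open>C\<close> of partial sections is again one, by a local check, and gives
  the join in \<open>\<Phi> A\<close>. Composition there involves \<open>Mu\<close>, so its
  preservation of joins is not an instance of precomposition in \<open>C\<close>; by
  \<open>joinI\<close> it is enough to compare domains, and these are inverse images along the
  target of \<open>g\<close>.\<close>

lemma Phi_join_restriction_category:
  fixes C :: "('o, 'u) rcat" (structure)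
  assumes "join_restriction_category C" "partite C A"
  shows "join_restriction_category (Phi_cat C A)"
proof -
  interpret join_restriction_category C by fact
  interpret partite C A by fact
  interpret \<Phi>: restriction_category \<Phi> by (rule Phi_restriction_category)
  have joinI': "is_join \<Phi> i j S f" if S: "S \<subseteq> hom \<Phi> i j" and f: "f \<in> hom \<Phi> i j"
    and J: "is_join C (PO A i) (PA A i j) (sect A ` S) (sect A f)" for i j S f
    unfolding is_join_def
  proof (intro conjI ballI impI)
    show "rle \<Phi> s f" if "s \<in> S" for s
      using Phi_rle[of s i j f] S f that J by (auto simp: is_join_def)
    show "rle \<Phi> f g" if g: "g \<in> hom \<Phi> i j" "\<forall>s\<in>S. rle \<Phi> s g" for g
    proof -
      have "\<forall>s\<in>S. rle C (sect A s) (sect A g)" using Phi_rle[OF _ g(1)] S g(2) by blast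
      then have "rle C (sect A f) (sect A g)" using J g(1) by (auto simp: is_join_def)
      then show ?thesis using Phi_rle[OF f g(1)] by simp
    qed
  qed (use f in auto)
  have ex: "\<exists>f. f \<in> hom \<Phi> i j \<and> is_join C (PO A i) (PA A i j) (sect A ` S) (sect A f)"
    if ij: "i \<in> Ix A" "j \<in> Ix A" and S: "S \<subseteq> hom \<Phi> i j"
      and cp: "\<forall>s\<in>S. \<forall>t\<in>S. compat C (sect A s) (sect A t)" for i j S
  proof -
    have sS: "sect A ` S \<subseteq> hom C (PO A i) (PA A i j)" using S by auto
    obtain J where J: "is_join C (PO A i) (PA A i j) (sect A ` S) J"
      using join_exists[OF _ _ sS] cp ij by auto
    then have Jm: "J \<in> hom C (PO A i) (PA A i j)" by (simp add: is_join_def)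
    have "Sg A i j \<cdot> J = \<rho> J"
    proof (rule join_eq_local[OF _ join_rst[OF sS J]])
      show "\<rho> ` sect A ` S \<subseteq> rid C (PO A i)" using sS by auto
      fix e assume "e \<in> \<rho> ` sect A ` S"
      then obtain s where s: "s \<in> S" "e = \<rho> (sect A s)" by blast
      have sm: "s \<in> Mor \<Phi>" "src s = i" "tgt s = j" using S s by auto
      have le: "rle C (sect A s) J" using J s by (auto simp: is_join_def)
      have "J \<cdot> \<rho> (sect A s) = sect A s" using le by (simp add: rle_def)
      moreover have "\<rho> J \<cdot> \<rho> (sect A s) = \<rho> (sect A s)" by (rule rle_rst[OF le]) (use Jm sm in auto)
      ultimately show "Sg A i j \<cdot> J \<cdot> e = \<rho> J \<cdot> e" using s sm ij Jm by auto
    qed (use Jm ij in auto)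
    from Phi_MorI[OF ij Jm this] J show ?thesis
      by (intro exI[of _ "Arw i (lbl J) j"]) auto
  qed
  show ?thesis
  proof
    fix i j S assume ij: "i \<in> Obj \<Phi>" "j \<in> Obj \<Phi>" and S: "S \<subseteq> hom \<Phi> i j" and cp: "\<forall>s\<in>S. \<forall>t\<in>S. compat \<Phi> s t"
    have "\<forall>s\<in>S. \<forall>t\<in>S. compat C (sect A s) (sect A t)"
    proof (intro ballI)
      fix s t assume st: "s \<in> S" "t \<in> S"
      then have "sect A (s \<cdot>\<^bsub>\<Phi>\<^esub> \<rho>\<^bsub>\<Phi>\<^esub> t) = sect A (t \<cdot>\<^bsub>\<Phi>\<^esub> \<rho>\<^bsub>\<Phi>\<^esub> s)" using cp by (simp add: compat_def)
      then show "compat C (sect A s) (sect A t)"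
        using Phi_Cmp_Rst[of s t] Phi_Cmp_Rst[of t s] subsetD[OF S st(1)] subsetD[OF S st(2)]
        by (simp add: compat_def)
    qed
    from ex[OF _ _ S this] ij joinI'[OF S] show "\<exists>f. is_join \<Phi> i j S f" by auto
  next
    fix S i j f g h assume S: "S \<subseteq> hom \<Phi> i j" and f: "is_join \<Phi> i j S f" and g: "g \<in> hom \<Phi> h i"
    have fm: "f \<in> hom \<Phi> i j" and le: "\<And>s. s \<in> S \<Longrightarrow> rle \<Phi> s f" using f by (auto simp: is_join_def)
    have ij: "i \<in> Ix A" "j \<in> Ix A" "h \<in> Ix A" using fm g by auto
    have leC: "rle C (sect A s) (sect A f)" if "s \<in> S" for s
      using Phi_rle[of s i j f] le[OF that] S fm that by blast
    have sm: "s \<in> Mor \<Phi>" "src s = i" "tgt s = j" if "s \<in> S" for s using S that by auto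
    have "compat C (sect A s) (sect A t)" if "s \<in> S" "t \<in> S" for s t
    proof -
      have "sect A s = sect A f \<cdot> \<rho> (sect A s)" "sect A t = sect A f \<cdot> \<rho> (sect A t)"
        using leC that by (auto simp: rle_def)
      moreover have "sect A f \<cdot> \<rho> (sect A s) \<cdot> \<rho> (sect A t) = sect A f \<cdot> \<rho> (sect A t) \<cdot> \<rho> (sect A s)"
        using sm[OF that(1)] sm[OF that(2)] fm rst_comm[of "sect A s" "sect A t"] by auto
      ultimately show ?thesis by (simp add: compat_def)
    qed
    then obtain f' where f': "f' \<in> hom \<Phi> i j" "is_join C (PO A i) (PA A i j) (sect A ` S) (sect A f')"
      using ex[OF ij(1,2) S] by blast
    then have "f' = f" using \<Phi>.join_unique[OF joinI'[OF S f'] f] by simp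
    then have fJ: "is_join C (PO A i) (PA A i j) (sect A ` S) (sect A f)" using f' by simp
    have sS: "sect A ` S \<subseteq> hom C (PO A i) (PA A i j)" using S by auto
    let ?b = "Ta A h i \<cdot> sect A g"
    have b: "?b \<in> hom C (PO A h) (PO A i)" using g ij by auto
    have sg: "s \<cdot>\<^bsub>\<Phi>\<^esub> g \<in> hom \<Phi> h j" "\<rho> (sect A (s \<cdot>\<^bsub>\<Phi>\<^esub> g)) = \<rho> (\<rho> (sect A s) \<cdot> ?b)"
      if "s \<in> hom \<Phi> i j" for s
      using Phi_Cmp[of g s] g that b by auto
    show "is_join \<Phi> h j ((\<lambda>s. s \<cdot>\<^bsub>\<Phi>\<^esub> g) ` S) (f \<cdot>\<^bsub>\<Phi>\<^esub> g)"
    proof (rule joinI')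
      show S': "(\<lambda>s. s \<cdot>\<^bsub>\<Phi>\<^esub> g) ` S \<subseteq> hom \<Phi> h j" using sg S by blast
      show "f \<cdot>\<^bsub>\<Phi>\<^esub> g \<in> hom \<Phi> h j" using sg fm by blast
      show "is_join C (PO A h) (PA A h j) (sect A ` (\<lambda>s. s \<cdot>\<^bsub>\<Phi>\<^esub> g) ` S) (sect A (f \<cdot>\<^bsub>\<Phi>\<^esub> g))"
      proof (rule joinI)
        show "sect A ` (\<lambda>s. s \<cdot>\<^bsub>\<Phi>\<^esub> g) ` S \<subseteq> hom C (PO A h) (PA A h j)" using S' by auto
        show "sect A (f \<cdot>\<^bsub>\<Phi>\<^esub> g) \<in> hom C (PO A h) (PA A h j)" using sg(1)[OF fm] by auto
        fix x assume "x \<in> sect A ` (\<lambda>s. s \<cdot>\<^bsub>\<Phi>\<^esub> g) ` S"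
        then obtain s where s: "s \<in> S" "x = sect A (s \<cdot>\<^bsub>\<Phi>\<^esub> g)" by blast
        have "rle \<Phi> (s \<cdot>\<^bsub>\<Phi>\<^esub> g) (f \<cdot>\<^bsub>\<Phi>\<^esub> g)"
          by (rule \<Phi>.rle_cmp[OF le[OF s(1)]]) (use sm[OF s(1)] fm g in auto)
        then show "rle C x (sect A (f \<cdot>\<^bsub>\<Phi>\<^esub> g))"
          using Phi_rle[OF sg(1) sg(1)[OF fm], of s] s S by blast
      next
        have "is_join C (PO A h) (PO A h) ((\<lambda>e. \<rho> (e \<cdot> ?b)) ` \<rho> ` sect A ` S) (\<rho> (\<rho> (sect A f) \<cdot> ?b))"
          by (rule cover_precomp[OF _ join_rst[OF sS fJ] b]) (use sS in auto)
        moreover have "(\<lambda>e. \<rho> (e \<cdot> ?b)) ` \<rho> ` sect A ` S = \<rho> ` sect A ` (\<lambda>s. s \<cdot>\<^bsub>\<Phi>\<^esub> g) ` S"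
          unfolding image_image using sg(2) S by (intro image_cong) auto
        ultimately show "is_join C (PO A h) (PO A h) (\<rho> ` sect A ` (\<lambda>s. s \<cdot>\<^bsub>\<Phi>\<^esub> g) ` S) (\<rho> (sect A (f \<cdot>\<^bsub>\<Phi>\<^esub> g)))"
          using sg(2)[OF fm] by simp
      qed
    qed
  qed
qed

text \<open>Smallness holds because \<open>sect\<close> embeds each hom-set into a hom-set of the
  locally small \<open>C\<close>.\<close>

lemma Phi_over_obj:
  fixes C :: "('o, 'u) rcat" (structure)
  assumes "partite C A" "locally_small C"
  shows "over_obj C (Phi_cat C A, Phi_proj C A)"
proof -
  interpret partite C A by fact
  have "hom \<Phi> i j \<prec> (UNIV :: 'u set)" if ij: "i \<in> Ix A" "j \<in> Ix A" for i j
  proof -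
    have "inj_on (sect A) (hom \<Phi> i j)" by (rule inj_onI) (auto intro: sect_eqI)
    moreover have "sect A ` hom \<Phi> i j \<subseteq> hom C (PO A i) (PA A i j)" by auto
    ultimately have "hom \<Phi> i j \<lesssim> hom C (PO A i) (PA A i j)" unfolding lepoll_def by blast
    moreover have "hom C (PO A i) (PA A i j) \<prec> (UNIV :: 'u set)"
      using assms(2) ij by (simp add: locally_small_def)
    ultimately show ?thesis by (rule lesspoll_trans1)
  qed
  then show ?thesis
    using Phi_restriction_category Phi_proj_restriction_functor ix_small
    by (simp add: over_obj_def locally_small_def)
qed

section \<open>The action of \<Phi> on cofunctors\<close>

context cofunctor
begin

definition Phi_arr where
  "Phi_arr s = Arw (CI F (src s))
     (lbl (act C A F (src s) (tgt s) (sect A s \<cdot> CO F (src s)) (\<rho> (sect A s \<cdot> CO F (src s)))))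
     (CI F (tgt s))"

lemma Phi_map_simps [simp]:
  "fst (Phi_map C A F) = res_functr (Phi_cat C A) \<lparr>FO = CI F, FA = Phi_arr\<rparr>"
  "snd (Phi_map C A F) = restrict (CO F) (Ix A)"
  by (simp_all add: Phi_map_def Phi_arr_def[abs_def] Let_def pb_lift_def act_def)

lemma Phi_actable:
  assumes s: "s \<in> Mor dom.\<Phi>"
  shows "actable (src s) (tgt s) (sect A s \<cdot> CO F (src s)) (\<rho> (sect A s \<cdot> CO F (src s)))"
  using lift_square[OF pullback, of "src s" "tgt s" "sect A s"] s by (simp add: actable_def)

lemma Phi_arr:
  assumes s: "s \<in> Mor dom.\<Phi>"
  shows "Phi_arr s \<in> Mor cod.\<Phi>" "src (Phi_arr s) = CI F (src s)" "tgt (Phi_arr s) = CI F (tgt s)"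
    "sect B (Phi_arr s) = act C A F (src s) (tgt s) (sect A s \<cdot> CO F (src s)) (\<rho> (sect A s \<cdot> CO F (src s)))"
    "\<rho> (sect B (Phi_arr s)) = \<rho> (sect A s \<cdot> CO F (src s))"
    "CO F (tgt s) \<cdot> (Ta B (CI F (src s)) (CI F (tgt s)) \<cdot> sect B (Phi_arr s))
      = Ta A (src s) (tgt s) \<cdot> (sect A s \<cdot> CO F (src s))"
proof -
  have I: "src s \<in> Ix A" "tgt s \<in> Ix A" using s by simp_all
  note a = act[OF I Phi_actable[OF s]]
  let ?x = "act C A F (src s) (tgt s) (sect A s \<cdot> CO F (src s)) (\<rho> (sect A s \<cdot> CO F (src s)))"
  have x: "?x \<in> hom C (PO B (CI F (src s))) (PA B (CI F (src s)) (CI F (tgt s)))"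
    "Sg B (CI F (src s)) (CI F (tgt s)) \<cdot> ?x = \<rho> ?x" using a s I by simp_all
  note p = cod.Phi_MorI[OF ci[OF I(1)] ci[OF I(2)] x]
  show "Phi_arr s \<in> Mor cod.\<Phi>" "src (Phi_arr s) = CI F (src s)" "tgt (Phi_arr s) = CI F (tgt s)"
    "sect B (Phi_arr s) = ?x" "\<rho> (sect B (Phi_arr s)) = \<rho> (sect A s \<cdot> CO F (src s))"
    "CO F (tgt s) \<cdot> (Ta B (CI F (src s)) (CI F (tgt s)) \<cdot> sect B (Phi_arr s))
      = Ta A (src s) (tgt s) \<cdot> (sect A s \<cdot> CO F (src s))"
    using p a s I unfolding Phi_arr_def by simp_all
qed

text \<open>Everything is cut down to \<open>b\<close>, the domain of the composite pulled back
  along \<open>CO F\<close>; there \<open>act_mul\<close> turns the action of a composite into the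
  composite of actions.\<close>

lemma Phi_arr_cmp:
  assumes s: "s \<in> Mor dom.\<Phi>" and t: "t \<in> Mor dom.\<Phi>" and st: "tgt s = src t"
  shows "Phi_arr (t \<cdot>\<^bsub>dom.\<Phi>\<^esub> s) = Phi_arr t \<cdot>\<^bsub>cod.\<Phi>\<^esub> Phi_arr s"
proof -
  note I [simp] = dom.Phi_Mor_simps(1,2)[OF s] dom.Phi_Mor_simps(1,2)[OF t]
  note [simp] = s t st
  note ts = dom.Phi_Cmp[OF s t st]
  note fs = Phi_arr[OF s] and ft = Phi_arr[OF t] and fts = Phi_arr[OF ts(1)]
  note fst = cod.Phi_Cmp[OF fs(1) ft(1)]
  define a0 where "a0 = sect A s \<cdot> CO F (src s)"
  define a' where "a' = sect A t \<cdot> (Ta A (src s) (src t) \<cdot> a0)"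
  define b where "b = \<rho> a'"
  have a0 [simp]: "a0 \<in> Mor C" "src a0 = PO B (CI F (src s))" "tgt a0 = PA A (src s) (src t)" by (simp_all add: a0_def)
  have a' [simp]: "a' \<in> Mor C" "src a' = PO B (CI F (src s))" "tgt a' = PA A (src t) (tgt t)" by (simp_all add: a'_def)
  have b: "b \<in> rid C (PO B (CI F (src s)))" by (simp add: b_def)
  note [simp] = rid_mor(1-4)[OF b]
  have bb: "\<rho> a0 \<cdot> b = b" unfolding b_def a'_def
    using rst_cmp_absorb'[of a0 "sect A t \<cdot> Ta A (src s) (src t)"] by simp
  note ac = Phi_actable[OF s, folded a0_def, simplified st]
  have acb: "actable (src s) (src t) (a0 \<cdot> b) b" using actable_cmp[OF ac, of b] bb by simp
  define x where "x = act C A F (src s) (src t) (a0 \<cdot> b) b"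
  have xs: "sect B (Phi_arr s) \<cdot> b = x"
    using act_cmp[OF _ _ ac, of b] bb fs(4) by (simp add: x_def a0_def[symmetric])
  note k = dom.Phi_composable[OF s t st]
  let ?l = "sect A t \<cdot> (Ta A (src s) (src t) \<cdot> sect A s)"
  have lb: "\<rho> ?l \<cdot> CO F (src s) = CO F (src s) \<cdot> b"
    using rst_shift[of "CO F (src s)" ?l] by (simp add: b_def a'_def a0_def)
  have k': "dom.composable (src s) (src t) (tgt t) a' (a0 \<cdot> b)"
    using dom.composable_cmp[OF k, of "CO F (src s)"] lb by (simp add: a'_def a0_def)
  have "sect A (t \<cdot>\<^bsub>dom.\<Phi>\<^esub> s) \<cdot> CO F (src s) = mul C A (src s) (src t) (tgt t) a' (a0 \<cdot> b)"
    using ts(4) dom.mul_cmp[OF _ _ _ k, of "CO F (src s)"] lb by (simp add: a'_def a0_def)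
  moreover have "\<rho> (mul C A (src s) (src t) (tgt t) a' (a0 \<cdot> b)) = b"
    using dom.mul(6)[OF _ _ _ k'] rst_cmp_rid[OF b, of a0] bb by simp
  ultimately have L: "sect B (Phi_arr (t \<cdot>\<^bsub>dom.\<Phi>\<^esub> s)) =
    mul C B (CI F (src s)) (CI F (src t)) (CI F (tgt t))
      (act C A F (src t) (tgt t) a' (Ta B (CI F (src s)) (CI F (src t)) \<cdot> x)) x"
    using fts(4) ts act_mul[OF _ _ _ acb k'] by (simp add: x_def)
  let ?T = "Ta B (CI F (src s)) (CI F (src t))"
  define y where "y = ?T \<cdot> sect B (Phi_arr s)"
  have y [simp]: "y \<in> Mor C" "src y = PO B (CI F (src s))" "tgt y = PO B (CI F (src t))"
    using fs(1-3) cod.Phi_Mor_simps(3)[OF fs(1)] by (simp_all add: y_def)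
  have ty: "sect A t \<cdot> (CO F (src t) \<cdot> y) = a'" using fs(6) by (simp add: a'_def y_def a0_def)
  note act' = Phi_actable[OF t]
  have ry: "\<rho> (sect A t \<cdot> CO F (src t)) \<cdot> y = y \<cdot> b"
    using rst_shift[of y "sect A t \<cdot> CO F (src t)"] ty by (simp add: b_def)
  have fy: "sect B (Phi_arr t) \<cdot> y = act C A F (src t) (tgt t) a' (y \<cdot> b)"
    using act_cmp[OF _ _ act', of y] ft(4) ty ry by simp
  have "\<rho> (sect B (Phi_arr t) \<cdot> y) = \<rho> (sect A t \<cdot> CO F (src t) \<cdot> y)"
    by (rule rst_cmp_eq) (use ft(1,2,3,5) cod.Phi_Mor_simps(3)[OF ft(1)] in simp_all)
  then have rfy: "\<rho> (sect B (Phi_arr t) \<cdot> y) = b" using ty by (simp add: b_def)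
  have yb: "y \<cdot> b = ?T \<cdot> x" using xs fs(1-3) cod.Phi_Mor_simps(3)[OF fs(1)] by (simp add: y_def)
  have R: "sect B (Phi_arr t \<cdot>\<^bsub>cod.\<Phi>\<^esub> Phi_arr s) =
    mul C B (CI F (src s)) (CI F (src t)) (CI F (tgt t))
      (act C A F (src t) (tgt t) a' (?T \<cdot> x)) x"
    using fst(4) fs(2,3) ft(2,3) fy rfy xs yb by (simp add: y_def[symmetric])
  show ?thesis
    by (rule sect_eqI[of _ _ B]) (use fts(1-3) fst(1-3) ts(2,3) fs(1-3) ft(1-3) L R in simp_all)
qed

lemma Phi_over_hom:
  "over_hom C (Phi_cat C A, Phi_proj C A) (Phi_cat C B, Phi_proj C B) (Phi_map C A F)"
proof -
  have m: "Phi_map C A F = (res_functr (Phi_cat C A) \<lparr>FO = CI F, FA = Phi_arr\<rparr>, restrict (CO F) (Ix A))"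
    by (rule prod_eqI) simp_all
  have "restriction_functor dom.\<Phi> cod.\<Phi> \<lparr>FO = CI F, FA = Phi_arr\<rparr>"
    unfolding restriction_functor_def is_functor_def
  proof (intro conjI ballI impI)
    show "category dom.\<Phi>" "category cod.\<Phi>" by (rule dom.Phi_category cod.Phi_category)+
    show "FA \<lparr>FO = CI F, FA = Phi_arr\<rparr> (Idn dom.\<Phi> i) = Idn cod.\<Phi> (FO \<lparr>FO = CI F, FA = Phi_arr\<rparr> i)"
      if "i \<in> Obj dom.\<Phi>" for i
    proof -
      have i [simp]: "i \<in> Ix A" using that by simp
      note d = dom.Phi_Idn[OF i] and c = cod.Phi_Idn[OF ci[OF i]]
      have "sect B (Phi_arr (Idn dom.\<Phi> i)) = Et B (CI F i)"
        using Phi_arr(4)[OF d(1)] d act_unit[OF i, of "Idn C (PO B (CI F i))"]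
          rst_total[of "Et A i \<cdot> CO F i"] by simp
      then have "Phi_arr (Idn dom.\<Phi> i) = Idn cod.\<Phi> (CI F i)"
        by (intro sect_eqI[of _ _ B]) (use Phi_arr[OF d(1)] d c in simp_all)
      then show ?thesis by simp
    qed
    show "FA \<lparr>FO = CI F, FA = Phi_arr\<rparr> (g \<cdot>\<^bsub>dom.\<Phi>\<^esub> f) =
        FA \<lparr>FO = CI F, FA = Phi_arr\<rparr> g \<cdot>\<^bsub>cod.\<Phi>\<^esub> FA \<lparr>FO = CI F, FA = Phi_arr\<rparr> f"
      if "f \<in> Mor dom.\<Phi>" "g \<in> Mor dom.\<Phi>" "tgt f = src g" for f g
      using Phi_arr_cmp[OF that] by simp
    show "FA \<lparr>FO = CI F, FA = Phi_arr\<rparr> (\<rho>\<^bsub>dom.\<Phi>\<^esub> s) = \<rho>\<^bsub>cod.\<Phi>\<^esub> (FA \<lparr>FO = CI F, FA = Phi_arr\<rparr> s)"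
      if s: "s \<in> Mor dom.\<Phi>" for s
    proof -
      have i [simp]: "src s \<in> Ix A" using s by simp
      note r = dom.Phi_Rst_simps[OF s] and fs = Phi_arr[OF s]
      note fr = Phi_arr[OF r(1)] and rf = cod.Phi_Rst_simps[OF fs(1)]
      let ?w = "\<rho> (sect A s \<cdot> CO F (src s))"
      have "\<rho> (sect A s) \<cdot> CO F (src s) = CO F (src s) \<cdot> ?w" using rst_shift[of "CO F (src s)" "sect A s"] s by simp
      then have "sect B (Phi_arr (\<rho>\<^bsub>dom.\<Phi>\<^esub> s)) = Et B (CI F (src s)) \<cdot> ?w"
        using fr(4) r s act_unit[of "src s" ?w] by simp
      then have "Phi_arr (\<rho>\<^bsub>dom.\<Phi>\<^esub> s) = \<rho>\<^bsub>cod.\<Phi>\<^esub> (Phi_arr s)"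
        by (intro sect_eqI[of _ _ B]) (use fr(1-3) rf fs(1-3,5) r in simp_all)
      then show ?thesis by simp
    qed
  qed (use Phi_arr in auto)
  moreover have "nat_trans dom.\<Phi> C (comp_functr (Phi_proj C B) (res_functr dom.\<Phi> \<lparr>FO = CI F, FA = Phi_arr\<rparr>))
    (Phi_proj C A) (restrict (CO F) (Ix A))"
    unfolding nat_trans_def
  proof (intro conjI ballI)
    fix f assume f: "f \<in> Mor dom.\<Phi>"
    show "restrict (CO F) (Ix A) (tgt f) \<cdot>
        FA (comp_functr (Phi_proj C B) (res_functr dom.\<Phi> \<lparr>FO = CI F, FA = Phi_arr\<rparr>)) f =
        FA (Phi_proj C A) f \<cdot> restrict (CO F) (Ix A) (src f)"
      using f Phi_arr(2,3,6)[OF f] by simp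
  qed simp
  ultimately show ?thesis
    by (simp add: m over_hom_def restriction_functor_res dom.Phi_restriction_category)
qed

end

lemma Phi_functor:
  fixes C :: "('o, 'u) rcat" (structure)
  assumes "restriction_category C" "locally_small C"
  shows "is_functor (pCat C) (rCat_over C) (Phi C)"
proof -
  interpret restriction_category C by fact
  have part: "partite C A" if "partite_category C A" for A using that assms by (simp add: partite_def)
  note oo = Phi_over_obj[OF part assms(2)]
  note mor = pCat_mor_iff[OF assms(1)]
  show ?thesis
    unfolding is_functor_def
  proof (intro conjI ballI impI)
    show "category (pCat C)" "category (rCat_over C)"
      using category_pCat category_rCat_over assms by blast+
    show "FO (Phi C) A \<in> Obj (rCat_over C)" if "A \<in> Obj (pCat C)" for A
      using oo that by (simp add: Phi_def)
    show "FA (Phi C) f \<in> hom (rCat_over C) (FO (Phi C) (src f)) (FO (Phi C) (tgt f))"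
      if f: "f \<in> Mor (pCat C)" for f
    proof -
      interpret cofunctor C "src f" "tgt f" "lbl f" using f by (simp add: mor)
      show ?thesis using Phi_over_hom oo dom.partite_category_axioms cod.partite_category_axioms
        by (simp add: Phi_def)
    qed
    show "FA (Phi C) (Idn (pCat C) A) = Idn (rCat_over C) (FO (Phi C) A)" if A: "A \<in> Obj (pCat C)" for A
    proof -
      have pA: "partite C A" using A part by simp
      interpret cofunctor C A A "cofun_id C A" by (rule cofunctor_id[OF pA])
      have eq: "Phi_arr s = s" if s: "s \<in> Mor dom.\<Phi>" for s
      proof -
        have "act C A (cofun_id C A) (src s) (tgt s) (sect A s) (\<rho> (sect A s)) = sect A s"
          using s by (intro act_cofun_id[OF pA]) auto
        then have "sect A (Phi_arr s) = sect A s" using Phi_arr(4)[OF s] s by simp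
        then show ?thesis by (intro sect_eqI[of _ _ A]) (use Phi_arr(2,3)[OF s] s in simp_all)
      qed
      have "fst (Phi_map C A (cofun_id C A)) = fst (over_id C (Phi_cat C A, Phi_proj C A))"
        unfolding Phi_map_simps over_id_def split fst_conv
        by (rule res_functr_eqI[of _ "dom.\<Phi>"]) (simp_all add: eq id_functr_def)
      moreover have "snd (Phi_map C A (cofun_id C A)) = snd (over_id C (Phi_cat C A, Phi_proj C A))"
        by (simp add: over_id_def cong: restrict_cong)
      ultimately have "Phi_map C A (cofun_id C A) = over_id C (Phi_cat C A, Phi_proj C A)"
        by (rule prod_eqI)
      then show ?thesis by (simp add: Phi_def)
    qed
    show "FA (Phi C) (g \<cdot>\<^bsub>pCat C\<^esub> f) = FA (Phi C) g \<cdot>\<^bsub>rCat_over C\<^esub> FA (Phi C) f"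
      if f: "f \<in> Mor (pCat C)" and g: "g \<in> Mor (pCat C)" and fg: "tgt f = src g" for f g
    proof -
      have "cofunctor_pair C (src f) (tgt f) (tgt g) (lbl f) (lbl g)"
        using f g fg assms(1) by (simp add: mor cofunctor_pair_def)
      then interpret cofunctor_pair C "src f" "tgt f" "tgt g" "lbl f" "lbl g" .
      interpret GF: cofunctor C "src f" "tgt g" GF by (rule cofunctor_comp)
      have eq: "GF.Phi_arr s = G.Phi_arr (F.Phi_arr s)" if s: "s \<in> Mor F.dom.\<Phi>" for s
      proof -
        have I [simp]: "src s \<in> Ix (src f)" "tgt s \<in> Ix (src f)" using s by simp_all
        note Fs = F.Phi_arr[OF s] and GFs = GF.Phi_arr[OF s]
        note GFs' = G.Phi_arr[OF Fs(1)]
        let ?g = "CO (lbl g) (CI (lbl f) (src s))"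
        let ?a = "sect (src f) s \<cdot> CO (lbl f) (src s)"
        have "\<rho> ?a \<cdot> ?g = ?g \<cdot> \<rho> (?a \<cdot> ?g)" using rst_shift[of ?g ?a] s by simp
        then have 1: "sect (tgt f) (F.Phi_arr s) \<cdot> ?g
          = act C (src f) (lbl f) (src s) (tgt s) (?a \<cdot> ?g) (?g \<cdot> \<rho> (?a \<cdot> ?g))"
          using F.act_cmp[OF _ _ F.Phi_actable[OF s], of ?g] Fs(4) s by simp
        have "\<rho> (sect (tgt f) (F.Phi_arr s) \<cdot> ?g) = \<rho> (?a \<cdot> ?g)"
          by (rule rst_cmp_eq) (use Fs(1,2,3,5) F.cod.Phi_Mor_simps(3)[OF Fs(1)] s in simp_all)
        then have "sect (tgt g) (G.Phi_arr (F.Phi_arr s)) = act C (tgt f) (lbl g) (CI (lbl f) (src s)) (CI (lbl f) (tgt s))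
           (act C (src f) (lbl f) (src s) (tgt s) (?a \<cdot> ?g) (?g \<cdot> \<rho> (?a \<cdot> ?g))) (\<rho> (?a \<cdot> ?g))"
          using GFs'(4) Fs(2,3) 1 by simp
        also have "\<dots> = act C (src f) GF (src s) (tgt s) (?a \<cdot> ?g) (\<rho> (?a \<cdot> ?g))"
          by (rule act_comp[symmetric]) (use GF.Phi_actable[OF s] s in \<open>auto simp: GF.actable_def\<close>)
        also have "\<dots> = sect (tgt g) (GF.Phi_arr s)" using GFs(4) s by simp
        finally show ?thesis
          by (intro sect_eqI[of _ _ "tgt g"]) (use GFs(2,3) GFs'(2,3) Fs(2,3) in simp_all)
      qed
      have "fst (Phi_map C (src f) GF) = fst (over_comp C (Phi_cat C (src f), Phi_proj C (src f))
         (Phi_map C (tgt f) (lbl g)) (Phi_map C (src f) (lbl f)))"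
        unfolding GF.Phi_map_simps over_comp_def split_beta fst_conv snd_conv F.Phi_map_simps G.Phi_map_simps
        by (rule res_functr_eqI[of _ "F.dom.\<Phi>"]) (simp_all add: F.Phi_arr(1) eq)
      moreover have "snd (Phi_map C (src f) GF) = snd (over_comp C (Phi_cat C (src f), Phi_proj C (src f))
         (Phi_map C (tgt f) (lbl g)) (Phi_map C (src f) (lbl f)))"
        by (simp add: over_comp_def split_beta cong: restrict_cong)
      ultimately have "Phi_map C (src f) GF = over_comp C (Phi_cat C (src f), Phi_proj C (src f))
         (Phi_map C (tgt f) (lbl g)) (Phi_map C (src f) (lbl f))"
        by (rule prod_eqI)
      then show ?thesis using fg by (intro arr.expand) (simp add: Phi_def)
    qed
  qed
qed

section \<open>The functor \<open>\<Psi>\<close>\<close>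

locale glued = join_restriction_category C
  for C :: "('o, 'u) rcat" (structure) +
  assumes small: "locally_small C" and glueings: "has_local_glueings C"

locale glued_over = glued C + A: restriction_category A
  for C :: "('o, 'u) rcat" (structure) and A :: "('u, 'u) rcat" +
  fixes P :: "('u, 'u, 'o, 'u) functr"
  assumes over_obj: "over_obj C (A, P)"
begin

abbreviation cmp_A (infixl \<open>\<star>\<close> 70) where "g \<star> f \<equiv> g \<cdot>\<^bsub>A\<^esub> f"
abbreviation rst_A (\<open>\<rho>\<^sub>A\<close>) where "\<rho>\<^sub>A \<equiv> Rst A"
abbreviation "X \<equiv> (A, P)"

lemma P_functor: "is_functor A C P" and P_rst [simp]: "f \<in> Mor A \<Longrightarrow> FA P (\<rho>\<^sub>A f) = \<rho> (FA P f)"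
  using over_obj by (simp_all add: over_obj_def restriction_functor_def)

lemmas P [simp] = is_functor_simps(1-5)[OF P_functor]

lemma P_cmp [simp]:
  "\<lbrakk>f \<in> Mor A; g \<in> Mor A; tgt f = src g\<rbrakk> \<Longrightarrow> FA P (g \<star> f) = FA P g \<cdot> FA P f"
  using is_functor_simps(6)[OF P_functor] .

lemma P_rid:
  assumes "e \<in> rid A i"
  shows "FA P e \<in> rid C (FO P i)"
proof -
  have "\<rho> (FA P e) = FA P e" using A.rid_mor[OF assms] by (metis P_rst)
  then show ?thesis using A.rid_mor[OF assms] by (simp add: rid_iff)
qed

text \<open>The index set of the join in \<open>eq_ext\<close>, with the order bound written as two
  absorption equations; \<open>agree_eq\<close> identifies the two forms.\<close>

definition agree where
  "agree f g = {e \<in> rid A (src f). \<rho>\<^sub>A f \<star> e = e \<and> \<rho>\<^sub>A g \<star> e = e \<and> f \<star> e = g \<star> e}"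

abbreviation "eqx \<equiv> eq_ext C X"

lemma agree_eq:
  assumes f: "f \<in> hom A i j" and g: "g \<in> hom A i j"
  shows "agree f g = {e \<in> rid A (src f). rle A e (\<rho>\<^sub>A f \<star> \<rho>\<^sub>A g) \<and> f \<star> e = g \<star> e}"
proof -
  have "rle A e (\<rho>\<^sub>A f \<star> \<rho>\<^sub>A g) \<longleftrightarrow> \<rho>\<^sub>A f \<star> e = e \<and> \<rho>\<^sub>A g \<star> e = e" if e: "e \<in> rid A (src f)" for e
  proof -
    note [simp] = A.rid_mor(1-4)[OF e]
    have r: "\<rho>\<^sub>A f \<in> rid A (src f)" "\<rho>\<^sub>A g \<in> rid A (src f)" using f g by auto
    have "rle A e (\<rho>\<^sub>A f \<star> \<rho>\<^sub>A g) \<longleftrightarrow> \<rho>\<^sub>A f \<star> (\<rho>\<^sub>A g \<star> e) = e"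
      using f g A.rle_rid_iff[OF e] by simp
    also have "\<dots> \<longleftrightarrow> \<rho>\<^sub>A f \<star> e = e \<and> \<rho>\<^sub>A g \<star> e = e"
      using A.rid_idem_cmp[OF r(1), of "\<rho>\<^sub>A g \<star> e"] A.rid_idem_cmp[OF r(2), of "\<rho>\<^sub>A f \<star> e"]
        A.rid_left_comm[OF r, of e] f g by auto
    finally show ?thesis .
  qed
  then show ?thesis by (auto simp: agree_def)
qed

lemma agree_img: "FA P ` agree f g \<subseteq> rid C (FO P (src f))"
  using P_rid by (auto simp: agree_def)

lemma eqx_join:
  assumes f: "f \<in> hom A i j" and g: "g \<in> hom A i j"
  shows "is_join C (FO P i) (FO P i) (FA P ` agree f g) (eqx f g)"
proof -
  obtain c where "is_join C (FO P i) (FO P i) (FA P ` agree f g) c"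
    using join_rid_exists[OF _ agree_img[of f g]] f by auto
  moreover have "eqx f g = Join C (FO P i) (FO P i) (FA P ` agree f g)"
    using agree_eq[OF f g] f by (simp add: eq_ext_def)
  ultimately show ?thesis using Join_eq by simp
qed

lemma eqx_rid:
  assumes f: "f \<in> hom A i j" and g: "g \<in> hom A i j"
  shows "eqx f g \<in> rid C (FO P i)"
  using join_rid[OF agree_img, of f g] eqx_join[OF f g] f by simp

lemma eqx_upper:
  assumes f: "f \<in> hom A i j" and g: "g \<in> hom A i j" and e: "e \<in> agree f g"
  shows "eqx f g \<cdot> FA P e = FA P e"
  using join_rid_upper[OF agree_img, of f g] eqx_join[OF f g] f e by simp

lemma eqx_local:
  assumes f: "f \<in> hom A i j" and g: "g \<in> hom A i j"
    and h: "h \<in> hom C (FO P i) Y" "k \<in> hom C (FO P i) Y"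
    and e: "\<And>e. e \<in> agree f g \<Longrightarrow> h \<cdot> FA P e = k \<cdot> FA P e"
  shows "h \<cdot> eqx f g = k \<cdot> eqx f g"
proof (rule join_local_eq[OF _ eqx_join[OF f g] h])
  show "FA P ` agree f g \<subseteq> rid C (FO P i)" using agree_img[of f g] f by simp
qed (use e in auto)

lemma agree_sym: "f \<in> hom A i j \<Longrightarrow> g \<in> hom A i j \<Longrightarrow> agree f g = agree g f"
  by (auto simp: agree_def)

text \<open>\<open>\<rho>\<^sub>A f\<close> is the largest member of \<open>agree f f\<close>, so
  its image is the join.\<close>

lemma eqx_refl:
  assumes f: "f \<in> hom A i j"
  shows "eqx f f = \<rho> (FA P f)"
proof -
  have rf: "\<rho>\<^sub>A f \<in> agree f f" using f by (simp add: agree_def)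
  have "is_join C (FO P i) (FO P i) (FA P ` agree f f) (\<rho> (FA P f))"
  proof (rule join_ridI)
    show "FA P ` agree f f \<subseteq> rid C (FO P i)" using agree_img[of f f] f by simp
    show "\<rho> (FA P f) \<in> rid C (FO P i)" using f by simp
    show "\<rho> (FA P f) \<cdot> e = e" if "e \<in> FA P ` agree f f" for e
    proof -
      obtain d where d: "e = FA P d" "d \<in> agree f f" using \<open>e \<in> _\<close> by blast
      then have "FA P (\<rho>\<^sub>A f \<star> d) = FA P d" "d \<in> rid A i" using f by (auto simp: agree_def)
      then show ?thesis using d f A.rid_mor[of d i] by simp
    qed
    show "u \<cdot> \<rho> (FA P f) = \<rho> (FA P f)" if "\<And>e. e \<in> FA P ` agree f f \<Longrightarrow> u \<cdot> e = e" for u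
      using that[of "FA P (\<rho>\<^sub>A f)"] rf f by simp
  qed
  then show ?thesis using eqx_join[OF f f] join_unique by blast
qed

lemma agreeD:
  assumes "e \<in> agree f g"
  shows "e \<in> rid A (src f)" "f \<star> e = g \<star> e" "\<rho>\<^sub>A f \<star> e = e" "\<rho>\<^sub>A g \<star> e = e"
    "e \<in> Mor A" "src e = src f" "tgt e = src f" "\<rho>\<^sub>A e = e"
  using assms A.rid_mor[of e "src f"] by (simp_all add: agree_def)

text \<open>For \<open>e\<close> in \<open>agree f g\<close> and \<open>d\<close> in
  \<open>agree g h\<close> the product \<open>e \<star> d\<close> lies in \<open>agree f h\<close>.
  The two joins are then removed one at a time by \<open>eqx_local\<close>.\<close>

lemma eqx_trans:
  assumes f: "f \<in> hom A i j" and g: "g \<in> hom A i j" and h: "h \<in> hom A i j"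
  shows "eqx f h \<cdot> (eqx g h \<cdot> eqx f g) = eqx g h \<cdot> eqx f g"
proof -
  note r = eqx_rid[OF f g] eqx_rid[OF g h] eqx_rid[OF f h]
  note [simp] = rid_mor(1-4)[OF r(1)] rid_mor(1-4)[OF r(2)] rid_mor(1-4)[OF r(3)]
  have 1: "eqx f h \<cdot> (FA P e \<cdot> eqx g h) = FA P e \<cdot> eqx g h" if e: "e \<in> agree f g" for e
  proof -
    note [simp] = agreeD[OF e]
    have sf: "src f = i" using f by simp
    have "eqx f h \<cdot> FA P e \<cdot> eqx g h = FA P e \<cdot> eqx g h"
    proof (rule eqx_local[OF g h])
      fix d assume d: "d \<in> agree g h"
      note dd = agreeD[OF d]
      have sg: "src g = i" using g by simp
      have d': "d \<in> rid A i" "e \<in> rid A i" using dd sg agreeD(1)[OF e] sf by simp_all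
      have "e \<star> d \<in> agree f h"
      proof -
        have "f \<star> (e \<star> d) = g \<star> (e \<star> d)" using A.cmp_reassoc[OF agreeD(2)[OF e], of d] dd f g by simp
        also have "\<dots> = h \<star> (e \<star> d)"
          using A.cmp_reassoc[OF dd(2), of e] A.rid_comm[OF d'] dd f g h by simp
        finally have 1: "f \<star> (e \<star> d) = h \<star> (e \<star> d)" .
        have 2: "\<rho>\<^sub>A f \<star> (e \<star> d) = e \<star> d" using A.cmp_reassoc[OF agreeD(3)[OF e], of d] dd f g by simp
        have 3: "\<rho>\<^sub>A h \<star> (e \<star> d) = e \<star> d"
          using A.cmp_reassoc[OF dd(4), of e] A.rid_comm[OF d'] dd f g h by simp
        show ?thesis using 1 2 3 A.rid_cmp[OF d'(2,1)] f by (simp add: agree_def)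
      qed
      from eqx_upper[OF f h this] show "eqx f h \<cdot> FA P e \<cdot> FA P d = FA P e \<cdot> FA P d"
        using dd f g by simp
    qed (use f g in auto)
    then show ?thesis using sf by simp
  qed
  have "eqx f h \<cdot> eqx g h \<cdot> eqx f g = eqx g h \<cdot> eqx f g"
  proof (rule eqx_local[OF f g])
    fix e assume e: "e \<in> agree f g"
    have er: "FA P e \<in> rid C (FO P i)" using agree_img[of f g] e f by auto
    show "eqx f h \<cdot> eqx g h \<cdot> FA P e = eqx g h \<cdot> FA P e"
      using 1[OF e] rid_comm[OF er r(2)] rid_mor[OF er] by simp
  qed auto
  then show ?thesis by simp
qed

lemma eqx_atlas: "i \<in> Obj A \<Longrightarrow> local_atlas C (FO P i) (hom A i j) eqx"
  unfolding local_atlas_def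
proof (intro conjI ballI)
  fix f g assume f: "f \<in> hom A i j" and g: "g \<in> hom A i j"
  show "eqx f g \<in> rid C (FO P i)" by (rule eqx_rid[OF f g])
  show "eqx f g = eqx g f"
    using join_unique[OF eqx_join[OF f g]] eqx_join[OF g f] agree_sym[OF f g] by simp
  fix h assume h: "h \<in> hom A i j"
  show "rle C (eqx g h \<cdot> eqx f g) (eqx f h)"
    using eqx_trans[OF f g h] rle_rid_iff[OF rid_cmp[OF eqx_rid[OF g h] eqx_rid[OF f g]]] by simp
qed

text \<open>The domain of the \<open>f\<close>-th partial isomorphism of the glueing, that is, the
  part of the glued object covered by \<open>sec f\<close>.\<close>

definition ide where "ide i j f = \<rho> (fst (snd (Psi_glueing C X i j)) f)"

lemma ide_eq: "(\<lambda>f. \<rho> (fst (snd (Psi_glueing C X i j)) f)) = ide i j"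
  by (simp add: ide_def fun_eq_iff)

abbreviation "\<sigma> \<equiv> Psi_sigma C X"
abbreviation "\<tau> \<equiv> Psi_tau C X"
abbreviation "sec \<equiv> Psi_sec C X"

lemma hom_small: "i \<in> Obj A \<Longrightarrow> j \<in> Obj A \<Longrightarrow> hom A i j \<prec> (UNIV :: 'u set)"
  using over_obj by (simp add: over_obj_def locally_small_def)

lemma Psi_is_glueing:
  assumes i: "i \<in> Obj A" and j: "j \<in> Obj A"
  shows "is_glueing C (FO P i) (hom A i j) eqx (\<sigma> i j) (fst (snd (Psi_glueing C X i j))) sec"
proof -
  let ?Q = "\<lambda>(p, pp, ss). is_glueing C (FO P i) (hom A i j) eqx p pp ss"
  obtain p pp ss where "is_glueing C (FO P i) (hom A i j) eqx p pp ss"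
    using is_glueing_any_index[OF glueings _ hom_small[OF i j] eqx_atlas[OF i]] i by auto
  then have "?Q (p, pp, ss)" by simp
  then have "?Q (Psi_glueing C X i j)" unfolding Psi_glueing_def snd_conv fst_conv by (rule someI[of ?Q])
  then have "is_glueing C (FO P i) (hom A i j) eqx (\<sigma> i j) (fst (snd (Psi_glueing C X i j)))
      (snd (snd (Psi_glueing C X i j)))"
    by (simp add: split_beta Psi_sigma_def)
  then show ?thesis
    unfolding is_glueing_def by (simp add: Psi_sec_def)
qed

lemma etale: "i \<in> Obj A \<Longrightarrow> j \<in> Obj A \<Longrightarrow> etale_family C (\<sigma> i j) (hom A i j) sec (ide i j)"
  using is_glueing_etale_family[OF join_restriction_category_axioms Psi_is_glueing] unfolding ide_eq .

lemma overlap_eqx: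
  "\<lbrakk>i \<in> Obj A; j \<in> Obj A; f \<in> hom A i j; g \<in> hom A i j\<rbrakk> \<Longrightarrow>
    etale_family.overlap C (\<sigma> i j) sec (ide i j) f g = eqx f g"
  using is_glueing_overlap[OF join_restriction_category_axioms Psi_is_glueing] unfolding ide_eq .

lemma \<sigma> [simp]:
  assumes "i \<in> Obj A" "j \<in> Obj A"
  shows "\<sigma> i j \<in> Mor C" "tgt (\<sigma> i j) = FO P i" "total C (\<sigma> i j)" "local_homeo C (\<sigma> i j)"
    "src (\<sigma> i j) \<in> Obj C"
proof -
  have l: "local_homeo C (\<sigma> i j)" "tgt (\<sigma> i j) = FO P i"
    using Psi_is_glueing[OF assms] unfolding is_glueing_def by blast+
  then have m: "\<sigma> i j \<in> Mor C" "total C (\<sigma> i j)" unfolding local_homeo_def by blast+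
  show "\<sigma> i j \<in> Mor C" "tgt (\<sigma> i j) = FO P i" "total C (\<sigma> i j)"
    "local_homeo C (\<sigma> i j)" "src (\<sigma> i j) \<in> Obj C"
    by (rule l m src_obj'[OF m(1)])+
qed

lemma sec [simp]:
  assumes "f \<in> Mor A"
  shows "sec f \<in> Mor C" "src (sec f) = FO P (src f)" "tgt (sec f) = src (\<sigma> (src f) (tgt f))"
    "\<sigma> (src f) (tgt f) \<cdot> sec f = \<rho> (FA P f)" "\<rho> (sec f) = \<rho> (FA P f)"
proof -
  interpret E: etale_family C "\<sigma> (src f) (tgt f)" "hom A (src f) (tgt f)" sec "ide (src f) (tgt f)"
    by (rule etale) (use assms in auto)
  have f: "f \<in> hom A (src f) (tgt f)" using assms by simp
  show "sec f \<in> Mor C" "src (sec f) = FO P (src f)" "tgt (sec f) = src (\<sigma> (src f) (tgt f))"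
    using E.s_mor[OF f] assms by simp_all
  \<comment> \<open>The diagonal entry of the atlas is the domain of the section.\<close>
  show r: "\<rho> (sec f) = \<rho> (FA P f)"
    using E.overlap_refl[OF f] overlap_eqx[OF _ _ f f] eqx_refl[OF f] assms by simp
  show "\<sigma> (src f) (tgt f) \<cdot> sec f = \<rho> (FA P f)" using E.p_s[OF f] r by simp
qed

lemma sec_eqx:
  assumes f: "f \<in> hom A i j" and g: "g \<in> hom A i j"
  shows "sec f \<cdot> eqx f g = sec g \<cdot> eqx f g"
proof -
  interpret E: etale_family C "\<sigma> i j" "hom A i j" sec "ide i j"
    by (rule etale) (use f in auto)
  show ?thesis using E.overlap(3)[OF f g] overlap_eqx[OF _ _ f g] f by auto
qed

text \<open>Maximality of the atlas entry, with an arbitrary element in place of an idempotent: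
  \<open>ide i j g\<close> fixes \<open>sec g \<cdot> y\<close>, hence the equal element
  \<open>sec f \<cdot> y\<close>.\<close>

lemma eqx_cmp:
  assumes f: "f \<in> hom A i j" and g: "g \<in> hom A i j" and y: "y \<in> Mor C" "tgt y = FO P i"
    and eq: "sec f \<cdot> y = sec g \<cdot> y"
  shows "eqx f g \<cdot> y = \<rho> (FA P f) \<cdot> y"
proof -
  have ij [simp]: "i \<in> Obj A" "j \<in> Obj A" using f by auto
  interpret E: etale_family C "\<sigma> i j" "hom A i j" sec "ide i j" by (rule etale[OF ij])
  have fm: "f \<in> Mor A" "src f = i" "tgt f = j" and gm: "g \<in> Mor A" "src g = i" "tgt g = j" using f g by auto
  have "ide i j g \<cdot> (sec f \<cdot> y) = sec f \<cdot> y"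
    using cmp_reassoc[OF E.e_s[OF g], of y] gm y E.e_mor[OF g] eq by simp
  then have "\<sigma> i j \<cdot> (ide i j g \<cdot> (sec f \<cdot> y)) = \<rho> (FA P f) \<cdot> y"
    using cmp_reassoc[OF sec(4)[OF fm(1)], of y] fm y by simp
  moreover have "eqx f g = \<sigma> i j \<cdot> (ide i j g \<cdot> sec f)"
    using overlap_eqx[OF ij f g] by (simp add: E.overlap_def)
  ultimately show ?thesis using fm gm y E.e_mor[OF g] by simp
qed

text \<open>Where \<open>sec f\<close> and \<open>sec g\<close> agree at \<open>y\<close>, their
  common domain is covered by the inverse images of the idempotents in \<open>agree f g\<close>; so
  \<open>f\<close> and \<open>g\<close> may be taken to agree already in \<open>A\<close>.\<close>

lemma eq_via_agree:
  assumes f: "f \<in> hom A i j" and g: "g \<in> hom A i j" and y: "y \<in> hom C W (FO P i)"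
    and eq: "sec f \<cdot> y = sec g \<cdot> y"
    and h: "h \<in> hom C W Y" "\<rho> h = \<rho> (sec f \<cdot> y)" and k: "k \<in> hom C W Y" "\<rho> k = \<rho> (sec f \<cdot> y)"
    and e: "\<And>e w. \<lbrakk>e \<in> agree f g; w = \<rho> (FA P e \<cdot> y); FA P e \<cdot> y = y \<cdot> w; w \<in> rid C W\<rbrakk> \<Longrightarrow> h \<cdot> w = k \<cdot> w"
  shows "h = k"
proof -
  have i: "FO P (src f) = FO P i" using f by simp
  have E: "FA P ` agree f g \<subseteq> rid C (FO P i)" using agree_img[of f g] i by simp
  have c: "is_join C W W ((\<lambda>e. \<rho> (e \<cdot> y)) ` FA P ` agree f g) (\<rho> (eqx f g \<cdot> y))"
    by (rule cover_precomp[OF E eqx_join[OF f g] y])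
  have r: "\<rho> (eqx f g \<cdot> y) = \<rho> (sec f \<cdot> y)"
  proof -
    have "\<rho> (eqx f g \<cdot> y) = \<rho> (\<rho> (sec f) \<cdot> y)" using eqx_cmp[OF f g _ _ eq] y f by simp
    then show ?thesis using y f by (subst (asm) rst_rst_cmp) auto
  qed
  show ?thesis
  proof (rule join_eq_local[OF _ c h(1) k(1)])
    show "h \<cdot> \<rho> (eqx f g \<cdot> y) = h" "k \<cdot> \<rho> (eqx f g \<cdot> y) = k"
      using h k cmp_rst_self[of h] cmp_rst_self[of k] by (simp_all add: r)
    show "(\<lambda>e. \<rho> (e \<cdot> y)) ` FA P ` agree f g \<subseteq> rid C W"
      using subsetD[OF E] y rid_mor[of _ "FO P i"] by auto
    fix w assume "w \<in> (\<lambda>e. \<rho> (e \<cdot> y)) ` FA P ` agree f g"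
    then obtain d where d: "d \<in> agree f g" "w = \<rho> (FA P d \<cdot> y)" by auto
    have dr: "FA P d \<in> rid C (FO P i)" using E d by blast
    show "h \<cdot> w = k \<cdot> w"
      by (rule e[OF d]) (use rid_shift[OF dr] rid_mor[OF dr] y d in auto)
  qed
qed

lemma sec_eq:
  assumes f: "f \<in> hom A i j" and g: "g \<in> hom A i j" and d: "d \<in> rid A i" and eq: "f \<star> d = g \<star> d"
  shows "sec f \<cdot> FA P d = sec g \<cdot> FA P d"
proof -
  have fm: "f \<in> Mor A" "src f = i" "tgt f = j" and gm: "g \<in> Mor A" "src g = i" "tgt g = j" using f g by auto
  note [simp] = fm gm A.rid_mor(1-4)[OF d]
  \<comment> \<open>Since \<open>f\<close> and \<open>g\<close> agree on \<open>d\<close>, their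
    domains do too; cut down to them, \<open>d\<close> becomes a member of
    \<open>agree f g\<close>.\<close>
  define e where "e = \<rho>\<^sub>A f \<star> d"
  have e: "e = \<rho>\<^sub>A g \<star> d"
    using A.rst_cmp_rid[OF d, of f] A.rst_cmp_rid[OF d, of g] eq by (simp add: e_def)
  have er: "e \<in> rid A i" using A.rid_cmp[OF _ d, of "\<rho>\<^sub>A f"] by (simp add: e_def)
  note [simp] = A.rid_mor(1-4)[OF er]
  have "e \<in> agree f g"
  proof -
    have "f \<star> e = f \<star> d" unfolding e_def using A.cmp_reassoc[OF A.cmp_rst_self, of f d] by simp
    moreover have "g \<star> e = g \<star> d" unfolding e using A.cmp_reassoc[OF A.cmp_rst_self, of g d] by simp
    moreover have "\<rho>\<^sub>A f \<star> e = e" unfolding e_def using A.cmp_reassoc[OF A.rst_idem, of f d] by simp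
    moreover have "\<rho>\<^sub>A g \<star> e = e" unfolding e using A.cmp_reassoc[OF A.rst_idem, of g d] by simp
    ultimately show ?thesis using er eq by (simp add: agree_def)
  qed
  then have q: "eqx f g \<cdot> FA P e = FA P e" by (rule eqx_upper[OF f g])
  note [simp] = rid_mor(1-4)[OF eqx_rid[OF f g]]
  have "sec f \<cdot> FA P e = sec g \<cdot> FA P e"
    using cmp_reassoc[OF sec_eqx[OF f g], of "FA P e"] q by simp
  moreover have "sec f \<cdot> FA P e = sec f \<cdot> FA P d"
    using cmp_reassoc[OF cmp_rst_self, of "sec f" "FA P d"] by (simp add: e_def)
  moreover have "sec g \<cdot> FA P e = sec g \<cdot> FA P d"
    using cmp_reassoc[OF cmp_rst_self, of "sec g" "FA P d"] by (simp add: e)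
  ultimately show ?thesis by simp
qed

text \<open>The arrows \<open>f\<close> and \<open>f \<star> d\<close> agree on \<open>d\<close>,
  and the domain of \<open>sec (f \<star> d)\<close> lies inside the image of
  \<open>d\<close>.\<close>

lemma sec_cmp_rid:
  assumes f: "f \<in> Mor A" and d: "d \<in> rid A (src f)"
  shows "sec (f \<star> d) = sec f \<cdot> FA P d"
proof -
  note [simp] = f A.rid_mor(1-4)[OF d]
  have "sec f \<cdot> FA P d = sec (f \<star> d) \<cdot> FA P d"
    by (rule sec_eq[of _ "src f" "tgt f"]) (use d A.rid_mor(5)[OF d] in simp_all)
  moreover have "sec (f \<star> d) \<cdot> FA P d = sec (f \<star> d)"
  proof -
    have r: "\<rho> (sec (f \<star> d)) = \<rho> (FA P f) \<cdot> FA P d"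
      using sec(5)[of "f \<star> d"] rst_cmp_rid[OF P_rid[OF d], of "FA P f"] by simp
    then have "\<rho> (sec (f \<star> d)) \<cdot> FA P d = \<rho> (FA P f) \<cdot> (FA P d \<cdot> FA P d)" by simp
    also have "\<dots> = \<rho> (sec (f \<star> d))" by (simp only: rid_mor(5)[OF P_rid[OF d]] r)
    finally have "sec (f \<star> d) \<cdot> (\<rho> (sec (f \<star> d)) \<cdot> FA P d) = sec (f \<star> d) \<cdot> \<rho> (sec (f \<star> d))"
      by (rule arg_cong)
    then show ?thesis by (subst (asm) cmp_reassoc[OF cmp_rst_self]) (simp_all del: sec(5))
  qed
  ultimately show ?thesis by simp
qed

text \<open>Where two sections coincide their arrows agree locally in \<open>A\<close>, hence so do
  the images under \<open>P\<close>; this is the condition under which \<open>extend\<close> defines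
  a map on the glued object.\<close>

lemma \<tau>_unique:
  assumes ij: "i \<in> Obj A" "j \<in> Obj A"
  shows "\<exists>!t. t \<in> hom C (src (\<sigma> i j)) (FO P j) \<and> (\<forall>f\<in>hom A i j. t \<cdot> sec f = FA P f)"
proof -
  interpret E: etale_family C "\<sigma> i j" "hom A i j" sec "ide i j" by (rule etale[OF ij])
  show ?thesis
  proof (rule E.extend)
    show "FA P f \<in> hom C (tgt (\<sigma> i j)) (FO P j)" "\<rho> (FA P f) = \<rho> (sec f)" if "f \<in> hom A i j" for f
      using that ij by auto
    fix f g d assume fg: "f \<in> hom A i j" "g \<in> hom A i j" and d: "d \<in> rid C (tgt (\<sigma> i j))"
      "\<rho> (sec f) \<cdot> d = d" "\<rho> (sec g) \<cdot> d = d" "sec f \<cdot> d = sec g \<cdot> d"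
    have dr: "d \<in> rid C (FO P i)" using d ij by simp
    note [simp] = rid_mor(1-4)[OF dr]
    have m: "f \<in> Mor A" "src f = i" "tgt f = j" "g \<in> Mor A" "src g = i" "tgt g = j" using fg by auto
    show "FA P f \<cdot> d = FA P g \<cdot> d"
    proof (rule eq_via_agree[OF fg _ d(4)])
      show "\<rho> (FA P f \<cdot> d) = \<rho> (sec f \<cdot> d)" using m by (simp add: rst_cmp_rid[OF dr])
      show "\<rho> (FA P g \<cdot> d) = \<rho> (sec f \<cdot> d)" unfolding d(4) using m by (simp add: rst_cmp_rid[OF dr])
      show "FA P f \<cdot> d \<cdot> w = FA P g \<cdot> d \<cdot> w" if e: "e \<in> agree f g" and w: "FA P e \<cdot> d = d \<cdot> w" "w \<in> rid C (FO P i)" for e w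
      proof -
        note a = agreeD[OF e]
        have "FA P f \<cdot> FA P e = FA P g \<cdot> FA P e"
          using P_cmp[of e f] P_cmp[of e g] a m by simp
        then have "FA P f \<cdot> (FA P e \<cdot> d) = FA P g \<cdot> (FA P e \<cdot> d)"
          using cmp_reassoc[of "FA P f" "FA P e" "FA P g \<cdot> FA P e" d] a m by simp
        then show ?thesis using w rid_mor[OF w(2)] m by simp
      qed
    qed (use m in auto)
  qed (use ij in auto)
qed

lemma \<tau> [simp]:
  assumes ij: "i \<in> Obj A" "j \<in> Obj A"
  shows "\<tau> i j \<in> Mor C" "src (\<tau> i j) = src (\<sigma> i j)" "tgt (\<tau> i j) = FO P j" "total C (\<tau> i j)"
    and \<tau>_sec: "\<And>f. f \<in> hom A i j \<Longrightarrow> \<tau> i j \<cdot> sec f = FA P f"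
proof -
  interpret E: etale_family C "\<sigma> i j" "hom A i j" sec "ide i j" by (rule etale[OF ij])
  have t: "\<tau> i j \<in> hom C (src (\<sigma> i j)) (FO P j) \<and> (\<forall>f\<in>hom A i j. \<tau> i j \<cdot> sec f = FA P f)"
    unfolding Psi_tau_def using theI'[OF \<tau>_unique[OF ij]] by simp
  then show "\<tau> i j \<in> Mor C" "src (\<tau> i j) = src (\<sigma> i j)" "tgt (\<tau> i j) = FO P j"
    "\<And>f. f \<in> hom A i j \<Longrightarrow> \<tau> i j \<cdot> sec f = FA P f" by simp_all
  show "total C (\<tau> i j)" by (rule E.extend_total[of _ "FO P j"]) (use t in auto)
qed

lemma \<tau>_sec_cmp:
  assumes "f \<in> Mor A" "x \<in> Mor C" "tgt x = FO P (src f)"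
  shows "\<tau> (src f) (tgt f) \<cdot> (sec f \<cdot> x) = FA P f \<cdot> x"
  using cmp_reassoc[OF \<tau>_sec, of "src f" "tgt f" f x] assms by simp

lemma \<sigma>_sec_cmp:
  assumes "f \<in> Mor A" "x \<in> Mor C" "tgt x = FO P (src f)"
  shows "\<sigma> (src f) (tgt f) \<cdot> (sec f \<cdot> x) = x \<cdot> \<rho> (FA P f \<cdot> x)"
  using cmp_reassoc[OF sec(4), of f x] rst_shift[of x "FA P f"] assms by simp

text \<open>An idempotent \<open>e\<close> on which \<open>g\<close> and \<open>g'\<close> agree can
  be moved through \<open>f\<close>, as \<open>e \<star> f = f \<star> d\<close>; then
  \<open>g \<star> f\<close> and \<open>g' \<star> f\<close> agree on \<open>d\<close>, and
  \<open>sec_eq\<close> applies.\<close>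

lemma sec_precomp:
  assumes f: "f \<in> hom A i j" and g: "g \<in> hom A j k" and g': "g' \<in> hom A j k"
    and x: "x \<in> hom C W (FO P i)" and eq: "sec g \<cdot> (FA P f \<cdot> x) = sec g' \<cdot> (FA P f \<cdot> x)"
  shows "sec (g \<star> f) \<cdot> x = sec (g' \<star> f) \<cdot> x"
proof (rule eq_via_agree[OF g g' _ eq])
  have m: "f \<in> Mor A" "src f = i" "tgt f = j" "g \<in> Mor A" "src g = j" "tgt g = k"
    "g' \<in> Mor A" "src g' = j" "tgt g' = k" using f g g' by auto
  note [simp] = m
  have [simp]: "x \<in> Mor C" "src x = W" "tgt x = FO P i" using x by auto
  have r: "\<rho> (sec (l \<star> f) \<cdot> x) = \<rho> (sec l \<cdot> (FA P f \<cdot> x))" if "l \<in> hom A j k" for l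
  proof -
    have "\<rho> (sec (l \<star> f) \<cdot> x) = \<rho> (FA P l \<cdot> FA P f \<cdot> x)" by (rule rst_cmp_eq) (use that in auto)
    also have "\<dots> = \<rho> (FA P l \<cdot> (FA P f \<cdot> x))" using that by auto
    also have "\<dots> = \<rho> (sec l \<cdot> (FA P f \<cdot> x))" by (rule rst_cmp_eq) (use that in auto)
    finally show ?thesis .
  qed
  show "\<rho> (sec (g \<star> f) \<cdot> x) = \<rho> (sec g \<cdot> (FA P f \<cdot> x))" by (rule r[OF g])
  show "\<rho> (sec (g' \<star> f) \<cdot> x) = \<rho> (sec g \<cdot> (FA P f \<cdot> x))" unfolding eq by (rule r[OF g'])
  show "FA P f \<cdot> x \<in> hom C W (FO P j)" by simp
  fix e w assume e: "e \<in> agree g g'" and w: "w = \<rho> (FA P e \<cdot> (FA P f \<cdot> x))" "w \<in> rid C W"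
  note a = agreeD[OF e]
  define d where "d = \<rho>\<^sub>A (e \<star> f)"
  have d: "d \<in> rid A i" using a m by (simp add: d_def)
  note [simp] = A.rid_mor(1-4)[OF d]
  have ef: "e \<star> f = f \<star> d" unfolding d_def by (rule A.rid_shift) (use a m in auto)
  have xw: "FA P d \<cdot> x = x \<cdot> w" using rst_shift[of x "FA P e \<cdot> FA P f"] a m w by (simp add: d_def)
  have "g \<star> f \<star> d = g' \<star> f \<star> d"
    using A.cmp_reassoc[OF a(2), of f] a m ef by simp
  then have "sec (g \<star> f) \<cdot> FA P d = sec (g' \<star> f) \<cdot> FA P d" by (intro sec_eq[of _ i k]) (use d in auto)
  then have "sec (g \<star> f) \<cdot> (FA P d \<cdot> x) = sec (g' \<star> f) \<cdot> (FA P d \<cdot> x)"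
    using cmp_reassoc[of "sec (g \<star> f)" "FA P d" "sec (g' \<star> f) \<cdot> FA P d" x] by simp
  then show "sec (g \<star> f) \<cdot> x \<cdot> w = sec (g' \<star> f) \<cdot> x \<cdot> w" using xw rid_mor[OF w(2)] by simp
qed (use assms in auto)

abbreviation "\<Psi> \<equiv> Psi_obj C X"

lemma Psi_simps [simp]:
  "Ix \<Psi> = Obj A" "PO \<Psi> i = FO P i" "PA \<Psi> i j = src (\<sigma> i j)" "Sg \<Psi> = \<sigma>" "Ta \<Psi> = \<tau>"
  "Et \<Psi> i = sec (Idn A i)" "Mu \<Psi> = Psi_mu C X"
  by (simp_all add: Psi_obj_def)

lemma \<sigma>_pullbacks:
  assumes "i \<in> Obj A" "j \<in> Obj A"
  shows "admits_pullbacks C (\<sigma> i j)"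
proof -
  interpret E: etale_family C "\<sigma> i j" "hom A i j" sec "ide i j" by (rule etale[OF assms])
  show ?thesis unfolding admits_pullbacks_def
    using E.pullback_exists[OF glueings hom_small[OF assms]] by blast
qed

lemma \<sigma>_pullback:
  assumes "i \<in> Obj A" "j \<in> Obj A" "g \<in> Mor C" "total C g" "tgt g = FO P i"
  shows "is_pullback C (\<sigma> i j) g (pb1 C (\<sigma> i j) g) (pb2 C (\<sigma> i j) g)"
  using \<sigma>_pullbacks[OF assms(1,2)] assms unfolding admits_pullbacks_def
  by (auto intro: is_pullback_chosen)

section \<open>Composition on the glued objects\<close>

context
  fixes i j k
  assumes ijk [simp]: "i \<in> Obj A" "j \<in> Obj A" "k \<in> Obj A"
begin

lemma pb: "is_pullback C (\<sigma> j k) (\<tau> i j) (pb1 C (\<sigma> j k) (\<tau> i j)) (pb2 C (\<sigma> j k) (\<tau> i j))"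
  by (rule \<sigma>_pullback) auto

abbreviation "lifted g f \<equiv> pb_lift C (\<sigma> j k) (\<tau> i j) (sec g) \<cdot> sec f"

lemma lift_sec:
  assumes g: "g \<in> hom A j k"
  shows "pb_lift C (\<sigma> j k) (\<tau> i j) (sec g) \<in> hom C (src (\<sigma> i j)) (pb_obj C (\<sigma> j k) (\<tau> i j))"
proof -
  have m: "g \<in> Mor A" "src g = j" "tgt g = k" using g by auto
  note sg = sec[OF m(1), unfolded m]
  have "\<sigma> j k \<cdot> sec g = \<rho> (sec g)" using sg by simp
  from lift(1-3)[OF pb sg(1) _ sg(3) this, folded pb_lift_def] show ?thesis using sg by simp
qed

lemma lifted:
  assumes f: "f \<in> hom A i j" and g: "g \<in> hom A j k"
  shows "lifted g f \<in> hom C (FO P i) (pb_obj C (\<sigma> j k) (\<tau> i j))"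
    "lifted g f = pb_pair C (\<sigma> j k) (\<tau> i j) (sec g \<cdot> FA P f) (sec f \<cdot> \<rho> (FA P g \<cdot> FA P f))"
    "pb1 C (\<sigma> j k) (\<tau> i j) \<cdot> lifted g f = sec g \<cdot> FA P f"
    "pb2 C (\<sigma> j k) (\<tau> i j) \<cdot> lifted g f = sec f \<cdot> \<rho> (FA P g \<cdot> FA P f)"
    "\<rho> (lifted g f) = \<rho> (FA P g \<cdot> FA P f)"
proof -
  have m: "f \<in> Mor A" "src f = i" "tgt f = j" "g \<in> Mor A" "src g = j" "tgt g = k" using f g by auto
  note sg = sec[OF m(4), unfolded m]
  have sq: "\<sigma> j k \<cdot> sec g = \<rho> (sec g)" using sg by simp
  note l = lift[OF pb sg(1) _ sg(3) sq, folded pb_lift_def]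
  note lc = lift_cmp[OF pb sg(1) _ sg(3) sq, folded pb_lift_def]
  have r: "\<rho> (sec g \<cdot> FA P f) = \<rho> (FA P g \<cdot> FA P f)" by (rule rst_cmp_eq) (use m in auto)
  have t: "\<tau> i j \<cdot> sec f = FA P f" using \<tau>_sec[OF ijk(1,2) f] .
  show "lifted g f \<in> hom C (FO P i) (pb_obj C (\<sigma> j k) (\<tau> i j))" using l m by simp
  show eq: "lifted g f = pb_pair C (\<sigma> j k) (\<tau> i j) (sec g \<cdot> FA P f) (sec f \<cdot> \<rho> (FA P g \<cdot> FA P f))"
    using lc[of "sec f"] m t r by simp
  have rt: "\<rho> (sec g \<cdot> \<tau> i j) \<cdot> sec f = sec f \<cdot> \<rho> (FA P g \<cdot> FA P f)"
    using rst_shift[of "sec f" "sec g \<cdot> \<tau> i j"] m sg t r by simp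
  show 1: "pb1 C (\<sigma> j k) (\<tau> i j) \<cdot> lifted g f = sec g \<cdot> FA P f"
    using cmp_reassoc[OF l(4), of "sec f"] m t l(1-3) pb_mor[OF pb] by simp
  show 2: "pb2 C (\<sigma> j k) (\<tau> i j) \<cdot> lifted g f = sec f \<cdot> \<rho> (FA P g \<cdot> FA P f)"
    using cmp_reassoc[OF l(5), of "sec f"] m rt l(1-3) pb_mor[OF pb] by simp
  have "\<rho> (lifted g f) = \<rho> (pb1 C (\<sigma> j k) (\<tau> i j) \<cdot> lifted g f)"
    using pb_mor[OF pb] pb_total[OF pb] l m by simp
  then show "\<rho> (lifted g f) = \<rho> (FA P g \<cdot> FA P f)" using 1 r by simp
qed

text \<open>The second projection is etale by base change of \<open>\<sigma> j k\<close>, and so is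
  its composite with \<open>\<sigma> i j\<close>. The sections of the composite are the lifted
  pairs, so a map out of the pullback may be defined and compared on these.\<close>

lemma etale_comp:
  "etale_family C (\<sigma> i j \<cdot> pb2 C (\<sigma> j k) (\<tau> i j)) (hom A i j \<times> hom A j k) (\<lambda>(f, g). lifted g f)
    (\<lambda>(f, g). \<rho> (ide j k g \<cdot> pb1 C (\<sigma> j k) (\<tau> i j)) \<cdot> \<rho> (ide i j f \<cdot> pb2 C (\<sigma> j k) (\<tau> i j)))"
proof -
  interpret E: etale_family C "\<sigma> i j" "hom A i j" sec "ide i j" by (rule etale) auto
  interpret F: etale_family C "\<sigma> j k" "hom A j k" sec "ide j k" by (rule etale) auto
  show ?thesis by (rule E.compose[OF F.base_change[OF pb]]) (use pb_mor[OF pb] in auto)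
qed

text \<open>The point is independence of the pair when \<open>(f, g)\<close> and
  \<open>(f', g')\<close> give the same lifted element: the first arrows agree locally on
  idempotents of \<open>A\<close>, and once they are equal \<open>sec_precomp\<close> exchanges the
  second ones.\<close>

lemma mu_unique: "\<exists>!m. m \<in> hom C (pb_obj C (\<sigma> j k) (\<tau> i j)) (src (\<sigma> i k)) \<and>
  (\<forall>f\<in>hom A i j. \<forall>g\<in>hom A j k. m \<cdot> lifted g f = sec (g \<star> f))"
proof -
  interpret E: etale_family C "\<sigma> i j \<cdot> pb2 C (\<sigma> j k) (\<tau> i j)" "hom A i j \<times> hom A j k"
    "\<lambda>(f, g). lifted g f"
    "\<lambda>(f, g). \<rho> (ide j k g \<cdot> pb1 C (\<sigma> j k) (\<tau> i j)) \<cdot> \<rho> (ide i j f \<cdot> pb2 C (\<sigma> j k) (\<tau> i j))"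
    by (rule etale_comp)
  note pm [simp] = pb_mor[OF pb]
  have "\<exists>!m. m \<in> hom C (src (\<sigma> i j \<cdot> pb2 C (\<sigma> j k) (\<tau> i j))) (src (\<sigma> i k)) \<and>
    (\<forall>x\<in>hom A i j \<times> hom A j k. m \<cdot> (case x of (f, g) \<Rightarrow> lifted g f) = (case x of (f, g) \<Rightarrow> sec (g \<star> f)))"
  proof (rule E.extend)
    fix x assume "x \<in> hom A i j \<times> hom A j k"
    then obtain f g where x: "x = (f, g)" and f: "f \<in> hom A i j" and g: "g \<in> hom A j k" by blast
    show "(case x of (f, g) \<Rightarrow> sec (g \<star> f)) \<in> hom C (tgt (\<sigma> i j \<cdot> pb2 C (\<sigma> j k) (\<tau> i j))) (src (\<sigma> i k))"
      using f g x by auto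
    show "\<rho> (case x of (f, g) \<Rightarrow> sec (g \<star> f)) = \<rho> (case x of (f, g) \<Rightarrow> lifted g f)"
      using f g x lifted(5)[OF f g] by auto
  next
    fix x y d assume "x \<in> hom A i j \<times> hom A j k" "y \<in> hom A i j \<times> hom A j k"
    then obtain f g f' g' where x: "x = (f, g)" "y = (f', g')" and f: "f \<in> hom A i j" and g: "g \<in> hom A j k"
      and f': "f' \<in> hom A i j" and g': "g' \<in> hom A j k" by blast
    assume "d \<in> rid C (tgt (\<sigma> i j \<cdot> pb2 C (\<sigma> j k) (\<tau> i j)))"
      and "\<rho> (case x of (f, g) \<Rightarrow> lifted g f) \<cdot> d = d" "\<rho> (case y of (f, g) \<Rightarrow> lifted g f) \<cdot> d = d"
      and "(case x of (f, g) \<Rightarrow> lifted g f) \<cdot> d = (case y of (f, g) \<Rightarrow> lifted g f) \<cdot> d"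
    then have d: "d \<in> rid C (FO P i)" and rd: "\<rho> (FA P g \<cdot> FA P f) \<cdot> d = d" "\<rho> (FA P g' \<cdot> FA P f') \<cdot> d = d"
      and eq: "lifted g f \<cdot> d = lifted g' f' \<cdot> d"
      using lifted(5)[OF f g] lifted(5)[OF f' g'] by (simp_all add: x)
    note dm [simp] = rid_mor(1-4)[OF d]
    have m: "f \<in> Mor A" "src f = i" "tgt f = j" "g \<in> Mor A" "src g = j" "tgt g = k"
      "f' \<in> Mor A" "src f' = i" "tgt f' = j" "g' \<in> Mor A" "src g' = j" "tgt g' = k" using f g f' g' by auto
    note lm = lifted(1)[OF f g] lifted(1)[OF f' g']
    have eqg: "sec g \<cdot> (FA P f \<cdot> d) = sec g' \<cdot> (FA P f' \<cdot> d)"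
      using arg_cong[OF eq, of "\<lambda>z. pb1 C (\<sigma> j k) (\<tau> i j) \<cdot> z"] lm m
        cmp_reassoc[OF lifted(3)[OF f g], of d] cmp_reassoc[OF lifted(3)[OF f' g'], of d] by simp
    have eqf: "sec f \<cdot> d = sec f' \<cdot> d"
      using arg_cong[OF eq, of "\<lambda>z. pb2 C (\<sigma> j k) (\<tau> i j) \<cdot> z"] lm m rd
        cmp_reassoc[OF lifted(4)[OF f g], of d] cmp_reassoc[OF lifted(4)[OF f' g'], of d] by simp
    have "sec (g \<star> f) \<cdot> d = sec (g' \<star> f') \<cdot> d"
    proof (rule join_eq_local[OF _ cover_precomp[OF _ eqx_join[OF f f'], of d "FO P i"]])
      have E: "FA P ` agree f f' \<subseteq> rid C (FO P i)" using agree_img[of f f'] m by simp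
      then show "FA P ` agree f f' \<subseteq> rid C (FO P i)" .
      show "(\<lambda>e. \<rho> (e \<cdot> d)) ` FA P ` agree f f' \<subseteq> rid C (FO P i)"
        using subsetD[OF E] rid_mor[of _ "FO P i"] by auto
      have "\<rho> (FA P f) \<cdot> d = d"
        using rd(1) cmp_reassoc[OF rst_cmp_absorb'[of "FA P f" "FA P g"], of d] m by simp
      then have c: "eqx f f' \<cdot> d = d" using eqx_cmp[OF f f' _ _ eqf] by simp
      show "sec (g \<star> f) \<cdot> d \<cdot> \<rho> (eqx f f' \<cdot> d) = sec (g \<star> f) \<cdot> d"
        "sec (g' \<star> f') \<cdot> d \<cdot> \<rho> (eqx f f' \<cdot> d) = sec (g' \<star> f') \<cdot> d"
        using c m rid_mor(5)[OF d] by simp_all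
      fix w assume "w \<in> (\<lambda>e. \<rho> (e \<cdot> d)) ` FA P ` agree f f'"
      then obtain e where e: "e \<in> agree f f'" "w = \<rho> (FA P e \<cdot> d)" by blast
      note a = agreeD[OF e(1)]
      have er: "e \<in> rid A i" using a m by simp
      note pe = P_rid[OF er]
      have w: "w = FA P e \<cdot> d" "w \<in> rid C (FO P i)" using e rid_cmp[OF pe d] by (auto simp: rid_iff)
      note [simp] = A.rid_mor(1-4)[OF er]
      have dw: "d \<cdot> w = FA P e \<cdot> d" using w(1) rid_comm[OF pe d] rid_idem_cmp[OF d, of "FA P e"] by simp
      have gfe: "sec (l \<star> h) \<cdot> (d \<cdot> w) = sec (l \<star> (h \<star> e)) \<cdot> d" if "h \<in> hom A i j" "l \<in> hom A j k" for h l
        using sec_cmp_rid[of "l \<star> h" e] er that by (auto simp: dw)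
      have "FA P f \<cdot> FA P e = FA P f' \<cdot> FA P e" using arg_cong[OF a(2), of "FA P"] m by simp
      then have PP: "FA P (f \<star> e) \<cdot> d = FA P f \<cdot> (d \<cdot> w)" "FA P (f \<star> e) \<cdot> d = FA P f' \<cdot> (d \<cdot> w)"
        using m cmp_reassoc[of "FA P f" "FA P e" "FA P f' \<cdot> FA P e" d] by (simp_all add: dw)
      \<comment> \<open>On \<open>w\<close> the arrow \<open>f\<close> may be replaced by
        \<open>f \<star> e\<close>, which is also \<open>f' \<star> e\<close>; after that only
        \<open>g\<close> has to change.\<close>
      have "sec (g \<star> f) \<cdot> (d \<cdot> w) = sec (g \<star> (f \<star> e)) \<cdot> d" using gfe[OF f g] .
      also have "\<dots> = sec (g' \<star> (f \<star> e)) \<cdot> d"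
      proof (rule sec_precomp[of _ i j _ k])
        have "sec g \<cdot> (FA P f \<cdot> (d \<cdot> w)) = sec g' \<cdot> (FA P f' \<cdot> (d \<cdot> w))"
          using arg_cong[OF eqg, of "\<lambda>z. z \<cdot> w"] m rid_mor[OF w(2)] by simp
        then show "sec g \<cdot> (FA P (f \<star> e) \<cdot> d) = sec g' \<cdot> (FA P (f \<star> e) \<cdot> d)" using PP by simp
      qed (use m g g' in auto)
      also have "\<dots> = sec (g' \<star> f') \<cdot> (d \<cdot> w)" using gfe[OF f' g'] a(2) by simp
      finally show "sec (g \<star> f) \<cdot> d \<cdot> w = sec (g' \<star> f') \<cdot> d \<cdot> w" using m rid_mor[OF w(2)] by simp
    qed (use m in auto)
    then show "(case x of (f, g) \<Rightarrow> sec (g \<star> f)) \<cdot> d = (case y of (f, g) \<Rightarrow> sec (g \<star> f)) \<cdot> d" by (simp add: x)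
  qed simp
  then show ?thesis by (simp del: in_hom)
qed

lemma Mu:
  "Psi_mu C X i j k \<in> hom C (pb_obj C (\<sigma> j k) (\<tau> i j)) (src (\<sigma> i k))"
  "\<lbrakk>f \<in> hom A i j; g \<in> hom A j k\<rbrakk> \<Longrightarrow> Psi_mu C X i j k \<cdot> lifted g f = sec (g \<star> f)"
proof -
  let ?m = "THE m. m \<in> hom C (pb_obj C (\<sigma> j k) (\<tau> i j)) (src (\<sigma> i k)) \<and>
    (\<forall>f\<in>hom A i j. \<forall>g\<in>hom A j k. m \<cdot> lifted g f = sec (g \<star> f))"
  have t: "?m \<in> hom C (pb_obj C (\<sigma> j k) (\<tau> i j)) (src (\<sigma> i k)) \<and>
    (\<forall>f\<in>hom A i j. \<forall>g\<in>hom A j k. ?m \<cdot> lifted g f = sec (g \<star> f))"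
    by (rule theI'[OF mu_unique])
  \<comment> \<open>\<open>Psi_mu\<close> brackets the composite to the left, \<open>lifted\<close>
    to the right. Associativity is available only for well-typed \<open>m\<close>, so the two
    descriptions are compared under the typing condition.\<close>
  have "m \<in> hom C (pb_obj C (\<sigma> j k) (\<tau> i j)) (src (\<sigma> i k)) \<Longrightarrow> f \<in> hom A i j \<Longrightarrow> g \<in> hom A j k \<Longrightarrow>
    m \<cdot> pb_lift C (\<sigma> j k) (\<tau> i j) (sec g) \<cdot> sec f = m \<cdot> lifted g f" for m f g
    using lift_sec[of g] by simp
  then have "Psi_mu C X i j k = ?m"
    unfolding Psi_mu_def fst_conv by (intro arg_cong[of _ _ The] ext conj_cong refl ball_cong) auto
  then show "Psi_mu C X i j k \<in> hom C (pb_obj C (\<sigma> j k) (\<tau> i j)) (src (\<sigma> i k))"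
    "\<lbrakk>f \<in> hom A i j; g \<in> hom A j k\<rbrakk> \<Longrightarrow> Psi_mu C X i j k \<cdot> lifted g f = sec (g \<star> f)"
    using t by auto
qed

end

text \<open>The form of \<open>local_eq\<close> for \<open>\<sigma> i j\<close>: the element may be
  taken to be \<open>sec f \<cdot> x\<close>, provided that both sides of the equation have its
  domain.\<close>

lemma elem_local:
  assumes ij: "i \<in> Obj A" "j \<in> Obj A" and a: "a \<in> hom C W (src (\<sigma> i j))"
    and h: "h \<in> hom C W Y" "\<rho> h = \<rho> a" and k: "k \<in> hom C W Y" "\<rho> k = \<rho> a"
    and eq: "\<And>f w x. \<lbrakk>f \<in> hom A i j; w \<in> rid C W; x \<in> hom C W (FO P i); a \<cdot> w = sec f \<cdot> x; \<rho> x = w;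
      x = \<sigma> i j \<cdot> (a \<cdot> w); \<rho> (a \<cdot> w) = w\<rbrakk> \<Longrightarrow> h \<cdot> w = k \<cdot> w"
  shows "h = k"
proof -
  interpret E: etale_family C "\<sigma> i j" "hom A i j" sec "ide i j" by (rule etale[OF ij])
  show ?thesis
  proof (rule E.local_eq[OF a h(1) _ k(1)])
    show "h \<cdot> \<rho> a = h" "k \<cdot> \<rho> a = k"
      using h k cmp_rst_self[of h] cmp_rst_self[of k] by simp_all
    fix f w assume f: "f \<in> hom A i j" and w: "w \<in> rid C W" "a \<cdot> w = sec f \<cdot> (\<sigma> i j \<cdot> (a \<cdot> w))" "\<rho> (a \<cdot> w) = w"
    have am: "a \<in> Mor C" "src a = W" "tgt a = src (\<sigma> i j)" using a by auto
    have xm: "\<sigma> i j \<cdot> (a \<cdot> w) \<in> hom C W (FO P i)" using am rid_mor[OF w(1)] ij by simp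
    have "\<rho> (\<sigma> i j \<cdot> (a \<cdot> w)) = w"
      using am rid_mor[OF w(1)] ij w(3) rst_cmp_total[of "\<sigma> i j" "a \<cdot> w"] by simp
    then show "h \<cdot> w = k \<cdot> w" using eq[OF f w(1) xm w(2) _ refl w(3)] by simp
  qed
qed

lemma Psi_mu_unfold: "mul C \<Psi> i j k b a = Psi_mu C X i j k \<cdot> pb_pair C (\<sigma> j k) (\<tau> i j) b a"
  by (simp add: mul_def)

text \<open>By \<open>r\<close> the element \<open>x\<close> lies in the domain of
  \<open>FA P g \<cdot> FA P f\<close>; there the pair is the lifted pair of sections precomposed
  with \<open>x\<close>, at which \<open>Psi_mu\<close> is known.\<close>

lemma mul_sec:
  assumes f: "f \<in> hom A i j" and g: "g \<in> hom A j k" and x: "x \<in> Mor C" "tgt x = FO P i"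
    and r: "\<rho> (FA P g \<cdot> (FA P f \<cdot> x)) = \<rho> x"
  shows "mul C \<Psi> i j k (sec g \<cdot> (FA P f \<cdot> x)) (sec f \<cdot> x) = sec (g \<star> f) \<cdot> x"
proof -
  have ijk: "i \<in> Obj A" "j \<in> Obj A" "k \<in> Obj A" using f g by auto
  have m: "f \<in> Mor A" "src f = i" "tgt f = j" "g \<in> Mor A" "src g = j" "tgt g = k" using f g by auto
  note l = lifted[OF ijk f g] and pb = pb[OF ijk]
  have "\<rho> (FA P g \<cdot> FA P f) \<cdot> x = x"
    using rst_shift[of x "FA P g \<cdot> FA P f"] m x r by simp
  then have "sec f \<cdot> \<rho> (FA P g \<cdot> FA P f) \<cdot> x = sec f \<cdot> x" using m x by simp
  moreover have "\<sigma> j k \<cdot> (sec g \<cdot> FA P f) = \<tau> i j \<cdot> (sec f \<cdot> \<rho> (FA P g \<cdot> FA P f))"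
  proof -
    have "\<sigma> j k \<cdot> (sec g \<cdot> FA P f) = FA P f \<cdot> \<rho> (FA P g \<cdot> FA P f)" using \<sigma>_sec_cmp[of g "FA P f"] m by simp
    then show ?thesis using \<tau>_sec_cmp[of f "\<rho> (FA P g \<cdot> FA P f)"] m by simp
  qed
  ultimately have "lifted i j k g f \<cdot> x = pb_pair C (\<sigma> j k) (\<tau> i j) (sec g \<cdot> (FA P f \<cdot> x)) (sec f \<cdot> x)"
    unfolding l(2) by (subst pair_cmp[OF pb]) (use m x in auto)
  moreover have "Psi_mu C X i j k \<cdot> (lifted i j k g f \<cdot> x) = sec (g \<star> f) \<cdot> x"
    using cmp_reassoc[OF Mu(2)[OF ijk f g], of x] Mu(1)[OF ijk] l(1) x m by simp
  ultimately show ?thesis by (simp add: Psi_mu_unfold)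
qed

text \<open>Established before units and associativity, whose proofs already use \<open>mul\<close>
  with its source and target laws. Both laws are tested on lifted pairs of sections.\<close>

sublocale G: partite_graph C \<Psi>
proof (unfold_locales, simp_all only: Psi_simps)
  fix i j assume "i \<in> Obj A" "j \<in> Obj A"
  then show "admits_pullbacks C (\<sigma> i j)" by (rule \<sigma>_pullbacks)
next
  fix i j k assume ijk: "i \<in> Obj A" "j \<in> Obj A" "k \<in> Obj A"
  interpret E: etale_family C "\<sigma> i j \<cdot> pb2 C (\<sigma> j k) (\<tau> i j)" "hom A i j \<times> hom A j k"
    "\<lambda>(f, g). lifted i j k g f"
    "\<lambda>(f, g). \<rho> (ide j k g \<cdot> pb1 C (\<sigma> j k) (\<tau> i j)) \<cdot> \<rho> (ide i j f \<cdot> pb2 C (\<sigma> j k) (\<tau> i j))"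
    by (rule etale_comp[OF ijk])
  note pm [simp] = pb_mor[OF pb[OF ijk]] ijk
  note Mu = Mu[OF ijk]
  show "Psi_mu C X i j k \<in> hom C (pb_obj C (\<sigma> j k) (\<tau> i j)) (src (\<sigma> i k))" by (rule Mu(1))
  have mm [simp]: "Psi_mu C X i j k \<in> Mor C" "src (Psi_mu C X i j k) = pb_obj C (\<sigma> j k) (\<tau> i j)"
    "tgt (Psi_mu C X i j k) = src (\<sigma> i k)" using Mu(1) by auto
  show "\<sigma> i k \<cdot> Psi_mu C X i j k = \<sigma> i j \<cdot> pb2 C (\<sigma> j k) (\<tau> i j)"
  proof (rule E.eq_on_sections)
    fix x assume "x \<in> hom A i j \<times> hom A j k"
    then obtain f g where x: "x = (f, g)" and f: "f \<in> hom A i j" and g: "g \<in> hom A j k" by blast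
    have m: "f \<in> Mor A" "src f = i" "tgt f = j" "g \<in> Mor A" "src g = j" "tgt g = k" using f g by auto
    note l = lifted[OF ijk f g]
    have lm: "lifted i j k g f \<in> Mor C" "src (lifted i j k g f) = FO P i"
      "tgt (lifted i j k g f) = pb_obj C (\<sigma> j k) (\<tau> i j)" using l(1) by auto
    have "\<sigma> i k \<cdot> (Psi_mu C X i j k \<cdot> lifted i j k g f) = \<rho> (FA P g \<cdot> FA P f)"
      using Mu(2)[OF f g] sec(4)[of "g \<star> f"] m by simp
    moreover have "\<sigma> i j \<cdot> (pb2 C (\<sigma> j k) (\<tau> i j) \<cdot> lifted i j k g f) = \<rho> (FA P g \<cdot> FA P f)"
      using l(4) cmp_reassoc[OF sec(4), of f "\<rho> (FA P g \<cdot> FA P f)"] m by simp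
    ultimately show "\<sigma> i k \<cdot> Psi_mu C X i j k \<cdot> (case x of (f, g) \<Rightarrow> lifted i j k g f)
      = \<sigma> i j \<cdot> pb2 C (\<sigma> j k) (\<tau> i j) \<cdot> (case x of (f, g) \<Rightarrow> lifted i j k g f)"
      unfolding x split using assoc[OF lm(1) mm(1), of "\<sigma> i k"] assoc[OF lm(1) pm(4), of "\<sigma> i j"] lm by simp
  qed auto
  show "\<tau> i k \<cdot> Psi_mu C X i j k = \<tau> j k \<cdot> pb1 C (\<sigma> j k) (\<tau> i j)"
  proof (rule E.eq_on_sections)
    fix x assume "x \<in> hom A i j \<times> hom A j k"
    then obtain f g where x: "x = (f, g)" and f: "f \<in> hom A i j" and g: "g \<in> hom A j k" by blast
    have m: "f \<in> Mor A" "src f = i" "tgt f = j" "g \<in> Mor A" "src g = j" "tgt g = k" using f g by auto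
    note l = lifted[OF ijk f g]
    have lm: "lifted i j k g f \<in> Mor C" "src (lifted i j k g f) = FO P i"
      "tgt (lifted i j k g f) = pb_obj C (\<sigma> j k) (\<tau> i j)" using l(1) by auto
    have "\<tau> i k \<cdot> (Psi_mu C X i j k \<cdot> lifted i j k g f) = FA P g \<cdot> FA P f"
      using Mu(2)[OF f g] \<tau>_sec[of i k "g \<star> f"] m by simp
    moreover have "\<tau> j k \<cdot> (pb1 C (\<sigma> j k) (\<tau> i j) \<cdot> lifted i j k g f) = FA P g \<cdot> FA P f"
      using l(3) \<tau>_sec_cmp[of g "FA P f"] m by simp
    ultimately show "\<tau> i k \<cdot> Psi_mu C X i j k \<cdot> (case x of (f, g) \<Rightarrow> lifted i j k g f)
      = \<tau> j k \<cdot> pb1 C (\<sigma> j k) (\<tau> i j) \<cdot> (case x of (f, g) \<Rightarrow> lifted i j k g f)"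
      unfolding x split using assoc[OF lm(1) mm(1), of "\<tau> i k"] assoc[OF lm(1) pm(1), of "\<tau> j k"] lm by simp
  qed auto
qed simp_all

text \<open>First \<open>a\<close> is localized and then, on each resulting piece, \<open>b\<close>.
  Its base point needs no new variable because composability determines it from
  \<open>a\<close>.\<close>

lemma elem_local2:
  assumes ijk: "i \<in> Obj A" "j \<in> Obj A" "k \<in> Obj A" and c: "G.composable i j k b a"
    and h: "h \<in> hom C (src a) Y" "\<rho> h = \<rho> a" and h': "h' \<in> hom C (src a) Y" "\<rho> h' = \<rho> a"
    and eq: "\<And>f g w x. \<lbrakk>f \<in> hom A i j; g \<in> hom A j k; w \<in> rid C (src a); x \<in> hom C (src a) (FO P i);
      a \<cdot> w = sec f \<cdot> x; b \<cdot> w = sec g \<cdot> (FA P f \<cdot> x); \<rho> x = w; \<rho> (FA P g \<cdot> (FA P f \<cdot> x)) = w;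
      x = \<sigma> i j \<cdot> (a \<cdot> w); \<rho> (a \<cdot> w) = w\<rbrakk> \<Longrightarrow> h \<cdot> w = h' \<cdot> w"
  shows "h = h'"
proof -
  have cm: "a \<in> Mor C" "b \<in> Mor C" "src b = src a" "tgt a = src (\<sigma> i j)" "tgt b = src (\<sigma> j k)"
    and cs: "\<sigma> j k \<cdot> b = \<tau> i j \<cdot> a" using c by (simp_all add: G.composable_def)
  have rab: "\<rho> a = \<rho> b" using rst_cmp_total[of "\<sigma> j k" b] rst_cmp_total[of "\<tau> i j" a] cm cs ijk by simp
  note [simp] = cm ijk
  show ?thesis
  proof (rule elem_local[OF ijk(1,2) _ h h'])
    show "a \<in> hom C (src a) (src (\<sigma> i j))" by simp
    fix f w x assume f: "f \<in> hom A i j" and w: "w \<in> rid C (src a)" and x: "x \<in> hom C (src a) (FO P i)"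
      and aw: "a \<cdot> w = sec f \<cdot> x" and xw: "\<rho> x = w" "x = \<sigma> i j \<cdot> (a \<cdot> w)" "\<rho> (a \<cdot> w) = w"
    note wm [simp] = rid_mor(1-4)[OF w]
    have [simp]: "x \<in> Mor C" "src x = src a" "tgt x = FO P i" using x by auto
    have fm: "f \<in> Mor A" "src f = i" "tgt f = j" using f by auto
    have hm: "h \<in> Mor C" "src h = src a" "tgt h = Y" "h' \<in> Mor C" "src h' = src a" "tgt h' = Y"
      using h h' by auto
    show "h \<cdot> w = h' \<cdot> w"
    proof (rule elem_local[OF ijk(2,3), of "b \<cdot> w" "src a"])
      show "b \<cdot> w \<in> hom C (src a) (src (\<sigma> j k))" "h \<cdot> w \<in> hom C (src a) Y" "h' \<cdot> w \<in> hom C (src a) Y"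
        using hm by simp_all
      show "\<rho> (h \<cdot> w) = \<rho> (b \<cdot> w)" "\<rho> (h' \<cdot> w) = \<rho> (b \<cdot> w)"
        using hm h(2) h'(2) rab by (simp_all add: rst_cmp_rid[OF w])
      fix g v y assume g: "g \<in> hom A j k" and v: "v \<in> rid C (src a)" and y: "y \<in> hom C (src a) (FO P j)"
        and bv: "b \<cdot> w \<cdot> v = sec g \<cdot> y" and yv: "\<rho> y = v" "y = \<sigma> j k \<cdot> (b \<cdot> w \<cdot> v)" "\<rho> (b \<cdot> w \<cdot> v) = v"
      note vm [simp] = rid_mor(1-4)[OF v]
      have gm: "g \<in> Mor A" "src g = j" "tgt g = k" using g by auto
      \<comment> \<open>The base point of \<open>b\<close> is the target of \<open>a\<close>, and
        \<open>\<tau>\<close> sends \<open>sec f\<close> at \<open>x\<close> to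
        \<open>FA P f\<close> at \<open>x\<close>.\<close>
      have yy: "y = FA P f \<cdot> (x \<cdot> v)"
      proof -
        have "y = \<tau> i j \<cdot> (a \<cdot> w \<cdot> v)" using yv(2) cmp_reassoc[OF cs, of "w \<cdot> v"] by simp
        also have "\<dots> = \<tau> i j \<cdot> (sec f \<cdot> (x \<cdot> v))" using fm by (simp only: aw) simp
        finally show ?thesis using \<tau>_sec_cmp[of f "x \<cdot> v"] fm by simp
      qed
      have wv: "w \<cdot> v = v"
      proof -
        have "\<rho> (b \<cdot> w \<cdot> v) = \<rho> (a \<cdot> w) \<cdot> v" using rst_cmp_rid[OF v, of "b \<cdot> w"] rst_cmp_rid[OF w] rab by simp
        then show ?thesis using xw yv by simp
      qed
      have "h \<cdot> (w \<cdot> v) = h' \<cdot> (w \<cdot> v)"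
      proof (rule eq[OF f g, of _ "x \<cdot> v"])
        show "w \<cdot> v \<in> rid C (src a)" using rid_cmp w v by blast
        show "x \<cdot> v \<in> hom C (src a) (FO P i)" by simp
        show "a \<cdot> (w \<cdot> v) = sec f \<cdot> (x \<cdot> v)" using cmp_reassoc[OF aw, of v] fm by simp
        show "b \<cdot> (w \<cdot> v) = sec g \<cdot> (FA P f \<cdot> (x \<cdot> v))" using bv yy by simp
        show "\<rho> (x \<cdot> v) = w \<cdot> v" using rst_cmp_rid[OF v, of x] xw by simp
        show "x \<cdot> v = \<sigma> i j \<cdot> (a \<cdot> (w \<cdot> v))" by (subst xw(2)) simp
        show "\<rho> (a \<cdot> (w \<cdot> v)) = w \<cdot> v" using rst_cmp_rid[OF v, of "a \<cdot> w"] xw by simp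
        have "\<rho> (FA P g \<cdot> (FA P f \<cdot> (x \<cdot> v))) = \<rho> (sec g \<cdot> (FA P f \<cdot> (x \<cdot> v)))"
          by (rule rst_cmp_eq) (use fm gm in auto)
        also have "\<dots> = \<rho> (b \<cdot> w \<cdot> v)" by (simp only: bv yy)
        finally show "\<rho> (FA P g \<cdot> (FA P f \<cdot> (x \<cdot> v))) = w \<cdot> v" using yv wv by simp
      qed
      then show "h \<cdot> w \<cdot> v = h' \<cdot> w \<cdot> v" using hm by simp
    qed
  qed
qed

lemma Psi_mul_unit_right:
  assumes ij [simp]: "i \<in> Obj A" "j \<in> Obj A"
  shows "mul C \<Psi> i i j (Idn C (src (\<sigma> i j))) (sec (Idn A i) \<cdot> \<sigma> i j) = Idn C (src (\<sigma> i j))"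
proof -
  interpret E: etale_family C "\<sigma> i j" "hom A i j" sec "ide i j" by (rule etale[OF ij])
  have s1: "sec (Idn A i) \<in> Mor C" "src (sec (Idn A i)) = FO P i" "tgt (sec (Idn A i)) = src (\<sigma> i i)"
    using sec[of "Idn A i"] by simp_all
  have t1: "\<tau> i i \<cdot> (sec (Idn A i) \<cdot> y) = y" if "y \<in> Mor C" "tgt y = FO P i" for y
    using \<tau>_sec_cmp[of "Idn A i" y] that by simp
  have c: "G.composable i i j (Idn C (src (\<sigma> i j))) (sec (Idn A i) \<cdot> \<sigma> i j)"
    using s1 t1[of "\<sigma> i j"] by (simp add: G.composable_def)
  note m = G.mul[OF _ _ _ c, simplified] and mc = G.mul_cmp[OF _ _ _ c]
  show ?thesis
  proof (rule E.eq_on_sections)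
    fix f assume f: "f \<in> hom A i j"
    then have fm: "f \<in> Mor A" "src f = i" "tgt f = j" by auto
    have "mul C \<Psi> i i j (Idn C (src (\<sigma> i j))) (sec (Idn A i) \<cdot> \<sigma> i j) \<cdot> sec f
      = mul C \<Psi> i i j (sec f) (sec (Idn A i) \<cdot> \<rho> (FA P f))"
      using mc[of "sec f"] fm sec(4)[of f] s1 by simp
    \<comment> \<open>The image of an identity is inserted to give the pair the shape required by
      \<open>mul_sec\<close>.\<close>
    also have "\<dots> = mul C \<Psi> i i j (sec f \<cdot> (FA P (Idn A i) \<cdot> \<rho> (FA P f))) (sec (Idn A i) \<cdot> \<rho> (FA P f))"
      using fm cmp_rst_self[of "sec f"] by simp
    also have "\<dots> = sec (f \<star> Idn A i) \<cdot> \<rho> (FA P f)"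
      by (rule mul_sec) (use fm f in auto)
    finally show "mul C \<Psi> i i j (Idn C (src (\<sigma> i j))) (sec (Idn A i) \<cdot> \<sigma> i j) \<cdot> sec f = Idn C (src (\<sigma> i j)) \<cdot> sec f"
      using fm cmp_rst_self[of "sec f"] by simp
  qed (use m s1 in auto)
qed

lemma Psi_mul_unit_left:
  assumes ij [simp]: "i \<in> Obj A" "j \<in> Obj A"
  shows "mul C \<Psi> i j j (sec (Idn A j) \<cdot> \<tau> i j) (Idn C (src (\<sigma> i j))) = Idn C (src (\<sigma> i j))"
proof -
  interpret E: etale_family C "\<sigma> i j" "hom A i j" sec "ide i j" by (rule etale[OF ij])
  have s1: "sec (Idn A j) \<in> Mor C" "src (sec (Idn A j)) = FO P j" "tgt (sec (Idn A j)) = src (\<sigma> j j)"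
    using sec[of "Idn A j"] by simp_all
  have t1: "\<sigma> j j \<cdot> (sec (Idn A j) \<cdot> y) = y" if "y \<in> Mor C" "tgt y = FO P j" for y
    using \<sigma>_sec_cmp[of "Idn A j" y] that by simp
  have c: "G.composable i j j (sec (Idn A j) \<cdot> \<tau> i j) (Idn C (src (\<sigma> i j)))"
    using s1 t1[of "\<tau> i j"] by (simp add: G.composable_def)
  note m = G.mul[OF _ _ _ c, simplified] and mc = G.mul_cmp[OF _ _ _ c]
  show ?thesis
  proof (rule E.eq_on_sections)
    fix f assume f: "f \<in> hom A i j"
    then have fm: "f \<in> Mor A" "src f = i" "tgt f = j" by auto
    have "mul C \<Psi> i j j (sec (Idn A j) \<cdot> \<tau> i j) (Idn C (src (\<sigma> i j))) \<cdot> sec f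
      = mul C \<Psi> i j j (sec (Idn A j) \<cdot> FA P f) (sec f)"
      using mc[of "sec f"] fm \<tau>_sec[OF ij f] s1 by simp
    also have "\<dots> = mul C \<Psi> i j j (sec (Idn A j) \<cdot> (FA P f \<cdot> \<rho> (FA P f))) (sec f \<cdot> \<rho> (FA P f))"
      using fm cmp_rst_self[of "sec f"] by simp
    also have "\<dots> = sec (Idn A j \<star> f) \<cdot> \<rho> (FA P f)"
      by (rule mul_sec) (use fm f in auto)
    finally show "mul C \<Psi> i j j (sec (Idn A j) \<cdot> \<tau> i j) (Idn C (src (\<sigma> i j))) \<cdot> sec f = Idn C (src (\<sigma> i j)) \<cdot> sec f"
      using fm cmp_rst_self[of "sec f"] by simp
  qed (use m s1 in auto)
qed

text \<open>After localizing \<open>a\<close> and \<open>b\<close> together and then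
  \<open>c\<close>, both bracketings become the section of a triple composite in \<open>A\<close>,
  where associativity is known.\<close>

lemma Psi_mul_assoc:
  assumes I [simp]: "i \<in> Obj A" "j \<in> Obj A" "k \<in> Obj A" "l \<in> Obj A"
    and ba: "G.composable i j k b a" and cb: "G.composable j k l c b"
  shows "mul C \<Psi> i k l c (mul C \<Psi> i j k b a) = mul C \<Psi> i j l (mul C \<Psi> j k l c b) a"
proof -
  have I': "i \<in> Ix \<Psi>" "j \<in> Ix \<Psi>" "k \<in> Ix \<Psi>" "l \<in> Ix \<Psi>" by simp_all
  note mba = G.mul[OF I'(1-3) ba] and mcb = G.mul[OF I'(2-4) cb]
  have m [simp]: "a \<in> Mor C" "b \<in> Mor C" "c \<in> Mor C" "src b = src a" "src c = src a"
    "tgt a = src (\<sigma> i j)" "tgt b = src (\<sigma> j k)" "tgt c = src (\<sigma> k l)"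
    and eqs: "\<sigma> j k \<cdot> b = \<tau> i j \<cdot> a" "\<sigma> k l \<cdot> c = \<tau> j k \<cdot> b"
    using ba cb by (simp_all add: G.composable_def)
  have c1: "G.composable i k l c (mul C \<Psi> i j k b a)" using mba eqs by (simp add: G.composable_def)
  have c2: "G.composable i j l (mul C \<Psi> j k l c b) a" using mcb eqs by (simp add: G.composable_def)
  note m1 = G.mul[OF I'(1,3,4) c1] and m2 = G.mul[OF I'(1,2,4) c2]
  have r: "\<rho> b = \<rho> a" "\<rho> c = \<rho> a"
    using rst_cmp_total[of "\<sigma> j k" b] rst_cmp_total[of "\<tau> i j" a]
      rst_cmp_total[of "\<sigma> k l" c] rst_cmp_total[of "\<tau> j k" b] eqs by simp_all
  show ?thesis
  proof (rule elem_local2[OF I(1-3) ba])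
    show "mul C \<Psi> i k l c (mul C \<Psi> i j k b a) \<in> hom C (src a) (src (\<sigma> i l))"
      "mul C \<Psi> i j l (mul C \<Psi> j k l c b) a \<in> hom C (src a) (src (\<sigma> i l))"
      "\<rho> (mul C \<Psi> i k l c (mul C \<Psi> i j k b a)) = \<rho> a"
      "\<rho> (mul C \<Psi> i j l (mul C \<Psi> j k l c b) a) = \<rho> a"
      using m1 m2 mba by simp_all
    fix f g w x assume f: "f \<in> hom A i j" and g: "g \<in> hom A j k" and w: "w \<in> rid C (src a)"
      and x: "x \<in> hom C (src a) (FO P i)" and aw: "a \<cdot> w = sec f \<cdot> x" and bw: "b \<cdot> w = sec g \<cdot> (FA P f \<cdot> x)"
      and xw: "\<rho> x = w" "\<rho> (FA P g \<cdot> (FA P f \<cdot> x)) = w" "\<rho> (a \<cdot> w) = w"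
    note wm [simp] = rid_mor(1-4)[OF w]
    have xm [simp]: "x \<in> Mor C" "src x = src a" "tgt x = FO P i" using x by auto
    have fm: "f \<in> Mor A" "src f = i" "tgt f = j" and gm: "g \<in> Mor A" "src g = j" "tgt g = k" using f g by auto
    show "mul C \<Psi> i k l c (mul C \<Psi> i j k b a) \<cdot> w = mul C \<Psi> i j l (mul C \<Psi> j k l c b) a \<cdot> w"
    proof (rule elem_local[OF I(3,4), of "c \<cdot> w" "src a"])
      show "c \<cdot> w \<in> hom C (src a) (src (\<sigma> k l))" by simp
      show "mul C \<Psi> i k l c (mul C \<Psi> i j k b a) \<cdot> w \<in> hom C (src a) (src (\<sigma> i l))"
        "mul C \<Psi> i j l (mul C \<Psi> j k l c b) a \<cdot> w \<in> hom C (src a) (src (\<sigma> i l))"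
        using m1 m2 mba by simp_all
      show "\<rho> (mul C \<Psi> i k l c (mul C \<Psi> i j k b a) \<cdot> w) = \<rho> (c \<cdot> w)"
        "\<rho> (mul C \<Psi> i j l (mul C \<Psi> j k l c b) a \<cdot> w) = \<rho> (c \<cdot> w)"
        using m1 m2 mba r by (simp_all add: rst_cmp_rid[OF w])
      fix h v y assume h: "h \<in> hom A k l" and v: "v \<in> rid C (src a)" and y: "y \<in> hom C (src a) (FO P k)"
        and cv: "c \<cdot> w \<cdot> v = sec h \<cdot> y" and yv: "\<rho> y = v" "y = \<sigma> k l \<cdot> (c \<cdot> w \<cdot> v)" "\<rho> (c \<cdot> w \<cdot> v) = v"
      note vm [simp] = rid_mor(1-4)[OF v]
      have hm: "h \<in> Mor A" "src h = k" "tgt h = l" using h by auto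
      \<comment> \<open>The base point shared by the three elements on the final piece
        \<open>v\<close>: there \<open>a\<close>, \<open>b\<close> and \<open>c\<close> are
        \<open>sec f\<close> at \<open>z\<close>, \<open>sec g\<close> at
        \<open>FA P f \<cdot> z\<close> and \<open>sec h\<close> at
        \<open>FA P g \<cdot> (FA P f \<cdot> z)\<close>.\<close>
      define z where "z = x \<cdot> v"
      have z [simp]: "z \<in> Mor C" "src z = src a" "tgt z = FO P i" by (simp_all add: z_def)
      have wv: "w \<cdot> v = v"
      proof -
        have "\<rho> (c \<cdot> w \<cdot> v) = \<rho> (a \<cdot> w) \<cdot> v" using rst_cmp_rid[OF v, of "c \<cdot> w"] rst_cmp_rid[OF w] r by simp
        then show ?thesis using xw yv by simp
      qed
      have rz: "\<rho> z = v" using rst_cmp_rid[OF v, of x] xw wv by (simp add: z_def)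
      have rgz: "\<rho> (FA P g \<cdot> (FA P f \<cdot> z)) = v"
        using rst_cmp_rid[OF v, of "FA P g \<cdot> (FA P f \<cdot> x)"] xw(2) wv fm gm by (simp add: z_def)
      have rfz: "\<rho> (FA P f \<cdot> z) = v"
        using rgz rz rst_cmp_absorb[of z "FA P f"] rst_cmp_absorb[of "FA P f \<cdot> z" "FA P g"] rid_comm[OF v, of "\<rho> (FA P f \<cdot> z)"] fm gm by simp
      have az: "a \<cdot> v = sec f \<cdot> z" using cmp_reassoc[OF aw, of v] fm wv by (simp add: z_def)
      have bz: "b \<cdot> v = sec g \<cdot> (FA P f \<cdot> z)" using cmp_reassoc[OF bw, of v] fm gm wv by (simp add: z_def)
      have yy: "y = FA P g \<cdot> (FA P f \<cdot> z)"
      proof -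
        have "y = \<tau> j k \<cdot> (b \<cdot> v)" using yv(2) cmp_reassoc[OF eqs(2), of v] wv by simp
        then show ?thesis using \<tau>_sec_cmp[of g "FA P f \<cdot> z"] fm gm by (simp add: bz)
      qed
      have cz: "c \<cdot> v = sec h \<cdot> (FA P g \<cdot> (FA P f \<cdot> z))" using cv wv yy by simp
      have "\<rho> (sec h \<cdot> (FA P g \<cdot> (FA P f \<cdot> z))) = \<rho> (FA P h \<cdot> (FA P g \<cdot> (FA P f \<cdot> z)))"
        by (rule rst_cmp_eq) (use fm gm hm in auto)
      moreover have "\<rho> (c \<cdot> v) = v" using yv(3) wv by simp
      ultimately have rhz: "\<rho> (FA P h \<cdot> (FA P g \<cdot> (FA P f \<cdot> z))) = v" using cz by simp
      have "mul C \<Psi> i k l c (mul C \<Psi> i j k b a) \<cdot> v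
        = mul C \<Psi> i k l (sec h \<cdot> (FA P g \<cdot> (FA P f \<cdot> z))) (mul C \<Psi> i j k (sec g \<cdot> (FA P f \<cdot> z)) (sec f \<cdot> z))"
        using G.mul_cmp[OF I'(1,3,4) c1, of v] G.mul_cmp[OF I'(1-3) ba, of v] mba by (simp add: az bz cz)
      also have "mul C \<Psi> i j k (sec g \<cdot> (FA P f \<cdot> z)) (sec f \<cdot> z) = sec (g \<star> f) \<cdot> z"
        by (rule mul_sec[OF f g]) (use rgz rz in auto)
      also have "FA P g \<cdot> (FA P f \<cdot> z) = FA P (g \<star> f) \<cdot> z" using fm gm by simp
      also have "mul C \<Psi> i k l (sec h \<cdot> (FA P (g \<star> f) \<cdot> z)) (sec (g \<star> f) \<cdot> z) = sec (h \<star> (g \<star> f)) \<cdot> z"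
        by (rule mul_sec) (use fm gm hm rhz rz in auto)
      finally have L: "mul C \<Psi> i k l c (mul C \<Psi> i j k b a) \<cdot> v = sec (h \<star> (g \<star> f)) \<cdot> z" .
      have "mul C \<Psi> i j l (mul C \<Psi> j k l c b) a \<cdot> v
        = mul C \<Psi> i j l (mul C \<Psi> j k l (sec h \<cdot> (FA P g \<cdot> (FA P f \<cdot> z))) (sec g \<cdot> (FA P f \<cdot> z))) (sec f \<cdot> z)"
        using G.mul_cmp[OF I'(1,2,4) c2, of v] G.mul_cmp[OF I'(2-4) cb, of v] mcb by (simp add: az bz cz)
      also have "mul C \<Psi> j k l (sec h \<cdot> (FA P g \<cdot> (FA P f \<cdot> z))) (sec g \<cdot> (FA P f \<cdot> z)) = sec (h \<star> g) \<cdot> (FA P f \<cdot> z)"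
        by (rule mul_sec[OF g h]) (use fm rhz rfz in auto)
      also have "mul C \<Psi> i j l (sec (h \<star> g) \<cdot> (FA P f \<cdot> z)) (sec f \<cdot> z) = sec (h \<star> g \<star> f) \<cdot> z"
        by (rule mul_sec) (use fm gm hm rhz rz in auto)
      finally have R: "mul C \<Psi> i j l (mul C \<Psi> j k l c b) a \<cdot> v = sec (h \<star> (g \<star> f)) \<cdot> z"
        using fm gm hm by simp
      show "mul C \<Psi> i k l c (mul C \<Psi> i j k b a) \<cdot> w \<cdot> v = mul C \<Psi> i j l (mul C \<Psi> j k l c b) a \<cdot> w \<cdot> v"
        using L R wv m1(1-3) m2(1-3) mba(1-3) by simp
    qed
  qed
qed

theorem Psi_partite: "partite C \<Psi>"
proof -
  have "partite_category C \<Psi>"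
  proof (unfold_locales, simp_all only: Psi_simps)
    show "Obj A \<prec> (UNIV :: 'u set)" using over_obj by (simp add: over_obj_def)
    show "src (\<sigma> i j) \<in> Obj C" "\<sigma> i j \<in> hom C (src (\<sigma> i j)) (FO P i)" "total C (\<sigma> i j)"
      "\<tau> i j \<in> hom C (src (\<sigma> i j)) (FO P j)" "total C (\<tau> i j)" "admits_pullbacks C (\<sigma> i j)"
      if "i \<in> Obj A" "j \<in> Obj A" for i j using that \<sigma>_pullbacks by auto
    show "sec (Idn A i) \<in> hom C (FO P i) (src (\<sigma> i i))" "\<sigma> i i \<cdot> sec (Idn A i) = Idn C (FO P i)"
      "\<tau> i i \<cdot> sec (Idn A i) = Idn C (FO P i)" "FO P i \<in> Obj C" if "i \<in> Obj A" for i
      using that sec[of "Idn A i"] \<tau>_sec[of i i "Idn A i"] by auto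
    fix i j assume ij: "i \<in> Obj A" "j \<in> Obj A"
    show "Psi_mu C X i i j \<cdot> pb_pair C (\<sigma> i j) (\<tau> i i) (Idn C (src (\<sigma> i j))) (sec (Idn A i) \<cdot> \<sigma> i j) = Idn C (src (\<sigma> i j))"
      using Psi_mul_unit_right[OF ij] by (simp add: mul_def)
    show "Psi_mu C X i j j \<cdot> pb_pair C (\<sigma> j j) (\<tau> i j) (sec (Idn A j) \<cdot> \<tau> i j) (Idn C (src (\<sigma> i j))) = Idn C (src (\<sigma> i j))"
      using Psi_mul_unit_left[OF ij] by (simp add: mul_def)
  next
    fix i j k assume I: "i \<in> Obj A" "j \<in> Obj A" "k \<in> Obj A"
    then show "Psi_mu C X i j k \<in> hom C (pb_obj C (\<sigma> j k) (\<tau> i j)) (src (\<sigma> i k))"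
      "\<sigma> i k \<cdot> Psi_mu C X i j k = \<sigma> i j \<cdot> pb2 C (\<sigma> j k) (\<tau> i j)"
      "\<tau> i k \<cdot> Psi_mu C X i j k = \<tau> j k \<cdot> pb1 C (\<sigma> j k) (\<tau> i j)"
      using Mu(1)[OF I] G.Sg_Mu[of i j k] G.Ta_Mu[of i j k] by simp_all
    fix l assume l: "l \<in> Obj A"
    define p1 where "p1 = pb1 C (\<sigma> j k) (\<tau> i j)"
    define p2 where "p2 = pb2 C (\<sigma> j k) (\<tau> i j)"
    define q1 where "q1 = pb1 C (\<sigma> k l) (\<tau> j k \<cdot> p1)"
    define q2 where "q2 = pb2 C (\<sigma> k l) (\<tau> j k \<cdot> p1)"
    note pb = pb[OF I]
    have p [simp]: "p1 \<in> Mor C" "src p1 = pb_obj C (\<sigma> j k) (\<tau> i j)" "tgt p1 = src (\<sigma> j k)"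
      "p2 \<in> Mor C" "src p2 = pb_obj C (\<sigma> j k) (\<tau> i j)" "tgt p2 = src (\<sigma> i j)"
      "total C p1" "total C p2" and sp: "\<sigma> j k \<cdot> p1 = \<tau> i j \<cdot> p2"
      using pb_mor[OF pb] pb_total[OF pb] pb_square[OF pb] I by (simp_all add: p1_def p2_def)
    have qb: "is_pullback C (\<sigma> k l) (\<tau> j k \<cdot> p1) q1 q2"
      unfolding q1_def q2_def using I l by (intro \<sigma>_pullback) auto
    have q [simp]: "q1 \<in> Mor C" "src q1 = src q2" "tgt q1 = src (\<sigma> k l)" "q2 \<in> Mor C"
      "tgt q2 = pb_obj C (\<sigma> j k) (\<tau> i j)" and sq: "\<sigma> k l \<cdot> q1 = \<tau> j k \<cdot> (p1 \<cdot> q2)"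
      using qb I l by (auto simp: is_pullback_def)
    have c1: "G.composable i j k (p1 \<cdot> q2) (p2 \<cdot> q2)"
      using cmp_reassoc[OF sp, of q2] I by (simp add: G.composable_def)
    have c2: "G.composable j k l q1 (p1 \<cdot> q2)" using sq I by (simp add: G.composable_def)
    have "pb_pair C (\<sigma> j k) (\<tau> i j) (p1 \<cdot> q2) (p2 \<cdot> q2) = q2"
      using pair_eta[OF pb, of q2] by (simp add: p1_def p2_def)
    \<comment> \<open>The projections of the threefold pullback are its generic triple;
      \<open>Psi_mul_assoc\<close> at this triple is the associativity diagram.\<close>
    then have "mul C \<Psi> i j k (p1 \<cdot> q2) (p2 \<cdot> q2) = Psi_mu C X i j k \<cdot> q2" by (simp add: mul_def)
    then show "let p1 = pb1 C (\<sigma> j k) (\<tau> i j); p2 = pb2 C (\<sigma> j k) (\<tau> i j);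
         q1 = pb1 C (\<sigma> k l) (\<tau> j k \<cdot> p1); q2 = pb2 C (\<sigma> k l) (\<tau> j k \<cdot> p1)
       in Psi_mu C X i k l \<cdot> pb_pair C (\<sigma> k l) (\<tau> i k) q1 (Psi_mu C X i j k \<cdot> q2)
        = Psi_mu C X i j l \<cdot> pb_pair C (\<sigma> j l) (\<tau> i j)
            (Psi_mu C X j k l \<cdot> pb_pair C (\<sigma> k l) (\<tau> j k) q1 (p1 \<cdot> q2)) (p2 \<cdot> q2)"
      using Psi_mul_assoc[OF I l c1 c2]
      by (simp add: Let_def mul_def p1_def[symmetric] p2_def[symmetric] q1_def[symmetric] q2_def[symmetric])
  qed
  then show ?thesis by (simp add: partite_def restriction_category_axioms)
qed

lemma Psi_source_etale: "source_etale C \<Psi>"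
  by (simp add: source_etale_def)

section \<open>The unit, and cofunctors out of the glued category\<close>

sublocale \<Psi>: partite C \<Psi> by (rule Psi_partite)

definition unit_arr where "unit_arr f = Arw (src f) (lbl (sec f)) (tgt f)"

lemma unit_arr:
  assumes f: "f \<in> Mor A"
  shows "unit_arr f \<in> Mor \<Psi>.\<Phi>" "src (unit_arr f) = src f" "tgt (unit_arr f) = tgt f"
    "sect \<Psi> (unit_arr f) = sec f"
proof -
  have "sec f \<in> hom C (PO \<Psi> (src f)) (PA \<Psi> (src f) (tgt f))"
    "Sg \<Psi> (src f) (tgt f) \<cdot> sec f = \<rho> (sec f)" using f by simp_all
  from \<Psi>.Phi_MorI[OF _ _ this] f
  show "unit_arr f \<in> Mor \<Psi>.\<Phi>" "src (unit_arr f) = src f" "tgt (unit_arr f) = tgt f"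
    "sect \<Psi> (unit_arr f) = sec f"
    unfolding unit_arr_def by simp_all
qed

lemma unit_arr_idn: "i \<in> Obj A \<Longrightarrow> unit_arr (Idn A i) = Idn \<Psi>.\<Phi> i"
  by (rule sect_eqI[of _ _ \<Psi>]) (use unit_arr[of "Idn A i"] \<Psi>.Phi_Idn[of i] in simp_all)

text \<open>\<open>mul_sec\<close> is applied at \<open>?x\<close>, the domain of the composite, to
  which composition in the category of partial sections cuts down its first factor.\<close>

lemma unit_arr_cmp:
  assumes f: "f \<in> Mor A" and g: "g \<in> Mor A" and fg: "tgt f = src g"
  shows "unit_arr (g \<star> f) = unit_arr g \<cdot>\<^bsub>\<Psi>.\<Phi>\<^esub> unit_arr f"
proof -
  note [simp] = f g fg
  note uf = unit_arr[OF f] and ug = unit_arr[OF g]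
  have gf: "g \<star> f \<in> Mor A" by simp
  note ugf = unit_arr[OF gf]
  have tf: "\<tau> (src f) (src g) \<cdot> sec f = FA P f" using \<tau>_sec[of "src f" "src g" f] by simp
  have r: "\<rho> (sec g \<cdot> FA P f) = \<rho> (FA P g \<cdot> FA P f)" by (rule rst_cmp_eq) auto
  let ?x = "\<rho> (FA P g \<cdot> FA P f)"
  have "sec g \<cdot> (FA P f \<cdot> ?x) = sec g \<cdot> FA P f" using cmp_cmp_rst[of "FA P f" "sec g"] r by simp
  moreover have "mul C \<Psi> (src f) (src g) (tgt g) (sec g \<cdot> (FA P f \<cdot> ?x)) (sec f \<cdot> ?x) = sec (g \<star> f) \<cdot> ?x"
    by (rule mul_sec) (auto simp: cmp_cmp_rst)
  moreover have "sec (g \<star> f) \<cdot> ?x = sec (g \<star> f)" using cmp_rst_self[of "sec (g \<star> f)"] by simp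
  ultimately have m: "mul C \<Psi> (src f) (src g) (tgt g) (sec g \<cdot> FA P f) (sec f \<cdot> ?x) = sec (g \<star> f)" by simp
  have "tgt (unit_arr f) = src (unit_arr g)" using uf ug by simp
  note c = \<Psi>.Phi_Cmp[OF uf(1) ug(1) this]
  have "sect \<Psi> (unit_arr g \<cdot>\<^bsub>\<Psi>.\<Phi>\<^esub> unit_arr f) = sec (g \<star> f)"
    using c(4) uf(2-4) ug(2-4) tf r m by simp
  then show ?thesis by (intro sect_eqI[of _ _ \<Psi>]) (use ugf c(2,3) uf ug in simp_all)
qed

lemma unit_arr_rst:
  assumes f: "f \<in> Mor A"
  shows "unit_arr (\<rho>\<^sub>A f) = \<rho>\<^bsub>\<Psi>.\<Phi>\<^esub> (unit_arr f)"
proof -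
  have "sec (\<rho>\<^sub>A f) = sec (Idn A (src f)) \<cdot> \<rho> (FA P f)"
    using sec_cmp_rid[of "Idn A (src f)" "\<rho>\<^sub>A f"] f by simp
  then show ?thesis
    by (intro sect_eqI[of _ _ \<Psi>])
      (use f unit_arr[OF f] unit_arr[of "\<rho>\<^sub>A f"] \<Psi>.Phi_Rst_simps[OF unit_arr(1)[OF f]] in simp_all)
qed

lemma unit_functor: "restriction_functor A \<Psi>.\<Phi> \<lparr>FO = \<lambda>i. i, FA = unit_arr\<rparr>"
  unfolding restriction_functor_def is_functor_def
  using unit_arr_idn unit_arr_cmp unit_arr_rst unit_arr(1-3) A.category_axioms \<Psi>.Phi_category by simp

lemma unit_proj: "f \<in> Mor A \<Longrightarrow> FA (Phi_proj C \<Psi>) (unit_arr f) = FA P f"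
  using unit_arr[of f] \<tau>_sec[of "src f" "tgt f" f] by simp

lemma adj_unit_eq:
  "adj_unit C X = Arw X (res_functr A \<lparr>FO = \<lambda>i. i, FA = unit_arr\<rparr>, \<lambda>i\<in>Obj A. Idn C (FO P i))
    (\<Psi>.\<Phi>, Phi_proj C \<Psi>)"
  by (simp add: adj_unit_def unit_arr_def[abs_def] Phi_def)

lemma adj_unit_mor: "adj_unit C X \<in> hom (rCat_over C) X (FO (Phi C) \<Psi>)"
proof -
  have "nat_trans A C (comp_functr (Phi_proj C \<Psi>) (res_functr A \<lparr>FO = \<lambda>i. i, FA = unit_arr\<rparr>)) P
     (\<lambda>i\<in>Obj A. Idn C (FO P i))"
    unfolding nat_trans_def
  proof (intro conjI ballI)
    fix f assume f: "f \<in> Mor A"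
    show "restrict (\<lambda>i. Idn C (FO P i)) (Obj A) (tgt f) \<cdot>
       FA (comp_functr (Phi_proj C \<Psi>) (res_functr A \<lparr>FO = \<lambda>i. i, FA = unit_arr\<rparr>)) f =
       FA P f \<cdot> restrict (\<lambda>i. Idn C (FO P i)) (Obj A) (src f)"
      using unit_proj[OF f] f by (simp del: \<Psi>.Phi_proj_simps)
  qed simp
  then have "over_hom C X (\<Psi>.\<Phi>, Phi_proj C \<Psi>)
      (res_functr A \<lparr>FO = \<lambda>i. i, FA = unit_arr\<rparr>, \<lambda>i\<in>Obj A. Idn C (FO P i))"
    using unit_functor by (simp add: over_hom_def restriction_functor_res A.restriction_category_axioms)
  then show ?thesis
    using over_obj Phi_over_obj[OF Psi_partite small] by (simp add: adj_unit_eq Phi_def)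
qed

text \<open>By \<open>r\<close> the element \<open>CO G i \<cdot> b\<close> lies in the domain of
  \<open>sec f\<close>, so the pair is the one defining \<open>Phi_arr\<close> at
  \<open>unit_arr f\<close>, precomposed with \<open>b\<close>.\<close>

lemma act_sec:
  assumes G: "cofunctor C \<Psi> B G" and f: "f \<in> hom A i j"
    and b: "b \<in> Mor C" "tgt b = PO B (CI G i)" and r: "\<rho> (sec f \<cdot> (CO G i \<cdot> b)) = \<rho> b"
  shows "act C \<Psi> G i j (sec f \<cdot> (CO G i \<cdot> b)) b = sect B (cofunctor.Phi_arr C \<Psi> G (unit_arr f)) \<cdot> b"
proof -
  interpret G: cofunctor C \<Psi> B G by fact
  have fm: "f \<in> Mor A" "src f = i" "tgt f = j" using f by auto
  have ij [simp]: "i \<in> Obj A" "j \<in> Obj A" using f by auto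
  note [simp] = fm
  note co [simp] = G.co[of i, simplified]
  note u = unit_arr[OF fm(1)]
  note ac = G.Phi_actable[OF u(1), unfolded u fm]
  have "\<rho> (sec f \<cdot> CO G i) \<cdot> b = b" using rst_shift[of b "sec f \<cdot> CO G i"] r b by simp
  then have "act C \<Psi> G i j (sec f \<cdot> CO G i) (\<rho> (sec f \<cdot> CO G i)) \<cdot> b = act C \<Psi> G i j (sec f \<cdot> (CO G i \<cdot> b)) b"
    using G.act_cmp[OF _ _ ac, of b] b by simp
  then show ?thesis using G.Phi_arr(4)[OF u(1)] u by simp
qed

text \<open>Locally an element is \<open>sec f\<close> at some point, and the action there is given
  by the image under \<Phi> at \<open>unit_arr f\<close>. This is the uniqueness half of the
  universal property of the unit.\<close>

lemma cofunctor_ext: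
  assumes G: "cofunctor C \<Psi> B G" and H: "cofunctor C \<Psi> B H"
    and ci: "\<And>i. i \<in> Obj A \<Longrightarrow> CI G i = CI H i" and co: "\<And>i. i \<in> Obj A \<Longrightarrow> CO G i = CO H i"
    and arr: "\<And>f. f \<in> Mor A \<Longrightarrow>
      cofunctor.Phi_arr C \<Psi> G (unit_arr f) = cofunctor.Phi_arr C \<Psi> H (unit_arr f)"
  shows "G = H"
proof -
  interpret G: cofunctor C \<Psi> B G by fact
  interpret H: cofunctor C \<Psi> B H by fact
  show ?thesis
  proof (rule cofun_eqI[OF G H])
    fix i j a b assume "i \<in> Ix \<Psi>" "j \<in> Ix \<Psi>" and ab: "G.actable i j a b"
    then have ij: "i \<in> Obj A" "j \<in> Obj A" by simp_all
    have ab': "H.actable i j a b" using ab ci co ij by (simp add: G.actable_def H.actable_def)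
    note Ga = G.act[OF _ _ ab] and Ha = H.act[OF _ _ ab']
    have m: "a \<in> Mor C" "b \<in> Mor C" "src a = src b" "tgt a = src (\<sigma> i j)" "tgt b = PO B (CI G i)"
      and s: "\<sigma> i j \<cdot> a = CO G i \<cdot> b" using ab by (simp_all add: G.actable_def)
    note co' [simp] = G.co[of i, simplified]
    have r: "\<rho> b = \<rho> a" using rst_cmp_total[of "\<sigma> i j" a] rst_cmp_total[of "CO G i" b] s m ij by simp
    show "act C \<Psi> G i j a b = act C \<Psi> H i j a b"
    proof (rule elem_local[OF ij])
      show "a \<in> hom C (src b) (src (\<sigma> i j))" using m by simp
      show "act C \<Psi> G i j a b \<in> hom C (src b) (PA B (CI G i) (CI G j))"
        "act C \<Psi> H i j a b \<in> hom C (src b) (PA B (CI G i) (CI G j))"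
        "\<rho> (act C \<Psi> G i j a b) = \<rho> a" "\<rho> (act C \<Psi> H i j a b) = \<rho> a"
        using Ga Ha r ij ci by simp_all
      fix f w x assume f: "f \<in> hom A i j" and w: "w \<in> rid C (src b)" and x: "x \<in> hom C (src b) (FO P i)"
        and aw: "a \<cdot> w = sec f \<cdot> x" "\<rho> x = w" "x = \<sigma> i j \<cdot> (a \<cdot> w)" "\<rho> (a \<cdot> w) = w"
      note wm = rid_mor(1-4)[OF w]
      have fm: "f \<in> Mor A" using f by simp
      have xb: "x = CO G i \<cdot> (b \<cdot> w)" using aw(3) cmp_reassoc[OF s, of w] m wm ij by simp
      have rb: "\<rho> (b \<cdot> w) = w"
        using rst_cmp_rid[OF w, of b] rst_cmp_rid[OF w, of a] m r aw(4) by simp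
      have bw: "b \<cdot> w \<in> Mor C" "tgt (b \<cdot> w) = PO B (CI G i)" "tgt (b \<cdot> w) = PO B (CI H i)"
        using m wm ci ij by simp_all
      have rr: "\<rho> (sec f \<cdot> (CO G i \<cdot> (b \<cdot> w))) = \<rho> (b \<cdot> w)" using aw xb rb by simp
      have "act C \<Psi> G i j a b \<cdot> w = act C \<Psi> G i j (sec f \<cdot> (CO G i \<cdot> (b \<cdot> w))) (b \<cdot> w)"
        using G.act_cmp[OF _ _ ab, of w] ij wm m aw(1) xb by simp
      also have "\<dots> = sect B (G.Phi_arr (unit_arr f)) \<cdot> (b \<cdot> w)" by (rule act_sec[OF G f bw(1,2) rr])
      also have "\<dots> = sect B (H.Phi_arr (unit_arr f)) \<cdot> (b \<cdot> w)" using arr[OF fm] by simp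
      also have "\<dots> = act C \<Psi> H i j (sec f \<cdot> (CO H i \<cdot> (b \<cdot> w))) (b \<cdot> w)"
        by (rule act_sec[OF H f bw(1,3), symmetric]) (use rr co ij in simp)
      also have "\<dots> = act C \<Psi> H i j a b \<cdot> w"
        using H.act_cmp[OF _ _ ab', of w] ij wm m aw(1) xb co by simp
      finally show "act C \<Psi> G i j a b \<cdot> w = act C \<Psi> H i j a b \<cdot> w" .
    qed
  qed (use ci co in auto)
qed

end

section \<open>Transposition across the adjunction\<close>

text \<open>A map from \<open>(A, P)\<close> to \<open>\<Phi> B\<close>, to be transposed to a cofunctor out of \<open>\<Psi> (A, P)\<close>.\<close>

locale over_arrow = glued_over C A P + B: partite C B
  for C :: "('o, 'u) rcat" (structure) and A P and B :: "('o, 'u) partite" +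
  fixes F :: "('u, 'u, 'u, 'u) functr" and \<alpha> :: "'u \<Rightarrow> ('o, 'u) arr"
  assumes over_hom: "over_hom C (A, P) (B.\<Phi>, Phi_proj C B) (F, \<alpha>)"
begin

lemma F_functor: "is_functor A B.\<Phi> F" and F_rst: "f \<in> Mor A \<Longrightarrow> FA F (\<rho>\<^sub>A f) = \<rho>\<^bsub>B.\<Phi>\<^esub> (FA F f)"
  using over_hom by (auto simp: over_hom_def restriction_functor_def)

lemmas F [simp] = is_functor_simps(1-4)[OF F_functor, simplified]

lemma \<alpha> [simp]:
  assumes "i \<in> Obj A"
  shows "\<alpha> i \<in> Mor C" "src (\<alpha> i) = PO B (FO F i)" "tgt (\<alpha> i) = FO P i" "total C (\<alpha> i)"
  using over_hom assms by (auto simp: over_hom_def nat_trans_def)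

definition val where "val f = sect B (FA F f)"

lemma val [simp]:
  assumes f: "f \<in> Mor A"
  shows "val f \<in> Mor C" "src (val f) = PO B (FO F (src f))" "tgt (val f) = PA B (FO F (src f)) (FO F (tgt f))"
    "Sg B (FO F (src f)) (FO F (tgt f)) \<cdot> val f = \<rho> (val f)"
  using B.Phi_Mor_simps(3,4)[OF F(2)[OF f]] f by (simp_all add: val_def)

lemma \<alpha>_val:
  assumes f: "f \<in> Mor A"
  shows "\<alpha> (tgt f) \<cdot> (Ta B (FO F (src f)) (FO F (tgt f)) \<cdot> val f) = FA P f \<cdot> \<alpha> (src f)"
proof -
  have "\<forall>f\<in>Mor A. \<alpha> (tgt f) \<cdot> FA (Phi_proj C B) (FA F f) = FA P f \<cdot> \<alpha> (src f)"
    using over_hom by (simp add: over_hom_def nat_trans_def del: B.Phi_proj_simps)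
  from bspec[OF this f] show ?thesis using f by (simp add: val_def)
qed

text \<open>Naturality at the restriction of \<open>f\<close>: as \<open>F\<close> preserves
  restrictions, its value there is \<open>Et\<close> restricted to \<open>\<rho> (val f)\<close>,
  and the target map undoes \<open>Et\<close>.\<close>

lemma \<alpha>_rst_val:
  assumes f: "f \<in> Mor A"
  shows "\<alpha> (src f) \<cdot> \<rho> (val f) = \<rho> (FA P f) \<cdot> \<alpha> (src f)"
proof -
  have "val (\<rho>\<^sub>A f) = Et B (FO F (src f)) \<cdot> \<rho> (val f)"
    using B.Phi_Rst_simps(4)[OF F(2)[OF f]] f by (simp add: val_def F_rst)
  then show ?thesis using \<alpha>_val[of "\<rho>\<^sub>A f"] f by simp
qed

text \<open>Composing with the total map \<open>\<alpha>\<close> does not change domains, so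
  \<open>\<alpha>_rst_val\<close> exhibits the domain of \<open>val f\<close> as the inverse image
  under \<open>\<alpha>\<close> of the domain of \<open>f\<close>.\<close>

lemma rst_val:
  assumes f: "f \<in> Mor A"
  shows "\<rho> (val f) = \<rho> (sec f \<cdot> \<alpha> (src f))"
proof -
  have "\<rho> (val f) = \<rho> (\<rho> (FA P f) \<cdot> \<alpha> (src f))"
    using rst_cmp_total[of "\<alpha> (src f)" "\<rho> (val f)"] \<alpha>_rst_val[OF f] f by (simp del: rst_rst_cmp)
  also have "\<dots> = \<rho> (sec f \<cdot> \<alpha> (src f))" by (rule rst_cmp_eq) (use f in auto)
  finally show ?thesis .
qed

lemma val_cmp_rid:
  assumes f: "f \<in> Mor A" and e: "e \<in> rid A (src f)"
  shows "val (f \<star> e) = val f \<cdot> \<rho> (val e)" "\<alpha> (src f) \<cdot> \<rho> (val e) = FA P e \<cdot> \<alpha> (src f)"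
proof -
  note em [simp] = A.rid_mor(1-4)[OF e]
  have "FA F e = \<rho>\<^bsub>B.\<Phi>\<^esub> (FA F e)" using F_rst[of e] by simp
  then have "FA F (f \<star> e) = FA F f \<cdot>\<^bsub>B.\<Phi>\<^esub> \<rho>\<^bsub>B.\<Phi>\<^esub> (FA F e)"
    using is_functor_simps(6)[OF F_functor, of e f] f by simp
  then show "val (f \<star> e) = val f \<cdot> \<rho> (val e)"
    using B.Phi_Cmp_Rst[of "FA F f" "FA F e"] f by (simp add: val_def)
  have "\<rho> (FA P e) = FA P e" using P_rst[of e] by simp
  then show "\<alpha> (src f) \<cdot> \<rho> (val e) = FA P e \<cdot> \<alpha> (src f)" using \<alpha>_rst_val[of e] by simp
qed

context
  fixes i j
  assumes ij [simp]: "i \<in> Obj A" "j \<in> Obj A"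
begin

lemma pb\<alpha>: "is_pullback C (\<sigma> i j) (\<alpha> i) (pb1 C (\<sigma> i j) (\<alpha> i)) (pb2 C (\<sigma> i j) (\<alpha> i))"
  by (rule \<sigma>_pullback) auto

lemma etale\<alpha>: "etale_family C (pb2 C (\<sigma> i j) (\<alpha> i)) (hom A i j) (\<lambda>f. pb_lift C (\<sigma> i j) (\<alpha> i) (sec f))
  (\<lambda>f. \<rho> (ide i j f \<cdot> pb1 C (\<sigma> i j) (\<alpha> i)))"
proof -
  interpret E: etale_family C "\<sigma> i j" "hom A i j" sec "ide i j" by (rule etale[OF ij])
  show ?thesis by (rule E.base_change[OF pb\<alpha>]) simp
qed

lemma lift\<alpha>:
  assumes f: "f \<in> hom A i j"
  defines "l \<equiv> pb_lift C (\<sigma> i j) (\<alpha> i) (sec f)"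
  shows "l \<in> Mor C" "src l = PO B (FO F i)" "tgt l = pb_obj C (\<sigma> i j) (\<alpha> i)"
    "pb1 C (\<sigma> i j) (\<alpha> i) \<cdot> l = sec f \<cdot> \<alpha> i" "pb2 C (\<sigma> i j) (\<alpha> i) \<cdot> l = \<rho> (sec f \<cdot> \<alpha> i)"
    "\<rho> l = \<rho> (sec f \<cdot> \<alpha> i)"
    "\<And>b. b \<in> Mor C \<Longrightarrow> tgt b = PO B (FO F i) \<Longrightarrow> \<rho> (sec f \<cdot> (\<alpha> i \<cdot> b)) = \<rho> b \<Longrightarrow>
      l \<cdot> b = pb_pair C (\<sigma> i j) (\<alpha> i) (sec f \<cdot> (\<alpha> i \<cdot> b)) b"
proof -
  have m: "f \<in> Mor A" "src f = i" "tgt f = j" using f by auto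
  note s = sec[OF m(1), unfolded m]
  have sq: "\<sigma> i j \<cdot> sec f = \<rho> (sec f)" using s by simp
  note l = lift[OF pb\<alpha> s(1) _ s(3) sq, folded pb_lift_def, folded l_def]
  show lm: "l \<in> Mor C" "src l = PO B (FO F i)" "tgt l = pb_obj C (\<sigma> i j) (\<alpha> i)"
    "pb1 C (\<sigma> i j) (\<alpha> i) \<cdot> l = sec f \<cdot> \<alpha> i" "pb2 C (\<sigma> i j) (\<alpha> i) \<cdot> l = \<rho> (sec f \<cdot> \<alpha> i)"
    using l s by simp_all
  show "\<rho> l = \<rho> (sec f \<cdot> \<alpha> i)"
    using rst_cmp_total[of "pb1 C (\<sigma> i j) (\<alpha> i)" l] lm pb_mor[OF pb\<alpha>] pb_total[OF pb\<alpha>] by simp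
  fix b assume b: "b \<in> Mor C" "tgt b = PO B (FO F i)" "\<rho> (sec f \<cdot> (\<alpha> i \<cdot> b)) = \<rho> b"
  then show "l \<cdot> b = pb_pair C (\<sigma> i j) (\<alpha> i) (sec f \<cdot> (\<alpha> i \<cdot> b)) b"
    using lift_cmp[OF pb\<alpha> s(1) _ s(3) sq, folded pb_lift_def, folded l_def, of b] s by simp
qed

text \<open>Where two lifted sections coincide, \<open>f\<close> and \<open>g\<close> agree locally
  on idempotents \<open>e\<close> of \<open>A\<close>. The functor \<open>F\<close> preserves these
  equations, and the domain of \<open>val e\<close> is the inverse image of \<open>FA P e\<close>
  under \<open>\<alpha>\<close>; so the values agree there too.\<close>

lemma transpose_unique:
  "\<exists>!K. K \<in> hom C (src (pb2 C (\<sigma> i j) (\<alpha> i))) (PA B (FO F i) (FO F j)) \<and>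
     (\<forall>f\<in>hom A i j. K \<cdot> pb_lift C (\<sigma> i j) (\<alpha> i) (sec f) = val f)"
proof -
  interpret E: etale_family C "pb2 C (\<sigma> i j) (\<alpha> i)" "hom A i j" "\<lambda>f. pb_lift C (\<sigma> i j) (\<alpha> i) (sec f)"
    "\<lambda>f. \<rho> (ide i j f \<cdot> pb1 C (\<sigma> i j) (\<alpha> i))" by (rule etale\<alpha>)
  note pm [simp] = pb_mor[OF pb\<alpha>]
  show ?thesis
  proof (rule E.extend)
    show "PA B (FO F i) (FO F j) \<in> Obj C" by simp
    show "val f \<in> hom C (tgt (pb2 C (\<sigma> i j) (\<alpha> i))) (PA B (FO F i) (FO F j))"
      "\<rho> (val f) = \<rho> (pb_lift C (\<sigma> i j) (\<alpha> i) (sec f))" if "f \<in> hom A i j" for f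
      using that lift\<alpha>(6)[OF that] rst_val[of f] by auto
    fix f g d assume f: "f \<in> hom A i j" and g: "g \<in> hom A i j" and "d \<in> rid C (tgt (pb2 C (\<sigma> i j) (\<alpha> i)))"
      and eq: "pb_lift C (\<sigma> i j) (\<alpha> i) (sec f) \<cdot> d = pb_lift C (\<sigma> i j) (\<alpha> i) (sec g) \<cdot> d"
    then have d: "d \<in> rid C (PO B (FO F i))" by simp
    note dm [simp] = rid_mor(1-4)[OF d]
    have fm: "f \<in> Mor A" "src f = i" "tgt f = j" and gm: "g \<in> Mor A" "src g = i" "tgt g = j" using f g by auto
    note lf = lift\<alpha>[OF f] and lg = lift\<alpha>[OF g]
    have eq': "sec f \<cdot> (\<alpha> i \<cdot> d) = sec g \<cdot> (\<alpha> i \<cdot> d)"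
      using arg_cong[OF eq, of "\<lambda>z. pb1 C (\<sigma> i j) (\<alpha> i) \<cdot> z"] lf(1-3) lg(1-3) fm gm
        cmp_reassoc[OF lf(4), of d] cmp_reassoc[OF lg(4), of d] by simp
    have rv: "\<rho> (val h \<cdot> d) = \<rho> (sec h \<cdot> (\<alpha> i \<cdot> d))" if "h \<in> hom A i j" for h
    proof -
      have "\<rho> (val h \<cdot> d) = \<rho> (sec h \<cdot> \<alpha> i \<cdot> d)" by (rule rst_cmp_eq) (use that rst_val[of h] in auto)
      then show ?thesis using that by auto
    qed
    show "val f \<cdot> d = val g \<cdot> d"
    proof (rule eq_via_agree[OF f g _ eq'])
      show "\<alpha> i \<cdot> d \<in> hom C (PO B (FO F i)) (FO P i)" by simp
      show "val f \<cdot> d \<in> hom C (PO B (FO F i)) (PA B (FO F i) (FO F j))"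
        "val g \<cdot> d \<in> hom C (PO B (FO F i)) (PA B (FO F i) (FO F j))" using fm gm by simp_all
      show "\<rho> (val f \<cdot> d) = \<rho> (sec f \<cdot> (\<alpha> i \<cdot> d))" by (rule rv[OF f])
      show "\<rho> (val g \<cdot> d) = \<rho> (sec f \<cdot> (\<alpha> i \<cdot> d))" unfolding eq' by (rule rv[OF g])
      fix e w assume e: "e \<in> agree f g" and w: "w = \<rho> (FA P e \<cdot> (\<alpha> i \<cdot> d))" "w \<in> rid C (PO B (FO F i))"
      note a = agreeD[OF e]
      have er: "e \<in> rid A (src f)" "e \<in> rid A (src g)" using a fm gm by simp_all
      note vf = val_cmp_rid[OF fm(1) er(1)] and vg = val_cmp_rid[OF gm(1) er(2)]
      have vm [simp]: "val e \<in> Mor C" "src (val e) = PO B (FO F i)" using a fm by simp_all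
      have dr: "\<rho> (val e) \<in> rid C (PO B (FO F i))" by simp
      have "FA P e \<cdot> (\<alpha> i \<cdot> d) = \<alpha> i \<cdot> (\<rho> (val e) \<cdot> d)"
        using cmp_reassoc[of "\<alpha> i" "\<rho> (val e)" "FA P e \<cdot> \<alpha> i" d] vf(2) a fm by simp
      then have "w = \<rho> (\<rho> (val e) \<cdot> d)" using w(1) rst_cmp_total[of "\<alpha> i" "\<rho> (val e) \<cdot> d"] by (simp del: rst_rst_cmp)
      also have "\<dots> = \<rho> (val e) \<cdot> d" using rid_mor(4)[OF rid_cmp[OF dr d]] by (simp del: rst_rst_cmp)
      finally have dw: "d \<cdot> w = \<rho> (val e) \<cdot> d"
        using rid_comm[OF d dr] rid_idem_cmp[OF d, of "\<rho> (val e)"] by simp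
      have "val f \<cdot> \<rho> (val e) = val g \<cdot> \<rho> (val e)" using vf(1) vg(1) a(2) by simp
      then show "val f \<cdot> d \<cdot> w = val g \<cdot> d \<cdot> w"
        using dw cmp_reassoc[of "val f" "\<rho> (val e)" "val g \<cdot> \<rho> (val e)" d] rid_mor[OF w(2)] fm gm by simp
    qed
  qed
qed

end

definition transpose :: "('o, 'u) cofun" where
  "transpose = \<lparr>CI = restrict (FO F) (Obj A), CO = restrict \<alpha> (Obj A),
     CA = \<lambda>i j. if i \<in> Obj A \<and> j \<in> Obj A then
       (THE K. K \<in> hom C (src (pb2 C (\<sigma> i j) (\<alpha> i))) (PA B (FO F i) (FO F j)) \<and>
         (\<forall>f\<in>hom A i j. K \<cdot> pb_lift C (\<sigma> i j) (\<alpha> i) (sec f) = val f)) else undefined\<rparr>"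

lemma transpose_simps [simp]:
  "i \<in> Obj A \<Longrightarrow> CI transpose i = FO F i" "i \<in> Obj A \<Longrightarrow> CO transpose i = \<alpha> i"
  by (simp_all add: transpose_def)

lemma transpose_CA:
  assumes ij: "i \<in> Obj A" "j \<in> Obj A"
  shows "CA transpose i j \<in> hom C (pb_obj C (\<sigma> i j) (\<alpha> i)) (PA B (FO F i) (FO F j))"
    "\<And>f. f \<in> hom A i j \<Longrightarrow> CA transpose i j \<cdot> pb_lift C (\<sigma> i j) (\<alpha> i) (sec f) = val f"
    "total C (CA transpose i j)"
proof -
  interpret E: etale_family C "pb2 C (\<sigma> i j) (\<alpha> i)" "hom A i j" "\<lambda>f. pb_lift C (\<sigma> i j) (\<alpha> i) (sec f)"
    "\<lambda>f. \<rho> (ide i j f \<cdot> pb1 C (\<sigma> i j) (\<alpha> i))" by (rule etale\<alpha>[OF ij])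
  have t: "CA transpose i j \<in> hom C (src (pb2 C (\<sigma> i j) (\<alpha> i))) (PA B (FO F i) (FO F j)) \<and>
     (\<forall>f\<in>hom A i j. CA transpose i j \<cdot> pb_lift C (\<sigma> i j) (\<alpha> i) (sec f) = val f)"
    using theI'[OF transpose_unique[OF ij]] ij by (simp add: transpose_def)
  then show "CA transpose i j \<in> hom C (pb_obj C (\<sigma> i j) (\<alpha> i)) (PA B (FO F i) (FO F j))"
    "\<And>f. f \<in> hom A i j \<Longrightarrow> CA transpose i j \<cdot> pb_lift C (\<sigma> i j) (\<alpha> i) (sec f) = val f"
    using pb_mor[OF pb\<alpha>[OF ij]] by simp_all
  show "total C (CA transpose i j)"
  proof (rule E.extend_total)
    show "CA transpose i j \<in> hom C (src (pb2 C (\<sigma> i j) (\<alpha> i))) (PA B (FO F i) (FO F j))" using t by blast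
    show "\<rho> (CA transpose i j \<cdot> pb_lift C (\<sigma> i j) (\<alpha> i) (sec f)) = \<rho> (pb_lift C (\<sigma> i j) (\<alpha> i) (sec f))"
      if "f \<in> hom A i j" for f
      using t that lift\<alpha>(6)[OF ij that] rst_val[of f] by auto
  qed
qed

text \<open>The laws of \<open>act\<close> for this candidate, derived by hand since the
  corresponding lemmas presuppose a cofunctor.\<close>

lemma act_transpose:
  assumes ij: "i \<in> Obj A" "j \<in> Obj A" and a: "a \<in> hom C (src b) (src (\<sigma> i j))"
    and b: "b \<in> Mor C" "tgt b = PO B (FO F i)" and ab: "\<sigma> i j \<cdot> a = \<alpha> i \<cdot> b"
  shows "act C \<Psi> transpose i j a b \<in> hom C (src b) (PA B (FO F i) (FO F j))"
    "\<rho> (act C \<Psi> transpose i j a b) = \<rho> b"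
    "\<And>x. x \<in> Mor C \<Longrightarrow> tgt x = src b \<Longrightarrow> act C \<Psi> transpose i j a b \<cdot> x = act C \<Psi> transpose i j (a \<cdot> x) (b \<cdot> x)"
    "\<rho> a = \<rho> b"
proof -
  have K [simp]: "CA transpose i j \<in> Mor C" "src (CA transpose i j) = pb_obj C (\<sigma> i j) (\<alpha> i)"
    "tgt (CA transpose i j) = PA B (FO F i) (FO F j)" "total C (CA transpose i j)"
    using transpose_CA[OF ij] by simp_all
  note p = pair[OF pb\<alpha>[OF ij], of a b] and rp = rst_pair[OF pb\<alpha>[OF ij], of a b]
  have p': "pb_pair C (\<sigma> i j) (\<alpha> i) a b \<in> Mor C" "src (pb_pair C (\<sigma> i j) (\<alpha> i) a b) = src b"
    "tgt (pb_pair C (\<sigma> i j) (\<alpha> i) a b) = pb_obj C (\<sigma> i j) (\<alpha> i)" "\<rho> (pb_pair C (\<sigma> i j) (\<alpha> i) a b) = \<rho> b"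
    using p rp a b ab ij by simp_all
  show "act C \<Psi> transpose i j a b \<in> hom C (src b) (PA B (FO F i) (FO F j))"
    "\<rho> (act C \<Psi> transpose i j a b) = \<rho> b"
    using p' ij by (simp_all add: act_def)
  show "act C \<Psi> transpose i j a b \<cdot> x = act C \<Psi> transpose i j (a \<cdot> x) (b \<cdot> x)"
    if x: "x \<in> Mor C" "tgt x = src b" for x
    using p' pair_cmp[OF pb\<alpha>[OF ij], of a b x] a b ab ij x by (simp add: act_def)
  show "\<rho> a = \<rho> b" using rst_cmp_total[of "\<sigma> i j" a] rst_cmp_total[of "\<alpha> i" b] a b ab ij by simp
qed

lemma act_transpose_sec:
  assumes f: "f \<in> hom A i j" and b: "b \<in> Mor C" "tgt b = PO B (FO F i)"
    and r: "\<rho> (sec f \<cdot> (\<alpha> i \<cdot> b)) = \<rho> b"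
  shows "act C \<Psi> transpose i j (sec f \<cdot> (\<alpha> i \<cdot> b)) b = val f \<cdot> b"
proof -
  have ij: "i \<in> Obj A" "j \<in> Obj A" using f by auto
  note l = lift\<alpha>[OF ij f] and K = transpose_CA[OF ij]
  have "CA transpose i j \<cdot> (pb_lift C (\<sigma> i j) (\<alpha> i) (sec f) \<cdot> b) = val f \<cdot> b"
    by (rule cmp_reassoc[OF K(2)[OF f]]) (use l K b in auto)
  then show ?thesis using l(7)[OF b r] ij by (simp add: act_def)
qed

text \<open>The pair acted on may be assumed of the form
  \<open>(sec f \<cdot> (\<alpha> i \<cdot> \<beta>), \<beta>)\<close>, where the value of the
  action is \<open>val f \<cdot> \<beta>\<close>.\<close>

lemma act_transpose_local:
  assumes ij: "i \<in> Obj A" "j \<in> Obj A" and a: "a \<in> hom C (src b) (src (\<sigma> i j))"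
    and b: "b \<in> Mor C" "tgt b = PO B (FO F i)" and ab: "\<sigma> i j \<cdot> a = \<alpha> i \<cdot> b"
    and h: "h \<in> hom C (src b) Y" "\<rho> h = \<rho> b" and k: "k \<in> hom C (src b) Y" "\<rho> k = \<rho> b"
    and eq: "\<And>f w \<beta>. \<lbrakk>f \<in> hom A i j; w \<in> rid C (src b); \<beta> = b \<cdot> w; \<beta> \<in> hom C (src b) (PO B (FO F i));
      a \<cdot> w = sec f \<cdot> (\<alpha> i \<cdot> \<beta>); \<rho> (sec f \<cdot> (\<alpha> i \<cdot> \<beta>)) = \<rho> \<beta>; \<rho> \<beta> = w;
      act C \<Psi> transpose i j a b \<cdot> w = val f \<cdot> \<beta>\<rbrakk> \<Longrightarrow> h \<cdot> w = k \<cdot> w"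
  shows "h = k"
proof -
  note t = act_transpose[OF ij a b ab]
  show ?thesis
  proof (rule elem_local[OF ij a h(1) _ k(1)])
    show "\<rho> h = \<rho> a" "\<rho> k = \<rho> a" using h k t(4) by simp_all
    fix f w x assume f: "f \<in> hom A i j" and w: "w \<in> rid C (src b)"
      and aw: "a \<cdot> w = sec f \<cdot> x" "\<rho> x = w" "x = \<sigma> i j \<cdot> (a \<cdot> w)" "\<rho> (a \<cdot> w) = w"
    note wm [simp] = rid_mor(1-4)[OF w]
    have am [simp]: "a \<in> Mor C" "src a = src b" "tgt a = src (\<sigma> i j)" using a by auto
    note [simp] = b ij
    have x: "x = \<alpha> i \<cdot> (b \<cdot> w)" using aw(3) cmp_reassoc[OF ab, of w] by simp
    have rb: "\<rho> (b \<cdot> w) = w" using rst_cmp_rid[OF w, of b] rst_cmp_rid[OF w, of a] t(4) aw(4) by simp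
    have rs: "\<rho> (sec f \<cdot> (\<alpha> i \<cdot> (b \<cdot> w))) = \<rho> (b \<cdot> w)" using aw x rb by simp
    show "h \<cdot> w = k \<cdot> w"
    proof (rule eq[OF f w refl])
      show "act C \<Psi> transpose i j a b \<cdot> w = val f \<cdot> (b \<cdot> w)"
        using t(3)[of w] aw(1) x act_transpose_sec[OF f _ _ rs] by simp
    qed (use aw x rb rs in simp_all)
  qed
qed

text \<open>The unit law is read off at the section of an identity. The other laws are tested
  locally, where the action is given by \<open>val\<close> and they become properties of
  \<open>F\<close> and \<open>\<alpha>\<close>.\<close>

lemma transpose_cofunctor: "cofunctor C \<Psi> B transpose"
proof (rule cofunctorI[OF Psi_partite])
  show "partite C B" by unfold_locales
  show "CI transpose \<in> Ix \<Psi> \<rightarrow>\<^sub>E Ix B" by (auto simp: transpose_def)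
  show "CO transpose \<in> extensional (Ix \<Psi>)" by (simp add: transpose_def)
  show "CA transpose i j = undefined" if "\<not> (i \<in> Ix \<Psi> \<and> j \<in> Ix \<Psi>)" for i j
    using that by (auto simp: transpose_def)
  show "CO transpose i \<in> hom C (PO B (CI transpose i)) (PO \<Psi> i) \<and> total C (CO transpose i)" if "i \<in> Ix \<Psi>" for i
    using that by simp
  show "CA transpose i j \<in> hom C (pb_obj C (Sg \<Psi> i j) (CO transpose i)) (PA B (CI transpose i) (CI transpose j))"
    if "i \<in> Ix \<Psi>" "j \<in> Ix \<Psi>" for i j
    using transpose_CA(1)[of i j] that by simp
next
  fix i b assume "i \<in> Ix \<Psi>" and b: "b \<in> Mor C" "tgt b = PO B (CI transpose i)"
  then have i: "i \<in> Obj A" and b': "tgt b = PO B (FO F i)" by simp_all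
  have "FA F (Idn A i) = Idn B.\<Phi> (FO F i)" using is_functor_simps(5)[OF F_functor] i by simp
  then have v: "val (Idn A i) = Et B (FO F i)" using B.Phi_Idn(4)[of "FO F i"] i by (simp add: val_def)
  have "total C (sec (Idn A i))" using \<Psi>.et_total[of i] i by simp
  then have "\<rho> (sec (Idn A i) \<cdot> (\<alpha> i \<cdot> b)) = \<rho> b" using i b(1) b' by simp
  then have "act C \<Psi> transpose i i (sec (Idn A i) \<cdot> (\<alpha> i \<cdot> b)) b = val (Idn A i) \<cdot> b"
    using act_transpose_sec[of "Idn A i" i i b] i b(1) b' by simp
  then show "act C \<Psi> transpose i i (Et \<Psi> i \<cdot> (CO transpose i \<cdot> b)) b = Et B (CI transpose i) \<cdot> b"
    using i v by simp
next
  fix i j a b assume "i \<in> Ix \<Psi>" "j \<in> Ix \<Psi>" "a \<in> hom C (src b) (PA \<Psi> i j)" and b: "b \<in> Mor C"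
    and "tgt b = PO B (CI transpose i)" "Sg \<Psi> i j \<cdot> a = CO transpose i \<cdot> b"
  then have ij [simp]: "i \<in> Obj A" "j \<in> Obj A" and a: "a \<in> hom C (src b) (src (\<sigma> i j))"
    and b' [simp]: "tgt b = PO B (FO F i)" and ab: "\<sigma> i j \<cdot> a = \<alpha> i \<cdot> b" by simp_all
  note [simp] = b
  have am [simp]: "a \<in> Mor C" "src a = src b" "tgt a = src (\<sigma> i j)" using a by auto
  let ?x = "act C \<Psi> transpose i j a b"
  note x = act_transpose[OF ij a b b' ab]
  have xm [simp]: "?x \<in> Mor C" "src ?x = src b" "tgt ?x = PA B (FO F i) (FO F j)" "\<rho> ?x = \<rho> b"
    using x(1,2) by auto
  have "Sg B (FO F i) (FO F j) \<cdot> ?x = b"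
  proof (rule act_transpose_local[OF ij a b b' ab])
    show "\<rho> (Sg B (FO F i) (FO F j) \<cdot> ?x) = \<rho> b" by simp
    fix f w \<beta> assume f: "f \<in> hom A i j" and w: "w \<in> rid C (src b)" and \<beta>: "\<beta> = b \<cdot> w"
      "\<beta> \<in> hom C (src b) (PO B (FO F i))" "a \<cdot> w = sec f \<cdot> (\<alpha> i \<cdot> \<beta>)"
      "\<rho> (sec f \<cdot> (\<alpha> i \<cdot> \<beta>)) = \<rho> \<beta>" "\<rho> \<beta> = w" "?x \<cdot> w = val f \<cdot> \<beta>"
    note wm [simp] = rid_mor(1-4)[OF w]
    have fm: "f \<in> Mor A" "src f = i" "tgt f = j" using f by auto
    have \<beta>m: "\<beta> \<in> Mor C" "src \<beta> = src b" "tgt \<beta> = PO B (FO F i)" using \<beta>(2) by auto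
    have "\<rho> (val f \<cdot> \<beta>) = \<rho> \<beta>"
      using rst_cmp_rid[OF w, of ?x] rst_cmp_rid[OF w, of b] \<beta> by simp
    then have "\<rho> (val f) \<cdot> \<beta> = \<beta>" using rst_shift[of \<beta> "val f"] fm \<beta>m by simp
    moreover have "Sg B (FO F i) (FO F j) \<cdot> (val f \<cdot> \<beta>) = \<rho> (val f) \<cdot> \<beta>"
      using cmp_reassoc[OF val(4)[OF fm(1)], of \<beta>] fm \<beta>m by simp
    ultimately show "Sg B (FO F i) (FO F j) \<cdot> ?x \<cdot> w = b \<cdot> w" using \<beta> by simp
  qed simp_all
  then show "Sg B (CI transpose i) (CI transpose j) \<cdot> act C \<Psi> transpose i j a b = b" by simp
  have tx: "\<alpha> j \<cdot> (Ta B (FO F i) (FO F j) \<cdot> ?x) = \<tau> i j \<cdot> a"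
  proof (rule act_transpose_local[OF ij a b b' ab])
    show "\<rho> (\<alpha> j \<cdot> (Ta B (FO F i) (FO F j) \<cdot> ?x)) = \<rho> b" "\<rho> (\<tau> i j \<cdot> a) = \<rho> b" using x(4) by simp_all
    fix f w \<beta> assume f: "f \<in> hom A i j" and w: "w \<in> rid C (src b)" and \<beta>: "\<beta> = b \<cdot> w"
      "\<beta> \<in> hom C (src b) (PO B (FO F i))" "a \<cdot> w = sec f \<cdot> (\<alpha> i \<cdot> \<beta>)" "?x \<cdot> w = val f \<cdot> \<beta>"
    note wm [simp] = rid_mor(1-4)[OF w]
    have fm: "f \<in> Mor A" "src f = i" "tgt f = j" using f by auto
    have \<beta>m: "\<beta> \<in> Mor C" "src \<beta> = src b" "tgt \<beta> = PO B (FO F i)" using \<beta>(2) by auto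
    have "\<alpha> j \<cdot> (Ta B (FO F i) (FO F j) \<cdot> (val f \<cdot> \<beta>)) = FA P f \<cdot> (\<alpha> i \<cdot> \<beta>)"
      using cmp_reassoc[OF \<alpha>_val[OF fm(1)], of \<beta>] fm \<beta>m by simp
    also have "\<dots> = \<tau> i j \<cdot> (a \<cdot> w)" using \<tau>_sec_cmp[of f "\<alpha> i \<cdot> \<beta>"] fm \<beta>m \<beta>(3) by simp
    finally show "\<alpha> j \<cdot> (Ta B (FO F i) (FO F j) \<cdot> ?x) \<cdot> w = \<tau> i j \<cdot> a \<cdot> w" using \<beta>(4) by simp
  qed simp_all
  then show "CO transpose j \<cdot> (Ta B (CI transpose i) (CI transpose j) \<cdot> act C \<Psi> transpose i j a b) = Ta \<Psi> i j \<cdot> a"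
    by simp
  fix k a' assume "k \<in> Ix \<Psi>" and c: "partite_graph.composable C \<Psi> i j k a' a"
  then have k [simp]: "k \<in> Obj A" by simp
  have a'm [simp]: "a' \<in> Mor C" "src a' = src b" "tgt a' = src (\<sigma> j k)" and a's: "\<sigma> j k \<cdot> a' = \<tau> i j \<cdot> a"
    using c by (simp_all add: G.composable_def)
  let ?T = "Ta B (FO F i) (FO F j) \<cdot> ?x"
  note m = G.mul[OF _ _ _ c, simplified]
  have sm: "\<sigma> i k \<cdot> mul C \<Psi> i j k a' a = \<alpha> i \<cdot> b" using m ab by simp
  have mm: "mul C \<Psi> i j k a' a \<in> hom C (src b) (src (\<sigma> i k))" using m by simp
  note L = act_transpose[OF ij(1) k mm b b' sm]
  have a'T: "a' \<in> hom C (src ?T) (src (\<sigma> j k))" and sT: "\<sigma> j k \<cdot> a' = \<alpha> j \<cdot> ?T"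
    using a's tx by simp_all
  have Tm: "?T \<in> Mor C" "tgt ?T = PO B (FO F j)" by simp_all
  note y = act_transpose[OF ij(2) k a'T Tm sT]
  have ym [simp]: "act C \<Psi> transpose j k a' ?T \<in> Mor C" "src (act C \<Psi> transpose j k a' ?T) = src b"
    "tgt (act C \<Psi> transpose j k a' ?T) = PA B (FO F j) (FO F k)"
    using y(1) by auto
  \<comment> \<open>The source law once more, for \<open>a'\<close> acting at \<open>?T\<close>; it
    makes the two values composable in \<open>B\<close>.\<close>
  have sy: "Sg B (FO F j) (FO F k) \<cdot> act C \<Psi> transpose j k a' ?T = ?T"
  proof (rule act_transpose_local[OF ij(2) k a'T Tm sT])
    show "\<rho> (Sg B (FO F j) (FO F k) \<cdot> act C \<Psi> transpose j k a' ?T) = \<rho> ?T" using y(2) by simp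
    fix f w \<beta> assume f: "f \<in> hom A j k" and "w \<in> rid C (src ?T)" and \<beta>: "\<beta> = ?T \<cdot> w"
      "\<beta> \<in> hom C (src ?T) (PO B (FO F j))" 
      "\<rho> \<beta> = w" "act C \<Psi> transpose j k a' ?T \<cdot> w = val f \<cdot> \<beta>"
    then have w: "w \<in> rid C (src b)" by simp
    note wm [simp] = rid_mor(1-4)[OF w]
    have fm: "f \<in> Mor A" "src f = j" "tgt f = k" using f by auto
    have \<beta>m: "\<beta> \<in> Mor C" "src \<beta> = src b" "tgt \<beta> = PO B (FO F j)" using \<beta>(2) by auto
    have "\<rho> (val f \<cdot> \<beta>) = \<rho> (act C \<Psi> transpose j k a' ?T \<cdot> w)" using \<beta>(4) by simp
    also have "\<dots> = \<rho> ?T \<cdot> w" using rst_cmp_rid[OF w, of "act C \<Psi> transpose j k a' ?T"] y(2) by simp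
    also have "\<dots> = \<rho> \<beta>" using rst_cmp_rid[OF w, of ?T] \<beta>(1) by simp
    finally have "\<rho> (val f) \<cdot> \<beta> = \<beta>" using rst_shift[of \<beta> "val f"] fm \<beta>m by simp
    moreover have "Sg B (FO F j) (FO F k) \<cdot> (val f \<cdot> \<beta>) = \<rho> (val f) \<cdot> \<beta>"
      using cmp_reassoc[OF val(4)[OF fm(1)], of \<beta>] fm \<beta>m by simp
    ultimately show "Sg B (FO F j) (FO F k) \<cdot> act C \<Psi> transpose j k a' ?T \<cdot> w = ?T \<cdot> w"
      using \<beta>(1,4) by simp
  qed simp_all
  have cB: "B.composable (FO F i) (FO F j) (FO F k) (act C \<Psi> transpose j k a' ?T) ?x"
    using sy by (simp add: B.composable_def)
  note R = B.mul[OF _ _ _ cB]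
  have "act C \<Psi> transpose i k (mul C \<Psi> i j k a' a) b =
    mul C B (FO F i) (FO F j) (FO F k) (act C \<Psi> transpose j k a' ?T) ?x"
  proof (rule elem_local2[OF ij k c])
    show "act C \<Psi> transpose i k (mul C \<Psi> i j k a' a) b \<in> hom C (src a) (PA B (FO F i) (FO F k))"
      "\<rho> (act C \<Psi> transpose i k (mul C \<Psi> i j k a' a) b) = \<rho> a" using L x(4) by simp_all
    show "mul C B (FO F i) (FO F j) (FO F k) (act C \<Psi> transpose j k a' ?T) ?x \<in> hom C (src a) (PA B (FO F i) (FO F k))"
      "\<rho> (mul C B (FO F i) (FO F j) (FO F k) (act C \<Psi> transpose j k a' ?T) ?x) = \<rho> a"
      using R x(4) by simp_all
    fix f g w z assume f: "f \<in> hom A i j" and g: "g \<in> hom A j k" and "w \<in> rid C (src a)"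
      and z: "a \<cdot> w = sec f \<cdot> z" "a' \<cdot> w = sec g \<cdot> (FA P f \<cdot> z)" "\<rho> z = w"
        "\<rho> (FA P g \<cdot> (FA P f \<cdot> z)) = w" "z = \<sigma> i j \<cdot> (a \<cdot> w)" "\<rho> (a \<cdot> w) = w"
    then have w: "w \<in> rid C (src b)" by simp
    note wm [simp] = rid_mor(1-4)[OF w]
    have fm: "f \<in> Mor A" "src f = i" "tgt f = j" and gm: "g \<in> Mor A" "src g = j" "tgt g = k" using f g by auto
    define \<beta> where "\<beta> = b \<cdot> w"
    have \<beta>m [simp]: "\<beta> \<in> Mor C" "src \<beta> = src b" "tgt \<beta> = PO B (FO F i)" by (simp_all add: \<beta>_def)
    have z\<beta>: "z = \<alpha> i \<cdot> \<beta>" using z(5) cmp_reassoc[OF ab, of w] by (simp add: \<beta>_def)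
    have r\<beta>: "\<rho> \<beta> = w" using z(3) z\<beta> by simp
    have xw: "?x \<cdot> w = val f \<cdot> \<beta>"
    proof -
      have "\<rho> (sec f \<cdot> (\<alpha> i \<cdot> \<beta>)) = \<rho> \<beta>" using z(1,6) z\<beta> r\<beta> by simp
      from act_transpose_sec[OF f _ _ this] show ?thesis using x(3)[of w] z(1) z\<beta> by (simp add: \<beta>_def)
    qed
    \<comment> \<open>The target in \<open>B\<close> reached by the first arrow. It lies over
      \<open>FA P f \<cdot> z\<close>, so the second arrow acts at \<open>\<gamma>\<close>.\<close>
    define \<gamma> where "\<gamma> = Ta B (FO F i) (FO F j) \<cdot> (val f \<cdot> \<beta>)"
    have \<gamma>m [simp]: "\<gamma> \<in> Mor C" "src \<gamma> = src b" "tgt \<gamma> = PO B (FO F j)" using fm by (simp_all add: \<gamma>_def)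
    have Tw: "?T \<cdot> w = \<gamma>" using xw by (simp add: \<gamma>_def)
    have \<alpha>\<gamma>: "FA P f \<cdot> z = \<alpha> j \<cdot> \<gamma>"
      using cmp_reassoc[OF \<alpha>_val[OF fm(1)], of \<beta>] fm by (simp add: \<gamma>_def z\<beta>)
    have r\<gamma>: "\<rho> \<gamma> = w"
    proof -
      have "\<rho> \<gamma> = \<rho> (?T \<cdot> w)" by (simp add: Tw)
      also have "\<dots> = \<rho> b \<cdot> w" using rst_cmp_rid[OF w, of ?T] by simp
      also have "\<dots> = w" using rst_cmp_rid[OF w, of b] r\<beta> by (simp add: \<beta>_def)
      finally show ?thesis .
    qed
    have rg: "\<rho> (sec g \<cdot> (\<alpha> j \<cdot> \<gamma>)) = \<rho> \<gamma>"
    proof -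
      have "\<rho> (sec g \<cdot> (\<alpha> j \<cdot> \<gamma>)) = \<rho> (FA P g \<cdot> (\<alpha> j \<cdot> \<gamma>))" by (rule rst_cmp_eq) (use gm in auto)
      then show ?thesis using z(4) \<alpha>\<gamma> r\<gamma> by simp
    qed
    have yw: "act C \<Psi> transpose j k a' ?T \<cdot> w = val g \<cdot> \<gamma>"
      using y(3)[of w] Tw z(2) \<alpha>\<gamma> act_transpose_sec[OF g _ _ rg] by simp
    have fs: "FA P (g \<star> f) \<cdot> z = FA P g \<cdot> (FA P f \<cdot> z)" using fm gm z\<beta> by simp
    have "mul C \<Psi> i j k a' a \<cdot> w = sec (g \<star> f) \<cdot> (\<alpha> i \<cdot> \<beta>)"
      using G.mul_cmp[OF _ _ _ c, of w] mul_sec[OF f g, of z] z(1-4) z\<beta> by simp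
    moreover have "\<rho> (sec (g \<star> f) \<cdot> (\<alpha> i \<cdot> \<beta>)) = \<rho> \<beta>"
    proof -
      have "\<rho> (sec (g \<star> f) \<cdot> (\<alpha> i \<cdot> \<beta>)) = \<rho> (FA P (g \<star> f) \<cdot> (\<alpha> i \<cdot> \<beta>))"
        by (rule rst_cmp_eq) (use fm gm in auto)
      then show ?thesis using fs z(4) r\<beta> z\<beta> by simp
    qed
    then have "act C \<Psi> transpose i k (sec (g \<star> f) \<cdot> (\<alpha> i \<cdot> \<beta>)) \<beta> = val (g \<star> f) \<cdot> \<beta>"
      using act_transpose_sec[of "g \<star> f" i k \<beta>] fm gm by simp
    ultimately have LL: "act C \<Psi> transpose i k (mul C \<Psi> i j k a' a) b \<cdot> w = val (g \<star> f) \<cdot> \<beta>"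
      using L(3)[of w] by (simp add: \<beta>_def)
    let ?l = "val g \<cdot> (Ta B (FO F i) (FO F j) \<cdot> val f)"
    have FF: "FA F f \<in> Mor B.\<Phi>" "FA F g \<in> Mor B.\<Phi>" "tgt (FA F f) = src (FA F g)" using fm gm by simp_all
    have cl: "B.composable (FO F i) (FO F j) (FO F k) ?l (val f \<cdot> \<rho> ?l)"
      using B.Phi_composable[OF FF] fm gm by (simp add: val_def)
    \<comment> \<open>Functoriality of \<open>F\<close> at a composite, read on underlying sections
      by the composition of \<open>\<Phi> B\<close>.\<close>
    have vgf: "val (g \<star> f) = mul C B (FO F i) (FO F j) (FO F k) ?l (val f \<cdot> \<rho> ?l)"
      using B.Phi_Cmp(4)[OF FF] is_functor_simps(6)[OF F_functor, of f g] fm gm by (simp add: val_def)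
    have lb: "?l \<cdot> \<beta> = val g \<cdot> \<gamma>" using fm gm by (simp add: \<gamma>_def)
    have "\<rho> (val g \<cdot> \<gamma>) = w"
      using yw rst_cmp_rid[OF w, of "act C \<Psi> transpose j k a' ?T"] y(2) rst_cmp_rid[OF w, of b] r\<beta>
      by (simp add: \<beta>_def)
    then have "\<rho> ?l \<cdot> \<beta> = \<beta>" using rst_shift[of \<beta> ?l] lb r\<beta> cmp_rst_self[of \<beta>] fm gm by simp
    then have "val (g \<star> f) \<cdot> \<beta> = mul C B (FO F i) (FO F j) (FO F k) (val g \<cdot> \<gamma>) (val f \<cdot> \<beta>)"
      using B.mul_cmp[OF _ _ _ cl, of \<beta>] lb vgf fm gm by simp
    also have "\<dots> = mul C B (FO F i) (FO F j) (FO F k) (act C \<Psi> transpose j k a' ?T) ?x \<cdot> w"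
      using B.mul_cmp[OF _ _ _ cB, of w] yw xw by simp
    finally show "act C \<Psi> transpose i k (mul C \<Psi> i j k a' a) b \<cdot> w =
      mul C B (FO F i) (FO F j) (FO F k) (act C \<Psi> transpose j k a' ?T) ?x \<cdot> w"
      using LL by simp
  qed
  then show "act C \<Psi> transpose i k (mul C \<Psi> i j k a' a) b =
    mul C B (CI transpose i) (CI transpose j) (CI transpose k)
      (act C \<Psi> transpose j k a' (Ta B (CI transpose i) (CI transpose j) \<cdot> act C \<Psi> transpose i j a b))
      (act C \<Psi> transpose i j a b)" by simp
qed

lemma transpose_arr:
  assumes f: "f \<in> Mor A"
  shows "cofunctor.Phi_arr C \<Psi> transpose (unit_arr f) = FA F f"
proof -
  interpret T: cofunctor C \<Psi> B transpose by (rule transpose_cofunctor)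
  note u = unit_arr[OF f] and p = T.Phi_arr[OF unit_arr(1)[OF f]]
  let ?b = "\<rho> (sec f \<cdot> \<alpha> (src f))"
  have s: "sec f \<cdot> (\<alpha> (src f) \<cdot> ?b) = sec f \<cdot> \<alpha> (src f)" using cmp_cmp_rst[of "\<alpha> (src f)" "sec f"] f by simp
  have "act C \<Psi> transpose (src f) (tgt f) (sec f \<cdot> (\<alpha> (src f) \<cdot> ?b)) ?b = val f \<cdot> ?b"
    by (rule act_transpose_sec) (use f s in auto)
  also have "\<dots> = val f" using cmp_rst_self[of "val f"] rst_val[OF f] f by simp
  finally have "sect B (T.Phi_arr (unit_arr f)) = val f" using p(4) u s f by simp
  then show ?thesis by (intro sect_eqI[of _ _ B]) (use p(2,3) u f in \<open>simp_all add: val_def\<close>)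
qed

end

context glued_over
begin

text \<open>The triangle with the unit is an equation between extensional data, so it splits into
  one condition for each object and one for each arrow of \<open>A\<close>.\<close>

lemma over_comp_unit:
  assumes "cofunctor C \<Psi> B G"
  shows "over_comp C X (Phi_map C \<Psi> G) (lbl (adj_unit C X)) = (F, \<alpha>) \<longleftrightarrow>
    F = res_functr A F \<and> \<alpha> \<in> extensional (Obj A) \<and>
    (\<forall>i\<in>Obj A. CI G i = FO F i \<and> CO G i = \<alpha> i) \<and>
    (\<forall>f\<in>Mor A. cofunctor.Phi_arr C \<Psi> G (unit_arr f) = FA F f)" (is "?L \<longleftrightarrow> ?R")
proof -
  interpret G: cofunctor C \<Psi> B G by fact
  let ?F = "res_functr A (comp_functr (res_functr \<Psi>.\<Phi> \<lparr>FO = CI G, FA = G.Phi_arr\<rparr>)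
    (res_functr A \<lparr>FO = \<lambda>i. i, FA = unit_arr\<rparr>))"
  let ?a = "\<lambda>i\<in>Obj A. CO G i"
  have c: "over_comp C X (Phi_map C \<Psi> G) (lbl (adj_unit C X)) = (?F, ?a)"
  proof -
    have "Phi_map C \<Psi> G = (res_functr \<Psi>.\<Phi> \<lparr>FO = CI G, FA = G.Phi_arr\<rparr>, restrict (CO G) (Obj A))"
      by (rule prod_eqI) simp_all
    moreover have "(\<lambda>i\<in>Obj A. (\<lambda>i\<in>Obj A. Idn C (FO P i)) i \<cdot> restrict (CO G) (Obj A) (FO (res_functr A \<lparr>FO = \<lambda>i. i, FA = unit_arr\<rparr>) i)) = ?a"
      by (rule restrict_ext) (simp add: G.co[simplified])
    ultimately show ?thesis by (simp add: over_comp_def adj_unit_eq)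
  qed
  have 1: "?F = F \<longleftrightarrow> F = res_functr A F \<and> (\<forall>i\<in>Obj A. CI G i = FO F i) \<and> (\<forall>f\<in>Mor A. G.Phi_arr (unit_arr f) = FA F f)"
  proof
    assume eq: "?F = F"
    then show "F = res_functr A F \<and> (\<forall>i\<in>Obj A. CI G i = FO F i) \<and> (\<forall>f\<in>Mor A. G.Phi_arr (unit_arr f) = FA F f)"
      using unit_arr(1) by (auto simp flip: eq)
  next
    assume "F = res_functr A F \<and> (\<forall>i\<in>Obj A. CI G i = FO F i) \<and> (\<forall>f\<in>Mor A. G.Phi_arr (unit_arr f) = FA F f)"
    then show "?F = F" using unit_arr(1) by (subst res_functr_eqI[of ?F A F]) simp_all
  qed
  have 2: "?a = \<alpha> \<longleftrightarrow> \<alpha> \<in> extensional (Obj A) \<and> (\<forall>i\<in>Obj A. CO G i = \<alpha> i)"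
    by (metis (no_types, lifting) extensionalityI restrict_apply' restrict_extensional)
  show ?thesis unfolding c using 1 2 by auto
qed

text \<open>\<open>transpose\<close> solves the triangle by \<open>transpose_arr\<close>, and
  \<open>cofunctor_ext\<close> shows that the triangle leaves no other solution.\<close>

theorem unit_universal:
  assumes B: "B \<in> Obj (pCat C)" and h: "h \<in> hom (rCat_over C) X (FO (Phi C) B)"
  shows "\<exists>!G. G \<in> hom (pCat C) \<Psi> B \<and> FA (Phi C) G \<cdot>\<^bsub>rCat_over C\<^esub> adj_unit C X = h"
proof -
  have pB: "partite C B" using B restriction_category_axioms by (simp add: partite_def)
  interpret B: partite C B by (rule pB)
  obtain F \<alpha> where h': "lbl h = (F, \<alpha>)" by fastforce
  have hh: "over_hom C X (B.\<Phi>, Phi_proj C B) (F, \<alpha>)" "src h = X" "tgt h = FO (Phi C) B"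
    using h h' by (auto simp: Phi_def)
  interpret over_arrow C A P B F \<alpha> by unfold_locales (rule hh(1))
  have Fa: "F = res_functr A F" "\<alpha> \<in> extensional (Obj A)" using hh(1) by (auto simp: over_hom_def)
  note mor = pCat_mor_iff[OF restriction_category_axioms]
  have key: "FA (Phi C) G \<cdot>\<^bsub>rCat_over C\<^esub> adj_unit C X = h \<longleftrightarrow>
    (\<forall>i\<in>Obj A. CI (lbl G) i = FO F i \<and> CO (lbl G) i = \<alpha> i) \<and>
    (\<forall>f\<in>Mor A. cofunctor.Phi_arr C \<Psi> (lbl G) (unit_arr f) = FA F f)" if G: "G \<in> hom (pCat C) \<Psi> B" for G
  proof -
    have cG: "cofunctor C \<Psi> B (lbl G)" "src G = \<Psi>" "tgt G = B" using G mor by auto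
    have "FA (Phi C) G \<cdot>\<^bsub>rCat_over C\<^esub> adj_unit C X = h \<longleftrightarrow>
      over_comp C X (Phi_map C \<Psi> (lbl G)) (lbl (adj_unit C X)) = (F, \<alpha>)"
    proof
      assume "FA (Phi C) G \<cdot>\<^bsub>rCat_over C\<^esub> adj_unit C X = h"
      from arg_cong[OF this, of lbl] show "over_comp C X (Phi_map C \<Psi> (lbl G)) (lbl (adj_unit C X)) = (F, \<alpha>)"
        using cG(2) h' by (simp add: Phi_def adj_unit_eq)
    next
      assume "over_comp C X (Phi_map C \<Psi> (lbl G)) (lbl (adj_unit C X)) = (F, \<alpha>)"
      then show "FA (Phi C) G \<cdot>\<^bsub>rCat_over C\<^esub> adj_unit C X = h"
        by (intro arr.expand) (use cG(2,3) h' hh in \<open>simp add: Phi_def adj_unit_eq\<close>)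
    qed
    then show ?thesis using over_comp_unit[OF cG(1)] Fa by simp
  qed
  show ?thesis
  proof (rule ex1I[of _ "Arw \<Psi> transpose B"])
    have t: "Arw \<Psi> transpose B \<in> hom (pCat C) \<Psi> B" using transpose_cofunctor by (simp add: mor)
    show "Arw \<Psi> transpose B \<in> hom (pCat C) \<Psi> B \<and>
      FA (Phi C) (Arw \<Psi> transpose B) \<cdot>\<^bsub>rCat_over C\<^esub> adj_unit C X = h"
      using t key[OF t] transpose_arr by simp
    fix G assume G: "G \<in> hom (pCat C) \<Psi> B \<and> FA (Phi C) G \<cdot>\<^bsub>rCat_over C\<^esub> adj_unit C X = h"
    then have k: "(\<forall>i\<in>Obj A. CI (lbl G) i = FO F i \<and> CO (lbl G) i = \<alpha> i) \<and>
      (\<forall>f\<in>Mor A. cofunctor.Phi_arr C \<Psi> (lbl G) (unit_arr f) = FA F f)" using key by blast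
    have cG: "cofunctor C \<Psi> B (lbl G)" "src G = \<Psi>" "tgt G = B" using G mor by auto
    have "lbl G = transpose"
      by (rule cofunctor_ext[OF cG(1) transpose_cofunctor]) (use k transpose_arr in auto)
    then show "G = Arw \<Psi> transpose B" using cG by (intro arr.expand) simp
  qed
qed

end

section \<open>Fixpoints\<close>

text \<open>Bijectivity on hom-sets makes the functor preserve and reflect the order, so
  compatibility and joins of parallel arrows may be computed in \<open>B\<close>.\<close>

lemma join_restriction_category_fully_faithful:
  assumes "restriction_category A" "join_restriction_category B" and F: "restriction_functor A B F"
    and ff: "\<And>i j. \<lbrakk>i \<in> Obj A; j \<in> Obj A\<rbrakk> \<Longrightarrow> bij_betw (FA F) (hom A i j) (hom B (FO F i) (FO F j))"
  shows "join_restriction_category A"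
proof -
  interpret A: restriction_category A by fact
  interpret B: join_restriction_category B by fact
  have Ff: "is_functor A B F" and Fr: "\<And>f. f \<in> Mor A \<Longrightarrow> FA F (\<rho>\<^bsub>A\<^esub> f) = \<rho>\<^bsub>B\<^esub> (FA F f)"
    using F by (auto simp: restriction_functor_def)
  note s [simp] = is_functor_simps[OF Ff] Fr
  have inj: "FA F f = FA F g \<longleftrightarrow> f = g" if "f \<in> hom A i j" "g \<in> hom A i j" for f g i j
  proof -
    have "inj_on (FA F) (hom A i j)" using that ff[of i j] by (auto simp: bij_betw_def)
    then show ?thesis using that by (auto simp only: inj_on_eq_iff)
  qed
  have surj: "\<exists>f\<in>hom A i j. FA F f = g" if "g \<in> hom B (FO F i) (FO F j)" "i \<in> Obj A" "j \<in> Obj A" for g i j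
    using bij_betw_imp_surj_on[OF ff[OF that(2,3)]] that(1) by (metis imageE)
  have rle: "rle A f g \<longleftrightarrow> rle B (FA F f) (FA F g)" if "f \<in> hom A i j" "g \<in> hom A i j" for f g i j
    using inj[of f i j "g \<cdot>\<^bsub>A\<^esub> \<rho>\<^bsub>A\<^esub> f"] that by (auto simp: rle_def)
  have join: "is_join A i j S f \<longleftrightarrow> is_join B (FO F i) (FO F j) (FA F ` S) (FA F f)"
    if S: "S \<subseteq> hom A i j" and f: "f \<in> hom A i j" for i j S f
  proof
    assume J: "is_join A i j S f"
    show "is_join B (FO F i) (FO F j) (FA F ` S) (FA F f)"
      unfolding is_join_def
    proof (intro conjI ballI impI)
      show "FA F f \<in> hom B (FO F i) (FO F j)" using f by auto
      show "rle B x (FA F f)" if "x \<in> FA F ` S" for x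
        using that rle[OF _ f] S J by (auto simp: is_join_def subset_iff)
      fix g assume g: "g \<in> hom B (FO F i) (FO F j)" "\<forall>s\<in>FA F ` S. rle B s g"
      obtain g' where g': "g' \<in> hom A i j" "FA F g' = g" using surj[OF g(1)] f by auto
      then have "\<forall>s\<in>S. rle A s g'" using g(2) rle[OF subsetD[OF S] g'(1)] by auto
      then show "rle B (FA F f) g" using J g' rle[OF f g'(1)] by (auto simp: is_join_def)
    qed
  next
    assume J: "is_join B (FO F i) (FO F j) (FA F ` S) (FA F f)"
    show "is_join A i j S f"
      unfolding is_join_def
    proof (intro conjI ballI impI)
      show "rle A x f" if "x \<in> S" for x
        using that rle[OF subsetD[OF S that] f] J by (auto simp: is_join_def)
      fix g assume g: "g \<in> hom A i j" "\<forall>s\<in>S. rle A s g"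
      then have "\<forall>s\<in>FA F ` S. rle B s (FA F g)" using rle[OF subsetD[OF S] g(1)] by auto
      moreover have "FA F g \<in> hom B (FO F i) (FO F j)" using g(1) by auto
      ultimately show "rle A f g" using J rle[OF f g(1)] by (auto simp: is_join_def)
    qed (use f in auto)
  qed
  show ?thesis
  proof
    fix i j S assume ij: "i \<in> Obj A" "j \<in> Obj A" and S: "S \<subseteq> hom A i j" and c: "\<forall>s\<in>S. \<forall>t\<in>S. compat A s t"
    have Sm: "s \<in> Mor A" "src s = i" "tgt s = j" if "s \<in> S" for s using S that by auto
    have "compat B (FA F s) (FA F t)" if st: "s \<in> S" "t \<in> S" for s t
    proof -
      have "FA F (s \<cdot>\<^bsub>A\<^esub> \<rho>\<^bsub>A\<^esub> t) = FA F (t \<cdot>\<^bsub>A\<^esub> \<rho>\<^bsub>A\<^esub> s)" using c st by (simp add: compat_def)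
      then show ?thesis using Sm[OF st(1)] Sm[OF st(2)] by (simp add: compat_def)
    qed
    moreover have S': "FA F ` S \<subseteq> hom B (FO F i) (FO F j)" using Sm by auto
    ultimately obtain J where J: "is_join B (FO F i) (FO F j) (FA F ` S) J"
      using B.join_exists[of "FO F i" "FO F j" "FA F ` S"] ij by auto
    then obtain f where "f \<in> hom A i j" "FA F f = J" using surj[of J i j] ij by (auto simp: is_join_def)
    then show "\<exists>f. is_join A i j S f" using join[OF S] J by blast
  next
    fix S i j f g h assume S: "S \<subseteq> hom A i j" and J: "is_join A i j S f" and g: "g \<in> hom A h i"
    have f: "f \<in> hom A i j" using J by (simp add: is_join_def)
    have S': "FA F ` S \<subseteq> hom B (FO F i) (FO F j)" using S by auto
    have "is_join B (FO F h) (FO F j) ((\<lambda>s. s \<cdot>\<^bsub>B\<^esub> FA F g) ` FA F ` S) (FA F f \<cdot>\<^bsub>B\<^esub> FA F g)"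
      by (rule B.join_precomp[OF S' iffD1[OF join[OF S f] J]]) (use g in auto)
    moreover have "(\<lambda>s. s \<cdot>\<^bsub>B\<^esub> FA F g) ` FA F ` S = FA F ` (\<lambda>s. s \<cdot>\<^bsub>A\<^esub> g) ` S"
      unfolding image_image using S g by (intro image_cong) auto
    moreover have "FA F f \<cdot>\<^bsub>B\<^esub> FA F g = FA F (f \<cdot>\<^bsub>A\<^esub> g)" using f g by simp
    ultimately have "is_join B (FO F h) (FO F j) (FA F ` (\<lambda>s. s \<cdot>\<^bsub>A\<^esub> g) ` S) (FA F (f \<cdot>\<^bsub>A\<^esub> g))"
      by simp
    moreover have "(\<lambda>s. s \<cdot>\<^bsub>A\<^esub> g) ` S \<subseteq> hom A h j" "f \<cdot>\<^bsub>A\<^esub> g \<in> hom A h j" using S f g by auto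
    ultimately show "is_join A h j ((\<lambda>s. s \<cdot>\<^bsub>A\<^esub> g) ` S) (f \<cdot>\<^bsub>A\<^esub> g)" using join by blast
  qed
qed

section \<open>Invertibility of the unit\<close>

context glued_over
begin

text \<open>Says that each partial section of \<open>\<sigma> i j\<close> is \<open>sec f\<close>
  for exactly one \<open>f\<close>. As the unit is the identity on objects, this is what its
  invertibility amounts to.\<close>

definition sections_bij where
  "sections_bij \<longleftrightarrow> (\<forall>i\<in>Obj A. \<forall>j\<in>Obj A. bij_betw unit_arr (hom A i j) (hom \<Psi>.\<Phi> i j))"

lemma sections_bij_iff:
  "sections_bij \<longleftrightarrow> inj_on unit_arr (Mor A) \<and> (\<forall>s\<in>Mor \<Psi>.\<Phi>. \<exists>f\<in>Mor A. unit_arr f = s)"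
proof
  assume b: sections_bij
  have "inj_on unit_arr (Mor A)"
  proof (rule inj_onI)
    fix f g assume fg: "f \<in> Mor A" "g \<in> Mor A" "unit_arr f = unit_arr g"
    then have "src f = src g" "tgt f = tgt g" using unit_arr(2,3) by metis+
    moreover have "inj_on unit_arr (hom A (src f) (tgt f))"
      using b fg by (simp add: sections_bij_def bij_betw_def)
    ultimately show "f = g" using fg by (auto dest: inj_onD)
  qed
  moreover have "\<exists>f\<in>Mor A. unit_arr f = s" if s: "s \<in> Mor \<Psi>.\<Phi>" for s
  proof -
    have "src s \<in> Obj A" "tgt s \<in> Obj A" using \<Psi>.Phi_Mor_simps(1,2)[OF s] by simp_all
    then have "unit_arr ` hom A (src s) (tgt s) = hom \<Psi>.\<Phi> (src s) (tgt s)"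
      using b by (auto simp: sections_bij_def bij_betw_def)
    then have "s \<in> unit_arr ` hom A (src s) (tgt s)" using s by simp
    then show ?thesis by auto
  qed
  ultimately show "inj_on unit_arr (Mor A) \<and> (\<forall>s\<in>Mor \<Psi>.\<Phi>. \<exists>f\<in>Mor A. unit_arr f = s)" by blast
next
  assume b: "inj_on unit_arr (Mor A) \<and> (\<forall>s\<in>Mor \<Psi>.\<Phi>. \<exists>f\<in>Mor A. unit_arr f = s)"
  show sections_bij
    unfolding sections_bij_def bij_betw_def
  proof (intro ballI conjI)
    fix i j assume "i \<in> Obj A" "j \<in> Obj A"
    show "inj_on unit_arr (hom A i j)" using b by (auto intro: inj_on_subset simp: hom_def)
    show "unit_arr ` hom A i j = hom \<Psi>.\<Phi> i j"
    proof
      show "unit_arr ` hom A i j \<subseteq> hom \<Psi>.\<Phi> i j" using unit_arr by auto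
      show "hom \<Psi>.\<Phi> i j \<subseteq> unit_arr ` hom A i j"
      proof
        fix s assume s: "s \<in> hom \<Psi>.\<Phi> i j"
        then obtain f where f: "f \<in> Mor A" "unit_arr f = s" using b by auto
        then have "f \<in> hom A i j" using unit_arr(2,3)[OF f(1)] s by simp
        then show "s \<in> unit_arr ` hom A i j" using f by blast
      qed
    qed
  qed
qed

lemma iso_unit_imp_bij:
  assumes "iso_arr (rCat_over C) (adj_unit C X)"
  shows "sections_bij"
proof -
  obtain g where g: "g \<in> hom (rCat_over C) (\<Psi>.\<Phi>, Phi_proj C \<Psi>) X"
    and gu: "g \<cdot>\<^bsub>rCat_over C\<^esub> adj_unit C X = Idn (rCat_over C) X"
    and ug: "adj_unit C X \<cdot>\<^bsub>rCat_over C\<^esub> g = Idn (rCat_over C) (\<Psi>.\<Phi>, Phi_proj C \<Psi>)"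
    using assms unfolding iso_arr_def by (auto simp: adj_unit_eq)
  obtain V \<beta> where V: "lbl g = (V, \<beta>)" by fastforce
  have oh: "over_hom C (\<Psi>.\<Phi>, Phi_proj C \<Psi>) X (V, \<beta>)" and sg: "src g = (\<Psi>.\<Phi>, Phi_proj C \<Psi>)"
    using g V by auto
  have Vf: "is_functor \<Psi>.\<Phi> A V" using oh by (auto simp: over_hom_def restriction_functor_def)
  have "over_comp C X (V, \<beta>) (res_functr A \<lparr>FO = \<lambda>i. i, FA = unit_arr\<rparr>, \<lambda>i\<in>Obj A. Idn C (FO P i)) = over_id C X"
    using arg_cong[OF gu, of lbl] V by (simp add: adj_unit_eq)
  then have 1: "res_functr A (comp_functr V (res_functr A \<lparr>FO = \<lambda>i. i, FA = unit_arr\<rparr>)) = res_functr A id_functr"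
    by (simp add: over_comp_def over_id_def)
  have vu: "FA V (unit_arr f) = f" if "f \<in> Mor A" for f
    using arg_cong[OF 1, of "\<lambda>F. FA F f"] that by (simp add: id_functr_def)
  have "over_comp C (\<Psi>.\<Phi>, Phi_proj C \<Psi>) (res_functr A \<lparr>FO = \<lambda>i. i, FA = unit_arr\<rparr>, \<lambda>i\<in>Obj A. Idn C (FO P i)) (V, \<beta>)
     = over_id C (\<Psi>.\<Phi>, Phi_proj C \<Psi>)"
    using arg_cong[OF ug, of lbl] V sg by (simp add: adj_unit_eq)
  then have 2: "res_functr \<Psi>.\<Phi> (comp_functr (res_functr A \<lparr>FO = \<lambda>i. i, FA = unit_arr\<rparr>) V) = res_functr \<Psi>.\<Phi> id_functr"
    by (simp add: over_comp_def over_id_def)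
  have uv: "unit_arr (FA V s) = s" if "s \<in> Mor \<Psi>.\<Phi>" for s
    using arg_cong[OF 2, of "\<lambda>F. FA F s"] that is_functor_simps(2)[OF Vf that] by (simp add: id_functr_def)
  show ?thesis
    unfolding sections_bij_iff using vu uv is_functor_simps(2)[OF Vf] by (metis inj_on_inverseI)
qed

text \<open>The inverse on arrows is functorial and respects restrictions and projections because
  \<open>unit_arr\<close> does; the accompanying transformation consists of identities.\<close>

lemma bij_imp_iso_unit:
  assumes bij: sections_bij
  shows "iso_arr (rCat_over C) (adj_unit C X)"
proof -
  define v where "v = the_inv_into (Mor A) unit_arr"
  have inj: "inj_on unit_arr (Mor A)" and surj: "\<And>s. s \<in> Mor \<Psi>.\<Phi> \<Longrightarrow> s \<in> unit_arr ` Mor A"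
    using bij sections_bij_iff by auto
  have vu [simp]: "v (unit_arr f) = f" if "f \<in> Mor A" for f
    unfolding v_def using the_inv_into_f_f[OF inj that] .
  have uv: "v s \<in> Mor A" "unit_arr (v s) = s" if "s \<in> Mor \<Psi>.\<Phi>" for s
    using surj[OF that] by auto
  have st: "src (v s) = src s" "tgt (v s) = tgt s" if "s \<in> Mor \<Psi>.\<Phi>" for s
    using unit_arr(2,3)[OF uv(1)[OF that]] uv(2)[OF that] by simp_all
  let ?V = "\<lparr>FO = \<lambda>i. i, FA = v\<rparr>"
  let ?a = "\<lambda>i\<in>Obj A. Idn C (FO P i)"
  have Vr: "restriction_functor \<Psi>.\<Phi> A ?V"
    unfolding restriction_functor_def is_functor_def
  proof (intro conjI ballI impI)
    show "category \<Psi>.\<Phi>" "category A" using \<Psi>.Phi_category A.category_axioms by blast+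
    show "FA ?V (Idn \<Psi>.\<Phi> i) = Idn A (FO ?V i)" if "i \<in> Obj \<Psi>.\<Phi>" for i
      using that vu[of "Idn A i"] by (simp add: unit_arr_idn)
    show "FA ?V (t \<cdot>\<^bsub>\<Psi>.\<Phi>\<^esub> s) = FA ?V t \<star> FA ?V s" if s: "s \<in> Mor \<Psi>.\<Phi>" and t: "t \<in> Mor \<Psi>.\<Phi>" and "tgt s = src t" for s t
    proof -
      have "v (unit_arr (v t \<star> v s)) = v t \<star> v s" using that st uv by simp
      then show ?thesis using that st uv by (simp add: unit_arr_cmp)
    qed
    show "FA ?V (\<rho>\<^bsub>\<Psi>.\<Phi>\<^esub> s) = \<rho>\<^sub>A (FA ?V s)" if s: "s \<in> Mor \<Psi>.\<Phi>" for s
      using vu[of "\<rho>\<^sub>A (v s)"] uv[OF s] by (simp add: unit_arr_rst)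
  qed (use uv st in auto)
  define g where "g = Arw (\<Psi>.\<Phi>, Phi_proj C \<Psi>) (res_functr \<Psi>.\<Phi> ?V, ?a) X"
  have "nat_trans \<Psi>.\<Phi> C (comp_functr P (res_functr \<Psi>.\<Phi> ?V)) (Phi_proj C \<Psi>) ?a"
    unfolding nat_trans_def
  proof (intro conjI ballI)
    fix s assume s: "s \<in> Mor \<Psi>.\<Phi>"
    have "FA (Phi_proj C \<Psi>) s = FA P (v s)" using unit_proj[OF uv(1)[OF s]] uv(2)[OF s] by simp
    then show "?a (tgt s) \<cdot> FA (comp_functr P (res_functr \<Psi>.\<Phi> ?V)) s = FA (Phi_proj C \<Psi>) s \<cdot> ?a (src s)"
      using s uv(1)[OF s] st[OF s] \<Psi>.Phi_Mor_simps(1,2)[OF s] by (simp del: \<Psi>.Phi_proj_simps)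
  qed simp
  then have gh: "g \<in> hom (rCat_over C) (\<Psi>.\<Phi>, Phi_proj C \<Psi>) X"
    using Vr over_obj Phi_over_obj[OF Psi_partite small]
    by (simp add: g_def over_hom_def restriction_functor_res \<Psi>.Phi_restriction_category)
  have 1: "g \<cdot>\<^bsub>rCat_over C\<^esub> adj_unit C X = Idn (rCat_over C) X"
  proof (rule arr.expand, intro conjI)
    have "res_functr A (comp_functr (res_functr \<Psi>.\<Phi> ?V) (res_functr A \<lparr>FO = \<lambda>i. i, FA = unit_arr\<rparr>)) = res_functr A id_functr"
      by (rule res_functr_eqI[of _ A]) (use unit_arr in \<open>simp_all add: id_functr_def\<close>)
    moreover have "(\<lambda>i\<in>Obj A. ?a i \<cdot> ?a (FO (res_functr A \<lparr>FO = \<lambda>i. i, FA = unit_arr\<rparr>) i)) = ?a"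
      by (rule restrict_ext) simp
    ultimately show "lbl (g \<cdot>\<^bsub>rCat_over C\<^esub> adj_unit C X) = lbl (Idn (rCat_over C) X)"
      by (simp add: g_def adj_unit_eq over_comp_def over_id_def)
  qed (simp_all add: g_def adj_unit_eq)
  have 2: "adj_unit C X \<cdot>\<^bsub>rCat_over C\<^esub> g = Idn (rCat_over C) (\<Psi>.\<Phi>, Phi_proj C \<Psi>)"
  proof (rule arr.expand, intro conjI)
    have "res_functr \<Psi>.\<Phi> (comp_functr (res_functr A \<lparr>FO = \<lambda>i. i, FA = unit_arr\<rparr>) (res_functr \<Psi>.\<Phi> ?V)) = res_functr \<Psi>.\<Phi> id_functr"
      by (rule res_functr_eqI[of _ \<Psi>.\<Phi>]) (use uv in \<open>simp_all add: id_functr_def\<close>)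
    moreover have "(\<lambda>i\<in>Obj A. ?a i \<cdot> ?a (FO (res_functr \<Psi>.\<Phi> ?V) i)) = ?a"
      by (rule restrict_ext) simp
    ultimately show "lbl (adj_unit C X \<cdot>\<^bsub>rCat_over C\<^esub> g) = lbl (Idn (rCat_over C) (\<Psi>.\<Phi>, Phi_proj C \<Psi>))"
      by (simp add: g_def adj_unit_eq over_comp_def over_id_def)
  qed (simp_all add: g_def adj_unit_eq)
  have m: "adj_unit C X \<in> Mor (rCat_over C)" using adj_unit_mor by (simp only: in_hom)
  have st: "src (adj_unit C X) = X" "tgt (adj_unit C X) = (\<Psi>.\<Phi>, Phi_proj C \<Psi>)"
    by (simp_all add: adj_unit_eq)
  show ?thesis unfolding iso_arr_def st using m gh 1 2 by blast
qed

text \<open>The category of partial sections has joins and is hyperconnected over \<open>C\<close>.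
  Both properties travel back along the fully faithful unit, the second because the unit commutes
  with the projections to \<open>C\<close>.\<close>

lemma bij_imp_join_hyperconnected:
  assumes bij: sections_bij
  shows "join_restriction_category A" "hyperconnected A C P"
proof -
  show "join_restriction_category A"
    by (rule join_restriction_category_fully_faithful[OF A.restriction_category_axioms
          Phi_join_restriction_category[OF join_restriction_category_axioms Psi_partite] unit_functor])
      (use bij in \<open>simp add: sections_bij_def\<close>)
  have inj: "inj_on unit_arr (Mor A)" and surj: "\<And>s. s \<in> Mor \<Psi>.\<Phi> \<Longrightarrow> \<exists>f\<in>Mor A. unit_arr f = s"
    using bij sections_bij_iff by auto
  interpret R: restriction_category \<Psi>.\<Phi> by (rule \<Psi>.Phi_restriction_category)
  have "bij_betw (FA P) (rid A i) (rid C (FO P i))" if i: "i \<in> Obj A" for i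
  proof -
    have "bij_betw unit_arr (rid A i) (rid \<Psi>.\<Phi> i)"
      unfolding bij_betw_def
    proof
      show "inj_on unit_arr (rid A i)" by (rule inj_on_subset[OF inj]) (auto simp: A.rid_iff)
      show "unit_arr ` rid A i = rid \<Psi>.\<Phi> i"
      proof
        show "unit_arr ` rid A i \<subseteq> rid \<Psi>.\<Phi> i"
          using unit_arr by (auto simp: A.rid_iff R.rid_iff unit_arr_rst[symmetric])
        show "rid \<Psi>.\<Phi> i \<subseteq> unit_arr ` rid A i"
        proof
          fix s assume "s \<in> rid \<Psi>.\<Phi> i"
          then have s: "s \<in> Mor \<Psi>.\<Phi>" "src s = i" "tgt s = i" "\<rho>\<^bsub>\<Psi>.\<Phi>\<^esub> s = s" by (auto simp: R.rid_iff)
          obtain f where f: "f \<in> Mor A" "unit_arr f = s" using surj[OF s(1)] by blast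
          have st: "src f = i" "tgt f = i" using unit_arr(2,3)[OF f(1)] f(2) s by simp_all
          have "unit_arr (\<rho>\<^sub>A f) = unit_arr f" using unit_arr_rst[OF f(1)] f(2) s(4) by simp
          then have "\<rho>\<^sub>A f = f" using inj_onD[OF inj] f by simp
          then show "s \<in> unit_arr ` rid A i" using f st by (auto simp: A.rid_iff)
        qed
      qed
    qed
    moreover have "bij_betw (FA (Phi_proj C \<Psi>)) (rid \<Psi>.\<Phi> i) (rid C (FO P i))"
      using \<Psi>.Phi_hyperconnected i unfolding hyperconnected_def by auto
    ultimately have "bij_betw (FA (Phi_proj C \<Psi>) \<circ> unit_arr) (rid A i) (rid C (FO P i))"
      by (rule bij_betw_trans)
    moreover have "(FA (Phi_proj C \<Psi>) \<circ> unit_arr) f = FA P f" if "f \<in> rid A i" for f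
      using unit_proj[of f] that by (simp add: A.rid_iff del: \<Psi>.Phi_proj_simps)
    ultimately show ?thesis using bij_betw_cong[of "rid A i" "FA (Phi_proj C \<Psi>) \<circ> unit_arr" "FA P"] by blast
  qed
  then show "hyperconnected A C P"
    using over_obj by (simp add: hyperconnected_def over_obj_def)
qed

text \<open>Injectivity: \<open>sec f = sec g\<close> makes \<open>eqx f g\<close> the whole domain
  of \<open>f\<close>; hyperconnectedness turns this join into one in \<open>A\<close>, on which
  \<open>f\<close> and \<open>g\<close> agree. Surjectivity: a partial section is split into
  restrictions of sections \<open>sec f\<close>, the idempotents are lifted to \<open>A\<close>, and
  the restricted arrows are joined there.\<close>

lemma join_hyperconnected_imp_bij:
  assumes "join_restriction_category A" and hyp: "hyperconnected A C P"
  shows sections_bij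
proof -
  interpret A: join_restriction_category A by fact
  have bij: "bij_betw (FA P) (rid A i) (rid C (FO P i))" if "i \<in> Obj A" for i
    using hyp that by (simp add: hyperconnected_def)
  have injP: "d = e" if "d \<in> rid A i" "e \<in> rid A i" "FA P d = FA P e" for d e i
  proof -
    have "i \<in> Obj A" using that(1) by (auto simp: A.rid_iff)
    then show ?thesis using bij[of i] that by (auto simp: bij_betw_def dest: inj_onD)
  qed
  have surjP: "\<exists>d\<in>rid A i. FA P d = w" if "w \<in> rid C (FO P i)" "i \<in> Obj A" for w i
    using bij_betw_imp_surj_on[OF bij[OF that(2)]] that(1) by (metis imageE)
  \<comment> \<open>An idempotent upper bound \<open>u\<close> in \<open>C\<close> is the image of
    some \<open>v\<close>, and \<open>FA P\<close> is injective on idempotents, so \<open>v\<close>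
    is an upper bound in \<open>A\<close>.\<close>
  have joinP: "is_join C (FO P i) (FO P i) (FA P ` E) (FA P c)"
    if E: "E \<subseteq> rid A i" and c: "is_join A i i E c" for E c i
  proof (rule join_ridI)
    have cr: "c \<in> rid A i" by (rule A.join_rid[OF E c])
    then have i: "i \<in> Obj A" by (auto simp: A.rid_iff)
    show "FA P ` E \<subseteq> rid C (FO P i)" "FA P c \<in> rid C (FO P i)" using E cr P_rid by auto
    have Pc: "FA P d \<cdot> FA P e = FA P (d \<star> e)" if "d \<in> rid A i" "e \<in> rid A i" for d e
      using that by (simp add: A.rid_iff)
    show "FA P c \<cdot> e = e" if "e \<in> FA P ` E" for e
      using that A.join_rid_upper[OF E c] Pc[OF cr] E by auto
    fix u assume u: "u \<in> rid C (FO P i)" and ue: "\<And>e. e \<in> FA P ` E \<Longrightarrow> u \<cdot> e = e"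
    obtain v where v: "v \<in> rid A i" "FA P v = u" using surjP[OF u i] by blast
    have "v \<star> e = e" if e: "e \<in> E" for e
    proof (rule injP)
      show "v \<star> e \<in> rid A i" "e \<in> rid A i" using A.rid_cmp[OF v(1)] E e by auto
      show "FA P (v \<star> e) = FA P e" using ue[of "FA P e"] Pc[OF v(1)] v(2) E e by auto
    qed
    then have "\<forall>e\<in>E. rle A e v" using A.rle_rid_iff E by blast
    then have "rle A c v" using c v(1) by (auto simp: is_join_def A.rid_iff)
    then have "v \<star> c = c" using A.rle_rid_iff[OF cr] by simp
    then show "u \<cdot> FA P c = FA P c" using Pc[OF v(1) cr] v(2) by simp
  qed
  have inj: "f = g" if f: "f \<in> hom A i j" and g: "g \<in> hom A i j" and eq: "sec f = sec g" for f g i j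
  proof -
    have m: "f \<in> Mor A" "src f = i" "tgt f = j" "g \<in> Mor A" "src g = i" "tgt g = j" using f g by auto
    have "\<rho>\<^sub>A f = \<rho>\<^sub>A g"
      by (rule injP[of _ i]) (use m arg_cong[OF eq, of "\<rho>"] in simp_all)
    have E: "agree f g \<subseteq> rid A i" using m by (auto simp: agree_def)
    obtain c where c: "is_join A i i (agree f g) c" using A.join_rid_exists[OF _ E] m by auto
    have "FA P c = eqx f g" using join_unique[OF joinP[OF E c] eqx_join[OF f g]] .
    also have "\<dots> = \<rho> (FA P f)"
      using A.src_obj'[OF m(1)] eqx_cmp[OF f g, of "Idn C (FO P i)"] rid_mor(1-3)[OF eqx_rid[OF f g]] m eq by simp
    finally have "c = \<rho>\<^sub>A f"
      by (intro injP[of _ i]) (use A.join_rid[OF E c] m in simp_all)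
    moreover have "f \<star> c = g \<star> c"
      by (rule A.join_local_eq[OF E c f g]) (simp add: agree_def)
    ultimately show ?thesis using \<open>\<rho>\<^sub>A f = \<rho>\<^sub>A g\<close> by (metis A.cmp_rst_self m(1,4))
  qed
  show ?thesis
    unfolding sections_bij_iff
  proof (intro conjI ballI inj_onI)
    fix f g assume fg: "f \<in> Mor A" "g \<in> Mor A" "unit_arr f = unit_arr g"
    then have "src f = src g" "tgt f = tgt g" "sec f = sec g" using unit_arr(2,3,4) by metis+
    then show "f = g" using inj[of f "src g" "tgt g" g] fg by simp
  next
    fix s assume s: "s \<in> Mor \<Psi>.\<Phi>"
    define i where "i = src s"
    define j where "j = tgt s"
    define t where "t = sect \<Psi> s"
    have ij [simp]: "i \<in> Obj A" "j \<in> Obj A" using \<Psi>.Phi_Mor_simps(1,2)[OF s] by (simp_all add: i_def j_def)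
    have t [simp]: "t \<in> Mor C" "src t = FO P i" "tgt t = src (\<sigma> i j)" and ts: "\<sigma> i j \<cdot> t = \<rho> t"
      using \<Psi>.Phi_Mor_simps(3,4)[OF s] by (simp_all add: i_def j_def t_def)
    interpret E: etale_family C "\<sigma> i j" "hom A i j" sec "ide i j" by (rule etale[OF ij])
    define w where "w f = \<rho> (ide i j f \<cdot> t)" for f
    have cov: "is_join C (FO P i) (FO P i) (w ` hom A i j) (\<rho> t)"
      using E.localize_cover[of t] by (simp add: w_def)
    have wr: "w f \<in> rid C (FO P i)" if "f \<in> hom A i j" for f using E.localize(1)[of t f] that by (simp add: w_def)
    have tw: "t \<cdot> w f = sec f \<cdot> w f" "\<rho> (t \<cdot> w f) = w f" if f: "f \<in> hom A i j" for f
    proof -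
      note l = E.localize[OF t(1,3) f, folded w_def]
      note wm [simp] = rid_mor(1-4)[OF wr[OF f]]
      show "\<rho> (t \<cdot> w f) = w f" by (rule l(3))
      have "\<sigma> i j \<cdot> (t \<cdot> w f) = \<rho> t \<cdot> w f" by (rule cmp_reassoc[OF ts]) auto
      also have "\<dots> = w f" using rst_cmp_rid[OF wr[OF f], of t] l(3) by simp
      finally show "t \<cdot> w f = sec f \<cdot> w f" using l(2) by simp
    qed
    \<comment> \<open>The idempotent of \<open>A\<close> lying over \<open>w f\<close>, provided by
      hyperconnectedness.\<close>
    define v where "v f = (SOME d. d \<in> rid A i \<and> FA P d = w f)" for f
    have v: "v f \<in> rid A i" "FA P (v f) = w f" if "f \<in> hom A i j" for f
      using someI_ex[of "\<lambda>d. d \<in> rid A i \<and> FA P d = w f"] surjP[OF wr[OF that]] unfolding v_def by auto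
    note vm = A.rid_mor(1-4)[OF v(1)]
    have rv: "\<rho>\<^sub>A (f \<star> v f) = v f" if f: "f \<in> hom A i j" for f
    proof (rule injP[of _ i])
      note [simp] = vm[OF f] v[OF f]
      have fm [simp]: "f \<in> Mor A" "src f = i" "tgt f = j" using f by auto
      show "\<rho>\<^sub>A (f \<star> v f) \<in> rid A i" "v f \<in> rid A i" by simp_all
      have "\<rho> (sec f \<cdot> w f) = w f" using tw[OF f] by simp
      then show "FA P (\<rho>\<^sub>A (f \<star> v f)) = FA P (v f)"
        using rst_cmp_rid[OF wr[OF f], of "sec f"] rst_cmp_rid[OF wr[OF f], of "FA P f"] by simp
    qed
    have secv: "sec (f \<star> v f) = t \<cdot> w f" if f: "f \<in> hom A i j" for f
      using sec_cmp_rid[of f "v f"] f v[OF f] tw[OF f] by simp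
    \<comment> \<open>Compatibility in \<open>A\<close> follows from injectivity of
      \<open>sec\<close>, since the sections of both sides are \<open>t\<close> restricted to the
      product of \<open>w f\<close> and \<open>w g\<close>.\<close>
    have "f \<star> v f \<star> \<rho>\<^sub>A (g \<star> v g) = g \<star> v g \<star> \<rho>\<^sub>A (f \<star> v f)" if f: "f \<in> hom A i j" and g: "g \<in> hom A i j" for f g
    proof (rule inj[of _ i j])
      note [simp] = vm[OF f] v[OF f] vm[OF g] v[OF g] wr[OF f, THEN rid_mor(1)] wr[OF g, THEN rid_mor(1)]
        wr[OF f, THEN rid_mor(2)] wr[OF g, THEN rid_mor(2)] wr[OF f, THEN rid_mor(3)] wr[OF g, THEN rid_mor(3)]
      have fm [simp]: "f \<in> Mor A" "src f = i" "tgt f = j" "g \<in> Mor A" "src g = i" "tgt g = j" using f g by auto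
      show "f \<star> v f \<star> \<rho>\<^sub>A (g \<star> v g) \<in> hom A i j" "g \<star> v g \<star> \<rho>\<^sub>A (f \<star> v f) \<in> hom A i j" by (simp_all add: rv f g)
      have "sec (f \<star> v f \<star> v g) = t \<cdot> w f \<cdot> w g"
        using sec_cmp_rid[of "f \<star> v f" "v g"] secv[OF f] by simp
      moreover have "sec (g \<star> v g \<star> v f) = t \<cdot> w g \<cdot> w f"
        using sec_cmp_rid[of "g \<star> v g" "v f"] secv[OF g] by simp
      moreover have "t \<cdot> w f \<cdot> w g = t \<cdot> w g \<cdot> w f" using rid_comm[OF wr[OF f] wr[OF g]] by simp
      ultimately show "sec (f \<star> v f \<star> \<rho>\<^sub>A (g \<star> v g)) = sec (g \<star> v g \<star> \<rho>\<^sub>A (f \<star> v f))"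
        using rv[OF f] rv[OF g] by simp
    qed
    then obtain h where h: "h \<in> hom A i j" and hv: "\<And>f. f \<in> hom A i j \<Longrightarrow> h \<star> \<rho>\<^sub>A (f \<star> v f) = f \<star> v f"
      and hj: "is_join A i i ((\<lambda>f. \<rho>\<^sub>A (f \<star> v f)) ` hom A i j) (\<rho>\<^sub>A h)"
      using A.glue_compat[of i j "hom A i j" "\<lambda>f. f \<star> v f"] vm by (auto simp: vm)
    have hm [simp]: "h \<in> Mor A" "src h = i" "tgt h = j" using h by auto
    have V: "(\<lambda>f. \<rho>\<^sub>A (f \<star> v f)) ` hom A i j = v ` hom A i j" using rv by (rule image_cong[OF refl])
    have "is_join C (FO P i) (FO P i) (FA P ` v ` hom A i j) (FA P (\<rho>\<^sub>A h))"
      by (rule joinP) (use hj V v in auto)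
    moreover have "FA P ` v ` hom A i j = w ` hom A i j" unfolding image_image using v(2) by (rule image_cong[OF refl])
    ultimately have rh: "\<rho> (sec h) = \<rho> t" using join_unique[OF cov] by simp
    have "sec h = t"
    proof (rule join_eq_local[OF _ cov])
      show "w ` hom A i j \<subseteq> rid C (FO P i)" using wr by auto
      show "sec h \<in> hom C (FO P i) (src (\<sigma> i j))" "t \<in> hom C (FO P i) (src (\<sigma> i j))" by simp_all
      show "sec h \<cdot> \<rho> t = sec h" "t \<cdot> \<rho> t = t" using cmp_rst_self[of "sec h"] rh by simp_all
      fix x assume "x \<in> w ` hom A i j"
      then obtain f where f: "f \<in> hom A i j" "x = w f" by blast
      have "sec h \<cdot> w f = sec (h \<star> v f)" using sec_cmp_rid[of h "v f"] v[OF f(1)] by simp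
      also have "\<dots> = t \<cdot> w f" using hv[OF f(1)] rv[OF f(1)] secv[OF f(1)] by simp
      finally show "sec h \<cdot> x = t \<cdot> x" using f by simp
    qed
    then have "unit_arr h = s"
      by (intro sect_eqI[of _ _ \<Psi>]) (use unit_arr[of h] in \<open>simp_all add: i_def j_def t_def\<close>)
    then show "\<exists>f\<in>Mor A. unit_arr f = s" using hm by blast
  qed
qed

theorem iso_unit_iff:
  "iso_arr (rCat_over C) (adj_unit C X) \<longleftrightarrow> join_restriction_category A \<and> hyperconnected A C P"
  using iso_unit_imp_bij bij_imp_iso_unit bij_imp_join_hyperconnected join_hyperconnected_imp_bij by blast

end

text \<open>Precomposition with \<open>k\<close> preserves the join, and a partial inverse
  \<open>t\<close> of \<open>s\<close> gives the partial inverse \<open>k' \<cdot> t\<close> of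
  \<open>s \<cdot> k\<close>.\<close>

lemma local_homeo_iso:
  fixes C :: "('o, 'u) rcat" (structure)
  assumes "join_restriction_category C" and p: "local_homeo C p"
    and k: "k \<in> hom C Y (src p)" "k' \<in> hom C (src p) Y" "k \<cdot> k' = Idn C (src p)" "k' \<cdot> k = Idn C Y"
  shows "local_homeo C (p \<cdot> k)"
proof -
  interpret join_restriction_category C by fact
  obtain S where S: "S \<subseteq> hom C (src p) (tgt p)" "\<And>s. s \<in> S \<Longrightarrow> partial_iso C s"
    and J: "is_join C (src p) (tgt p) S p" and pm [simp]: "p \<in> Mor C" "total C p"
    using p by (auto simp: local_homeo_def)
  have km [simp]: "k \<in> Mor C" "src k = Y" "tgt k = src p" "k' \<in> Mor C" "src k' = src p" "tgt k' = Y"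
    using k by auto
  have Y: "Y \<in> Obj C" using src_obj'[OF km(1)] by simp
  have tot [simp]: "total C k" "total C k'"
    using total_of_cmp[of k' k] total_of_cmp[of k k'] k(3,4) Y by simp_all
  have "is_join C Y (tgt p) ((\<lambda>s. s \<cdot> k) ` S) (p \<cdot> k)" by (rule join_precomp[OF S(1) J k(1)])
  moreover have "partial_iso C (s \<cdot> k)" if s: "s \<in> S" for s
  proof -
    obtain t where t: "partial_inverse C s t" using S(2)[OF s] by (auto simp: partial_iso_def)
    have sm [simp]: "s \<in> Mor C" "src s = src p" "tgt s = tgt p" using S(1) s by auto
    have tm [simp]: "t \<in> Mor C" "src t = tgt p" "tgt t = src p" and inv: "t \<cdot> s = \<rho> s" "s \<cdot> t = \<rho> t"
      using t by (auto simp: partial_inverse_def)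
    have "k' \<cdot> (t \<cdot> (s \<cdot> k)) = \<rho> (s \<cdot> k)"
      using cmp_reassoc[OF inv(1), of k] rst_shift[of k s] cmp_reassoc[OF k(4), of "\<rho> (s \<cdot> k)"] by simp
    moreover have "s \<cdot> (k \<cdot> (k' \<cdot> t)) = \<rho> (k' \<cdot> t)"
      using cmp_reassoc[OF k(3), of t] inv by simp
    ultimately have "partial_inverse C (s \<cdot> k) (k' \<cdot> t)" by (simp add: partial_inverse_def)
    then show ?thesis by (auto simp: partial_iso_def)
  qed
  moreover have "(\<lambda>s. s \<cdot> k) ` S \<subseteq> hom C Y (tgt p)" using S(1) by auto
  ultimately show ?thesis unfolding local_homeo_def by auto
qed

section \<open>Invertibility of the counit\<close>

locale glued_partite = glued C + B: partite C B
  for C :: "('o, 'u) rcat" (structure) and B :: "('o, 'u) partite"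
begin

sublocale E: glued_over C B.\<Phi> "Phi_proj C B"
proof (intro glued_over.intro glued_over_axioms.intro)
  show "glued C" by unfold_locales
  show "restriction_category B.\<Phi>" by (rule B.Phi_restriction_category)
  show "over_obj C (B.\<Phi>, Phi_proj C B)"
    by (rule Phi_over_obj) (unfold_locales, rule small)
qed

definition \<epsilon> where "\<epsilon> = lbl (adj_counit C B)"

lemma B_obj: "B \<in> Obj (pCat C)"
  using B.partite_category_axioms by simp

lemma counit_arr:
  "adj_counit C B \<in> hom (pCat C) E.\<Psi> B"
  "FA (Phi C) (adj_counit C B) \<cdot>\<^bsub>rCat_over C\<^esub> adj_unit C (B.\<Phi>, Phi_proj C B)
    = Idn (rCat_over C) (B.\<Phi>, Phi_proj C B)"
proof -
  interpret O: category "rCat_over C" by (rule category_rCat_over[OF restriction_category_axioms])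
  have P: "FO (Phi C) B = (B.\<Phi>, Phi_proj C B)" by (simp add: Phi_def)
  have "Idn (rCat_over C) (B.\<Phi>, Phi_proj C B) \<in> hom (rCat_over C) (B.\<Phi>, Phi_proj C B) (FO (Phi C) B)"
    using O.idn_hom[of "(B.\<Phi>, Phi_proj C B)"] E.over_obj P by simp
  from theI'[OF E.unit_universal[OF B_obj this]]
  show "adj_counit C B \<in> hom (pCat C) E.\<Psi> B"
    "FA (Phi C) (adj_counit C B) \<cdot>\<^bsub>rCat_over C\<^esub> adj_unit C (B.\<Phi>, Phi_proj C B)
      = Idn (rCat_over C) (B.\<Phi>, Phi_proj C B)"
    unfolding adj_counit_def P by blast+
qed

lemma counit_eq: "adj_counit C B = Arw E.\<Psi> \<epsilon> B"
  using counit_arr(1) by (intro arr.expand) (simp add: \<epsilon>_def)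

sublocale \<epsilon>: cofunctor C E.\<Psi> B \<epsilon>
  using counit_arr(1) pCat_mor_iff[OF restriction_category_axioms] by (simp add: counit_eq)

text \<open>Read off from the triangle identity defining the counit, split up by
  \<open>over_comp_unit\<close>.\<close>

lemma \<epsilon>:
  "i \<in> Ix B \<Longrightarrow> CI \<epsilon> i = i" "i \<in> Ix B \<Longrightarrow> CO \<epsilon> i = Idn C (PO B i)"
  "s \<in> Mor B.\<Phi> \<Longrightarrow> \<epsilon>.Phi_arr (E.unit_arr s) = s"
proof -
  have "over_comp C (B.\<Phi>, Phi_proj C B) (Phi_map C E.\<Psi> \<epsilon>) (lbl (adj_unit C (B.\<Phi>, Phi_proj C B)))
    = (res_functr B.\<Phi> id_functr, \<lambda>i\<in>Ix B. Idn C (PO B i))"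
    using arg_cong[OF counit_arr(2), of lbl] by (simp add: Phi_def counit_eq E.adj_unit_eq over_id_def)
  then have e: "(\<forall>i\<in>Obj B.\<Phi>. CI \<epsilon> i = FO (res_functr B.\<Phi> id_functr) i \<and> CO \<epsilon> i = (\<lambda>i\<in>Ix B. Idn C (PO B i)) i) \<and>
    (\<forall>f\<in>Mor B.\<Phi>. \<epsilon>.Phi_arr (E.unit_arr f) = FA (res_functr B.\<Phi> id_functr) f)"
    unfolding E.over_comp_unit[OF \<epsilon>.cofunctor_axioms] by blast
  show "i \<in> Ix B \<Longrightarrow> CI \<epsilon> i = i" "i \<in> Ix B \<Longrightarrow> CO \<epsilon> i = Idn C (PO B i)"
    "s \<in> Mor B.\<Phi> \<Longrightarrow> \<epsilon>.Phi_arr (E.unit_arr s) = s"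
    using e by (simp_all add: id_functr_def)
qed

text \<open>Since the counit is the identity on objects, it amounts to a family of maps between the objects of
  arrows.\<close>

definition ev where "ev i j = act C E.\<Psi> \<epsilon> i j (Idn C (src (E.\<sigma> i j))) (E.\<sigma> i j)"

context
  fixes i j
  assumes ij [simp]: "i \<in> Ix B" "j \<in> Ix B"
begin

lemma ij' [simp]: "i \<in> Obj B.\<Phi>" "j \<in> Obj B.\<Phi>"
  by simp_all

lemma ev_actable: "\<epsilon>.actable i j (Idn C (src (E.\<sigma> i j))) (E.\<sigma> i j)"
  using E.\<sigma>[OF ij'] by (simp add: \<epsilon>.actable_def \<epsilon>)

lemma ev:
  "ev i j \<in> Mor C" "src (ev i j) = src (E.\<sigma> i j)" "tgt (ev i j) = PA B i j"
  "Sg B i j \<cdot> ev i j = E.\<sigma> i j" "Ta B i j \<cdot> ev i j = E.\<tau> i j"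
proof -
  note a = \<epsilon>.act[OF _ _ ev_actable]
  show m: "ev i j \<in> Mor C" "src (ev i j) = src (E.\<sigma> i j)" "tgt (ev i j) = PA B i j"
    "Sg B i j \<cdot> ev i j = E.\<sigma> i j"
    using a(1-4) by (simp_all add: ev_def \<epsilon>)
  show "Ta B i j \<cdot> ev i j = E.\<tau> i j"
    using a(5) m E.\<tau>[OF ij'] by (simp add: ev_def[symmetric] \<epsilon>)
qed

lemma act_ev:
  assumes "a \<in> Mor C" "tgt a = src (E.\<sigma> i j)" "b = E.\<sigma> i j \<cdot> a"
  shows "act C E.\<Psi> \<epsilon> i j a b = ev i j \<cdot> a"
  using \<epsilon>.act_cmp[OF _ _ ev_actable, of a] assms E.\<sigma>[OF ij'] by (simp add: ev_def)

text \<open>By the triangle identity the counit sends \<open>unit_arr s\<close> back to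
  \<open>s\<close>, and \<open>act_sec\<close> expresses this on elements.\<close>

lemma ev_sec:
  assumes s: "s \<in> hom B.\<Phi> i j"
  shows "ev i j \<cdot> E.sec s = sect B s"
proof -
  have sm: "s \<in> Mor B.\<Phi>" "src s = i" "tgt s = j" using s by auto
  note sc = E.sec[OF sm(1), unfolded sm]
  have P: "\<rho> (FA (Phi_proj C B) s) = \<rho> (sect B s)" using sm B.Phi_Mor_simps(3)[OF sm(1)] by simp
  have r: "E.sec s \<cdot> \<rho> (sect B s) = E.sec s" using cmp_rst_self[OF sc(1)] sc(5) P by simp
  have m: "sect B s \<in> Mor C" "src (sect B s) = PO B i" using B.Phi_Mor_simps(3)[OF sm(1)] sm by simp_all
  have "act C E.\<Psi> \<epsilon> i j (E.sec s \<cdot> (CO \<epsilon> i \<cdot> \<rho> (sect B s))) (\<rho> (sect B s))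
    = sect B (\<epsilon>.Phi_arr (E.unit_arr s)) \<cdot> \<rho> (sect B s)"
    by (rule E.act_sec[OF \<epsilon>.cofunctor_axioms s]) (use m sc r P in \<open>simp_all add: \<epsilon>\<close>)
  also have "\<dots> = sect B s" using m by (simp add: \<epsilon>(3)[OF sm(1)])
  also have "E.sec s \<cdot> (CO \<epsilon> i \<cdot> \<rho> (sect B s)) = E.sec s" using r m by (simp add: \<epsilon>)
  finally show ?thesis using act_ev[of "E.sec s" "\<rho> (sect B s)"] sc P by simp
qed

end

lemma ev_unit: "i \<in> Ix B \<Longrightarrow> ev i i \<cdot> E.sec (Idn B.\<Phi> i) = Et B i"
  using ev_sec[of i i "Idn B.\<Phi> i"] B.Phi_Idn[of i] by simp

text \<open>This is \<open>act_mul\<close> for the counit, with each action rewritten through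
  \<open>act_ev\<close>.\<close>

lemma ev_mul:
  assumes I [simp]: "i \<in> Ix B" "j \<in> Ix B" "k \<in> Ix B" and c: "E.G.composable i j k a' a"
  shows "ev i k \<cdot> mul C E.\<Psi> i j k a' a = mul C B i j k (ev j k \<cdot> a') (ev i j \<cdot> a)"
proof -
  have cm: "a \<in> Mor C" "a' \<in> Mor C" "src a' = src a" "tgt a = src (E.\<sigma> i j)" "tgt a' = src (E.\<sigma> j k)"
    "E.\<sigma> j k \<cdot> a' = E.\<tau> i j \<cdot> a" using c by (simp_all add: E.G.composable_def)
  note m = E.G.mul[OF _ _ _ c, simplified]
  note s = E.\<sigma>[of i j, simplified] E.\<sigma>[of j k, simplified] E.\<sigma>[of i k, simplified] E.\<tau>[of i j, simplified]
  have ac: "\<epsilon>.actable i j a (E.\<sigma> i j \<cdot> a)" using cm s by (simp add: \<epsilon>.actable_def \<epsilon>)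
  have e: "act C E.\<Psi> \<epsilon> i j a (E.\<sigma> i j \<cdot> a) = ev i j \<cdot> a" by (rule act_ev) (use cm in auto)
  have "Ta B i j \<cdot> (ev i j \<cdot> a) = E.\<sigma> j k \<cdot> a'"
    using cmp_reassoc[OF ev(5)[OF I(1,2)], of a] ev(1-3)[OF I(1,2)] cm by simp
  then have e': "act C E.\<Psi> \<epsilon> j k a' (Ta B i j \<cdot> (ev i j \<cdot> a)) = ev j k \<cdot> a'"
    by (intro act_ev) (use cm in auto)
  have "act C E.\<Psi> \<epsilon> i k (mul C E.\<Psi> i j k a' a) (E.\<sigma> i j \<cdot> a) = ev i k \<cdot> mul C E.\<Psi> i j k a' a"
    by (rule act_ev) (use m in auto)
  then show ?thesis using \<epsilon>.act_mul[OF _ _ _ ac c] e e' by (simp add: \<epsilon>)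
qed

text \<open>The inverse cofunctor is the identity on objects, because the counit and the composite
  of the two are; its action on the identity of \<open>PA B i j\<close> is the inverse of
  \<open>ev i j\<close>.\<close>

lemma iso_counit_imp_ev_iso:
  assumes iso: "iso_arr (pCat C) (adj_counit C B)" and ij [simp]: "i \<in> Ix B" "j \<in> Ix B"
  shows "\<exists>k. k \<in> hom C (PA B i j) (src (E.\<sigma> i j)) \<and> ev i j \<cdot> k = Idn C (PA B i j) \<and>
    k \<cdot> ev i j = Idn C (src (E.\<sigma> i j))"
proof -
  obtain g where g: "g \<in> hom (pCat C) B E.\<Psi>"
    and ge: "g \<cdot>\<^bsub>pCat C\<^esub> adj_counit C B = Idn (pCat C) E.\<Psi>"
    and eg: "adj_counit C B \<cdot>\<^bsub>pCat C\<^esub> g = Idn (pCat C) B"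
    using iso unfolding iso_arr_def by (auto simp: counit_eq)
  define H where "H = lbl g"
  have st: "src g = B" "tgt g = E.\<Psi>" using g by auto
  interpret H: cofunctor C B E.\<Psi> H using g pCat_mor_iff[OF restriction_category_axioms] st by (auto simp: H_def)
  interpret HE: cofunctor_pair C E.\<Psi> B E.\<Psi> \<epsilon> H by unfold_locales
  interpret EH: cofunctor_pair C B E.\<Psi> B H \<epsilon> by unfold_locales
  have 1: "HE.GF = cofun_id C E.\<Psi>" using arg_cong[OF ge, of lbl] by (simp add: counit_eq H_def)
  have 2: "EH.GF = cofun_id C B" using arg_cong[OF eg, of lbl] st by (simp add: counit_eq H_def)
  have ci: "CI H l = l" if "l \<in> Ix B" for l using arg_cong[OF 1, of "\<lambda>F. CI F l"] that by (simp add: \<epsilon>)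
  have co: "CO H l = Idn C (PO B l)" if "l \<in> Ix B" for l
    using arg_cong[OF 1, of "\<lambda>F. CO F l"] that H.co[OF that] ci[OF that] by (simp add: \<epsilon>)
  note s [simp] = E.\<sigma>[OF ij'[OF ij]]
  note e = ev[OF ij]
  have ac: "H.actable i j (Idn C (PA B i j)) (Sg B i j)"
    by (simp add: H.actable_def co ci)
  define k where "k = act C B H i j (Idn C (PA B i j)) (Sg B i j)"
  note k = H.act(1-4)[OF ij ac, folded k_def]
  have km: "k \<in> Mor C" "src k = PA B i j" "tgt k = src (E.\<sigma> i j)" "E.\<sigma> i j \<cdot> k = Sg B i j"
    using k by (simp_all add: ci)
  have "act C B EH.GF i j (Idn C (PA B i j)) (Sg B i j) = act C E.\<Psi> \<epsilon> i j k (Sg B i j)"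
    using EH.act_comp[of i j "Idn C (PA B i j)" "Sg B i j"] by (simp add: ci co \<epsilon> k_def)
  also have "\<dots> = ev i j \<cdot> k" by (rule act_ev[OF ij]) (use km in auto)
  finally have ek: "ev i j \<cdot> k = Idn C (PA B i j)"
    using act_cofun_id[of C B i j "Idn C (PA B i j)" "Sg B i j"] B.partite_axioms 2 by simp
  have "act C E.\<Psi> HE.GF i j (Idn C (src (E.\<sigma> i j))) (E.\<sigma> i j) = act C B H i j (ev i j) (E.\<sigma> i j)"
    using HE.act_comp[of i j "Idn C (src (E.\<sigma> i j))" "E.\<sigma> i j"] by (simp add: ci co \<epsilon> ev_def)
  also have "\<dots> = k \<cdot> ev i j" using H.act_cmp[OF ij ac, of "ev i j"] e by (simp add: k_def)
  finally have "k \<cdot> ev i j = Idn C (src (E.\<sigma> i j))"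
    using act_cofun_id[of C E.\<Psi> i j "Idn C (src (E.\<sigma> i j))" "E.\<sigma> i j"] E.Psi_partite 1 by simp
  then show ?thesis using km ek by auto
qed

text \<open>With \<open>ev i j\<close> invertible over the base, \<open>Sg B i j\<close> is the
  local homeomorphism \<open>E.\<sigma> i j\<close> up to isomorphism.\<close>

lemma iso_counit_imp_etale:
  assumes iso: "iso_arr (pCat C) (adj_counit C B)"
  shows "source_etale C B"
  unfolding source_etale_def
proof (intro ballI)
  fix i j assume ij: "i \<in> Ix B" "j \<in> Ix B"
  obtain k where k: "k \<in> hom C (PA B i j) (src (E.\<sigma> i j))" "ev i j \<cdot> k = Idn C (PA B i j)"
    "k \<cdot> ev i j = Idn C (src (E.\<sigma> i j))" using iso_counit_imp_ev_iso[OF iso ij] by blast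
  note e = ev[OF ij]
  have "Sg B i j = E.\<sigma> i j \<cdot> k"
    using cmp_reassoc[OF e(4), of k] e(1-3) k ij by simp
  moreover have "local_homeo C (E.\<sigma> i j \<cdot> k)"
    by (rule local_homeo_iso[OF join_restriction_category_axioms _ k(1) _ k(3,2)]) (use e ij in auto)
  ultimately show "local_homeo C (Sg B i j)" by simp
qed

text \<open>A partial inverse \<open>t l\<close> of a partial isomorphism below
  \<open>Sg B i j\<close> is a partial section, hence an arrow \<open>T l\<close> of
  \<open>\<Phi> B\<close>. Since the \<open>t l\<close> present \<open>Sg B i j\<close>, a map out
  of \<open>PA B i j\<close> can be defined by sending \<open>t l\<close> to
  \<open>E.sec (T l)\<close>; this is the inverse.\<close>

lemma etale_imp_ev_iso:
  assumes et: "source_etale C B" and ij [simp]: "i \<in> Ix B" "j \<in> Ix B"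
  shows "\<exists>k. k \<in> hom C (PA B i j) (src (E.\<sigma> i j)) \<and> ev i j \<cdot> k = Idn C (PA B i j) \<and>
    k \<cdot> ev i j = Idn C (src (E.\<sigma> i j))"
proof -
  obtain S where S: "S \<subseteq> hom C (PA B i j) (PO B i)" "\<forall>l\<in>S. partial_iso C l"
    and J: "is_join C (PA B i j) (PO B i) S (Sg B i j)"
  proof -
    have "local_homeo C (Sg B i j)" using et ij by (simp only: source_etale_def)
    then show ?thesis using that by (simp add: local_homeo_def) blast
  qed
  define t where "t l = (SOME t. partial_inverse C l t)" for l
  have inv: "partial_inverse C l (t l)" if "l \<in> S" for l
    using S(2) that unfolding t_def partial_iso_def by (auto intro: someI_ex)
  interpret F: etale_family C "Sg B i j" S t "\<lambda>l. \<rho> l"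
    by (rule etale_family_of_partial_inverses[OF join_restriction_category_axioms]) (use S J inv in auto)
  note s [simp] = E.\<sigma>[OF ij'[OF ij]]
  note e = ev[OF ij]
  interpret E': etale_family C "E.\<sigma> i j" "hom B.\<Phi> i j" E.sec "E.ide i j" by (rule E.etale) simp_all
  define T where "T l = Arw i (lbl (t l)) j" for l
  have T: "T l \<in> hom B.\<Phi> i j" "sect B (T l) = t l" if l: "l \<in> S" for l
  proof -
    have "t l \<in> hom C (PO B i) (PA B i j)" "Sg B i j \<cdot> t l = \<rho> (t l)" using F.s_mor[OF l] F.p_s[OF l] by simp_all
    from B.Phi_MorI[OF ij this] show "T l \<in> hom B.\<Phi> i j" "sect B (T l) = t l" by (simp_all add: T_def)
  qed
  have rsec: "\<rho> (E.sec u) = \<rho> (sect B u)" "E.sec u \<in> Mor C" "src (E.sec u) = PO B i"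
    "tgt (E.sec u) = src (E.\<sigma> i j)" "sect B u \<in> Mor C" "src (sect B u) = PO B i" "tgt (sect B u) = PA B i j"
    if "u \<in> hom B.\<Phi> i j" for u
    using that E.sec[of u] B.Phi_Mor_simps(3)[of u] by auto
  \<comment> \<open>Agreement of underlying sections on \<open>d\<close> is equality of arrows after
    composing with \<open>Phi_rid i d\<close>; \<open>E.sec_eq\<close> carries it to the glued
    object.\<close>
  have sec_d: "E.sec u \<cdot> d = E.sec u' \<cdot> d"
    if u: "u \<in> hom B.\<Phi> i j" "u' \<in> hom B.\<Phi> i j" and d: "d \<in> rid C (PO B i)" and eq: "sect B u \<cdot> d = sect B u' \<cdot> d"
    for u u' d
  proof -
    note r = B.Phi_rid[OF ij(1) d]
    have rr: "B.Phi_rid i d \<in> rid B.\<Phi> i"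
      using r rid_mor[OF d] by (simp add: E.A.rid_iff B.Phi_Rst)
    have "u \<cdot>\<^bsub>B.\<Phi>\<^esub> B.Phi_rid i d = u' \<cdot>\<^bsub>B.\<Phi>\<^esub> B.Phi_rid i d"
      by (rule sect_eqI[of _ _ B]) (use u r B.Phi_cmp_rid[of u d] B.Phi_cmp_rid[of u' d] d eq in auto)
    from E.sec_eq[OF u rr this] show ?thesis using r rid_mor[OF d] by simp
  qed
  have "\<exists>!k. k \<in> hom C (src (Sg B i j)) (src (E.\<sigma> i j)) \<and> (\<forall>l\<in>S. k \<cdot> t l = E.sec (T l))"
  proof (rule F.extend)
    show "E.sec (T l) \<in> hom C (tgt (Sg B i j)) (src (E.\<sigma> i j))" "\<rho> (E.sec (T l)) = \<rho> (t l)" if "l \<in> S" for l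
      using rsec[OF T(1)[OF that]] T(2)[OF that] by simp_all
    show "E.sec (T l) \<cdot> d = E.sec (T m) \<cdot> d"
      if "l \<in> S" "m \<in> S" "d \<in> rid C (tgt (Sg B i j))" "t l \<cdot> d = t m \<cdot> d" for l m d
      by (rule sec_d) (use that T in auto)
  qed simp
  then obtain k where k: "k \<in> hom C (PA B i j) (src (E.\<sigma> i j))" and kt: "\<And>l. l \<in> S \<Longrightarrow> k \<cdot> t l = E.sec (T l)"
    by auto
  have km [simp]: "k \<in> Mor C" "src k = PA B i j" "tgt k = src (E.\<sigma> i j)" using k by auto
  have "ev i j \<cdot> k = Idn C (PA B i j)"
  proof (rule F.eq_on_sections)
    fix l assume l: "l \<in> S"
    have "ev i j \<cdot> (k \<cdot> t l) = t l" using ev_sec[OF ij T(1)[OF l]] kt[OF l] T(2)[OF l] by simp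
    then show "ev i j \<cdot> k \<cdot> t l = Idn C (PA B i j) \<cdot> t l" using l e by simp
  qed (use e in auto)
  moreover have "k \<cdot> ev i j = Idn C (src (E.\<sigma> i j))"
  proof (rule E'.eq_on_sections)
    fix u assume u: "u \<in> hom B.\<Phi> i j"
    note r [simp] = rsec[OF u]
    have um [simp]: "u \<in> Mor B.\<Phi>" "src u = i" "tgt u = j" using u by auto
    \<comment> \<open>The map \<open>k\<close> is prescribed only on the sections
      \<open>t l\<close>, but an arbitrary partial section coincides locally with one of
      them.\<close>
    have "k \<cdot> sect B u = E.sec u"
    proof (rule F.local_eq)
      show "sect B u \<in> hom C (PO B i) (src (Sg B i j))" using u by simp
      show "k \<cdot> sect B u \<in> hom C (PO B i) (src (E.\<sigma> i j))" "E.sec u \<in> hom C (PO B i) (src (E.\<sigma> i j))" by simp_all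
      show "k \<cdot> sect B u \<cdot> \<rho> (sect B u) = k \<cdot> sect B u" by simp
      show "E.sec u \<cdot> \<rho> (sect B u) = E.sec u" using cmp_rst_self[of "E.sec u"] by simp
      fix l w assume l: "l \<in> S" and w: "w \<in> rid C (PO B i)"
        and uw: "sect B u \<cdot> w = t l \<cdot> (Sg B i j \<cdot> (sect B u \<cdot> w))" "\<rho> (sect B u \<cdot> w) = w"
      note wm [simp] = rid_mor(1-4)[OF w]
      have "Sg B i j \<cdot> (sect B u \<cdot> w) = \<rho> (sect B u) \<cdot> w"
        using cmp_reassoc[OF B.Phi_Mor_simps(4)[OF um(1)], of w] um by simp
      also have "\<dots> = w" using rst_cmp_rid[OF w, of "sect B u"] uw(2) by simp
      finally have uw': "sect B u \<cdot> w = t l \<cdot> w" using uw(1) by simp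
      have "k \<cdot> (t l \<cdot> w) = E.sec (T l) \<cdot> w" using cmp_reassoc[OF kt[OF l], of w] l by simp
      also have "\<dots> = E.sec u \<cdot> w" by (rule sec_d[OF T(1)[OF l] u w]) (use uw' T(2)[OF l] in simp)
      finally show "k \<cdot> sect B u \<cdot> w = E.sec u \<cdot> w" using uw' by simp
    qed
    then show "k \<cdot> ev i j \<cdot> E.sec u = Idn C (src (E.\<sigma> i j)) \<cdot> E.sec u" using ev_sec[OF ij u] e by simp
  qed (use e in auto)
  ultimately show ?thesis using k by blast
qed

text \<open>The inverse cofunctor \<open>H\<close> is the identity on objects and acts on arrows by
  \<open>k i j\<close>. It respects composition because \<open>ev\<close> does and \<open>k\<close>
  inverts it.\<close>

lemma ev_iso_imp_iso_counit:
  assumes iso: "\<And>i j. \<lbrakk>i \<in> Ix B; j \<in> Ix B\<rbrakk> \<Longrightarrow> \<exists>k. k \<in> hom C (PA B i j) (src (E.\<sigma> i j)) \<and>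
    ev i j \<cdot> k = Idn C (PA B i j) \<and> k \<cdot> ev i j = Idn C (src (E.\<sigma> i j))"
  shows "iso_arr (pCat C) (adj_counit C B)"
proof -
  obtain k where k: "\<And>i j. \<lbrakk>i \<in> Ix B; j \<in> Ix B\<rbrakk> \<Longrightarrow> k i j \<in> hom C (PA B i j) (src (E.\<sigma> i j)) \<and>
    ev i j \<cdot> k i j = Idn C (PA B i j) \<and> k i j \<cdot> ev i j = Idn C (src (E.\<sigma> i j))"
    using iso by metis
  have km [simp]: "k i j \<in> Mor C" "src (k i j) = PA B i j" "tgt (k i j) = src (E.\<sigma> i j)"
    "ev i j \<cdot> k i j = Idn C (PA B i j)" "k i j \<cdot> ev i j = Idn C (src (E.\<sigma> i j))"
    if "i \<in> Ix B" "j \<in> Ix B" for i j using k[OF that] by auto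
  note [simp] = ev(1-3)
  have \<sigma>m [simp]: "E.\<sigma> i j \<in> Mor C" "tgt (E.\<sigma> i j) = PO B i" "E.\<tau> i j \<in> Mor C"
    "src (E.\<tau> i j) = src (E.\<sigma> i j)" "tgt (E.\<tau> i j) = PO B j" "src (E.\<sigma> i j) \<in> Obj C"
    if "i \<in> Ix B" "j \<in> Ix B" for i j using that E.\<sigma>[of i j] E.\<tau>[of i j] by simp_all
  have ek [simp]: "ev i j \<cdot> (k i j \<cdot> x) = x" if "i \<in> Ix B" "j \<in> Ix B" "x \<in> Mor C" "tgt x = PA B i j" for i j x
    using cmp_reassoc[OF km(4), of i j x] that by simp
  have ke [simp]: "k i j \<cdot> (ev i j \<cdot> x) = x" if "i \<in> Ix B" "j \<in> Ix B" "x \<in> Mor C" "tgt x = src (E.\<sigma> i j)" for i j x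
    using cmp_reassoc[OF km(5), of i j x] that by simp
  have \<sigma>k: "E.\<sigma> i j \<cdot> (k i j \<cdot> x) = Sg B i j \<cdot> x" if "i \<in> Ix B" "j \<in> Ix B" "x \<in> Mor C" "tgt x = PA B i j" for i j x
    using cmp_reassoc[OF ev(4), of i j "k i j \<cdot> x"] that by simp
  have \<tau>k: "E.\<tau> i j \<cdot> (k i j \<cdot> x) = Ta B i j \<cdot> x" if "i \<in> Ix B" "j \<in> Ix B" "x \<in> Mor C" "tgt x = PA B i j" for i j x
    using cmp_reassoc[OF ev(5), of i j "k i j \<cdot> x"] that by simp
  define H :: "('o, 'u) cofun" where "H = \<lparr>CI = (\<lambda>i\<in>Ix B. i), CO = (\<lambda>i\<in>Ix B. Idn C (PO B i)),
    CA = (\<lambda>i j. if i \<in> Ix B \<and> j \<in> Ix B then k i j \<cdot> pb1 C (Sg B i j) (Idn C (PO B i)) else undefined)\<rparr>"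
  have H_simps [simp]: "CI H i = i" "CO H i = Idn C (PO B i)" if "i \<in> Ix B" for i
    using that by (simp_all add: H_def)
  have pb: "is_pullback C (Sg B i j) (Idn C (PO B i)) (pb1 C (Sg B i j) (Idn C (PO B i)))
      (pb2 C (Sg B i j) (Idn C (PO B i)))" if "i \<in> Ix B" "j \<in> Ix B" for i j
    by (rule B.pullback_along) (use that in auto)
  have actH: "act C B H i j a b = k i j \<cdot> a"
    if ij: "i \<in> Ix B" "j \<in> Ix B" and "a \<in> hom C (src b) (PA B i j)" "b \<in> Mor C" "tgt b = PO B i" "Sg B i j \<cdot> a = b"
    for i j a b
    using pair[OF pb[OF ij], of a b] pb_mor[OF pb[OF ij]] that by (auto simp: act_def H_def)
  have H: "cofunctor C B E.\<Psi> H"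
  proof (rule cofunctorI[OF B.partite_axioms E.Psi_partite])
    show "CI H \<in> Ix B \<rightarrow>\<^sub>E Ix E.\<Psi>" by (auto simp: H_def)
    show "CO H \<in> extensional (Ix B)" by (simp add: H_def)
    show "CA H i j = undefined" if "\<not> (i \<in> Ix B \<and> j \<in> Ix B)" for i j using that by (auto simp: H_def)
    show "CO H i \<in> hom C (PO E.\<Psi> (CI H i)) (PO B i) \<and> total C (CO H i)" if "i \<in> Ix B" for i using that by simp
    show "CA H i j \<in> hom C (pb_obj C (Sg B i j) (CO H i)) (PA E.\<Psi> (CI H i) (CI H j))" if "i \<in> Ix B" "j \<in> Ix B" for i j
      using that pb_mor[OF pb[OF that]] by (simp add: H_def)
  next
    fix i b assume i [simp]: "i \<in> Ix B" and b [simp]: "b \<in> Mor C" "tgt b = PO E.\<Psi> (CI H i)"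
    have s1: "E.sec (Idn B.\<Phi> i) \<in> Mor C" "src (E.sec (Idn B.\<Phi> i)) = PO B i"
      "tgt (E.sec (Idn B.\<Phi> i)) = src (E.\<sigma> i i)"
      using E.\<Psi>.unit_mor[of i] by simp_all
    have "k i i \<cdot> (Et B i \<cdot> b) = E.sec (Idn B.\<Phi> i) \<cdot> b"
      unfolding ev_unit[OF i, symmetric] using s1 b(1) b(2)[simplified] by simp
    moreover have "act C B H i i (Et B i \<cdot> b) b = k i i \<cdot> (Et B i \<cdot> b)"
      by (rule actH) (use b(2) in simp_all)
    ultimately show "act C B H i i (Et B i \<cdot> (CO H i \<cdot> b)) b = Et E.\<Psi> (CI H i) \<cdot> b"
      using b(2)[simplified] by simp
  next
    fix i j a b assume ij [simp]: "i \<in> Ix B" "j \<in> Ix B" and a: "a \<in> hom C (src b) (PA B i j)" and b: "b \<in> Mor C"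
      and "tgt b = PO E.\<Psi> (CI H i)" "Sg B i j \<cdot> a = CO H i \<cdot> b"
    then have b' [simp]: "tgt b = PO B i" "b \<in> Mor C" and ab: "Sg B i j \<cdot> a = b" by simp_all
    have am [simp]: "a \<in> Mor C" "tgt a = PA B i j" "src a = src b" using a by auto
    note e = actH[OF ij a b b'(1) ab]
    show "Sg E.\<Psi> (CI H i) (CI H j) \<cdot> act C B H i j a b = b" using \<sigma>k[of i j a] ab e by simp
    show "CO H j \<cdot> (Ta E.\<Psi> (CI H i) (CI H j) \<cdot> act C B H i j a b) = Ta B i j \<cdot> a"
      using \<tau>k[of i j a] e by simp
    fix l a' assume l [simp]: "l \<in> Ix B" and c: "partite_graph.composable C B i j l a' a"
    have a' [simp]: "a' \<in> Mor C" "src a' = src b" "tgt a' = PA B j l" and a's: "Sg B j l \<cdot> a' = Ta B i j \<cdot> a"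
      using c by (simp_all add: B.composable_def)
    note m = B.mul[OF ij l c]
    have "act C B H i l (mul C B i j l a' a) b = k i l \<cdot> mul C B i j l a' a"
      by (rule actH) (use m ab in auto)
    moreover have "act C B H j l a' (Ta B i j \<cdot> a) = k j l \<cdot> a'"
      by (rule actH) (use a's in auto)
    moreover have "k i l \<cdot> mul C B i j l a' a = mul C E.\<Psi> i j l (k j l \<cdot> a') (k i j \<cdot> a)"
    proof -
      have c': "E.G.composable i j l (k j l \<cdot> a') (k i j \<cdot> a)"
        using \<sigma>k[of j l a'] \<tau>k[of i j a] a's by (simp add: E.G.composable_def)
      note m' = E.G.mul[OF _ _ _ c', simplified]
      have "ev i l \<cdot> mul C E.\<Psi> i j l (k j l \<cdot> a') (k i j \<cdot> a) = mul C B i j l a' a"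
        using ev_mul[OF ij l c'] by simp
      then show ?thesis using ke[OF ij(1) l m'(1,3)] by simp
    qed
    ultimately show "act C B H i l (mul C B i j l a' a) b = mul C E.\<Psi> (CI H i) (CI H j) (CI H l)
       (act C B H j l a' (Ta E.\<Psi> (CI H i) (CI H j) \<cdot> act C B H i j a b)) (act C B H i j a b)"
      using e \<tau>k[of i j a] by simp
  qed
  interpret H: cofunctor C B E.\<Psi> H by (rule H)
  interpret HE: cofunctor_pair C E.\<Psi> B E.\<Psi> \<epsilon> H by unfold_locales
  interpret EH: cofunctor_pair C B E.\<Psi> B H \<epsilon> by unfold_locales
  have 1: "HE.GF = cofun_id C E.\<Psi>"
  proof (rule cofun_eqI[OF HE.cofunctor_comp cofunctor_id[OF E.Psi_partite]])
    show "CI HE.GF i = CI (cofun_id C E.\<Psi>) i" "CO HE.GF i = CO (cofun_id C E.\<Psi>) i" if "i \<in> Ix E.\<Psi>" for i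
      using that by (simp_all add: \<epsilon>)
    fix i j a b assume "i \<in> Ix E.\<Psi>" "j \<in> Ix E.\<Psi>" "cofunctor.actable C E.\<Psi> E.\<Psi> HE.GF i j a b"
    then have ij [simp]: "i \<in> Ix B" "j \<in> Ix B" and ab: "a \<in> Mor C" "b \<in> Mor C" "src a = src b"
      "tgt a = src (E.\<sigma> i j)" "tgt b = PO B i" "E.\<sigma> i j \<cdot> a = b"
      unfolding cofunctor.actable_def[OF HE.cofunctor_comp] by (simp_all add: \<epsilon>)
    have ea: "act C E.\<Psi> \<epsilon> i j a b = ev i j \<cdot> a" by (rule act_ev) (use ab in auto)
    have "act C E.\<Psi> HE.GF i j a b = act C B H i j (ev i j \<cdot> a) b"
      using HE.act_comp[of i j a b] ab ea by (simp add: \<epsilon>)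
    also have "\<dots> = k i j \<cdot> (ev i j \<cdot> a)"
      by (rule actH) (use ab cmp_reassoc[OF ev(4), of i j a] in auto)
    also have "\<dots> = a" using ab by simp
    also have "\<dots> = act C E.\<Psi> (cofun_id C E.\<Psi>) i j a b"
      by (rule act_cofun_id[OF E.Psi_partite, symmetric]) (use ab in auto)
    finally show "act C E.\<Psi> HE.GF i j a b = act C E.\<Psi> (cofun_id C E.\<Psi>) i j a b" .
  qed
  have 2: "EH.GF = cofun_id C B"
  proof (rule cofun_eqI[OF EH.cofunctor_comp cofunctor_id[OF B.partite_axioms]])
    show "CI EH.GF i = CI (cofun_id C B) i" "CO EH.GF i = CO (cofun_id C B) i" if "i \<in> Ix B" for i
      using that by (simp_all add: \<epsilon>)
    fix i j a b assume ij [simp]: "i \<in> Ix B" "j \<in> Ix B" and "cofunctor.actable C B B EH.GF i j a b"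
    then have ab: "a \<in> Mor C" "b \<in> Mor C" "src a = src b" "tgt a = PA B i j" "tgt b = PO B i" "Sg B i j \<cdot> a = b"
      unfolding cofunctor.actable_def[OF EH.cofunctor_comp] by (simp_all add: \<epsilon>)
    have ka: "act C B H i j a b = k i j \<cdot> a" by (rule actH) (use ab in auto)
    have "act C B EH.GF i j a b = act C E.\<Psi> \<epsilon> i j (k i j \<cdot> a) b"
      using EH.act_comp[of i j a b] ab ka by (simp add: \<epsilon>)
    also have "\<dots> = ev i j \<cdot> (k i j \<cdot> a)"
      by (rule act_ev) (use ab \<sigma>k[of i j a] in auto)
    also have "\<dots> = a" using ab by simp
    also have "\<dots> = act C B (cofun_id C B) i j a b"
      by (rule act_cofun_id[OF B.partite_axioms, symmetric]) (use ab in auto)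
    finally show "act C B EH.GF i j a b = act C B (cofun_id C B) i j a b" .
  qed
  have g: "Arw B H E.\<Psi> \<in> hom (pCat C) B E.\<Psi>"
    using H by (simp add: pCat_mor_iff[OF restriction_category_axioms])
  have "adj_counit C B \<in> Mor (pCat C)" using counit_arr(1) unfolding in_hom by (rule conjunct1)
  moreover have "Arw B H E.\<Psi> \<cdot>\<^bsub>pCat C\<^esub> adj_counit C B = Idn (pCat C) E.\<Psi>"
    using 1 by (intro arr.expand) (simp add: counit_eq)
  moreover have "adj_counit C B \<cdot>\<^bsub>pCat C\<^esub> Arw B H E.\<Psi> = Idn (pCat C) B"
    using 2 by (intro arr.expand) (simp add: counit_eq)
  ultimately show ?thesis
    unfolding iso_arr_def using g by (intro conjI bexI[of _ "Arw B H E.\<Psi>"]) (simp_all add: counit_eq)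
qed

theorem iso_counit_iff: "iso_arr (pCat C) (adj_counit C B) \<longleftrightarrow> source_etale C B"
  using iso_counit_imp_etale etale_imp_ev_iso ev_iso_imp_iso_counit by blast

end

section \<open>The equivalence\<close>

theorem theorem5p17:
  fixes C :: "('o, 'u) rcat"
  assumes "join_restriction_category C"
    and "locally_small C"
    and "has_local_glueings C"
  shows "adjunction (rCat_over C) (pCat C) (Psi C) (Phi C) (adj_unit C) (adj_counit C)
    \<and> left_fixpoints (pCat C) (adj_counit C) = Obj (peCat C)
    \<and> right_fixpoints (rCat_over C) (adj_unit C) = Obj (jrCat_over C)
    \<and> adjoint_equivalence (jrCat_over C) (peCat C) (Psi C) (Phi C) (adj_unit C) (adj_counit C)"
proof -
  interpret glued C using assms by (simp add: glued_def glued_axioms_def)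
  have over: "glued_over C A P" if "over_obj C (A, P)" for A P
    using that glued_axioms by (simp add: glued_over_def glued_over_axioms_def over_obj_def)
  have part: "glued_partite C B" if "partite_category C B" for B
    using that glued_axioms restriction_category_axioms by (simp add: glued_partite_def partite_def)
  have PsiFO: "FO (Psi C) = Psi_obj C" by (simp add: Psi_def)
  have PhiFO: "FO (Phi C) B = (Phi_cat C B, Phi_proj C B)" for B by (simp add: Phi_def)
  have et: "source_etale C (FO (Psi C) X)" if "X \<in> Obj (rCat_over C)" for X
  proof -
    obtain A P where X: "X = (A, P)" by fastforce
    interpret glued_over C A P by (rule over) (use that X in simp)
    show ?thesis using Psi_source_etale by (simp add: X PsiFO)
  qed
  let ?S = "\<lambda>(A, P). join_restriction_category A \<and> hyperconnected A C P"
  \<comment> \<open>As with \<open>et\<close> for \<open>Psi\<close>, this holds on all objects, so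
    the adjunction restricts by \<open>adjunction_full_subcat\<close>.\<close>
  have jh: "?S (FO (Phi C) B)" if "B \<in> Obj (pCat C)" for B
  proof -
    interpret glued_partite C B by (rule part) (use that in simp)
    show ?thesis using Phi_join_restriction_category[OF assms(1) B.partite_axioms] B.Phi_hyperconnected
      by (simp add: PhiFO)
  qed
  have unit: "FO (Psi C) X \<in> Obj (pCat C) \<and> adj_unit C X \<in> hom (rCat_over C) X (FO (Phi C) (FO (Psi C) X))
      \<and> (iso_arr (rCat_over C) (adj_unit C X) \<longleftrightarrow> ?S X)"
    if X: "X \<in> Obj (rCat_over C)" for X
  proof -
    obtain A P where AP: "X = (A, P)" by fastforce
    interpret glued_over C A P by (rule over) (use X AP in simp)
    show ?thesis using adj_unit_mor \<Psi>.partite_category_axioms iso_unit_iff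
      by (simp add: AP PsiFO del: in_hom)
  qed
  have univ: "\<exists>!G. G \<in> hom (pCat C) (FO (Psi C) X) B \<and> FA (Phi C) G \<cdot>\<^bsub>rCat_over C\<^esub> adj_unit C X = h"
    if X: "X \<in> Obj (rCat_over C)" and "B \<in> Obj (pCat C)" "h \<in> hom (rCat_over C) X (FO (Phi C) B)" for X B h
  proof -
    obtain A P where AP: "X = (A, P)" by fastforce
    interpret glued_over C A P by (rule over) (use X AP in simp)
    show ?thesis using unit_universal[of B h] that by (simp add: AP PsiFO del: in_hom)
  qed
  have adj: "adjunction (rCat_over C) (pCat C) (Psi C) (Phi C) (adj_unit C) (adj_counit C)"
  proof (rule adjunction_from_universal[OF Phi_functor[OF restriction_category_axioms assms(2)]])
    show "FO (Psi C) X \<in> Obj (pCat C) \<and> adj_unit C X \<in> hom (rCat_over C) X (FO (Phi C) (FO (Psi C) X))"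
      if "X \<in> Obj (rCat_over C)" for X using unit[OF that] by blast
    show "FA (Psi C) h = (THE G. G \<in> hom (pCat C) (FO (Psi C) (src h)) (FO (Psi C) (tgt h)) \<and>
      FA (Phi C) G \<cdot>\<^bsub>rCat_over C\<^esub> adj_unit C (src h) = adj_unit C (tgt h) \<cdot>\<^bsub>rCat_over C\<^esub> h)" for h
      by (simp add: Psi_def)
    show "adj_counit C B = (THE G. G \<in> hom (pCat C) (FO (Psi C) (FO (Phi C) B)) B \<and>
      FA (Phi C) G \<cdot>\<^bsub>rCat_over C\<^esub> adj_unit C (FO (Phi C) B) = Idn (rCat_over C) (FO (Phi C) B))" for B
      by (simp add: adj_counit_def PsiFO)
  qed (rule univ)
  have counit: "iso_arr (pCat C) (adj_counit C B) \<longleftrightarrow> source_etale C B" "src (adj_counit C B) = FO (Psi C) (FO (Phi C) B)"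
    "tgt (adj_counit C B) = B" if "B \<in> Obj (pCat C)" for B
  proof -
    interpret glued_partite C B by (rule part) (use that in simp)
    show "iso_arr (pCat C) (adj_counit C B) \<longleftrightarrow> source_etale C B" by (rule iso_counit_iff)
    show "src (adj_counit C B) = FO (Psi C) (FO (Phi C) B)" "tgt (adj_counit C B) = B"
      by (simp_all add: counit_eq PsiFO PhiFO)
  qed
  have left: "left_fixpoints (pCat C) (adj_counit C) = Obj (peCat C)"
    unfolding left_fixpoints_def peCat_def using counit(1) by auto
  have right: "right_fixpoints (rCat_over C) (adj_unit C) = Obj (jrCat_over C)"
    unfolding right_fixpoints_def jrCat_over_def using unit by auto
  have "adjoint_equivalence (jrCat_over C) (peCat C) (Psi C) (Phi C) (adj_unit C) (adj_counit C)"
    unfolding adjoint_equivalence_def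
  proof (intro conjI ballI)
    show "adjunction (jrCat_over C) (peCat C) (Psi C) (Phi C) (adj_unit C) (adj_counit C)"
      unfolding jrCat_over_def peCat_def 
      by (rule adjunction_full_subcat[where S = ?S and T = "source_etale C"]) (rule adj et jh; assumption?)+
    fix X assume X: "X \<in> Obj (jrCat_over C)"
    then have X': "X \<in> Obj (rCat_over C)" "?S X" by (auto simp: jrCat_over_def)
    have "src (adj_unit C X) = X" "tgt (adj_unit C X) = FO (Phi C) (FO (Psi C) X)" using unit[OF X'(1)] by auto
    then have "?S (src (adj_unit C X))" "?S (tgt (adj_unit C X))" using X'(2) jh unit[OF X'(1)] by auto
    from iso_arr_full_subcat[where S = ?S and A = "rCat_over C", OF this] show "iso_arr (jrCat_over C) (adj_unit C X)"
      unfolding jrCat_over_def using unit[OF X'(1)] X'(2) by (simp only:)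
  next
    fix B assume B: "B \<in> Obj (peCat C)"
    then have B': "B \<in> Obj (pCat C)" "source_etale C B" by (auto simp: peCat_def)
    have "FO (Phi C) B \<in> Obj (rCat_over C)"
      using is_functor_simps(1)[OF Phi_functor[OF restriction_category_axioms assms(2)] B'(1)] .
    then have "source_etale C (src (adj_counit C B))" "source_etale C (tgt (adj_counit C B))"
      using counit(2,3)[OF B'(1)] et B'(2) by simp_all
    then show "iso_arr (peCat C) (adj_counit C B)"
      unfolding peCat_def using iso_arr_full_subcat[of "source_etale C"] counit(1)[OF B'(1)] B'(2) by blast
  qed
  then show ?thesis using adj left right by blast
qed

end
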